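(* Assume $F(0)<1$. Then $(u,a_*,b_* )$ is the unique triple $(\hat u,\hat a,\hat b)$, with $0<\hat a<\hat b<\infty$ and $\hat u:(0,\infty)\to\mathbb R$, that solves the following problem: (i) $\hat u\in C^1((0,\infty))\cap C^2([\hat a,\hat b])$ and $\hat u$ is super-harmonic, i.e. $\mathsf E[e^{-(r-\mu_1)\tau}\hat u(Z^z_\tau)]\le\hat u(z)$ for all $\tau\in\mathcal T$ and $z>0$; (ii) $\hat u\ge\max\{1,\Pi\hat u\}$ on $(0,\infty)$, with $\hat u(z)>\max\{1,(\Pi\hat u)(z)\}$ if and only if $z\in(\hat a,\hat b)$; (iii) the following conditions hold: $$\big(\mathcal L_Z-(r-\mu_1)\big)\hat u(z)=0\quad\text{for }z\in(\hat a,\hat b),$$ $$\hat u(\hat a)=1,\qquad\hat u(\hat b)=(\Pi\hat u)(\hat b),$$ $$\hat u'(\hat a)=0,\qquad\hat u'(\hat b)=(\Pi\hat u)'(\hat b).$$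
   Context: $B^1,B^2$ are independent Brownian motions on $(\Omega,\mathcal F,\mathsf P)$, $\mathbb F$ their completed natural filtration, $\mathcal T$ the set of $\mathbb F$-stopping times with values in $[0,\infty]$. Constants: $\mu_1,\mu_2\in\mathbb R$, $\sigma_1,\sigma_2>0$, $\nu\in[-1,1]$, $p\in(0,1)$, $r>0$ with $r>\mu_i+\sigma_i^2/2$ for $i=1,2$. $F$ is the cumulative distribution function of a non-negative random variable (integrals against $F(\mathrm dt)$ include a possible atom at $0$). Let $\beta_1=\sigma_2\nu-\sigma_1$, $\beta_2=\sigma_2\sqrt{1-\nu^2}$, assume $\beta_1^2+\beta_2^2>0$, let $\tilde B=(\beta_1B^1+\beta_2B^2)/\sqrt{\beta_1^2+\beta_2^2}$ and let $Z=Z^z$ solve $\mathrm dZ_t=(\mu_2-\mu_1)Z_t\,\mathrm dt+\sqrt{\beta_1^2+\beta_2^2}\,Z_t\,\mathrm d\tilde B_t$, $Z_0=z>0$ ($\mathsf E_z[f(Z_\cdot)]=\mathsf E[f(Z^z_\cdot)]$). Its generator is $(\mathcal L_Zf)(z)=\tfrac12(\beta_1^2+\beta_2^2)z^2f''(z)+(\mu_2-\mu_1)zf'(z)$. $\mathcal A_1^+$ is the set of continuous $g:(0,\infty)\to[0,\infty)$ with $\sup_{z>0}|g(z)|^2/(1+z^2)<\infty$. $(\Pi g)(z)=\int_0^\infty e^{-(r-\mu_1)t}\mathsf E_z[p(1+Z_t)+(1-p)g(Z_t)]F(\mathrm dt)$. $u$ denotes the unique function in $\mathcal A_1^+$ (it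 exists) with $$u(z)=\sup_{\tau\in\mathcal T}\mathsf E_z[e^{-(r-\mu_1)\tau}\max\{1,(\Pi u)(Z_\tau)\}],\qquad z>0.$$ Discounted payoffs are $0$ on $\{\tau=\infty\}$. When $F(0)<1$, the set $\{z>0:u(z)>\max[1,(\Pi u)(z)]\}$ is an open interval $(a_*,b_* )$ with $0<a_*<z_0<b_*<\infty$, $z_0=\inf\{z>0:(\Pi u)(z)>1\}$; this defines $a_*,b_*$. $C^2([\hat a,\hat b])$ means that the restriction to $[\hat a,\hat b]$ is twice continuously differentiable up to the endpoints (one-sided derivatives). *)

theory Defs
  imports "HOL-Probability.Probability"
begin

section \<open>Brownian motion and its completed filtration\<close>

text \<open>
  Time is \<^typ>\<open>real\<close>, restricted to \<open>t \<ge> 0\<close>; stopping times, which may be infinite, take values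
  in \<^typ>\<open>ennreal\<close>, and so filtrations are indexed by \<^typ>\<open>ennreal\<close>.  The underlying space \<open>M\<close>
  need not be complete, whereas the filtration is; expectations of filtration-measurable
  quantities are therefore taken under \<open>completion M\<close>.
\<close>

definition brownian_motion :: "'a measure \<Rightarrow> (real \<Rightarrow> 'a \<Rightarrow> real) \<Rightarrow> bool" where
  "brownian_motion M B \<longleftrightarrow>
     (\<forall>t\<ge>0. B t \<in> borel_measurable M) \<and>
     (AE \<omega> in M. B 0 \<omega> = 0) \<and>
     (AE \<omega> in M. continuous_on {0..} (\<lambda>t. B t \<omega>)) \<and>
     (\<forall>n t. 0 \<le> t 0 \<and> mono t \<longrightarrow>
        prob_space.indep_vars M (\<lambda>_. borel)
          (\<lambda>i \<omega>. B (t (Suc i)) \<omega> - B (t i) \<omega>) {..<n::nat}) \<and>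
     (\<forall>s t. 0 \<le> s \<and> s < t \<longrightarrow>
        distributed M lborel (\<lambda>\<omega>. B t \<omega> - B s \<omega>) (normal_density 0 (sqrt (t - s))))"

definition independent_processes ::
    "'a measure \<Rightarrow> (real \<Rightarrow> 'a \<Rightarrow> real) \<Rightarrow> (real \<Rightarrow> 'a \<Rightarrow> real) \<Rightarrow> bool" where
  "independent_processes M X Y \<longleftrightarrow>
     prob_space.indep_var M
       (PiM {0..} (\<lambda>_. borel)) (\<lambda>\<omega>. \<lambda>t\<in>{0..}. X t \<omega>)
       (PiM {0..} (\<lambda>_. borel)) (\<lambda>\<omega>. \<lambda>t\<in>{0..}. Y t \<omega>)"

definition completed_filtration ::
    "'a measure \<Rightarrow> (real \<Rightarrow> 'a \<Rightarrow> real) \<Rightarrow> (real \<Rightarrow> 'a \<Rightarrow> real) \<Rightarrow> ennreal \<Rightarrow> 'a measure" where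
  "completed_filtration M B1 B2 t =
     sigma (space M)
       ({B1 s -` A \<inter> space M | s A. 0 \<le> s \<and> ennreal s \<le> t \<and> A \<in> sets borel} \<union>
        {B2 s -` A \<inter> space M | s A. 0 \<le> s \<and> ennreal s \<le> t \<and> A \<in> sets borel} \<union>
        null_sets (completion M))"


section \<open>Stochastic differential equations\<close>

definition tendsto_in_prob ::
    "'a measure \<Rightarrow> (nat \<Rightarrow> 'a \<Rightarrow> real) \<Rightarrow> ('a \<Rightarrow> real) \<Rightarrow> bool" where
  "tendsto_in_prob M X Y \<longleftrightarrow>
     (\<forall>n. X n \<in> borel_measurable M) \<and> Y \<in> borel_measurable M \<and>
     (\<forall>\<epsilon>>0. (\<lambda>n. measure M {\<omega> \<in> space M. \<epsilon> < \<bar>X n \<omega> - Y \<omega>\<bar>}) \<longlonglongrightarrow> 0)"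

text \<open>
  The data \<open>k\<close>, \<open>s\<close>, \<open>\<xi>\<close> encode the simple process \<open>\<Sum>i<k. \<xi>\<^sub>i 1\<^bsub>(s\<^sub>i, s\<^sub>i\<^sub>+\<^sub>1]\<^esub>\<close>, where every \<open>\<xi>\<^sub>i\<close>
  is bounded and measurable at time \<open>s\<^sub>i\<close>.
\<close>

definition simple_process ::
    "(ennreal \<Rightarrow> 'a measure) \<Rightarrow> nat \<Rightarrow> (nat \<Rightarrow> real) \<Rightarrow> (nat \<Rightarrow> 'a \<Rightarrow> real) \<Rightarrow> bool" where
  "simple_process \<F> k s \<xi> \<longleftrightarrow>
     0 \<le> s 0 \<and> (\<forall>i<k. s i \<le> s (Suc i)) \<and>
     (\<forall>i<k. \<xi> i \<in> borel_measurable (\<F> (ennreal (s i))) \<and>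
            bounded (\<xi> i ` space (\<F> (ennreal (s i)))))"

definition simple_value ::
    "nat \<Rightarrow> (nat \<Rightarrow> real) \<Rightarrow> (nat \<Rightarrow> 'a \<Rightarrow> real) \<Rightarrow> real \<Rightarrow> 'a \<Rightarrow> real" where
  "simple_value k s \<xi> t \<omega> = (\<Sum>i<k. \<xi> i \<omega> * indicator {s i<..s (Suc i)} t)"

definition simple_integral ::
    "(real \<Rightarrow> 'a \<Rightarrow> real) \<Rightarrow> nat \<Rightarrow> (nat \<Rightarrow> real) \<Rightarrow> (nat \<Rightarrow> 'a \<Rightarrow> real) \<Rightarrow> real \<Rightarrow> 'a \<Rightarrow> real" where
  "simple_integral W k s \<xi> t \<omega> =
     (\<Sum>i<k. \<xi> i \<omega> * (W (min t (s (Suc i))) \<omega> - W (min t (s i)) \<omega>))"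

text \<open>
  \<open>I\<close> is (a version of) the Ito integral of \<open>H\<close> against \<open>W\<close> over \<open>[0, t]\<close>: the limit in
  probability of integrals of simple processes approximating \<open>H\<close> in \<open>L\<^sup>2([0, t])\<close> in probability.
  Only adapted integrands with almost surely continuous paths are covered.
\<close>

definition is_ito_integral ::
    "'a measure \<Rightarrow> (ennreal \<Rightarrow> 'a measure) \<Rightarrow> (real \<Rightarrow> 'a \<Rightarrow> real) \<Rightarrow> (real \<Rightarrow> 'a \<Rightarrow> real)
       \<Rightarrow> real \<Rightarrow> ('a \<Rightarrow> real) \<Rightarrow> bool" where
  "is_ito_integral M \<F> W H t I \<longleftrightarrow>
     (\<forall>s\<in>{0..t}. H s \<in> borel_measurable (\<F> (ennreal s))) \<and>
     (AE \<omega> in M. continuous_on {0..t} (\<lambda>s. H s \<omega>)) \<and>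
     (\<exists>k s \<xi>.
        (\<forall>n. simple_process \<F> (k n) (s n) (\<xi> n)) \<and>
        tendsto_in_prob M
          (\<lambda>n \<omega>. LINT q:{0..t}|lborel. (simple_value (k n) (s n) (\<xi> n) q \<omega> - H q \<omega>)\<^sup>2) (\<lambda>_. 0) \<and>
        tendsto_in_prob M (\<lambda>n. simple_integral W (k n) (s n) (\<xi> n) t) I)"

text \<open>\<open>dX\<^sub>t = b(X\<^sub>t) dt + c(X\<^sub>t) dW\<^sub>t\<close>, \<open>X\<^sub>0 = x\<close>, in integrated form.\<close>

definition solves_sde ::
    "'a measure \<Rightarrow> (ennreal \<Rightarrow> 'a measure) \<Rightarrow> (real \<Rightarrow> 'a \<Rightarrow> real) \<Rightarrow> (real \<Rightarrow> real) \<Rightarrow> (real \<Rightarrow> real)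
       \<Rightarrow> real \<Rightarrow> (real \<Rightarrow> 'a \<Rightarrow> real) \<Rightarrow> bool" where
  "solves_sde M \<F> W b c x X \<longleftrightarrow>
     (\<forall>t\<ge>0. X t \<in> borel_measurable (\<F> (ennreal t))) \<and>
     (AE \<omega> in M. continuous_on {0..} (\<lambda>t. X t \<omega>)) \<and>
     (AE \<omega> in M. X 0 \<omega> = x) \<and>
     (\<forall>t\<ge>0. is_ito_integral M \<F> W (\<lambda>q \<omega>. c (X q \<omega>)) t
        (\<lambda>\<omega>. X t \<omega> - x - (LINT q:{0..t}|lborel. b (X q \<omega>))))"


section \<open>The stopping problem\<close>

text \<open>
  Functions on \<open>(0, \<infinity>)\<close> are represented by functions on \<^typ>\<open>real\<close> whose values on \<open>(-\<infinity>, 0]\<close> are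
  irrelevant.  In all definitions below, \<open>\<delta>\<close> is the discount rate and \<open>Z z\<close> the process started
  at \<open>z\<close>.
\<close>

definition nonneg_cdf :: "(real \<Rightarrow> real) \<Rightarrow> bool" where
  "nonneg_cdf F \<longleftrightarrow> (\<exists>D. real_distribution D \<and> (AE t in D. 0 \<le> t) \<and> F = cdf D)"

definition A1_plus :: "(real \<Rightarrow> real) set" where
  "A1_plus = {g. continuous_on {0<..} g \<and> (\<forall>z>0. 0 \<le> g z) \<and>
                 bdd_above ((\<lambda>z. \<bar>g z\<bar>\<^sup>2 / (1 + z\<^sup>2)) ` {0<..})}"

definition Pi_op ::
    "'a measure \<Rightarrow> real \<Rightarrow> real \<Rightarrow> (real \<Rightarrow> real) \<Rightarrow> (real \<Rightarrow> real \<Rightarrow> 'a \<Rightarrow> real)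
       \<Rightarrow> (real \<Rightarrow> real) \<Rightarrow> real \<Rightarrow> real" where
  "Pi_op M \<delta> p F Z g z =
     (LINT t:{0..}|interval_measure F.
        exp (- \<delta> * t) *
        (LINT \<omega>|completion M. p * (1 + Z z t \<omega>) + (1 - p) * g (Z z t \<omega>)))"

definition discounted ::
    "real \<Rightarrow> (real \<Rightarrow> real) \<Rightarrow> (real \<Rightarrow> 'a \<Rightarrow> real) \<Rightarrow> ('a \<Rightarrow> ennreal) \<Rightarrow> 'a \<Rightarrow> real" where
  "discounted \<delta> f X \<tau> \<omega> =
     (if \<tau> \<omega> = \<infinity> then 0
      else exp (- \<delta> * enn2real (\<tau> \<omega>)) * f (X (enn2real (\<tau> \<omega>)) \<omega>))"

text \<open>
  No boundedness side condition is needed for the supremum: for \<open>u\<close> in \<^const>\<open>A1_plus\<close> the reward grows at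
  most linearly, and under the standing assumptions on the parameters \<open>exp (- \<delta> t) (1 + Z\<^sub>t)\<close> is
  a nonnegative supermartingale.
\<close>

definition value_fixed_point ::
    "'a measure \<Rightarrow> (ennreal \<Rightarrow> 'a measure) \<Rightarrow> real \<Rightarrow> real \<Rightarrow> (real \<Rightarrow> real)
       \<Rightarrow> (real \<Rightarrow> real \<Rightarrow> 'a \<Rightarrow> real) \<Rightarrow> (real \<Rightarrow> real) \<Rightarrow> bool" where
  "value_fixed_point M \<F> \<delta> p F Z u \<longleftrightarrow>
     u \<in> A1_plus \<and>
     (\<forall>z>0. u z =
        (SUP \<tau>\<in>{\<tau>. stopping_time \<F> \<tau>}.
           LINT \<omega>|completion M. discounted \<delta> (\<lambda>y. max 1 (Pi_op M \<delta> p F Z u y)) (Z z) \<tau> \<omega>))"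

text \<open>
  Integrability is required explicitly since the Bochner integral of a non-integrable function
  is \<open>0\<close>.  For a nonnegative \<open>f\<close> it is implied by the inequality, read with the expectation
  in \<open>[0, \<infinity>]\<close>.
\<close>

definition superharmonic ::
    "'a measure \<Rightarrow> (ennreal \<Rightarrow> 'a measure) \<Rightarrow> real \<Rightarrow> (real \<Rightarrow> real \<Rightarrow> 'a \<Rightarrow> real)
       \<Rightarrow> (real \<Rightarrow> real) \<Rightarrow> bool" where
  "superharmonic M \<F> \<delta> Z f \<longleftrightarrow>
     (\<forall>\<tau> z. stopping_time \<F> \<tau> \<and> 0 < z \<longrightarrow>
        integrable (completion M) (discounted \<delta> f (Z z) \<tau>) \<and>
        (LINT \<omega>|completion M. discounted \<delta> f (Z z) \<tau> \<omega>) \<le> f z)"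

definition generator :: "real \<Rightarrow> real \<Rightarrow> (real \<Rightarrow> real) \<Rightarrow> real \<Rightarrow> real" where
  "generator m v f z = 1/2 * v * z\<^sup>2 * deriv (deriv f) z + m * z * deriv f z"

definition C2_on_interval :: "(real \<Rightarrow> real) \<Rightarrow> real \<Rightarrow> real \<Rightarrow> bool" where
  "C2_on_interval f a b \<longleftrightarrow>
     (\<exists>f' f''.
        (\<forall>x\<in>{a..b}. (f has_real_derivative f' x) (at x within {a..b}) \<and>
                    (f' has_real_derivative f'' x) (at x within {a..b})) \<and>
        continuous_on {a..b} f'')"

text \<open>
  Here \<open>m\<close> is the drift coefficient and \<open>v\<close> the squared volatility coefficient of \<open>Z\<close>.  The last
  condition comprises the existence of the derivative of \<open>Pi_op M \<delta> p F Z f\<close> at \<open>b\<close>.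
\<close>

definition free_boundary_solution ::
    "'a measure \<Rightarrow> (ennreal \<Rightarrow> 'a measure) \<Rightarrow> real \<Rightarrow> real \<Rightarrow> (real \<Rightarrow> real)
       \<Rightarrow> real \<Rightarrow> real \<Rightarrow> (real \<Rightarrow> real \<Rightarrow> 'a \<Rightarrow> real)
       \<Rightarrow> (real \<Rightarrow> real) \<Rightarrow> real \<Rightarrow> real \<Rightarrow> bool" where
  "free_boundary_solution M \<F> \<delta> p F m v Z f a b \<longleftrightarrow>
     0 < a \<and> a < b \<and>
     f C1_differentiable_on {0<..} \<and> C2_on_interval f a b \<and> superharmonic M \<F> \<delta> Z f \<and>
     (\<forall>z>0. max 1 (Pi_op M \<delta> p F Z f z) \<le> f z) \<and>
     (\<forall>z>0. max 1 (Pi_op M \<delta> p F Z f z) < f z \<longleftrightarrow> z \<in> {a<..<b}) \<and>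
     (\<forall>z\<in>{a<..<b}. generator m v f z - \<delta> * f z = 0) \<and>
     f a = 1 \<and> f b = Pi_op M \<delta> p F Z f b \<and>
     deriv f a = 0 \<and> (Pi_op M \<delta> p F Z f has_real_derivative deriv f b) (at b)"

end

(* Z is a geometric Brownian motion, so up to a null set it is z times an explicit exponential of W.
   With the roots alpha > 1 and -beta < 0 of the characteristic equation, x^alpha and x^(-beta)
   give discounted martingales.  At each z the value function u equals a minimal majorant
   h = A x^alpha + B x^(-beta), A, B >= 0, of the reward G = max 1 (Pi u), which either meets G at z
   or meets it on both sides of z; then u = h between the contact points by stopping at the exit
   time, whence superharmonicity and the form of u on [a, b].
   Smooth fit is a squeeze: 1 <= u <= h near a, and V <= u <= h near b, where V is the solution of
   V = Pi u with the atom of F at 0 split off; V is C^1 because Gaussian smoothing of a Lipschitz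
   function is.  For uniqueness a solution is again a value function, for its own reward, and
   Pi contracts by 1 - p in the norm weighted by x^alpha + x^(-beta). *)
theory Submission
  imports Defs "HOL-Real_Asymp.Real_Asymp"
begin

text \<open>An Ito integral is given here only as a limit in probability for some choice of simple
  approximations, and \<open>Z\<close> is any solution in that sense. The equation becomes usable
  once left-point sums are shown to have the same limit; a comparison on finite grids then forces
  \<open>Z\<close> to be the exponential. From there on stopped expectations reduce to powers of
  that exponential, and optional stopping of Wald martingales does the work of Ito's formula. The
  minimal majorant likewise does the work of the strong Markov property: a single function,
  superharmonic by inspection, lies above \<open>u\<close> and touches it at the given point.

  Two obstacles shape the end. Gaussian smoothing over a delay \<open>t\<close> has a derivative
  formula with the factor \<open>1 / sqrt t\<close>, while the delay law may charge small times
  heavily; a uniform bound comes from \<open>u\<close> being 1-Lipschitz, which is extracted from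
  the fixed-point equation by iteration. And a candidate solution comes without any growth bound;
  one is derived from superharmonicity by comparing exits from intervals, before the contraction can
  start.\<close>

section \<open>Independence of the past and the later increments\<close>

lemma (in prob_space) indep_varI:
  assumes X: "random_variable S X" and Y: "random_variable T Y"
    and eq: "\<And>A B. A \<in> sets S \<Longrightarrow> B \<in> sets T \<Longrightarrow>
      prob ((X -` A \<inter> space M) \<inter> (Y -` B \<inter> space M)) = prob (X -` A \<inter> space M) * prob (Y -` B \<inter> space M)"
  shows "indep_var S X T Y"
proof -
  have st: "Int_stable {X -` A \<inter> space M |A. A \<in> sets S}" for S X
  proof (safe intro!: Int_stableI)
    fix A B assume "A \<in> sets S" "B \<in> sets S"
    then show "\<exists>C. (X -` A \<inter> space M) \<inter> (X -` B \<inter> space M) = (X -` C \<inter> space M) \<and> C \<in> sets S"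
      by (intro exI[of _ "A \<inter> B"]) auto
  qed
  have "indep_set {X -` A \<inter> space M |A. A \<in> sets S} {Y -` A \<inter> space M |A. A \<in> sets T}"
    unfolding indep_sets2_eq using assms by (auto intro: measurable_sets)
  from indep_set_sigma_sets[OF this st st] show ?thesis
    unfolding indep_var_eq using X Y by blast
qed

definition cylinder :: "'a measure \<Rightarrow> (real \<Rightarrow> 'a \<Rightarrow> real) \<Rightarrow> real set \<Rightarrow> (real \<Rightarrow> real set) \<Rightarrow> 'a set" where
  "cylinder M B J C = {\<omega> \<in> space M. \<forall>q\<in>J. B q \<omega> \<in> C q}"

lemma mono_if_sorted_nth:
  fixes L :: "real list"
  assumes "sorted L" "\<And>x. x \<in> set L \<Longrightarrow> x \<le> t"
  shows "mono (\<lambda>i. if i < length L then L ! i else t)"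
  using assms by (auto simp: mono_def sorted_nth_mono)

text \<open>The values of \<open>B\<close> at the times in \<open>J\<close> are partial sums of the
  increments along the sorted points of \<open>J\<close> together with 0 and \<open>s\<close>.
  Appending \<open>t\<close> makes the increment from \<open>s\<close> to \<open>t\<close> the next
  member of the same independent family.\<close>

lemma brownian_cylinder_indep:
  assumes "prob_space M" and bm: "brownian_motion M B" and st: "0 \<le> s" "s \<le> t"
    and J: "finite J" "J \<subseteq> {0..s}" and C: "\<And>q. q \<in> J \<Longrightarrow> C q \<in> sets borel" and D: "D \<in> sets borel"
  shows "measure M (cylinder M B J C \<inter> {\<omega>\<in>space M. B t \<omega> - B s \<omega> \<in> D})
       = measure M (cylinder M B J C) * measure M {\<omega>\<in>space M. B t \<omega> - B s \<omega> \<in> D}"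
proof -
  interpret prob_space M by fact
  have Bm[measurable]: "B q \<in> borel_measurable M" if "0 \<le> q" for q
    using bm that by (auto simp: brownian_motion_def)
  have B0: "AE \<omega> in M. B 0 \<omega> = 0" using bm by (auto simp: brownian_motion_def)
  define L where "L = sorted_list_of_set (insert 0 (insert s J))"
  have fin: "finite (insert 0 (insert s J))" using J by auto
  have setL: "set L = insert 0 (insert s J)" and sL: "sorted L" and dL: "distinct L"
    using fin unfolding L_def by (auto simp del: sorted_list_of_set_insert_remove)
  have L_ne: "L \<noteq> []" using setL by auto
  define N where "N = length L - 1"
  have lenL: "length L = Suc N" using L_ne by (simp add: N_def)
  \<comment> \<open>The definition of Brownian motion asks for a sequence monotone on all of
    \<open>nat\<close>; the default value \<open>t\<close> beyond the list also supplies the last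
    point \<open>\<tau> (Suc N)\<close>.\<close>
  define \<tau> where "\<tau> i = (if i < length L then L ! i else t)" for i
  have mono: "mono \<tau>" unfolding \<tau>_def
    using sL setL J st by (intro mono_if_sorted_nth) auto
  have Lge: "0 \<le> x" "x \<le> s" if "x \<in> set L" for x using that setL J st by auto
  obtain i0 where i0: "i0 < length L" "L ! i0 = 0" using setL by (metis in_set_conv_nth insertI1)
  have t0: "\<tau> 0 = 0"
    using sorted_nth_mono[OF sL, of 0 i0] i0 Lge(1)[of "L!0"] L_ne by (auto simp: \<tau>_def)
  obtain i1 where i1: "i1 < length L" "L ! i1 = s" using setL by (metis in_set_conv_nth insertI1 insertI2)
  have tN: "\<tau> N = s"
    using sorted_nth_mono[OF sL, of i1 N] i1 Lge(2)[of "L!N"] lenL by (auto simp: \<tau>_def)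
  have tSN: "\<tau> (Suc N) = t" by (simp add: \<tau>_def lenL)
  have tge: "0 \<le> \<tau> i" for i using monoD[OF mono, of 0 i] t0 by simp
  define X where "X i \<omega> = B (\<tau> (Suc i)) \<omega> - B (\<tau> i) \<omega>" for i \<omega>
  have ind: "indep_vars (\<lambda>_. borel) X {..<Suc N}"
    using bm mono tge[of 0] unfolding brownian_motion_def X_def by blast
  have ind2: "indep_var (PiM {..<N} (\<lambda>_. borel)) (\<lambda>\<omega>. restrict (\<lambda>i. X i \<omega>) {..<N})
                 (PiM {N} (\<lambda>_. borel)) (\<lambda>\<omega>. restrict (\<lambda>i. X i \<omega>) {N})"
    by (rule indep_var_restrict[OF ind]) auto
  define EA where "EA = {x \<in> space (PiM {..<N} (\<lambda>_. borel :: real measure)). \<forall>i\<in>{i. i \<le> N \<and> L ! i \<in> J}. (\<Sum>j<i. x j) \<in> C (L ! i)}"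
  define EB where "EB = {x \<in> space (PiM {N} (\<lambda>_. borel :: real measure)). x N \<in> D}"
  have EA: "EA \<in> sets (PiM {..<N} (\<lambda>_. borel))"
  proof -
    have "Measurable.pred (PiM {..<N} (\<lambda>_. borel)) (\<lambda>x. (\<Sum>j<i. x j) \<in> C (L ! i))"
      if "i \<le> N" "L ! i \<in> J" for i
    proof -
      have [measurable]: "C (L ! i) \<in> sets borel" using C that by auto
      have [measurable]: "(\<lambda>x. (\<Sum>j<i. x j)) \<in> borel_measurable (PiM {..<N} (\<lambda>_. borel :: real measure))"
        using that by (intro borel_measurable_sum measurable_component_singleton) auto
      show ?thesis by measurable
    qed
    then show ?thesis unfolding EA_def
      by (intro pred_intros_finite predE) (auto intro!: pred_intros_finite)
  qed
  have EB: "EB \<in> sets (PiM {N} (\<lambda>_. borel))"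
    unfolding EB_def using D by measurable
  have sumX: "(\<Sum>j<i. X j \<omega>) = B (L ! i) \<omega> - B 0 \<omega>" if "i \<le> N" for i \<omega>
  proof -
    have "(\<Sum>j<i. X j \<omega>) = B (\<tau> i) \<omega> - B (\<tau> 0) \<omega>"
      unfolding X_def by (induction i) auto
    then show ?thesis using that t0 lenL by (simp add: \<tau>_def)
  qed
  have cyl: "(\<omega> \<in> cylinder M B J C) = ((\<lambda>i\<in>{..<N}. X i \<omega>) \<in> EA)" if "\<omega> \<in> space M" "B 0 \<omega> = 0" for \<omega>
  proof -
    have "((\<lambda>i\<in>{..<N}. X i \<omega>) \<in> EA) = (\<forall>i\<in>{i. i \<le> N \<and> L ! i \<in> J}. B (L ! i) \<omega> \<in> C (L ! i))"
      unfolding EA_def using sumX that by (auto simp: space_PiM)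
    also have "\<dots> = (\<forall>q\<in>J. B q \<omega> \<in> C q)"
    proof safe
      fix q assume a: "\<forall>i\<in>{i. i \<le> N \<and> L ! i \<in> J}. B (L ! i) \<omega> \<in> C (L ! i)" and q: "q \<in> J"
      then obtain i where "i < length L" "L ! i = q" using setL by (metis in_set_conv_nth insertI2)
      then show "B q \<omega> \<in> C q" using a q lenL by auto
    qed auto
    finally show ?thesis using that by (auto simp: cylinder_def)
  qed
  have incr: "((\<lambda>i\<in>{N}. X i \<omega>) \<in> EB) = (B t \<omega> - B s \<omega> \<in> D)" for \<omega>
    unfolding EB_def X_def using tN tSN by (auto simp: space_PiM)
  have cylM: "cylinder M B J C \<in> sets M"
  proof -
    have "Measurable.pred M (\<lambda>\<omega>. B q \<omega> \<in> C q)" if "q \<in> J" for q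
      using that J C[of q] Bm[of q] by (auto simp: measurable_compose_rev intro!: pred_sets2)
    then show ?thesis unfolding cylinder_def using J
      by (intro predE pred_intros_finite) auto
  qed
  have DD: "{\<omega>\<in>space M. B t \<omega> - B s \<omega> \<in> D} \<in> sets M"
  proof -
    have [measurable]: "B t \<in> borel_measurable M" "B s \<in> borel_measurable M" using st by auto
    show ?thesis using D by measurable
  qed
  have mA: "(\<lambda>\<omega>. restrict (\<lambda>i. X i \<omega>) {..<N}) \<in> measurable M (PiM {..<N} (\<lambda>_. borel))"
    and mB: "(\<lambda>\<omega>. restrict (\<lambda>i. X i \<omega>) {N}) \<in> measurable M (PiM {N} (\<lambda>_. borel))"
    using ind2 by (auto dest: indep_var_rv1 indep_var_rv2)
  define PA where "PA = (\<lambda>\<omega>. restrict (\<lambda>i. X i \<omega>) {..<N}) -` EA \<inter> space M"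
  have PA: "PA \<in> events" unfolding PA_def by (rule measurable_sets[OF mA EA])
  have PB: "(\<lambda>\<omega>. restrict (\<lambda>i. X i \<omega>) {N}) -` EB \<inter> space M = {\<omega>\<in>space M. B t \<omega> - B s \<omega> \<in> D}"
    using incr by auto
  \<comment> \<open>The partial sums return \<open>B\<close> only up to \<open>B 0\<close>, which
    vanishes almost surely, so the two events agree up to a null set.\<close>
  have ae: "AE \<omega> in M. (\<omega> \<in> cylinder M B J C) = (\<omega> \<in> PA)"
    using B0 AE_space by eventually_elim (simp add: cyl PA_def)
  have "measure M (cylinder M B J C \<inter> {\<omega>\<in>space M. B t \<omega> - B s \<omega> \<in> D}) =
      prob (PA \<inter> {\<omega>\<in>space M. B t \<omega> - B s \<omega> \<in> D})"
    by (rule finite_measure_eq_AE) (use ae PA cylM DD in auto)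
  also have "PA \<inter> {\<omega>\<in>space M. B t \<omega> - B s \<omega> \<in> D} =
     (\<lambda>\<omega>. (restrict (\<lambda>i. X i \<omega>) {..<N}, restrict (\<lambda>i. X i \<omega>) {N})) -` (EA \<times> EB) \<inter> space M"
    unfolding PB[symmetric] PA_def by auto
  also have "prob \<dots> = prob PA *
       prob ((\<lambda>\<omega>. restrict (\<lambda>i. X i \<omega>) {N}) -` EB \<inter> space M)"
    unfolding PA_def by (rule indep_varD[OF ind2 EA EB])
  also have "prob PA = prob (cylinder M B J C)"
    by (rule finite_measure_eq_AE) (use ae PA cylM in auto)
  finally show ?thesis unfolding PB .
qed

lemma cylinder_sets:
  assumes "\<And>q. 0 \<le> q \<Longrightarrow> B q \<in> borel_measurable N" and "space N = space M"
    and "finite J" "J \<subseteq> {0..}" "\<And>q. q \<in> J \<Longrightarrow> C q \<in> sets borel"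
  shows "cylinder M B J C \<in> sets N"
proof -
  have "Measurable.pred N (\<lambda>\<omega>. B q \<omega> \<in> C q)" if "q \<in> J" for q
    using that assms(1)[of q] assms(4,5) by (intro pred_sets2[of _ borel]) auto
  then show ?thesis unfolding cylinder_def assms(2)[symmetric] using assms
    by (intro predE pred_intros_finite) auto
qed

lemma cylinder_Int:
  "cylinder M B J C \<inter> cylinder M B J' C' =
   cylinder M B (J \<union> J') (\<lambda>q. (if q \<in> J then C q else UNIV) \<inter> (if q \<in> J' then C' q else UNIV))"
  by (auto simp: cylinder_def)

text \<open>Events of the form \<open>E\<^sub>1 \<inter> E\<^sub>2\<close> with \<open>E\<^sub>i\<close> a cylinder set of the i-th motion up to time \<open>s\<close>
  form an intersection-stable generator of the uncompleted past.\<close>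

definition past_cylinders :: "'a measure \<Rightarrow> (real \<Rightarrow> 'a \<Rightarrow> real) \<Rightarrow> (real \<Rightarrow> 'a \<Rightarrow> real) \<Rightarrow> real \<Rightarrow> 'a set set" where
  "past_cylinders M B1 B2 s = {cylinder M B1 J1 C1 \<inter> cylinder M B2 J2 C2 | J1 C1 J2 C2.
      finite J1 \<and> J1 \<subseteq> {0..s} \<and> (\<forall>q\<in>J1. C1 q \<in> sets borel) \<and>
      finite J2 \<and> J2 \<subseteq> {0..s} \<and> (\<forall>q\<in>J2. C2 q \<in> sets borel)}"

definition increment_events :: "'a measure \<Rightarrow> (real \<Rightarrow> 'a \<Rightarrow> real) \<Rightarrow> (real \<Rightarrow> 'a \<Rightarrow> real) \<Rightarrow> real \<Rightarrow> real \<Rightarrow> 'a set set" where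
  "increment_events M B1 B2 s t = {{\<omega>\<in>space M. B1 t \<omega> - B1 s \<omega> \<in> D1} \<inter> {\<omega>\<in>space M. B2 t \<omega> - B2 s \<omega> \<in> D2} | D1 D2.
      D1 \<in> sets borel \<and> D2 \<in> sets borel}"

lemma past_cylindersI:
  "finite J1 \<Longrightarrow> J1 \<subseteq> {0..s} \<Longrightarrow> (\<And>q. q \<in> J1 \<Longrightarrow> C1 q \<in> sets borel) \<Longrightarrow>
   finite J2 \<Longrightarrow> J2 \<subseteq> {0..s} \<Longrightarrow> (\<And>q. q \<in> J2 \<Longrightarrow> C2 q \<in> sets borel) \<Longrightarrow>
   cylinder M B1 J1 C1 \<inter> cylinder M B2 J2 C2 \<in> past_cylinders M B1 B2 s"
  unfolding past_cylinders_def by blast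

lemma Int_stable_past_cylinders: "Int_stable (past_cylinders M B1 B2 s)"
proof (rule Int_stableI)
  fix a b assume "a \<in> past_cylinders M B1 B2 s" "b \<in> past_cylinders M B1 B2 s"
  then obtain J1 C1 J2 C2 K1 D1 K2 D2 where
    a: "a = cylinder M B1 J1 C1 \<inter> cylinder M B2 J2 C2" "finite J1" "J1 \<subseteq> {0..s}" "\<forall>q\<in>J1. C1 q \<in> sets borel"
      "finite J2" "J2 \<subseteq> {0..s}" "\<forall>q\<in>J2. C2 q \<in> sets borel" and
    b: "b = cylinder M B1 K1 D1 \<inter> cylinder M B2 K2 D2" "finite K1" "K1 \<subseteq> {0..s}" "\<forall>q\<in>K1. D1 q \<in> sets borel"
      "finite K2" "K2 \<subseteq> {0..s}" "\<forall>q\<in>K2. D2 q \<in> sets borel"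
    unfolding past_cylinders_def by blast
  have "a \<inter> b = (cylinder M B1 J1 C1 \<inter> cylinder M B1 K1 D1) \<inter> (cylinder M B2 J2 C2 \<inter> cylinder M B2 K2 D2)"
    unfolding a(1) b(1) by blast
  then show "a \<inter> b \<in> past_cylinders M B1 B2 s"
    unfolding cylinder_Int using a b
    by (auto intro!: past_cylindersI sets.Int)
qed

lemma Int_stable_increment_events: "Int_stable (increment_events M B1 B2 s t)"
proof (rule Int_stableI)
  fix a b assume "a \<in> increment_events M B1 B2 s t" "b \<in> increment_events M B1 B2 s t"
  then obtain A1 A2 D1 D2 where *: "a = {\<omega>\<in>space M. B1 t \<omega> - B1 s \<omega> \<in> A1} \<inter> {\<omega>\<in>space M. B2 t \<omega> - B2 s \<omega> \<in> A2}"
    "b = {\<omega>\<in>space M. B1 t \<omega> - B1 s \<omega> \<in> D1} \<inter> {\<omega>\<in>space M. B2 t \<omega> - B2 s \<omega> \<in> D2}"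
    "A1 \<in> sets borel" "A2 \<in> sets borel" "D1 \<in> sets borel" "D2 \<in> sets borel"
    unfolding increment_events_def by blast
  then show "a \<inter> b \<in> increment_events M B1 B2 s t"
    unfolding increment_events_def
    by (intro CollectI exI[of _ "A1 \<inter> D1"] exI[of _ "A2 \<inter> D2"]) auto
qed

text \<open>Independence of the motions splits a probability into its two coordinates, and each
  coordinate splits into past and increment. Regrouping the four factors gives the product rule on
  two intersection-stable generators.\<close>

lemma past_increment_indep:
  assumes "prob_space M" and bm1: "brownian_motion M B1" and bm2: "brownian_motion M B2"
    and ind: "independent_processes M B1 B2" and st: "0 \<le> s" "s \<le> t"
  shows "prob_space.indep_set M (sigma_sets (space M) (past_cylinders M B1 B2 s))
           (sigma_sets (space M) (increment_events M B1 B2 s t))"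
proof -
  interpret prob_space M by fact
  have Bm1: "B1 q \<in> borel_measurable M" if "0 \<le> q" for q
    using bm1 that by (auto simp: brownian_motion_def)
  have Bm2: "B2 q \<in> borel_measurable M" if "0 \<le> q" for q
    using bm2 that by (auto simp: brownian_motion_def)
  have incr_sets: "{\<omega>\<in>space M. B t \<omega> - B s \<omega> \<in> D} \<in> sets M"
    if "\<And>q. 0 \<le> q \<Longrightarrow> B q \<in> borel_measurable M" "D \<in> sets borel" for B :: "real \<Rightarrow> 'a \<Rightarrow> real" and D
  proof -
    have [measurable]: "B t \<in> borel_measurable M" "B s \<in> borel_measurable M" using that st by auto
    show ?thesis using that by measurable
  qed
  have iv: "indep_var (PiM {0..} (\<lambda>_. borel)) (\<lambda>\<omega>. \<lambda>t\<in>{0..}. B1 t \<omega>)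
       (PiM {0..} (\<lambda>_. borel)) (\<lambda>\<omega>. \<lambda>t\<in>{0..}. B2 t \<omega>)"
    using ind unfolding independent_processes_def .
  \<comment> \<open>Independence of the processes speaks of path space, so past and increment of one
    motion are packed into one set of paths.\<close>
  define P :: "real set \<Rightarrow> (real \<Rightarrow> real set) \<Rightarrow> real set \<Rightarrow> (real \<Rightarrow> real) set" where
    "P J C D = {x \<in> space (PiM {0..} (\<lambda>_. borel)). (\<forall>q\<in>J. x q \<in> C q) \<and> x t - x s \<in> D}" for J C D
  have Psets: "P J C D \<in> sets (PiM {0..} (\<lambda>_. borel))"
    if "finite J" "J \<subseteq> {0..s}" "\<forall>q\<in>J. C q \<in> sets borel" "D \<in> sets borel" for J C D
  proof -
    have [measurable]: "(\<lambda>x. x q) \<in> borel_measurable (PiM {0..} (\<lambda>_. borel :: real measure))" if "0 \<le> q" for q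
      by (rule measurable_component_singleton) (use that in auto)
    have [measurable]: "(\<lambda>x. x t - x s) \<in> borel_measurable (PiM {0..} (\<lambda>_. borel :: real measure))"
      using st by (intro borel_measurable_diff measurable_component_singleton) auto
    have 1: "Measurable.pred (PiM {0..} (\<lambda>_. borel :: real measure)) (\<lambda>x. x q \<in> C q)" if "q \<in> J" for q
      using that \<open>J \<subseteq> {0..s}\<close> \<open>\<forall>q\<in>J. C q \<in> sets borel\<close>
      by (intro pred_sets2[of _ borel] measurable_component_singleton) auto
    have 2: "Measurable.pred (PiM {0..} (\<lambda>_. borel :: real measure)) (\<lambda>x. x t - x s \<in> D)"
      using that st by (intro pred_sets2[of _ borel] borel_measurable_diff measurable_component_singleton) auto
    show ?thesis unfolding P_def
      by (intro predE pred_intros_logic pred_intros_finite 1 2 \<open>finite J\<close>)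
  qed
  have Ppre: "(\<lambda>\<omega>. \<lambda>t\<in>{0..}. B t \<omega>) -` P J C D \<inter> space M = cylinder M B J C \<inter> {\<omega>\<in>space M. B t \<omega> - B s \<omega> \<in> D}"
    if "J \<subseteq> {0..s}" for J C D and B :: "real \<Rightarrow> 'a \<Rightarrow> real"
    using that st unfolding P_def cylinder_def by (fastforce simp: space_PiM)
  have "indep_set (past_cylinders M B1 B2 s) (increment_events M B1 B2 s t)"
    unfolding indep_sets2_eq
  proof (intro conjI ballI subsetI)
    fix a assume "a \<in> past_cylinders M B1 B2 s"
    then obtain J1 C1 J2 C2 where
      a: "a = cylinder M B1 J1 C1 \<inter> cylinder M B2 J2 C2" "finite J1" "J1 \<subseteq> {0..s}" "\<forall>q\<in>J1. C1 q \<in> sets borel"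
      "finite J2" "J2 \<subseteq> {0..s}" "\<forall>q\<in>J2. C2 q \<in> sets borel"
      unfolding past_cylinders_def by blast
    have "cylinder M B1 J1 C1 \<in> events" "cylinder M B2 J2 C2 \<in> events"
      using a by (auto intro!: cylinder_sets Bm1 Bm2)
    then show "a \<in> events" unfolding a(1) by (rule sets.Int)
  next
    fix a assume "a \<in> increment_events M B1 B2 s t"
    then show "a \<in> events" unfolding increment_events_def
      using incr_sets Bm1 Bm2 by blast
  next
    fix a b assume "a \<in> past_cylinders M B1 B2 s" "b \<in> increment_events M B1 B2 s t"
    then obtain J1 C1 J2 C2 D1 D2 where
      a: "a = cylinder M B1 J1 C1 \<inter> cylinder M B2 J2 C2" "finite J1" "J1 \<subseteq> {0..s}" "\<forall>q\<in>J1. C1 q \<in> sets borel"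
      "finite J2" "J2 \<subseteq> {0..s}" "\<forall>q\<in>J2. C2 q \<in> sets borel" and
      b: "b = {\<omega>\<in>space M. B1 t \<omega> - B1 s \<omega> \<in> D1} \<inter> {\<omega>\<in>space M. B2 t \<omega> - B2 s \<omega> \<in> D2}"
      "D1 \<in> sets borel" "D2 \<in> sets borel"
      unfolding past_cylinders_def increment_events_def by blast
    let ?c1 = "cylinder M B1 J1 C1" and ?c2 = "cylinder M B2 J2 C2"
    let ?d1 = "{\<omega>\<in>space M. B1 t \<omega> - B1 s \<omega> \<in> D1}" and ?d2 = "{\<omega>\<in>space M. B2 t \<omega> - B2 s \<omega> \<in> D2}"
    have prod: "prob (cylinder M B1 J1 C1 \<inter> {\<omega>\<in>space M. B1 t \<omega> - B1 s \<omega> \<in> D1} \<inter>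
          (cylinder M B2 J2 C2 \<inter> {\<omega>\<in>space M. B2 t \<omega> - B2 s \<omega> \<in> D2})) =
        prob (cylinder M B1 J1 C1 \<inter> {\<omega>\<in>space M. B1 t \<omega> - B1 s \<omega> \<in> D1}) *
        prob (cylinder M B2 J2 C2 \<inter> {\<omega>\<in>space M. B2 t \<omega> - B2 s \<omega> \<in> D2})"
      if "finite J1" "J1 \<subseteq> {0..s}" "\<forall>q\<in>J1. C1 q \<in> sets borel" "finite J2" "J2 \<subseteq> {0..s}"
        "\<forall>q\<in>J2. C2 q \<in> sets borel" "D1 \<in> sets borel" "D2 \<in> sets borel" for J1 C1 J2 C2 D1 D2
    proof -
      have "prob ((\<lambda>\<omega>. (\<lambda>t\<in>{0..}. B1 t \<omega>, \<lambda>t\<in>{0..}. B2 t \<omega>)) -` (P J1 C1 D1 \<times> P J2 C2 D2) \<inter> space M) =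
          prob ((\<lambda>\<omega>. \<lambda>t\<in>{0..}. B1 t \<omega>) -` P J1 C1 D1 \<inter> space M) * prob ((\<lambda>\<omega>. \<lambda>t\<in>{0..}. B2 t \<omega>) -` P J2 C2 D2 \<inter> space M)"
        by (rule indep_varD[OF iv Psets Psets]) (use that in auto)
      moreover have "(\<lambda>\<omega>. (\<lambda>t\<in>{0..}. B1 t \<omega>, \<lambda>t\<in>{0..}. B2 t \<omega>)) -` (P J1 C1 D1 \<times> P J2 C2 D2) \<inter> space M =
         ((\<lambda>\<omega>. \<lambda>t\<in>{0..}. B1 t \<omega>) -` P J1 C1 D1 \<inter> space M) \<inter> ((\<lambda>\<omega>. \<lambda>t\<in>{0..}. B2 t \<omega>) -` P J2 C2 D2 \<inter> space M)"
        by auto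
      ultimately show ?thesis using Ppre that by simp
    qed
    have cyl0: "cylinder M B {} C = space M" for B :: "real \<Rightarrow> 'a \<Rightarrow> real" and C by (auto simp: cylinder_def)
    have "prob (a \<inter> b) = prob (?c1 \<inter> ?d1 \<inter> (?c2 \<inter> ?d2))"
      unfolding a(1) b(1) by (intro arg_cong[where f=prob]) blast
    also have "\<dots> = prob (?c1 \<inter> ?d1) * prob (?c2 \<inter> ?d2)"
      by (rule prod) (use a b in auto)
    also have "prob (?c1 \<inter> ?d1) = prob ?c1 * prob ?d1"
      by (rule brownian_cylinder_indep[OF _ bm1]) (use a b st \<open>prob_space M\<close> in auto)
    also have "prob (?c2 \<inter> ?d2) = prob ?c2 * prob ?d2"
      by (rule brownian_cylinder_indep[OF _ bm2]) (use a b st \<open>prob_space M\<close> in auto)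
    also have "prob ?c1 * prob ?d1 * (prob ?c2 * prob ?d2) = (prob ?c1 * prob ?c2) * (prob ?d1 * prob ?d2)"
      by simp
    \<comment> \<open>Trivial increments, \<open>UNIV\<close>, and in the next step an empty set of
      past times turn the product rule into the factorisation of each marginal.\<close>
    also have "prob ?c1 * prob ?c2 = prob a"
      using prod[of J1 C1 J2 C2 UNIV UNIV] a by (simp add: cylinder_def Int_def conj_ac)
    also have "prob ?d1 * prob ?d2 = prob b"
      using prod[of "{}" C1 "{}" C2 D1 D2] b by (simp add: cylinder_def Int_def conj_ac)
    finally show "prob (a \<inter> b) = prob a * prob b" .
  qed
  then show ?thesis
    by (intro indep_set_sigma_sets Int_stable_past_cylinders Int_stable_increment_events)
qed

section \<open>Brownian motion adapted to a complete filtration\<close>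

text \<open>Independence is stated for random variables because it enters through products
  \<open>\<xi> * h (W q' - W q)\<close> with \<open>\<xi>\<close> known at time
  \<open>q\<close>.\<close>

locale wiener = prob_space P for P :: "'a measure" +
  fixes Ft :: "ennreal \<Rightarrow> 'a measure" and W :: "real \<Rightarrow> 'a \<Rightarrow> real"
  assumes complete: "complete_measure P"
    and space_Ft[simp]: "space (Ft t) = space P"
    and sets_Ft: "sets (Ft t) \<subseteq> sets P"
    and Ft_mono: "s \<le> t \<Longrightarrow> sets (Ft s) \<subseteq> sets (Ft t)"
    and null_Ft: "N \<in> null_sets P \<Longrightarrow> N \<in> sets (Ft t)"
    and W_adapted: "0 \<le> q \<Longrightarrow> W q \<in> borel_measurable (Ft (ennreal q))"
    and W_0: "AE \<omega> in P. W 0 \<omega> = 0"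
    and W_cont: "AE \<omega> in P. continuous_on {0..} (\<lambda>q. W q \<omega>)"
    and W_normal: "0 \<le> q \<Longrightarrow> q < q' \<Longrightarrow>
      distributed P lborel (\<lambda>\<omega>. W q' \<omega> - W q \<omega>) (normal_density 0 (sqrt (q' - q)))"
    and W_indep: "0 \<le> q \<Longrightarrow> q \<le> q' \<Longrightarrow> \<xi> \<in> borel_measurable (Ft (ennreal q)) \<Longrightarrow>
      indep_var borel \<xi> borel (\<lambda>\<omega>. W q' \<omega> - W q \<omega>)"

lemma sets_completed_filtration:
  assumes "\<And>q. 0 \<le> q \<Longrightarrow> B1 q \<in> borel_measurable M" "\<And>q. 0 \<le> q \<Longrightarrow> B2 q \<in> borel_measurable M"
  shows "sets (completed_filtration M B1 B2 t) = sigma_sets (space M)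
       ({B1 s -` A \<inter> space M | s A. 0 \<le> s \<and> ennreal s \<le> t \<and> A \<in> sets borel} \<union>
        {B2 s -` A \<inter> space M | s A. 0 \<le> s \<and> ennreal s \<le> t \<and> A \<in> sets borel} \<union>
        null_sets (completion M))" (is "_ = sigma_sets _ ?G")
    and "{B1 s -` A \<inter> space M | s A. 0 \<le> s \<and> ennreal s \<le> t \<and> A \<in> sets borel} \<union>
        {B2 s -` A \<inter> space M | s A. 0 \<le> s \<and> ennreal s \<le> t \<and> A \<in> sets borel} \<union>
        null_sets (completion M) \<subseteq> sets (completion M)"
proof -
  have "null_sets (completion M) \<subseteq> Pow (space M)"
    using sets.sets_into_space[of _ "completion M"] by (auto simp: null_sets_def)
  then show "sets (completed_filtration M B1 B2 t) = sigma_sets (space M) ?G"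
    unfolding completed_filtration_def by (intro sets_measure_of) auto
  have "B1 q -` A \<inter> space M \<in> sets (completion M)" "B2 q -` A \<inter> space M \<in> sets (completion M)"
    if "0 \<le> q" "A \<in> sets borel" for q A
    using measurable_sets[OF assms(1)[OF that(1)] that(2)] measurable_sets[OF assms(2)[OF that(1)] that(2)]
    by auto
  then show "?G \<subseteq> sets (completion M)" by auto
qed

text \<open>The completed past is generated by cylinder events and null sets; null sets are
  approximated by the empty set, and approximability up to a null set survives complements and
  countable unions. Independence, proved for the uncompleted past, transfers along this.\<close>

lemma past_approx:
  assumes "prob_space M"
    and B1: "\<And>q. 0 \<le> q \<Longrightarrow> B1 q \<in> borel_measurable M" and B2: "\<And>q. 0 \<le> q \<Longrightarrow> B2 q \<in> borel_measurable M"
    and s: "0 \<le> s" and A: "A \<in> sets (completed_filtration M B1 B2 (ennreal s))"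
  shows "\<exists>A'\<in>sigma_sets (space M) (past_cylinders M B1 B2 s). AE \<omega> in M. \<omega> \<in> A \<longleftrightarrow> \<omega> \<in> A'"
proof -
  from A have "A \<in> sigma_sets (space M)
       ({B1 q -` A \<inter> space M | q A. 0 \<le> q \<and> ennreal q \<le> ennreal s \<and> A \<in> sets borel} \<union>
        {B2 q -` A \<inter> space M | q A. 0 \<le> q \<and> ennreal q \<le> ennreal s \<and> A \<in> sets borel} \<union>
        null_sets (completion M))"
    using sets_completed_filtration(1)[of B1 M B2 "ennreal s"] B1 B2 by simp
  then show ?thesis
proof (induction rule: sigma_sets.induct)
  case (Basic a)
  have cyl0: "cylinder M B {} C = space M" for B :: "real \<Rightarrow> 'a \<Rightarrow> real" and C by (auto simp: cylinder_def)
  from Basic consider (1) q A where "a = B1 q -` A \<inter> space M" "0 \<le> q" "q \<le> s" "A \<in> sets borel"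
    | (2) q A where "a = B2 q -` A \<inter> space M" "0 \<le> q" "q \<le> s" "A \<in> sets borel"
    | (3) "a \<in> null_sets (completion M)"
    using s by auto
  then show ?case
  proof cases
    case 1
    have "a = cylinder M B1 {q} (\<lambda>_. A) \<inter> cylinder M B2 {} (\<lambda>_. A)"
      unfolding 1 by (auto simp: cylinder_def)
    then have "a \<in> past_cylinders M B1 B2 s"
      by (simp only:, intro past_cylindersI) (use 1 in auto)
    then show ?thesis by (intro bexI[of _ a] sigma_sets.Basic) auto
  next
    case 2
    have "a = cylinder M B1 {} (\<lambda>_. A) \<inter> cylinder M B2 {q} (\<lambda>_. A)"
      unfolding 2 by (auto simp: cylinder_def)
    then have "a \<in> past_cylinders M B1 B2 s"
      by (simp only:, intro past_cylindersI) (use 2 in auto)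
    then show ?thesis by (intro bexI[of _ a] sigma_sets.Basic) auto
  next
    case 3
    then have "AE \<omega> in completion M. \<omega> \<notin> a" by (rule AE_not_in)
    then have "AE \<omega> in M. \<omega> \<in> a \<longleftrightarrow> \<omega> \<in> {}" unfolding AE_completion_iff by simp
    then show ?thesis by (intro bexI[of _ "{}"] sigma_sets.Empty)
  qed
next
  case Empty
  then show ?case by (intro bexI[of _ "{}"] sigma_sets.Empty) auto
next
  case (Compl a)
  then obtain a' where a': "a' \<in> sigma_sets (space M) (past_cylinders M B1 B2 s)" "AE \<omega> in M. \<omega> \<in> a \<longleftrightarrow> \<omega> \<in> a'"
    by blast
  show ?case
  proof (intro bexI[of _ "space M - a'"] sigma_sets.Compl a')
    show "AE \<omega> in M. \<omega> \<in> space M - a \<longleftrightarrow> \<omega> \<in> space M - a'" using a'(2) by eventually_elim auto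
  qed
next
  case (Union a)
  then obtain a' where a': "\<And>i. a' i \<in> sigma_sets (space M) (past_cylinders M B1 B2 s)"
     "\<And>i. AE \<omega> in M. \<omega> \<in> a i \<longleftrightarrow> \<omega> \<in> a' i"
    by metis
  have "AE \<omega> in M. \<forall>i::nat. \<omega> \<in> a i \<longleftrightarrow> \<omega> \<in> a' i" using a'(2) by (subst AE_all_countable) auto
  then have "AE \<omega> in M. \<omega> \<in> \<Union> (range a) \<longleftrightarrow> \<omega> \<in> \<Union> (range a')" by eventually_elim auto
  then show ?case by (intro bexI[of _ "\<Union> (range a')"] sigma_sets.Union a')
qed
qed

lemma distributed_completion:
  assumes "distributed M lborel X f"
  shows "distributed (completion M) lborel X f"
  using assms unfolding distributed_def
  by (auto simp: distr_completion intro: measurable_completion)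

lemma increment_eventsI:
  "D1 \<in> sets borel \<Longrightarrow> D2 \<in> sets borel \<Longrightarrow>
   {\<omega>\<in>space M. B1 t \<omega> - B1 s \<omega> \<in> D1} \<inter> {\<omega>\<in>space M. B2 t \<omega> - B2 s \<omega> \<in> D2} \<in> increment_events M B1 B2 s t"
  unfolding increment_events_def by blast

text \<open>An increment of the combination is a sum of two independent centred normal variables
  whose variances \<open>(b1 / r)\<^sup>2 * (q' - q)\<close> and
  \<open>(b2 / r)\<^sup>2 * (q' - q)\<close> add up to \<open>q' - q\<close>. As a function of both
  increments jointly, it is independent of the joint past.\<close>

lemma wiener_of_brownian_motions:
  fixes M :: "'a measure"
  assumes "prob_space M" and bm1: "brownian_motion M B1" and bm2: "brownian_motion M B2"
    and ind: "independent_processes M B1 B2" and pos: "0 < b1\<^sup>2 + b2\<^sup>2"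
  shows "wiener (completion M) (completed_filtration M B1 B2)
    (\<lambda>t \<omega>. (b1 * B1 t \<omega> + b2 * B2 t \<omega>) / sqrt (b1\<^sup>2 + b2\<^sup>2))"
proof -
  interpret prob_space M by fact
  interpret C: prob_space "completion M"
    by (rule prob_spaceI) (simp add: emeasure_space_1)
  define W where "W = (\<lambda>t \<omega>. (b1 * B1 t \<omega> + b2 * B2 t \<omega>) / sqrt (b1\<^sup>2 + b2\<^sup>2))"
  define Ft where "Ft = completed_filtration M B1 B2"
  define r where "r = sqrt (b1\<^sup>2 + b2\<^sup>2)"
  have r: "0 < r" "r\<^sup>2 = b1\<^sup>2 + b2\<^sup>2" using pos by (auto simp: r_def)
  have Wr: "W t \<omega> = b1 / r * B1 t \<omega> + b2 / r * B2 t \<omega>" for t \<omega>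
    by (simp add: W_def r_def add_divide_distrib)
  have Bm1: "B1 q \<in> borel_measurable M" if "0 \<le> q" for q
    using bm1 that by (auto simp: brownian_motion_def)
  have Bm2: "B2 q \<in> borel_measurable M" if "0 \<le> q" for q
    using bm2 that by (auto simp: brownian_motion_def)
  define G where "G t = {B1 s -` A \<inter> space M | s A. 0 \<le> s \<and> ennreal s \<le> t \<and> A \<in> sets borel} \<union>
        {B2 s -` A \<inter> space M | s A. 0 \<le> s \<and> ennreal s \<le> t \<and> A \<in> sets borel} \<union>
        null_sets (completion M)" for t
  have setsF: "sets (Ft t) = sigma_sets (space M) (G t)" "G t \<subseteq> sets (completion M)" for t
    using sets_completed_filtration[of B1 M B2 t] Bm1 Bm2 by (auto simp: Ft_def G_def)
  have sp: "space (Ft t) = space M" for t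
    by (simp add: Ft_def completed_filtration_def space_measure_of_conv)
  have adB1: "B1 q \<in> borel_measurable (Ft (ennreal q))" if "0 \<le> q" for q
  proof (rule measurableI)
    fix A :: "real set" assume "A \<in> sets borel"
    then show "B1 q -` A \<inter> space (Ft (ennreal q)) \<in> sets (Ft (ennreal q))"
      unfolding sp setsF(1) G_def using that
      by (intro sigma_sets.Basic UnI1 CollectI exI[of _ q] exI[of _ A]) auto
  qed simp
  have adB2: "B2 q \<in> borel_measurable (Ft (ennreal q))" if "0 \<le> q" for q
  proof (rule measurableI)
    fix A :: "real set" assume "A \<in> sets borel"
    then show "B2 q -` A \<inter> space (Ft (ennreal q)) \<in> sets (Ft (ennreal q))"
      unfolding sp setsF(1) G_def using that
      by (intro sigma_sets.Basic UnI1 UnI2 CollectI exI[of _ q] exI[of _ A]) auto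
  qed simp
  have subF: "sets (Ft t) \<subseteq> sets (completion M)" for t
    unfolding setsF(1) using sets.sigma_sets_subset[OF setsF(2)] by simp
  have WM: "W q \<in> borel_measurable M" if "0 \<le> q" for q
    unfolding W_def using Bm1[OF that] Bm2[OF that] by measurable
  have key: "measure M (A \<inter> {\<omega>\<in>space M. W t \<omega> - W s \<omega> \<in> D}) = measure M A * measure M {\<omega>\<in>space M. W t \<omega> - W s \<omega> \<in> D}"
    if A: "A \<in> sigma_sets (space M) (past_cylinders M B1 B2 s)" and D: "D \<in> sets borel" and st: "0 \<le> s" "s \<le> t" for A s t D
  proof -
    let ?I = "sigma_sets (space M) (increment_events M B1 B2 s t)"
    have ind_past: "indep_set (sigma_sets (space M) (past_cylinders M B1 B2 s)) ?I"
      by (rule past_increment_indep[OF \<open>prob_space M\<close> bm1 bm2 ind st])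
    have sub: "increment_events M B1 B2 s t \<subseteq> Pow (space M)" unfolding increment_events_def by blast
    define N where "N = sigma (space M) (increment_events M B1 B2 s t)"
    have N: "sets N = ?I" "space N = space M"
      unfolding N_def using sub by (auto simp: sets_measure_of space_measure_of)
    have 1: "(\<lambda>\<omega>. B1 t \<omega> - B1 s \<omega>) \<in> borel_measurable N"
    proof (rule measurableI)
      fix A :: "real set" assume "A \<in> sets borel"
      then have "{\<omega>\<in>space M. B1 t \<omega> - B1 s \<omega> \<in> A} \<inter> {\<omega>\<in>space M. B2 t \<omega> - B2 s \<omega> \<in> UNIV} \<in> ?I"
        by (intro sigma_sets.Basic increment_eventsI) auto
      also have "{\<omega>\<in>space M. B1 t \<omega> - B1 s \<omega> \<in> A} \<inter> {\<omega>\<in>space M. B2 t \<omega> - B2 s \<omega> \<in> UNIV} =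
        (\<lambda>\<omega>. B1 t \<omega> - B1 s \<omega>) -` A \<inter> space N" by (auto simp: N)
      finally show "(\<lambda>\<omega>. B1 t \<omega> - B1 s \<omega>) -` A \<inter> space N \<in> sets N" by (simp add: N)
    qed auto
    have 2: "(\<lambda>\<omega>. B2 t \<omega> - B2 s \<omega>) \<in> borel_measurable N"
    proof (rule measurableI)
      fix A :: "real set" assume "A \<in> sets borel"
      then have "{\<omega>\<in>space M. B1 t \<omega> - B1 s \<omega> \<in> UNIV} \<inter> {\<omega>\<in>space M. B2 t \<omega> - B2 s \<omega> \<in> A} \<in> ?I"
        by (intro sigma_sets.Basic increment_eventsI) auto
      also have "{\<omega>\<in>space M. B1 t \<omega> - B1 s \<omega> \<in> UNIV} \<inter> {\<omega>\<in>space M. B2 t \<omega> - B2 s \<omega> \<in> A} =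
        (\<lambda>\<omega>. B2 t \<omega> - B2 s \<omega>) -` A \<inter> space N" by (auto simp: N)
      finally show "(\<lambda>\<omega>. B2 t \<omega> - B2 s \<omega>) -` A \<inter> space N \<in> sets N" by (simp add: N)
    qed auto
    have "W t \<omega> - W s \<omega> = b1 / r * (B1 t \<omega> - B1 s \<omega>) + b2 / r * (B2 t \<omega> - B2 s \<omega>)" for \<omega>
      by (simp add: Wr algebra_simps)
    then have "(\<lambda>\<omega>. W t \<omega> - W s \<omega>) \<in> borel_measurable N"
      by (simp only:) (intro borel_measurable_add borel_measurable_times borel_measurable_const 1 2)
    then have "(\<lambda>\<omega>. W t \<omega> - W s \<omega>) -` D \<inter> space N \<in> sets N" using D by (rule measurable_sets)
    also have "(\<lambda>\<omega>. W t \<omega> - W s \<omega>) -` D \<inter> space N = {\<omega>\<in>space M. W t \<omega> - W s \<omega> \<in> D}" by (auto simp: N)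
    finally show ?thesis using ind_past A N unfolding indep_sets2_eq by blast
  qed
  show ?thesis
    unfolding W_def[symmetric] Ft_def[symmetric]
  proof (unfold_locales)
    show "space (Ft t) = space (completion M)" for t by (simp add: sp)
    show "sets (Ft t) \<subseteq> sets (completion M)" for t by (rule subF)
    show "sets (Ft s) \<subseteq> sets (Ft t)" if "s \<le> t" for s t
      unfolding setsF(1) using that unfolding G_def by (intro sigma_sets_mono') (blast intro: order.trans)
    show "N \<in> sets (Ft t)" if "N \<in> null_sets (completion M)" for N t
      unfolding setsF(1) G_def using that by (intro sigma_sets.Basic) auto
    show "W q \<in> borel_measurable (Ft (ennreal q))" if "0 \<le> q" for q
      unfolding W_def using adB1[OF that] adB2[OF that] by measurable
    have "AE \<omega> in M. W 0 \<omega> = 0"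
    proof -
      have "AE \<omega> in M. B1 0 \<omega> = 0" "AE \<omega> in M. B2 0 \<omega> = 0"
        using bm1 bm2 by (auto simp: brownian_motion_def)
      then show ?thesis by eventually_elim (simp add: W_def)
    qed
    then show "AE \<omega> in completion M. W 0 \<omega> = 0" by (rule AE_completion)
    have "AE \<omega> in M. continuous_on {0..} (\<lambda>q. W q \<omega>)"
    proof -
      have "AE \<omega> in M. continuous_on {0..} (\<lambda>q. B1 q \<omega>)" "AE \<omega> in M. continuous_on {0..} (\<lambda>q. B2 q \<omega>)"
        using bm1 bm2 by (auto simp: brownian_motion_def)
      then show ?thesis by eventually_elim (use r in \<open>auto simp: Wr intro!: continuous_intros\<close>)
    qed
    then show "AE \<omega> in completion M. continuous_on {0..} (\<lambda>q. W q \<omega>)" by (rule AE_completion)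
    show "distributed (completion M) lborel (\<lambda>\<omega>. W q' \<omega> - W q \<omega>) (normal_density 0 (sqrt (q' - q)))"
      if q: "0 \<le> q" "q < q'" for q q'
    proof (rule distributed_completion)
      let ?d1 = "\<lambda>\<omega>. B1 q' \<omega> - B1 q \<omega>" and ?d2 = "\<lambda>\<omega>. B2 q' \<omega> - B2 q \<omega>"
      have d1: "distributed M lborel ?d1 (normal_density 0 (sqrt (q' - q)))"
        and d2: "distributed M lborel ?d2 (normal_density 0 (sqrt (q' - q)))"
        using bm1 bm2 q by (auto simp: brownian_motion_def)
      have s0: "0 < sqrt (q' - q)" using q by simp
      have e1: "distributed M lborel (\<lambda>\<omega>. 0 + b1 / r * ?d1 \<omega>) (normal_density (0 + b1 / r * 0) (\<bar>b1 / r\<bar> * sqrt (q' - q)))"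
        if "b1 \<noteq> 0" by (rule normal_density_affine[OF d1 s0]) (use that r in auto)
      have e2: "distributed M lborel (\<lambda>\<omega>. 0 + b2 / r * ?d2 \<omega>) (normal_density (0 + b2 / r * 0) (\<bar>b2 / r\<bar> * sqrt (q' - q)))"
        if "b2 \<noteq> 0" by (rule normal_density_affine[OF d2 s0]) (use that r in auto)
      have eqW: "(\<lambda>\<omega>. W q' \<omega> - W q \<omega>) = (\<lambda>\<omega>. b1 / r * ?d1 \<omega> + b2 / r * ?d2 \<omega>)"
        by (simp add: Wr fun_eq_iff algebra_simps)
      \<comment> \<open>A summand with zero coefficient has no density, so the addition rule for
        independent normal variables covers only the third case.\<close>
      consider "b1 = 0" "b2 \<noteq> 0" | "b2 = 0" "b1 \<noteq> 0" | "b1 \<noteq> 0" "b2 \<noteq> 0" using pos by force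
      then show "distributed M lborel (\<lambda>\<omega>. W q' \<omega> - W q \<omega>) (normal_density 0 (sqrt (q' - q)))"
      proof cases
        case 1
        then have "\<bar>b2 / r\<bar> = 1" using r by (simp add: r_def)
        then show ?thesis using e2 1 unfolding eqW by simp
      next
        case 2
        then have "\<bar>b1 / r\<bar> = 1" using r by (simp add: r_def)
        then show ?thesis using e1 2 unfolding eqW by simp
      next
        case 3
        have "indep_var (PiM {0..} (\<lambda>_. borel)) (\<lambda>\<omega>. \<lambda>t\<in>{0..}. B1 t \<omega>)
           (PiM {0..} (\<lambda>_. borel)) (\<lambda>\<omega>. \<lambda>t\<in>{0..}. B2 t \<omega>)"
          using ind unfolding independent_processes_def .
        then have "indep_var borel ((\<lambda>x. b1 / r * (x q' - x q)) \<circ> (\<lambda>\<omega>. \<lambda>t\<in>{0..}. B1 t \<omega>))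
            borel ((\<lambda>x. b2 / r * (x q' - x q)) \<circ> (\<lambda>\<omega>. \<lambda>t\<in>{0..}. B2 t \<omega>))"
          by (rule indep_var_compose) (use q in \<open>auto intro!: borel_measurable_times borel_measurable_diff measurable_component_singleton\<close>)
        then have i: "indep_var borel (\<lambda>\<omega>. b1 / r * ?d1 \<omega>) borel (\<lambda>\<omega>. b2 / r * ?d2 \<omega>)"
          using q by (simp add: o_def)
        have "distributed M lborel (\<lambda>\<omega>. b1 / r * ?d1 \<omega> + b2 / r * ?d2 \<omega>)
          (normal_density (0 + 0) (sqrt ((\<bar>b1 / r\<bar> * sqrt (q' - q))\<^sup>2 + (\<bar>b2 / r\<bar> * sqrt (q' - q))\<^sup>2)))"
          using e1 e2 3 r s0 by (intro add_indep_normal[OF i]) auto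
        moreover have "(\<bar>b1 / r\<bar> * sqrt (q' - q))\<^sup>2 + (\<bar>b2 / r\<bar> * sqrt (q' - q))\<^sup>2 = q' - q"
        proof -
          have "(\<bar>b1 / r\<bar> * sqrt (q' - q))\<^sup>2 + (\<bar>b2 / r\<bar> * sqrt (q' - q))\<^sup>2 = (b1\<^sup>2 + b2\<^sup>2) / r\<^sup>2 * (q' - q)"
            using q by (simp add: power_mult_distrib power_divide field_simps add_divide_distrib)
          then show ?thesis using r pos 3 by simp
        qed
        ultimately show ?thesis unfolding eqW by simp
      qed
    qed
    show "C.indep_var borel \<xi> borel (\<lambda>\<omega>. W q' \<omega> - W q \<omega>)"
      if q: "0 \<le> q" "q \<le> q'" and xi: "\<xi> \<in> borel_measurable (Ft (ennreal q))" for q q' \<xi>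
    proof (rule C.indep_varI)
      show "C.random_variable borel \<xi>"
        using xi subF by (auto simp: measurable_def sp)
      show Wd: "C.random_variable borel (\<lambda>\<omega>. W q' \<omega> - W q \<omega>)"
        using WM q by (intro measurable_completion borel_measurable_diff) auto
      fix A D :: "real set" assume AD: "A \<in> sets borel" "D \<in> sets borel"
      have X: "\<xi> -` A \<inter> space M \<in> sets (Ft (ennreal q))"
        using measurable_sets[OF xi AD(1)] by (simp add: sp)
      \<comment> \<open>The event is exchanged for one of the uncompleted past, at the price of a
        null set.\<close>
      have "\<exists>A'\<in>sigma_sets (space M) (past_cylinders M B1 B2 q). AE \<omega> in M. \<omega> \<in> \<xi> -` A \<inter> space M \<longleftrightarrow> \<omega> \<in> A'"
        by (rule past_approx[OF \<open>prob_space M\<close> _ _ q(1)]) (use Bm1 Bm2 X in \<open>simp_all add: Ft_def\<close>)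
      then obtain A' where A': "A' \<in> sigma_sets (space M) (past_cylinders M B1 B2 q)"
        "AE \<omega> in M. \<omega> \<in> \<xi> -` A \<inter> space M \<longleftrightarrow> \<omega> \<in> A'"
        by blast
      have A'M: "A' \<in> sets M"
        using past_increment_indep[OF \<open>prob_space M\<close> bm1 bm2 ind q] A'(1) unfolding indep_sets2_eq by blast
      have DM: "{\<omega>\<in>space M. W q' \<omega> - W q \<omega> \<in> D} \<in> sets M"
      proof -
        have [measurable]: "W q' \<in> borel_measurable M" "W q \<in> borel_measurable M" using WM q by auto
        show ?thesis using AD by measurable
      qed
      have Deq: "(\<lambda>\<omega>. W q' \<omega> - W q \<omega>) -` D \<inter> space (completion M) = {\<omega>\<in>space M. W q' \<omega> - W q \<omega> \<in> D}" by auto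
      have XC: "\<xi> -` A \<inter> space M \<in> sets (completion M)" using X subF by blast
      have ae: "AE \<omega> in completion M. \<omega> \<in> \<xi> -` A \<inter> space M \<longleftrightarrow> \<omega> \<in> A'"
        using A'(2) by (rule AE_completion)
      have "measure (completion M) (\<xi> -` A \<inter> space M \<inter> {\<omega>\<in>space M. W q' \<omega> - W q \<omega> \<in> D}) =
         measure (completion M) (A' \<inter> {\<omega>\<in>space M. W q' \<omega> - W q \<omega> \<in> D})"
        by (rule C.finite_measure_eq_AE) (use ae XC A'M DM in auto)
      also have "\<dots> = measure M A' * measure M {\<omega>\<in>space M. W q' \<omega> - W q \<omega> \<in> D}"
        using key[OF A'(1) AD(2) q] A'M DM by simp
      also have "measure M A' = measure (completion M) (\<xi> -` A \<inter> space M)"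
        unfolding measure_completion[OF A'M, symmetric]
        by (rule C.finite_measure_eq_AE) (use ae XC A'M in auto)
      finally show "C.prob (\<xi> -` A \<inter> space (completion M) \<inter> ((\<lambda>\<omega>. W q' \<omega> - W q \<omega>) -` D \<inter> space (completion M))) =
         C.prob (\<xi> -` A \<inter> space (completion M)) * C.prob ((\<lambda>\<omega>. W q' \<omega> - W q \<omega>) -` D \<inter> space (completion M))"
        unfolding Deq using DM by simp
    qed
  qed
qed

subsection \<open>Normal increments\<close>

text \<open>Completing the square. Exponential moments of a centred normal law thereby become the
  mass and the mean of a shifted one.\<close>

lemma normal_density_tilt:
  assumes "0 < s"
  shows "normal_density 0 s y * exp (\<theta> * y) = exp (\<theta>\<^sup>2 * s\<^sup>2 / 2) * normal_density (\<theta> * s\<^sup>2) s y"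
proof -
  have "- (y - 0)\<^sup>2 / (2 * s\<^sup>2) + \<theta> * y = \<theta>\<^sup>2 * s\<^sup>2 / 2 + (- (y - \<theta> * s\<^sup>2)\<^sup>2 / (2 * s\<^sup>2))"
    using assms by (simp add: field_simps power2_eq_square)
  then have "exp (- (y - 0)\<^sup>2 / (2 * s\<^sup>2)) * exp (\<theta> * y) = exp (\<theta>\<^sup>2 * s\<^sup>2 / 2) * exp (- (y - \<theta> * s\<^sup>2)\<^sup>2 / (2 * s\<^sup>2))"
    by (metis exp_add)
  then show ?thesis by (simp add: normal_density_def field_simps)
qed

lemma has_bochner_integral_normal_exp:
  assumes s: "0 < s"
  shows "has_bochner_integral lborel (\<lambda>y. normal_density 0 s y * exp (\<theta> * y)) (exp (\<theta>\<^sup>2 * s\<^sup>2 / 2))"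
    and "has_bochner_integral lborel (\<lambda>y. normal_density 0 s y * (y * exp (\<theta> * y))) (\<theta> * s\<^sup>2 * exp (\<theta>\<^sup>2 * s\<^sup>2 / 2))"
    and "has_bochner_integral lborel (\<lambda>y. normal_density 0 s y * y\<^sup>2) (s\<^sup>2)"
proof -
  have "has_bochner_integral lborel (\<lambda>y. exp (\<theta>\<^sup>2 * s\<^sup>2 / 2) * normal_density (\<theta> * s\<^sup>2) s y) (exp (\<theta>\<^sup>2 * s\<^sup>2 / 2) * 1)"
    using s by (intro has_bochner_integral_mult_right) (simp add: has_bochner_integral_iff)
  then show "has_bochner_integral lborel (\<lambda>y. normal_density 0 s y * exp (\<theta> * y)) (exp (\<theta>\<^sup>2 * s\<^sup>2 / 2))"
    using normal_density_tilt[OF s] by simp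
  have "has_bochner_integral lborel (\<lambda>y. exp (\<theta>\<^sup>2 * s\<^sup>2 / 2) * (normal_density (\<theta> * s\<^sup>2) s y * y)) (exp (\<theta>\<^sup>2 * s\<^sup>2 / 2) * (\<theta> * s\<^sup>2))"
    using s by (intro has_bochner_integral_mult_right normal_moment_nz_1)
  then show "has_bochner_integral lborel (\<lambda>y. normal_density 0 s y * (y * exp (\<theta> * y))) (\<theta> * s\<^sup>2 * exp (\<theta>\<^sup>2 * s\<^sup>2 / 2))"
    using normal_density_tilt[OF s] by (simp add: mult_ac)
  show "has_bochner_integral lborel (\<lambda>y. normal_density 0 s y * y\<^sup>2) (s\<^sup>2)"
    using normal_moment_even[OF s, of 0 1] s by (simp add: field_simps power2_eq_square)
qed

context wiener
begin

sublocale complete_measure P by (rule complete)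

lemma measurable_Ft: "f \<in> borel_measurable (Ft t) \<Longrightarrow> f \<in> borel_measurable P"
  using sets_Ft[of t] by (auto simp: measurable_def)

lemma measurable_Ft_mono: "s \<le> t \<Longrightarrow> f \<in> borel_measurable (Ft s) \<Longrightarrow> f \<in> borel_measurable (Ft t)"
  using Ft_mono[of s t] by (auto simp: measurable_def)

lemma W_meas[measurable]: "0 \<le> q \<Longrightarrow> W q \<in> borel_measurable P"
  using W_adapted measurable_Ft by blast

text \<open>Completeness of \<open>P\<close> in its working form. Limits and path integrals are
  under control only where the path is continuous; what happens on the exceptional null set is then
  harmless.\<close>

lemma borel_measurable_AE_eq:
  fixes f g :: "'a \<Rightarrow> real"
  assumes f: "f \<in> borel_measurable P" and eq: "AE \<omega> in P. f \<omega> = g \<omega>"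
  shows "g \<in> borel_measurable P"
proof (rule measurableI)
  fix A :: "real set" assume A: "A \<in> sets borel"
  show "g -` A \<inter> space P \<in> sets P"
  proof (rule in_sets_AE)
    show "AE x in P. x \<in> f -` A \<inter> space P \<longleftrightarrow> x \<in> g -` A \<inter> space P" using eq by eventually_elim auto
    show "f -` A \<inter> space P \<in> sets P" using f A by (rule measurable_sets)
  qed auto
qed simp

lemma increment_integral:
  assumes q: "0 \<le> q" "q < q'" and h: "h \<in> borel_measurable borel"
    and I: "has_bochner_integral lborel (\<lambda>y. normal_density 0 (sqrt (q' - q)) y * h y) c"
  shows "has_bochner_integral P (\<lambda>\<omega>. h (W q' \<omega> - W q \<omega>)) (c :: real)"
proof -
  have "distributed P lborel (\<lambda>\<omega>. W q' \<omega> - W q \<omega>) (normal_density 0 (sqrt (q' - q)))"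
    by (rule W_normal[OF q])
  note * = distributed_integrable[OF this, where g=h] distributed_integral[OF this, where g=h]
  show ?thesis using I * h unfolding has_bochner_integral_iff by auto
qed

lemma increment_moments:
  assumes q: "0 \<le> q" "q \<le> q'"
  shows "has_bochner_integral P (\<lambda>\<omega>. W q' \<omega> - W q \<omega>) 0"
    and "has_bochner_integral P (\<lambda>\<omega>. (W q' \<omega> - W q \<omega>)\<^sup>2) (q' - q)"
    and "has_bochner_integral P (\<lambda>\<omega>. exp (\<theta> * (W q' \<omega> - W q \<omega>))) (exp (\<theta>\<^sup>2 * (q' - q) / 2))"
    and "has_bochner_integral P (\<lambda>\<omega>. (W q' \<omega> - W q \<omega>) * exp (\<theta> * (W q' \<omega> - W q \<omega>))) (\<theta> * (q' - q) * exp (\<theta>\<^sup>2 * (q' - q) / 2))"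
proof -
  have *: "has_bochner_integral P (\<lambda>\<omega>. W q' \<omega> - W q \<omega>) 0 \<and>
     has_bochner_integral P (\<lambda>\<omega>. (W q' \<omega> - W q \<omega>)\<^sup>2) (q' - q) \<and>
     has_bochner_integral P (\<lambda>\<omega>. exp (\<theta> * (W q' \<omega> - W q \<omega>))) (exp (\<theta>\<^sup>2 * (q' - q) / 2)) \<and>
     has_bochner_integral P (\<lambda>\<omega>. (W q' \<omega> - W q \<omega>) * exp (\<theta> * (W q' \<omega> - W q \<omega>))) (\<theta> * (q' - q) * exp (\<theta>\<^sup>2 * (q' - q) / 2))"
  \<comment> \<open>An increment over an empty interval has no density; it is zero and handled
    apart.\<close>
  proof (cases "q < q'")
    case True
    have s: "0 < sqrt (q' - q)" "(sqrt (q' - q))\<^sup>2 = q' - q" using True by auto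
    note m = has_bochner_integral_normal_exp(1,2)[OF s(1), of \<theta>, unfolded s(2)]
      has_bochner_integral_normal_exp(3)[OF s(1), unfolded s(2)]
    have "has_bochner_integral lborel (\<lambda>y. normal_density 0 (sqrt (q' - q)) y * y) 0"
      using normal_moment_nz_1[of "sqrt (q' - q)" 0] s by simp
    then show ?thesis
      using increment_integral[OF q(1) True, of "\<lambda>y. y" 0] increment_integral[OF q(1) True _ m(3)]
        increment_integral[OF q(1) True _ m(1)] increment_integral[OF q(1) True _ m(2)] by auto
  next
    case False
    then have "q' = q" using q by simp
    then show ?thesis by (simp add: has_bochner_integral_iff prob_space)
  qed
  then show "has_bochner_integral P (\<lambda>\<omega>. W q' \<omega> - W q \<omega>) 0"
    "has_bochner_integral P (\<lambda>\<omega>. (W q' \<omega> - W q \<omega>)\<^sup>2) (q' - q)"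
    "has_bochner_integral P (\<lambda>\<omega>. exp (\<theta> * (W q' \<omega> - W q \<omega>))) (exp (\<theta>\<^sup>2 * (q' - q) / 2))"
    "has_bochner_integral P (\<lambda>\<omega>. (W q' \<omega> - W q \<omega>) * exp (\<theta> * (W q' \<omega> - W q \<omega>))) (\<theta> * (q' - q) * exp (\<theta>\<^sup>2 * (q' - q) / 2))"
    by auto
qed

lemma integral_mult_increment:
  assumes q: "0 \<le> q" "q \<le> q'" and xi: "\<xi> \<in> borel_measurable (Ft (ennreal q))" and h: "h \<in> borel_measurable borel"
    and i: "integrable P \<xi>" "integrable P (\<lambda>\<omega>. h (W q' \<omega> - W q \<omega>))"
  shows "integrable P (\<lambda>\<omega>. \<xi> \<omega> * (h (W q' \<omega> - W q \<omega>) :: real))"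
    and "(LINT \<omega>|P. \<xi> \<omega> * h (W q' \<omega> - W q \<omega>)) = (LINT \<omega>|P. \<xi> \<omega>) * (LINT \<omega>|P. h (W q' \<omega> - W q \<omega>))"
proof -
  have "indep_var borel (id \<circ> \<xi>) borel (h \<circ> (\<lambda>\<omega>. W q' \<omega> - W q \<omega>))"
    by (rule indep_var_compose[OF W_indep[OF q xi]]) (use h in auto)
  then have ind: "indep_var borel \<xi> borel (\<lambda>\<omega>. h (W q' \<omega> - W q \<omega>))" by (simp add: o_def)
  show "integrable P (\<lambda>\<omega>. \<xi> \<omega> * h (W q' \<omega> - W q \<omega>))" by (rule indep_var_integrable[OF ind i])
  show "(LINT \<omega>|P. \<xi> \<omega> * h (W q' \<omega> - W q \<omega>)) = (LINT \<omega>|P. \<xi> \<omega>) * (LINT \<omega>|P. h (W q' \<omega> - W q \<omega>))"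
    by (rule indep_var_lebesgue_integral[OF ind i])
qed

lemma integrable_mult_of_squares:
  fixes f g :: "'a \<Rightarrow> real"
  assumes [measurable]: "f \<in> borel_measurable P" "g \<in> borel_measurable P"
    and "integrable P (\<lambda>\<omega>. (f \<omega>)\<^sup>2)" "integrable P (\<lambda>\<omega>. (g \<omega>)\<^sup>2)"
  shows "integrable P (\<lambda>\<omega>. f \<omega> * g \<omega>)"
proof (rule Bochner_Integration.integrable_bound)
  show "integrable P (\<lambda>\<omega>. (f \<omega>)\<^sup>2 + (g \<omega>)\<^sup>2)" using assms by auto
  have "\<bar>a * b\<bar> \<le> a\<^sup>2 + b\<^sup>2" for a b :: real
  proof -
    have "0 \<le> (\<bar>a\<bar> - \<bar>b\<bar>)\<^sup>2" "0 \<le> \<bar>a\<bar> * \<bar>b\<bar>" by auto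
    then have "2 * (\<bar>a\<bar> * \<bar>b\<bar>) \<le> a\<^sup>2 + b\<^sup>2" by (simp add: power2_eq_square algebra_simps)
    then show ?thesis using \<open>0 \<le> \<bar>a\<bar> * \<bar>b\<bar>\<close> unfolding abs_mult by linarith
  qed
  then show "AE \<omega> in P. norm (f \<omega> * g \<omega>) \<le> norm ((f \<omega>)\<^sup>2 + (g \<omega>)\<^sup>2)" by auto
qed measurable

subsection \<open>Discrete stochastic integrals\<close>

text \<open>Pairwise orthogonality of the terms \<open>d\<^sub>i h\<^sub>i(W(p\<^sub>i\<^sub>+\<^sub>1) - W(p\<^sub>i))\<close>.\<close>

lemma discrete_isometry:
  fixes d :: "nat \<Rightarrow> 'a \<Rightarrow> real" and h :: "nat \<Rightarrow> real \<Rightarrow> real"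
  assumes p: "0 \<le> p 0" "\<And>i. i < n \<Longrightarrow> p i \<le> p (Suc i)"
    and d: "\<And>i. i < n \<Longrightarrow> d i \<in> borel_measurable (Ft (ennreal (p i)))"
    and d2: "\<And>i. i < n \<Longrightarrow> integrable P (\<lambda>\<omega>. (d i \<omega>)\<^sup>2)"
    and h: "\<And>i. i < n \<Longrightarrow> h i \<in> borel_measurable borel"
    and h2: "\<And>i. i < n \<Longrightarrow> integrable P (\<lambda>\<omega>. (h i (W (p (Suc i)) \<omega> - W (p i) \<omega>))\<^sup>2)"
    and h0: "\<And>i. i < n \<Longrightarrow> (LINT \<omega>|P. h i (W (p (Suc i)) \<omega> - W (p i) \<omega>)) = 0"
  shows "(\<lambda>\<omega>. \<Sum>i<n. d i \<omega> * h i (W (p (Suc i)) \<omega> - W (p i) \<omega>)) \<in> borel_measurable (Ft (ennreal (p n))) \<and>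
    integrable P (\<lambda>\<omega>. (\<Sum>i<n. d i \<omega> * h i (W (p (Suc i)) \<omega> - W (p i) \<omega>))\<^sup>2) \<and>
    (LINT \<omega>|P. (\<Sum>i<n. d i \<omega> * h i (W (p (Suc i)) \<omega> - W (p i) \<omega>))\<^sup>2) =
      (\<Sum>i<n. (LINT \<omega>|P. (d i \<omega>)\<^sup>2) * (LINT \<omega>|P. (h i (W (p (Suc i)) \<omega> - W (p i) \<omega>))\<^sup>2))"
  using assms
proof (induction n)
  case 0
  then show ?case by simp
next
  case (Suc n)
  let ?S = "\<lambda>\<omega>. \<Sum>i<n. d i \<omega> * h i (W (p (Suc i)) \<omega> - W (p i) \<omega>)"
  let ?h = "\<lambda>\<omega>. h n (W (p (Suc n)) \<omega> - W (p n) \<omega>)"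
  have IH: "?S \<in> borel_measurable (Ft (ennreal (p n)))" "integrable P (\<lambda>\<omega>. (?S \<omega>)\<^sup>2)"
    "(LINT \<omega>|P. (?S \<omega>)\<^sup>2) = (\<Sum>i<n. (LINT \<omega>|P. (d i \<omega>)\<^sup>2) * (LINT \<omega>|P. (h i (W (p (Suc i)) \<omega> - W (p i) \<omega>))\<^sup>2))"
    using Suc.IH Suc.prems by auto
  have pge: "0 \<le> p i" if "i \<le> Suc n" for i
    using that
  proof (induction i)
    case (Suc i)
    then show ?case using Suc.prems \<open>\<And>i. i < Suc n \<Longrightarrow> p i \<le> p (Suc i)\<close>[of i] by (auto intro: order_trans)
  qed (use Suc.prems in auto)
  have pn: "0 \<le> p n" "p n \<le> p (Suc n)" using pge[of n] Suc.prems by auto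
  have dn: "d n \<in> borel_measurable (Ft (ennreal (p n)))" and hn[measurable]: "h n \<in> borel_measurable borel"
    and dn2: "integrable P (\<lambda>\<omega>. (d n \<omega>)\<^sup>2)" and hn2: "integrable P (\<lambda>\<omega>. (?h \<omega>)\<^sup>2)"
    and hn0: "(LINT \<omega>|P. ?h \<omega>) = 0"
    using Suc.prems by auto
  have le: "ennreal (p n) \<le> ennreal (p (Suc n))" using pn by (auto intro: ennreal_leI)
  have Wn: "W (p n) \<in> borel_measurable (Ft (ennreal (p (Suc n))))"
    by (rule measurable_Ft_mono[OF le W_adapted]) (use pn in auto)
  have WSn: "W (p (Suc n)) \<in> borel_measurable (Ft (ennreal (p (Suc n))))"
    by (rule W_adapted) (use pn in auto)
  have hF: "?h \<in> borel_measurable (Ft (ennreal (p (Suc n))))"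
    using Wn WSn by measurable
  have hP[measurable]: "?h \<in> borel_measurable P" by (rule measurable_Ft[OF hF])
  have SP[measurable]: "?S \<in> borel_measurable P" by (rule measurable_Ft[OF IH(1)])
  have dP[measurable]: "d n \<in> borel_measurable P" by (rule measurable_Ft[OF dn])
  have ih: "integrable P ?h" using hP hn2 by (rule square_integrable_imp_integrable)
  have Sd: "integrable P (\<lambda>\<omega>. ?S \<omega> * d n \<omega>)"
    by (rule integrable_mult_of_squares) (use IH dn2 in auto)
  have SdF: "(\<lambda>\<omega>. ?S \<omega> * d n \<omega>) \<in> borel_measurable (Ft (ennreal (p n)))"
    using IH(1) dn by measurable
  have d2F: "(\<lambda>\<omega>. (d n \<omega>)\<^sup>2) \<in> borel_measurable (Ft (ennreal (p n)))" using dn by measurable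
  note cross = integral_mult_increment[OF pn SdF hn Sd ih]
  have h2m: "(\<lambda>y. (h n y)\<^sup>2) \<in> borel_measurable borel" by measurable
  note diag = integral_mult_increment[OF pn d2F h2m dn2 hn2]
  \<comment> \<open>The mixed term has mean zero, since \<open>?S * d n\<close> is known at time
    \<open>p n\<close> and \<open>?h\<close> is centred and independent of it. For this the
    induction carries the measurability of the partial sum.\<close>
  have expand: "(\<Sum>i<Suc n. d i \<omega> * h i (W (p (Suc i)) \<omega> - W (p i) \<omega>))\<^sup>2 =
     (?S \<omega>)\<^sup>2 + (2 * ((?S \<omega> * d n \<omega>) * ?h \<omega>) + (d n \<omega>)\<^sup>2 * (?h \<omega>)\<^sup>2)" for \<omega>
    by (simp add: power2_eq_square algebra_simps)
  have "(\<lambda>\<omega>. ?S \<omega> + d n \<omega> * ?h \<omega>) \<in> borel_measurable (Ft (ennreal (p (Suc n))))"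
    by (intro borel_measurable_add borel_measurable_times hF measurable_Ft_mono[OF le IH(1)] measurable_Ft_mono[OF le dn])
  moreover have "integrable P (\<lambda>\<omega>. (\<Sum>i<Suc n. d i \<omega> * h i (W (p (Suc i)) \<omega> - W (p i) \<omega>))\<^sup>2)"
    unfolding expand using IH cross(1) diag(1) by (intro Bochner_Integration.integrable_add integrable_mult_right) auto
  moreover have "(LINT \<omega>|P. (\<Sum>i<Suc n. d i \<omega> * h i (W (p (Suc i)) \<omega> - W (p i) \<omega>))\<^sup>2) =
      (LINT \<omega>|P. (?S \<omega>)\<^sup>2) + (2 * (LINT \<omega>|P. (?S \<omega> * d n \<omega>) * ?h \<omega>) + (LINT \<omega>|P. (d n \<omega>)\<^sup>2 * (?h \<omega>)\<^sup>2))"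
    unfolding expand using IH(2) cross(1) diag(1)
    by (subst Bochner_Integration.integral_add, simp, simp, subst Bochner_Integration.integral_add, simp_all)
  ultimately show ?case
    using IH(3) cross(2) diag(2) hn0 by simp
qed

text \<open>The coefficient \<open>\<xi> i\<close> is switched off once the accumulated sum
  \<open>A (Suc i)\<close> exceeds \<open>\<eta>\<close>; this sum is already known at time
  \<open>p i\<close>, so the truncated coefficients \<open>d i\<close> stay adapted. Their integral
  has second moment at most \<open>\<eta>\<close>, whence the term
  \<open>\<eta> / \<epsilon>\<^sup>2\<close> by Markov's inequality, and both integrals coincide
  unless \<open>\<eta> < A n\<close>. The inequality thus works without moments of
  \<open>\<xi>\<close>.\<close>

lemma discrete_lenglart:
  fixes \<xi> :: "nat \<Rightarrow> 'a \<Rightarrow> real"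
  assumes p: "0 \<le> p 0" "\<And>i. i < n \<Longrightarrow> p i < p (Suc i)"
    and xi: "\<And>i. i < n \<Longrightarrow> \<xi> i \<in> borel_measurable (Ft (ennreal (p i)))"
    and "0 < \<epsilon>" "0 < \<eta>"
  shows "prob {\<omega>\<in>space P. \<epsilon> < \<bar>\<Sum>i<n. \<xi> i \<omega> * (W (p (Suc i)) \<omega> - W (p i) \<omega>)\<bar>}
     \<le> prob {\<omega>\<in>space P. \<eta> < (\<Sum>i<n. (\<xi> i \<omega>)\<^sup>2 * (p (Suc i) - p i))} + \<eta> / \<epsilon>\<^sup>2"
proof -
  define A where "A i \<omega> = (\<Sum>j<i. (\<xi> j \<omega>)\<^sup>2 * (p (Suc j) - p j))" for i \<omega>
  define d where "d i \<omega> = (if A (Suc i) \<omega> \<le> \<eta> then \<xi> i \<omega> else 0)" for i \<omega>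
  have pmono: "p i \<le> p j" if "i \<le> j" "j \<le> n" for i j
    using that
  proof (induction rule: dec_induct)
    case (step m)
    then show ?case using p(2)[of m] by simp
  qed simp
  have p0: "0 \<le> p i" if "i \<le> n" for i using pmono[of 0 i] that p by auto
  have xiP[measurable]: "\<xi> i \<in> borel_measurable P" if "i < n" for i using measurable_Ft xi that by blast
  have AP: "A i \<in> borel_measurable (Ft (ennreal (p k)))" if "i \<le> Suc k" "k < n" for i k
  proof -
    have "\<xi> j \<in> borel_measurable (Ft (ennreal (p k)))" if "j < i" for j
      by (rule measurable_Ft_mono[OF ennreal_leI xi]) (use that \<open>i \<le> Suc k\<close> \<open>k < n\<close> pmono[of j k] in auto)
    then show ?thesis unfolding A_def
      by (intro borel_measurable_sum borel_measurable_times borel_measurable_power borel_measurable_const) auto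
  qed
  have dF: "d i \<in> borel_measurable (Ft (ennreal (p i)))" if "i < n" for i
    unfolding d_def using AP[of "Suc i" i] xi[OF that] that by measurable
  have dP[measurable]: "d i \<in> borel_measurable P" if "i < n" for i using measurable_Ft dF that by blast
  have Amono: "(\<xi> i \<omega>)\<^sup>2 * (p (Suc i) - p i) \<le> A (Suc i) \<omega>" if "i < n" for i \<omega>
  proof -
    have "0 \<le> A i \<omega>" unfolding A_def using p(2) that
      by (intro sum_nonneg mult_nonneg_nonneg) (auto simp: less_imp_le)
    then show ?thesis by (simp add: A_def)
  qed
  \<comment> \<open>The cutoff alone bounds the coefficient, in terms of the length of its interval;
    strict monotonicity of \<open>p\<close> makes this bound finite.\<close>
  have dbd: "(d i \<omega>)\<^sup>2 \<le> \<eta> / (p (Suc i) - p i)" if "i < n" for i \<omega>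
  proof (cases "A (Suc i) \<omega> \<le> \<eta>")
    case True
    then have "(\<xi> i \<omega>)\<^sup>2 * (p (Suc i) - p i) \<le> \<eta>" using Amono[OF that, of \<omega>] by simp
    then show ?thesis using True p(2)[OF that] by (simp add: d_def field_simps)
  qed (use p(2)[OF that] \<open>0 < \<eta>\<close> in \<open>simp add: d_def\<close>)
  have di: "integrable P (\<lambda>\<omega>. (d i \<omega>)\<^sup>2)" if "i < n" for i
    by (rule integrable_const_bound[where B="\<eta> / (p (Suc i) - p i)"]) (use dbd that in auto)
  have inc: "has_bochner_integral P (\<lambda>\<omega>. W (p (Suc i)) \<omega> - W (p i) \<omega>) 0"
    "has_bochner_integral P (\<lambda>\<omega>. (W (p (Suc i)) \<omega> - W (p i) \<omega>)\<^sup>2) (p (Suc i) - p i)" if "i < n" for i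
    using increment_moments(1,2)[of "p i" "p (Suc i)"] p0[of i] p(2)[OF that] that by auto
  let ?S = "\<lambda>\<omega>. \<Sum>i<n. d i \<omega> * (W (p (Suc i)) \<omega> - W (p i) \<omega>)"
  have iso: "?S \<in> borel_measurable (Ft (ennreal (p n))) \<and> integrable P (\<lambda>\<omega>. (?S \<omega>)\<^sup>2) \<and>
    (LINT \<omega>|P. (?S \<omega>)\<^sup>2) = (\<Sum>i<n. (LINT \<omega>|P. (d i \<omega>)\<^sup>2) * (LINT \<omega>|P. (W (p (Suc i)) \<omega> - W (p i) \<omega>)\<^sup>2))"
    using discrete_isometry[of p n d "\<lambda>_ y. y"] p(1) p(2) dF di inc
    by (auto simp: has_bochner_integral_iff less_imp_le)
  have [measurable]: "?S \<in> borel_measurable P" using iso measurable_Ft by blast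
  have sumd: "(\<Sum>j<k. (d j \<omega>)\<^sup>2 * (p (Suc j) - p j)) \<le> min \<eta> (A k \<omega>)" if "k \<le> n" for k \<omega>
    using that
  proof (induction k)
    case 0 then show ?case using \<open>0 < \<eta>\<close> by (simp add: A_def)
  next
    case (Suc k)
    have "0 \<le> (\<xi> k \<omega>)\<^sup>2 * (p (Suc k) - p k)" using p(2)[of k] Suc by simp
    then show ?case using Suc by (auto simp: d_def A_def)
  qed
  have "(LINT \<omega>|P. (?S \<omega>)\<^sup>2) = (\<Sum>i<n. (LINT \<omega>|P. (d i \<omega>)\<^sup>2) * (p (Suc i) - p i))"
    using iso inc by (auto simp: has_bochner_integral_iff)
  also have "\<dots> = (LINT \<omega>|P. (\<Sum>i<n. (d i \<omega>)\<^sup>2 * (p (Suc i) - p i)))"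
    using di by (subst Bochner_Integration.integral_sum) auto
  also have "\<dots> \<le> (LINT \<omega>|P. \<eta>)"
    by (intro integral_mono) (use di sumd[of n] in auto)
  finally have S2: "(LINT \<omega>|P. (?S \<omega>)\<^sup>2) \<le> \<eta>" by (simp add: prob_space)
  have A_le: "A (Suc i) \<omega> \<le> A n \<omega>" if "i < n" for i \<omega>
  proof -
    have "sum (\<lambda>j. (\<xi> j \<omega>)\<^sup>2 * (p (Suc j) - p j)) {..<Suc i} \<le> sum (\<lambda>j. (\<xi> j \<omega>)\<^sup>2 * (p (Suc j) - p j)) {..<n}"
      by (rule sum_mono2) (use that p(2) in \<open>auto intro!: mult_nonneg_nonneg simp: less_imp_le\<close>)
    then show ?thesis by (simp add: A_def)
  qed
  have same: "?S \<omega> = (\<Sum>i<n. \<xi> i \<omega> * (W (p (Suc i)) \<omega> - W (p i) \<omega>))" if "A n \<omega> \<le> \<eta>" for \<omega>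
    using A_le[of _ \<omega>] that by (intro sum.cong) (auto simp: d_def intro: order_trans)
  have WP: "(\<lambda>\<omega>. W (p (Suc i)) \<omega> - W (p i) \<omega>) \<in> borel_measurable P" if "i < n" for i
    using p0[of i] p0[of "Suc i"] that by (intro borel_measurable_diff W_meas) auto
  have [measurable]: "A n \<in> borel_measurable P" unfolding A_def
    by (intro borel_measurable_sum borel_measurable_times borel_measurable_power borel_measurable_const xiP) auto
  have [measurable]: "(\<lambda>\<omega>. \<Sum>i<n. \<xi> i \<omega> * (W (p (Suc i)) \<omega> - W (p i) \<omega>)) \<in> borel_measurable P"
    by (intro borel_measurable_sum borel_measurable_times xiP WP) auto
  have "prob {\<omega>\<in>space P. \<epsilon> < \<bar>\<Sum>i<n. \<xi> i \<omega> * (W (p (Suc i)) \<omega> - W (p i) \<omega>)\<bar>}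
     \<le> prob ({\<omega>\<in>space P. \<eta> < A n \<omega>} \<union> {\<omega>\<in>space P. \<epsilon>\<^sup>2 \<le> (?S \<omega>)\<^sup>2})"
  proof (rule finite_measure_mono)
    show "{\<omega>\<in>space P. \<epsilon> < \<bar>\<Sum>i<n. \<xi> i \<omega> * (W (p (Suc i)) \<omega> - W (p i) \<omega>)\<bar>} \<subseteq>
       {\<omega>\<in>space P. \<eta> < A n \<omega>} \<union> {\<omega>\<in>space P. \<epsilon>\<^sup>2 \<le> (?S \<omega>)\<^sup>2}"
    proof
      fix \<omega> assume w: "\<omega> \<in> {\<omega>\<in>space P. \<epsilon> < \<bar>\<Sum>i<n. \<xi> i \<omega> * (W (p (Suc i)) \<omega> - W (p i) \<omega>)\<bar>}"
      show "\<omega> \<in> {\<omega>\<in>space P. \<eta> < A n \<omega>} \<union> {\<omega>\<in>space P. \<epsilon>\<^sup>2 \<le> (?S \<omega>)\<^sup>2}"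
      proof (cases "A n \<omega> \<le> \<eta>")
        case True
        have "\<epsilon> < \<bar>?S \<omega>\<bar>" unfolding same[OF True] using w by simp
        then have "\<epsilon>\<^sup>2 \<le> \<bar>?S \<omega>\<bar>\<^sup>2" using \<open>0 < \<epsilon>\<close> by (intro power_mono) auto
        then show ?thesis using w by simp
      qed (use w in simp)
    qed
  qed measurable
  also have "\<dots> \<le> prob {\<omega>\<in>space P. \<eta> < A n \<omega>} + prob {\<omega>\<in>space P. \<epsilon>\<^sup>2 \<le> (?S \<omega>)\<^sup>2}"
    by (rule measure_Un_le) measurable
  also have "prob {\<omega>\<in>space P. \<epsilon>\<^sup>2 \<le> (?S \<omega>)\<^sup>2} \<le> (LINT \<omega>|P. (?S \<omega>)\<^sup>2) / \<epsilon>\<^sup>2"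
    using iso \<open>0 < \<epsilon>\<close> by (intro integral_Markov_inequality_measure[where A="{}"]) simp_all
  also have "(LINT \<omega>|P. (?S \<omega>)\<^sup>2) / \<epsilon>\<^sup>2 \<le> \<eta> / \<epsilon>\<^sup>2" using S2 by (simp add: divide_right_mono)
  finally show ?thesis by (simp add: A_def)
qed

end

subsection \<open>Step functions on a partition\<close>

lemma cell_sum:
  fixes s :: "nat \<Rightarrow> real" and c :: "nat \<Rightarrow> real"
  assumes "\<And>i. i < k \<Longrightarrow> s i \<le> s (Suc i)" "s 0 < q" "q \<le> s k"
  shows "\<exists>i<k. s i < q \<and> q \<le> s (Suc i) \<and> (\<Sum>j<k. c j * indicator {s j<..s (Suc j)} q) = c i"
  using assms
proof (induction k)
  case 0
  then show ?case by simp
next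
  case (Suc k)
  show ?case
  proof (cases "q \<le> s k")
    case True
    then obtain i where "i < k" "s i < q" "q \<le> s (Suc i)" "(\<Sum>j<k. c j * indicator {s j<..s (Suc j)} q) = c i"
      using Suc by auto
    then show ?thesis using True by (intro exI[of _ i]) (auto simp: indicator_def)
  next
    case False
    have mono: "s j \<le> s k" if "j \<le> k" for j
      using that
    proof (induction rule: inc_induct)
      case (step n)
      then show ?case using Suc.prems(1)[of n] by simp
    qed simp
    have "c j * indicator {s j<..s (Suc j)} q = 0" if "j < k" for j
      using mono[of "Suc j"] that False by (auto simp: indicator_def)
    then have "(\<Sum>j<k. c j * indicator {s j<..s (Suc j)} q) = 0" by (intro sum.neutral) auto
    then show ?thesis using False Suc.prems by (intro exI[of _ k]) (auto simp: indicator_def)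
  qed
qed

lemma sum_cells_telescope:
  fixes p :: "nat \<Rightarrow> real" and w :: "real \<Rightarrow> real"
  assumes p: "\<And>i. i < N \<Longrightarrow> p i < p (Suc i)" and lr: "l \<le> r" "r \<le> N"
  shows "(\<Sum>j<N. indicator {p l<..p r} (p (Suc j)) * (w (p (Suc j)) - w (p j))) = w (p r) - w (p l)"
proof -
  have less: "p i < p j" if "i < j" "j \<le> N" for i j
    using that
  proof (induction j)
    case (Suc j)
    then show ?case using p[of j] by (cases "i = j") auto
  qed simp
  have iff: "p i < p j \<longleftrightarrow> i < j" if "i \<le> N" "j \<le> N" for i j
    using less[of i j] less[of j i] that by (cases i j rule: linorder_cases) auto
  have "(\<Sum>j<N. indicator {p l<..p r} (p (Suc j)) * (w (p (Suc j)) - w (p j))) =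
      (\<Sum>j\<in>{l..<r}. w (p (Suc j)) - w (p j))"
  proof (rule sum.mono_neutral_cong_right)
    show "\<forall>i\<in>{..<N} - {l..<r}. indicator {p l<..p r} (p (Suc i)) * (w (p (Suc i)) - w (p i)) = 0"
    proof
      fix i assume i: "i \<in> {..<N} - {l..<r}"
      then have "\<not> p l < p (Suc i) \<or> \<not> p (Suc i) \<le> p r"
        using iff[of l "Suc i"] iff[of r "Suc i"] lr by (auto simp: not_le)
      then show "indicator {p l<..p r} (p (Suc i)) * (w (p (Suc i)) - w (p i)) = 0" by auto
    qed
    fix i assume i: "i \<in> {l..<r}"
    then have "p l < p (Suc i)" "p (Suc i) \<le> p r"
      using iff[of l "Suc i"] iff[of r "Suc i"] lr by auto
    then show "indicator {p l<..p r} (p (Suc i)) * (w (p (Suc i)) - w (p i)) = w (p (Suc i)) - w (p i)" by simp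
  qed (use lr in auto)
  also have "\<dots> = w (p r) - w (p l)"
    using sum_Suc_diff'[OF lr(1), of "\<lambda>j. w (p j)"] by simp
  finally show ?thesis .
qed

text \<open>\<open>F\<close> is prescribed on half-open cells, which miss the point 0. On the rest
  of \<open>[0, t]\<close> it is a step function, and this settles both its measurability and its
  integral.\<close>

lemma step_integral:
  fixes p :: "nat \<Rightarrow> real" and F :: "real \<Rightarrow> real"
  assumes p: "\<And>i. i < N \<Longrightarrow> p i \<le> p (Suc i)" "p 0 = 0" "p N = t"
    and F: "\<And>j q. j < N \<Longrightarrow> p j < q \<Longrightarrow> q \<le> p (Suc j) \<Longrightarrow> F q = c j"
  shows "(LINT q:{0..t}|lborel. F q) = (\<Sum>j<N. c j * (p (Suc j) - p j))"
proof -
  have mono: "p i \<le> p j" if "i \<le> j" "j \<le> N" for i j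
    using that
  proof (induction j)
    case (Suc j)
    then show ?case using p(1)[of j] by (cases "i = Suc j") auto
  qed simp
  let ?g = "\<lambda>q. \<Sum>j<N. c j * indicator {p j<..p (Suc j)} q"
  have pointwise: "indicator {0..t} q *\<^sub>R F q = ?g q" if elim: "q \<noteq> 0" for q
  proof (cases "0 < q \<and> q \<le> t")
        case True
        then obtain i where "i < N" "p i < q" "q \<le> p (Suc i)" "(\<Sum>j<N. c j * indicator {p j<..p (Suc j)} q) = c i"
          using cell_sum[of N p q c] p by auto
        then show ?thesis using F[of i q] True by simp
      next
        case False
        have "c j * indicator {p j<..p (Suc j)} q = 0" if "j < N" for j
          using False elim mono[of 0 j] mono[of "Suc j" N] that p by (auto simp: indicator_def)
        then have "(\<Sum>j<N. c j * indicator {p j<..p (Suc j)} q) = 0" by (intro sum.neutral) auto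
        then show ?thesis using False elim by (auto simp: indicator_def)
  qed
  have "?g \<in> borel_measurable borel" by measurable
  moreover have "(\<lambda>q. indicator {0..t} q *\<^sub>R F q) =
      (\<lambda>q. if q = 0 then indicator {0..t} (0::real) * F 0 else ?g q)"
    using pointwise by (auto simp: fun_eq_iff)
  ultimately have meas: "(\<lambda>q. indicator {0..t} q *\<^sub>R F q) \<in> borel_measurable borel" by simp
  have "(LINT q:{0..t}|lborel. F q) = (LINT q|lborel. ?g q)"
    unfolding set_lebesgue_integral_def
  proof (rule integral_cong_AE)
    have "AE q in lborel. q \<noteq> (0::real)" by (rule AE_lborel_singleton)
    then show "AE q in lborel. indicator {0..t} q *\<^sub>R F q = ?g q"
      by eventually_elim (rule pointwise)
  qed (use meas in \<open>simp, measurable\<close>)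
  also have "\<dots> = (\<Sum>j<N. LINT q|lborel. c j * indicator {p j<..p (Suc j)} q)"
    by (intro Bochner_Integration.integral_sum integrable_mult_right)
      (auto simp: emeasure_lborel_Ioc p(1))
  also have "\<dots> = (\<Sum>j<N. c j * (p (Suc j) - p j))"
    by (intro sum.cong) (auto simp: p(1))
  finally show ?thesis .
qed

lemma ex_partition:
  fixes A :: "real set"
  assumes "finite A" "0 \<in> A" "t \<in> A" "A \<subseteq> {0..t}"
  shows "\<exists>N p. p 0 = 0 \<and> p N = t \<and> (\<forall>i<N. p i < p (Suc i)) \<and> p ` {..N} = A"
proof -
  define L where "L = sorted_list_of_set A"
  have L: "sorted_wrt (<) L" "set L = A" "L \<noteq> []" using assms unfolding L_def by auto
  define N where "N = length L - 1"
  have len: "length L = Suc N" using L(3) by (simp add: N_def)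
  have less: "L ! i < L ! j" if "i < j" "j \<le> N" for i j
    using sorted_wrt_nth_less[OF L(1)] that len by auto
  have img: "(\<lambda>i. L ! i) ` {..N} = A"
    using L(2) len by (auto simp: set_conv_nth less_Suc_eq_le)
  have L_in: "L ! i \<in> {0..t}" if "i \<le> N" for i using img that assms(4) by blast
  obtain i where "i \<le> N" "L ! i = 0" using img assms(2) by force
  then have "L ! 0 = 0" using less[of 0 i] L_in[of 0] by (cases i) auto
  obtain j where "j \<le> N" "L ! j = t" using img assms(3) by force
  then have "L ! N = t" using less[of j N] L_in[of N] by (cases "j = N") auto
  show ?thesis
    using \<open>L ! 0 = 0\<close> \<open>L ! N = t\<close> less img by (intro exI[of _ N] exI[of _ "\<lambda>i. L ! i"]) auto
qed

text \<open>\<open>p\<close> is a partition of \<open>[0, t]\<close> containing all breakpoints of a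
  step process, capped at \<open>t\<close> because breakpoints may lie beyond. Two interpretations
  with the same \<open>p\<close> make two step processes comparable cell by cell.\<close>

locale refinement =
  fixes s :: "nat \<Rightarrow> real" and k :: nat and p :: "nat \<Rightarrow> real" and N :: nat and t :: real
  assumes s0: "0 \<le> s 0" and s_mono: "\<And>i. i < k \<Longrightarrow> s i \<le> s (Suc i)"
    and p0: "p 0 = 0" and pN: "p N = t" and p_less: "\<And>i. i < N \<Longrightarrow> p i < p (Suc i)"
    and ref: "\<And>i. i \<le> k \<Longrightarrow> min t (s i) \<in> p ` {..N}"
begin

lemma p_less': "i < j \<Longrightarrow> j \<le> N \<Longrightarrow> p i < p j"
proof (induction j)
  case (Suc j)
  then show ?case using p_less[of j] by (cases "i = j") auto
qed simp

lemma p_iff: "i \<le> N \<Longrightarrow> j \<le> N \<Longrightarrow> p i < p j \<longleftrightarrow> i < j"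
  using p_less'[of i j] p_less'[of j i] by (cases i j rule: linorder_cases) auto

lemma p_le_t: "i \<le> N \<Longrightarrow> p i \<le> t"
  using p_less'[of i N] pN by (cases "i = N") auto

text \<open>No breakpoint lies strictly inside a cell: a breakpoint below \<open>t\<close> is a
  partition point, and any other lies to the right of all cells or at the end of the last.\<close>

lemma s_less_iff:
  assumes as: "j < N" "p j < q" "q \<le> p (Suc j)" "i \<le> k"
  shows "s i < q \<longleftrightarrow> s i < p (Suc j)" "s i < p (Suc j) \<longleftrightarrow> s i \<le> p j"
proof -
  obtain l where l: "l \<le> N" "min t (s i) = p l" using ref[OF as(4)] by force
  have t: "p (Suc j) \<le> t" using p_le_t as by simp
  have "s i \<le> p j" if "s i < p (Suc j)"
  proof -
    have "s i = p l" using l t that by (simp add: min_def split: if_splits)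
    then have "l \<le> j" using that p_iff[of l "Suc j"] l \<open>j < N\<close> by simp
    then show ?thesis using \<open>s i = p l\<close> p_less'[of l j] \<open>j < N\<close> by (cases "l = j") auto
  qed
  then show "s i < q \<longleftrightarrow> s i < p (Suc j)" "s i < p (Suc j) \<longleftrightarrow> s i \<le> p j"
    using as p_less[of j] by auto
qed

lemma q_le_iff: "q \<le> s i \<longleftrightarrow> p (Suc j) \<le> s i"
  if "j < N" "p j < q" "q \<le> p (Suc j)" "i \<le> k"
  using s_less_iff[OF that] that by auto

lemma simple_value_const:
  assumes "j < N" "p j < q" "q \<le> p (Suc j)"
  shows "simple_value k s \<xi> q \<omega> = simple_value k s \<xi> (p (Suc j)) \<omega>"
  unfolding simple_value_def
proof (intro sum.cong refl)
  fix i assume "i \<in> {..<k}"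
  then show "\<xi> i \<omega> * indicator {s i<..s (Suc i)} q = \<xi> i \<omega> * indicator {s i<..s (Suc i)} (p (Suc j))"
    using s_less_iff(1)[OF assms, of i] q_le_iff[OF assms, of "Suc i"] by (simp add: indicator_def)
qed

text \<open>Each interval of the step process, cut at \<open>t\<close>, is a union of cells, over
  which the increments of \<open>W\<close> telescope; the two sums are then interchanged. Evaluation
  at the right endpoint \<open>p (Suc j)\<close> picks the value on the whole half-open
  cell.\<close>

lemma simple_integral_eq:
  "simple_integral W k s \<xi> t \<omega> = (\<Sum>j<N. simple_value k s \<xi> (p (Suc j)) \<omega> * (W (p (Suc j)) \<omega> - W (p j) \<omega>))"
proof -
  have "(\<Sum>j<N. indicator {s i<..s (Suc i)} (p (Suc j)) * (W (p (Suc j)) \<omega> - W (p j) \<omega>)) =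
      W (min t (s (Suc i))) \<omega> - W (min t (s i)) \<omega>" if i: "i < k" for i
  proof -
    obtain l where l: "l \<le> N" "min t (s i) = p l" using ref[of i] i by force
    obtain r where r: "r \<le> N" "min t (s (Suc i)) = p r" using ref[of "Suc i"] i by force
    have "p l \<le> p r" using l r s_mono[OF i] by (metis min.mono order_refl)
    then have lr: "l \<le> r" using p_iff[of r l] l r by auto
    have "(\<Sum>j<N. indicator {s i<..s (Suc i)} (p (Suc j)) * (W (p (Suc j)) \<omega> - W (p j) \<omega>)) =
      (\<Sum>j<N. indicator {p l<..p r} (p (Suc j)) * (W (p (Suc j)) \<omega> - W (p j) \<omega>))"
    proof (intro sum.cong refl)
      fix j assume "j \<in> {..<N}"
      then have "p (Suc j) \<le> t" using p_le_t by simp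
      then have "p (Suc j) \<in> {s i<..s (Suc i)} \<longleftrightarrow> p (Suc j) \<in> {min t (s i)<..min t (s (Suc i))}"
        by (auto simp: min_def)
      then show "indicator {s i<..s (Suc i)} (p (Suc j)) * (W (p (Suc j)) \<omega> - W (p j) \<omega>) =
         indicator {p l<..p r} (p (Suc j)) * (W (p (Suc j)) \<omega> - W (p j) \<omega>)"
        unfolding l r by (simp add: indicator_def)
    qed
    also have "\<dots> = W (p r) \<omega> - W (p l) \<omega>"
      by (rule sum_cells_telescope[of N p l r "\<lambda>q. W q \<omega>"]) (use p_less lr r in auto)
    finally show ?thesis unfolding l r .
  qed
  then have "simple_integral W k s \<xi> t \<omega> =
     (\<Sum>i<k. \<xi> i \<omega> * (\<Sum>j<N. indicator {s i<..s (Suc i)} (p (Suc j)) * (W (p (Suc j)) \<omega> - W (p j) \<omega>)))"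
    unfolding simple_integral_def by simp
  also have "\<dots> = (\<Sum>j<N. simple_value k s \<xi> (p (Suc j)) \<omega> * (W (p (Suc j)) \<omega> - W (p j) \<omega>))"
    unfolding simple_value_def sum_distrib_left sum_distrib_right
    by (subst sum.swap) (simp add: mult_ac)
  finally show ?thesis .
qed

end

text \<open>\<open>simple_process\<close> without boundedness: left-point approximations of an
  unbounded integrand are of this kind.\<close>

definition adapted_step :: "(ennreal \<Rightarrow> 'a measure) \<Rightarrow> nat \<Rightarrow> (nat \<Rightarrow> real) \<Rightarrow> (nat \<Rightarrow> 'a \<Rightarrow> real) \<Rightarrow> bool" where
  "adapted_step Ft k s \<xi> \<longleftrightarrow> 0 \<le> s 0 \<and> (\<forall>i<k. s i \<le> s (Suc i)) \<and>
     (\<forall>i<k. \<xi> i \<in> borel_measurable (Ft (ennreal (s i))))"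

text \<open>A step \<open>\<xi> i\<close> active on the cell that ends at \<open>p (Suc j)\<close>
  starts no later than \<open>p j\<close>, so its value is known at the left end of the
  cell.\<close>

lemma (in refinement) simple_value_adapted:
  assumes "wiener P Ft W" "adapted_step Ft k s \<xi>" "j < N"
  shows "simple_value k s \<xi> (p (Suc j)) \<in> borel_measurable (Ft (ennreal (p j)))"
proof -
  interpret wiener P Ft W by fact
  have "(\<lambda>\<omega>. \<xi> i \<omega> * indicator {s i<..s (Suc i)} (p (Suc j))) \<in> borel_measurable (Ft (ennreal (p j)))" if "i < k" for i
  proof (cases "s i < p (Suc j)")
    case True
    then have "s i \<le> p j" using s_less_iff(2)[of j "p (Suc j)" i] assms(3) p_less[of j] that by auto
    then have "\<xi> i \<in> borel_measurable (Ft (ennreal (p j)))"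
      using measurable_Ft_mono[OF ennreal_leI] assms(2) that unfolding adapted_step_def by blast
    then show ?thesis by measurable
  qed simp
  then show ?thesis unfolding simple_value_def by (intro borel_measurable_sum) auto
qed

context wiener
begin

text \<open>On a common refinement the difference of two step processes is again a step process,
  with coefficients known at the left ends of the cells, and the discrete inequality applies to
  it.\<close>

lemma step_process_lenglart:
  assumes A: "adapted_step Ft k s \<xi>" and A': "adapted_step Ft k' s' \<xi>'"
    and t: "0 < t" and pos: "0 < \<epsilon>" "0 < \<eta>"
  shows "prob {\<omega>\<in>space P. \<epsilon> < \<bar>simple_integral W k s \<xi> t \<omega> - simple_integral W k' s' \<xi>' t \<omega>\<bar>}
     \<le> prob {\<omega>\<in>space P. \<eta> < (LINT q:{0..t}|lborel. (simple_value k s \<xi> q \<omega> - simple_value k' s' \<xi>' q \<omega>)\<^sup>2)} + \<eta> / \<epsilon>\<^sup>2"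
proof -
  have nonneg: "0 \<le> s i" if "i \<le> k" "0 \<le> s 0" "\<forall>i<k. s i \<le> s (Suc i)" for i k and s :: "nat \<Rightarrow> real"
    using that by (induction i) (auto intro: order_trans)
  define PP where "PP = {0, t} \<union> ((\<lambda>i. min t (s i)) ` {..k} \<union> (\<lambda>i. min t (s' i)) ` {..k'})"
  have "finite PP" "0 \<in> PP" "t \<in> PP" "PP \<subseteq> {0..t}"
    using nonneg[of _ k s] nonneg[of _ k' s'] A A' t by (auto simp: PP_def adapted_step_def)
  from ex_partition[OF this] obtain N p where p: "p 0 = 0" "p N = t" "\<And>i. i < N \<Longrightarrow> p i < p (Suc i)" "p ` {..N} = PP"
    by auto
  interpret R: refinement s k p N t
    by unfold_locales (use A p in \<open>auto simp: adapted_step_def PP_def\<close>)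
  interpret R': refinement s' k' p N t
    by unfold_locales (use A' p in \<open>auto simp: adapted_step_def PP_def\<close>)
  let ?d = "\<lambda>j \<omega>. simple_value k s \<xi> (p (Suc j)) \<omega> - simple_value k' s' \<xi>' (p (Suc j)) \<omega>"
  have int: "simple_integral W k s \<xi> t \<omega> - simple_integral W k' s' \<xi>' t \<omega> = (\<Sum>j<N. ?d j \<omega> * (W (p (Suc j)) \<omega> - W (p j) \<omega>))" for \<omega>
    unfolding R.simple_integral_eq R'.simple_integral_eq by (simp add: sum_subtractf left_diff_distrib)
  have int2: "(LINT q:{0..t}|lborel. (simple_value k s \<xi> q \<omega> - simple_value k' s' \<xi>' q \<omega>)\<^sup>2) = (\<Sum>j<N. (?d j \<omega>)\<^sup>2 * (p (Suc j) - p j))" for \<omega>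
  proof (rule step_integral)
    fix j q assume "j < N" "p j < q" "q \<le> p (Suc j)"
    then show "(simple_value k s \<xi> q \<omega> - simple_value k' s' \<xi>' q \<omega>)\<^sup>2 = (?d j \<omega>)\<^sup>2"
      by (simp only: R.simple_value_const[of j q] R'.simple_value_const[of j q])
  qed (use p in \<open>auto simp: less_imp_le\<close>)
  have W: "wiener P Ft W" by unfold_locales
  show ?thesis unfolding int int2
    by (rule discrete_lenglart)
      (use p pos R.simple_value_adapted[OF W A] R'.simple_value_adapted[OF W A'] in auto)
qed

end

subsection \<open>Left-point sums\<close>

text \<open>\<open>Suc n\<close> cells rather than \<open>n\<close>, so that every index
  \<open>n\<close> yields a genuine partition.\<close>

definition grid :: "real \<Rightarrow> nat \<Rightarrow> nat \<Rightarrow> real" where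
  "grid t n i = t * real i / real (Suc n)"

lemma grid_simps: "grid t n 0 = 0" "grid t n (Suc n) = t" "grid t n (Suc i) - grid t n i = t / real (Suc n)"
proof -
  show "grid t n 0 = 0" by (simp add: grid_def)
  show "grid t n (Suc n) = t" by (simp add: grid_def del: of_nat_Suc)
  show "grid t n (Suc i) - grid t n i = t / real (Suc n)"
    unfolding grid_def diff_divide_distrib[symmetric] by (simp add: algebra_simps)
qed

lemma grid_mono: "0 \<le> t \<Longrightarrow> i \<le> j \<Longrightarrow> grid t n i \<le> grid t n j"
  by (auto simp: grid_def intro!: divide_right_mono mult_left_mono)

lemma grid_less: "0 < t \<Longrightarrow> grid t n i < grid t n (Suc i)"
  using grid_simps(3)[of t n i] by (smt (verit) divide_pos_pos of_nat_0_less_iff zero_less_Suc)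

lemma grid_range: "0 \<le> t \<Longrightarrow> i \<le> Suc n \<Longrightarrow> grid t n i \<in> {0..t}"
  using grid_mono[of t 0 i n] grid_mono[of t i "Suc n" n] by (simp add: grid_simps)

definition left_step :: "real \<Rightarrow> (real \<Rightarrow> real) \<Rightarrow> nat \<Rightarrow> real \<Rightarrow> real" where
  "left_step t f n q = (\<Sum>i<Suc n. f (grid t n i) * indicator {grid t n i<..grid t n (Suc i)} q)"

lemma left_step_cell:
  assumes "0 < t" "0 < q" "q \<le> t"
  shows "\<exists>x\<in>{0..t}. \<bar>q - x\<bar> \<le> t / real (Suc n) \<and> left_step t f n q = f x"
proof -
  obtain i where i: "i < Suc n" "grid t n i < q" "q \<le> grid t n (Suc i)" "left_step t f n q = f (grid t n i)"
    using cell_sum[of "Suc n" "grid t n" q "\<lambda>i. f (grid t n i)"] assms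
    by (auto simp: grid_simps left_step_def grid_less less_imp_le)
  moreover have "\<bar>q - grid t n i\<bar> \<le> t / real (Suc n)" using i grid_simps(3)[of t n i] by auto
  ultimately show ?thesis using grid_range[of t i n] assms by (intro bexI[of _ "grid t n i"]) auto
qed

lemma left_step_tendsto:
  assumes f: "continuous_on {0..t} f" and q: "0 < q" "q \<le> t"
  shows "(\<lambda>n. left_step t f n q) \<longlonglongrightarrow> f q"
proof -
  have "\<exists>x. \<forall>n. x n \<in> {0..t} \<and> \<bar>q - x n\<bar> \<le> t / real (Suc n) \<and> left_step t f n q = f (x n)"
  proof (rule choice, rule allI)
    fix n
    have "0 < t" using q by simp
    then show "\<exists>x. x \<in> {0..t} \<and> \<bar>q - x\<bar> \<le> t / real (Suc n) \<and> left_step t f n q = f x"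
      using left_step_cell[of t q n f] q by blast
  qed
  then obtain x where x: "\<And>n. x n \<in> {0..t}" "\<And>n. \<bar>q - x n\<bar> \<le> t / real (Suc n)" "\<And>n. left_step t f n q = f (x n)"
    by auto
  have "(\<lambda>n. t / real (Suc n)) \<longlonglongrightarrow> 0" by (rule LIMSEQ_Suc) (rule lim_const_over_n)
  then have "(\<lambda>n. q - x n) \<longlonglongrightarrow> 0"
    by (rule Lim_null_comparison[rotated]) (use x in auto)
  then have "x \<longlonglongrightarrow> q" using tendsto_diff[OF tendsto_const[of q]] by fastforce
  then have "(\<lambda>n. f (x n)) \<longlonglongrightarrow> f q"
    using f x(1) q unfolding continuous_on_sequentially by (auto simp: o_def)
  then show ?thesis using x(3) by simp
qed

lemma left_step_measurable: "left_step t f n \<in> borel_measurable borel"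
  unfolding left_step_def by measurable

lemma continuous_on_bounded_interval:
  fixes f :: "real \<Rightarrow> real"
  assumes "continuous_on {a..b} f"
  obtains R where "0 \<le> R" "\<And>x. x \<in> {a..b} \<Longrightarrow> \<bar>f x\<bar> \<le> R"
proof -
  have "compact (f ` {a..b})" using assms by (intro compact_continuous_image) auto
  then have "bounded (f ` {a..b})" by (rule compact_imp_bounded)
  then obtain R where "\<forall>y\<in>f ` {a..b}. \<bar>y\<bar> \<le> R" unfolding bounded_iff by auto
  then have "\<And>x. x \<in> {a..b} \<Longrightarrow> \<bar>f x\<bar> \<le> max R 0" by force
  then show ?thesis using that[of "max R 0"] by auto
qed

text \<open>A bound for \<open>f\<close> on the compact interval also bounds its left-point step
  functions, so dominated convergence applies to both integrals; the sums in the second claim are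
  the integrals of the step functions.\<close>

lemma left_step_integrals:
  assumes f: "continuous_on {0..t} f" and t: "0 < t"
  shows "(\<lambda>n. LINT q:{0..t}|lborel. (left_step t f n q - f q)\<^sup>2) \<longlonglongrightarrow> 0"
    and "(\<lambda>n. \<Sum>i<Suc n. f (grid t n i) * (t / real (Suc n))) \<longlonglongrightarrow> (LINT q:{0..t}|lborel. f q)"
proof -
  obtain R where R: "0 \<le> R" "\<And>x. x \<in> {0..t} \<Longrightarrow> \<bar>f x\<bar> \<le> R" using continuous_on_bounded_interval[OF f] by blast
  have bd: "\<bar>left_step t f n q\<bar> \<le> R" if "0 < q" "q \<le> t" for n q
    using left_step_cell[OF t that, of n f] R by auto
  have fm: "(\<lambda>q. indicator {0..t} q * f q) \<in> borel_measurable borel"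
    using borel_measurable_continuous_on_indicator[OF _ f] by simp
  have lm: "(\<lambda>q. indicator {0..t} q * left_step t f n q) \<in> borel_measurable borel" for n
    using left_step_measurable[of t f n] by measurable
  have d: "(\<lambda>q. indicator {0..t} q * (left_step t f n q - f q)\<^sup>2) \<in> borel_measurable borel" for n
  proof -
    have "(\<lambda>q. indicator {0..t} q * (left_step t f n q - f q)\<^sup>2) =
       (\<lambda>q. (indicator {0..t} q * left_step t f n q - indicator {0..t} q * f q)\<^sup>2)"
      by (auto simp: fun_eq_iff indicator_def)
    then show ?thesis using fm lm[of n] by simp
  qed
  have w: "integrable lborel (\<lambda>q. c * indicator {0..t} q)" for c :: real by (simp add: t less_imp_le)
  have AE0: "AE q in lborel. q \<noteq> (0::real)" by (rule AE_lborel_singleton)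
  have "(\<lambda>n. LINT q|lborel. indicator {0..t} q * (left_step t f n q - f q)\<^sup>2) \<longlonglongrightarrow> (LINT (q::real)|lborel. (0::real))"
  proof (rule integral_dominated_convergence[where w="\<lambda>q. (2 * R)\<^sup>2 * indicator {0..t} q" and f="\<lambda>_. 0"])
    show "AE q in lborel. (\<lambda>n. indicator {0..t} q * (left_step t f n q - f q)\<^sup>2) \<longlonglongrightarrow> 0"
      using AE0
    proof eventually_elim
      case (elim q)
      show ?case
      proof (cases "q \<in> {0..t}")
        case True
        then have "(\<lambda>n. (left_step t f n q - f q)\<^sup>2) \<longlonglongrightarrow> (f q - f q)\<^sup>2"
          using elim by (intro tendsto_intros left_step_tendsto[OF f]) auto
        then show ?thesis using True by simp
      qed simp
    qed
    show "AE q in lborel. norm (indicator {0..t} q * (left_step t f n q - f q)\<^sup>2) \<le> (2 * R)\<^sup>2 * indicator {0..t} q" for n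
      using AE0
    proof eventually_elim
      case (elim q)
      show ?case
      proof (cases "q \<in> {0..t}")
        case True
        then have "\<bar>left_step t f n q - f q\<bar> \<le> 2 * R" using bd[of q n] R(2)[of q] elim by auto
        then have "\<bar>left_step t f n q - f q\<bar>\<^sup>2 \<le> (2 * R)\<^sup>2" by (intro power_mono) auto
        then show ?thesis using True by simp
      qed simp
    qed
  qed (use d w in auto)
  then show "(\<lambda>n. LINT q:{0..t}|lborel. (left_step t f n q - f q)\<^sup>2) \<longlonglongrightarrow> 0"
    by (simp add: set_lebesgue_integral_def)
  have "(\<lambda>n. LINT q|lborel. indicator {0..t} q * left_step t f n q) \<longlonglongrightarrow> (LINT q|lborel. indicator {0..t} q * f q)"
  proof (rule integral_dominated_convergence[where w="\<lambda>q. R * indicator {0..t} q"])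
    show "AE q in lborel. (\<lambda>n. indicator {0..t} q * left_step t f n q) \<longlonglongrightarrow> indicator {0..t} q * f q"
      using AE0
    proof eventually_elim
      case (elim q)
      show ?case
      proof (cases "q \<in> {0..t}")
        case True
        then show ?thesis using elim by (intro tendsto_intros left_step_tendsto[OF f]) auto
      qed simp
    qed
    show "AE q in lborel. norm (indicator {0..t} q * left_step t f n q) \<le> R * indicator {0..t} q" for n
      using AE0
    proof eventually_elim
      case (elim q)
      then show ?case using bd[of q n] by (cases "q \<in> {0..t}") (auto simp: indicator_def)
    qed
  qed (use fm lm w in auto)
  moreover have "(LINT q|lborel. indicator {0..t} q * left_step t f n q) = (\<Sum>i<Suc n. f (grid t n i) * (t / real (Suc n)))" for n
  proof -
    have "(LINT q:{0..t}|lborel. left_step t f n q) = (\<Sum>i<Suc n. f (grid t n i) * (grid t n (Suc i) - grid t n i))"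
    proof (rule step_integral)
      fix j q assume j: "j < Suc n" "grid t n j < q" "q \<le> grid t n (Suc j)"
      have "left_step t f n q = (\<Sum>i<Suc n. if i = j then f (grid t n j) else 0)"
        unfolding left_step_def
      proof (intro sum.cong refl)
        fix i assume "i \<in> {..<Suc n}"
        show "f (grid t n i) * indicator {grid t n i<..grid t n (Suc i)} q = (if i = j then f (grid t n j) else 0)"
        proof (cases i j rule: linorder_cases)
          case less
          then have "grid t n (Suc i) \<le> grid t n j" using t by (intro grid_mono) auto
          then show ?thesis using j less by (auto simp: indicator_def)
        next
          case greater
          then have "grid t n (Suc j) \<le> grid t n i" using t by (intro grid_mono) auto
          then show ?thesis using j greater by (auto simp: indicator_def)
        qed (use j in auto)
      qed
      then show "left_step t f n q = f (grid t n j)" using j by simp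
    qed (use t grid_less[of t n] in \<open>auto simp: grid_simps less_imp_le\<close>)
    then show ?thesis by (simp only: grid_simps set_lebesgue_integral_def real_scaleR_def)
  qed
  ultimately show "(\<lambda>n. \<Sum>i<Suc n. f (grid t n i) * (t / real (Suc n))) \<longlonglongrightarrow> (LINT q:{0..t}|lborel. f q)"
    by (simp add: set_lebesgue_integral_def)
qed

section \<open>Convergence in probability\<close>

lemma (in prob_space) tendsto_in_prob_AE:
  assumes X[measurable]: "\<And>n. X n \<in> borel_measurable M" and Y[measurable]: "Y \<in> borel_measurable M"
    and lim: "AE \<omega> in M. (\<lambda>n. X n \<omega>) \<longlonglongrightarrow> (Y \<omega> :: real)"
  shows "tendsto_in_prob M X Y"
  unfolding tendsto_in_prob_def
proof (intro conjI allI impI X Y)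
  fix \<epsilon> :: real assume "0 < \<epsilon>"
  have "(\<lambda>n. LINT \<omega>|M. indicator {\<omega> \<in> space M. \<epsilon> < \<bar>X n \<omega> - Y \<omega>\<bar>} \<omega>) \<longlonglongrightarrow> (LINT \<omega>|M. (0::real))"
  proof (rule integral_dominated_convergence[where w="\<lambda>_. 1"])
    show "AE \<omega> in M. (\<lambda>n. indicator {\<omega> \<in> space M. \<epsilon> < \<bar>X n \<omega> - Y \<omega>\<bar>} \<omega> :: real) \<longlonglongrightarrow> 0"
      using lim
    proof eventually_elim
      case (elim \<omega>)
      then have "\<forall>\<^sub>F n in sequentially. dist (X n \<omega>) (Y \<omega>) < \<epsilon>" using \<open>0 < \<epsilon>\<close> by (rule tendstoD)
      then have "\<forall>\<^sub>F n in sequentially. (indicator {\<omega> \<in> space M. \<epsilon> < \<bar>X n \<omega> - Y \<omega>\<bar>} \<omega> :: real) = 0"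
        by eventually_elim (auto simp: dist_real_def)
      then show ?case by (rule tendsto_eventually)
    qed
  qed (auto simp: indicator_def)
  then show "(\<lambda>n. measure M {\<omega> \<in> space M. \<epsilon> < \<bar>X n \<omega> - Y \<omega>\<bar>}) \<longlonglongrightarrow> 0"
    by (simp add: Int_absorb1 subset_eq)
qed

lemma tendsto_in_probD:
  "tendsto_in_prob M X Y \<Longrightarrow> 0 < \<epsilon> \<Longrightarrow> (\<lambda>n. measure M {\<omega> \<in> space M. \<epsilon> < \<bar>X n \<omega> - Y \<omega>\<bar>}) \<longlonglongrightarrow> 0"
  unfolding tendsto_in_prob_def by auto

lemma tendsto_0_squeeze:
  fixes f g :: "nat \<Rightarrow> real"
  assumes "\<And>n. 0 \<le> f n" "\<And>n. f n \<le> g n" "g \<longlonglongrightarrow> 0"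
  shows "f \<longlonglongrightarrow> 0"
  by (rule Lim_null_comparison[OF _ assms(3)]) (use assms in auto)

lemma (in prob_space) tendsto_in_prob_add:
  assumes X: "tendsto_in_prob M X X'" and Y: "tendsto_in_prob M Y Y'"
  shows "tendsto_in_prob M (\<lambda>n \<omega>. X n \<omega> + Y n \<omega>) (\<lambda>\<omega>. X' \<omega> + Y' \<omega>)"
proof -
  have [measurable]: "\<And>n. X n \<in> borel_measurable M" "X' \<in> borel_measurable M"
    "\<And>n. Y n \<in> borel_measurable M" "Y' \<in> borel_measurable M"
    using X Y unfolding tendsto_in_prob_def by auto
  show ?thesis unfolding tendsto_in_prob_def
  proof (intro conjI allI impI)
    fix \<epsilon> :: real assume "0 < \<epsilon>"
    let ?a = "\<lambda>n. measure M {\<omega> \<in> space M. \<epsilon> / 2 < \<bar>X n \<omega> - X' \<omega>\<bar>}"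
    let ?b = "\<lambda>n. measure M {\<omega> \<in> space M. \<epsilon> / 2 < \<bar>Y n \<omega> - Y' \<omega>\<bar>}"
    have "?a \<longlonglongrightarrow> 0" "?b \<longlonglongrightarrow> 0" using \<open>0 < \<epsilon>\<close> by (intro tendsto_in_probD X Y; simp)+
    then have "(\<lambda>n. ?a n + ?b n) \<longlonglongrightarrow> 0 + 0" by (rule tendsto_add)
    moreover have "measure M {\<omega> \<in> space M. \<epsilon> < \<bar>X n \<omega> + Y n \<omega> - (X' \<omega> + Y' \<omega>)\<bar>} \<le> ?a n + ?b n" for n
    proof -
      have "measure M {\<omega> \<in> space M. \<epsilon> < \<bar>X n \<omega> + Y n \<omega> - (X' \<omega> + Y' \<omega>)\<bar>} \<le>
        measure M ({\<omega> \<in> space M. \<epsilon> / 2 < \<bar>X n \<omega> - X' \<omega>\<bar>} \<union> {\<omega> \<in> space M. \<epsilon> / 2 < \<bar>Y n \<omega> - Y' \<omega>\<bar>})"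
        by (rule finite_measure_mono) (auto, argo?)
      also have "\<dots> \<le> ?a n + ?b n" by (rule measure_Un_le) measurable
      finally show ?thesis .
    qed
    ultimately show "(\<lambda>n. measure M {\<omega> \<in> space M. \<epsilon> < \<bar>X n \<omega> + Y n \<omega> - (X' \<omega> + Y' \<omega>)\<bar>}) \<longlonglongrightarrow> 0"
      by (rule_tac tendsto_0_squeeze[OF measure_nonneg]) simp_all
  qed measurable
qed

lemma (in prob_space) tendsto_in_prob_AE_eq:
  assumes X: "tendsto_in_prob M X X'" and Y: "\<And>n. Y n \<in> borel_measurable M" "Y' \<in> borel_measurable M"
    and eq: "\<And>n. AE \<omega> in M. X n \<omega> = Y n \<omega>" "AE \<omega> in M. X' \<omega> = Y' \<omega>"
  shows "tendsto_in_prob M Y Y'"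
proof -
  have [measurable]: "\<And>n. X n \<in> borel_measurable M" "X' \<in> borel_measurable M"
    using X unfolding tendsto_in_prob_def by auto
  note [measurable] = Y
  have "measure M {\<omega> \<in> space M. \<epsilon> < \<bar>X n \<omega> - X' \<omega>\<bar>} = measure M {\<omega> \<in> space M. \<epsilon> < \<bar>Y n \<omega> - Y' \<omega>\<bar>}" for n \<epsilon>
  proof (rule finite_measure_eq_AE)
    show "AE \<omega> in M. (\<omega> \<in> {\<omega> \<in> space M. \<epsilon> < \<bar>X n \<omega> - X' \<omega>\<bar>}) = (\<omega> \<in> {\<omega> \<in> space M. \<epsilon> < \<bar>Y n \<omega> - Y' \<omega>\<bar>})"
      using eq(1)[of n] eq(2) by eventually_elim auto
  qed measurable
  then show ?thesis using X Y unfolding tendsto_in_prob_def by auto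
qed

lemma (in prob_space) tendsto_in_prob_L2:
  assumes [measurable]: "\<And>n. X n \<in> borel_measurable M" "Y \<in> borel_measurable M"
    and i: "\<And>n. integrable M (\<lambda>\<omega>. (X n \<omega> - Y \<omega>)\<^sup>2)"
    and lim: "(\<lambda>n. LINT \<omega>|M. (X n \<omega> - (Y \<omega> :: real))\<^sup>2) \<longlonglongrightarrow> 0"
  shows "tendsto_in_prob M X Y"
  unfolding tendsto_in_prob_def
proof (intro conjI allI impI)
  fix \<epsilon> :: real assume "0 < \<epsilon>"
  have "measure M {\<omega> \<in> space M. \<epsilon> < \<bar>X n \<omega> - Y \<omega>\<bar>} \<le> (LINT \<omega>|M. (X n \<omega> - Y \<omega>)\<^sup>2) / \<epsilon>\<^sup>2" for n
  proof -
    have "measure M {\<omega> \<in> space M. \<epsilon> < \<bar>X n \<omega> - Y \<omega>\<bar>} \<le> measure M {\<omega> \<in> space M. \<epsilon>\<^sup>2 \<le> (X n \<omega> - Y \<omega>)\<^sup>2}"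
    proof (rule finite_measure_mono)
      have "\<epsilon>\<^sup>2 \<le> x\<^sup>2" if "\<epsilon> < \<bar>x\<bar>" for x :: real
        using power_mono[of \<epsilon> "\<bar>x\<bar>" 2] that \<open>0 < \<epsilon>\<close> by simp
      then show "{\<omega> \<in> space M. \<epsilon> < \<bar>X n \<omega> - Y \<omega>\<bar>} \<subseteq> {\<omega> \<in> space M. \<epsilon>\<^sup>2 \<le> (X n \<omega> - Y \<omega>)\<^sup>2}" by auto
    qed measurable
    also have "\<dots> \<le> (LINT \<omega>|M. (X n \<omega> - Y \<omega>)\<^sup>2) / \<epsilon>\<^sup>2"
      using i \<open>0 < \<epsilon>\<close> by (intro integral_Markov_inequality_measure[where A="{}"]) simp_all
    finally show ?thesis .
  qed
  moreover have "(\<lambda>n. (LINT \<omega>|M. (X n \<omega> - Y \<omega>)\<^sup>2) / \<epsilon>\<^sup>2) \<longlonglongrightarrow> 0"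
    using tendsto_divide[OF lim tendsto_const[of "\<epsilon>\<^sup>2"]] \<open>0 < \<epsilon>\<close> by simp
  ultimately show "(\<lambda>n. measure M {\<omega> \<in> space M. \<epsilon> < \<bar>X n \<omega> - Y \<omega>\<bar>}) \<longlonglongrightarrow> 0"
    by (rule tendsto_0_squeeze[OF measure_nonneg])
qed measurable

text \<open>Fatou's lemma along an almost surely convergent subsequence.\<close>

lemma (in prob_space) integral_square_le_of_tendsto_in_prob:
  assumes X: "tendsto_in_prob M X Y" and i: "\<And>n. integrable M (\<lambda>\<omega>. (X n \<omega>)\<^sup>2)"
    and bd: "\<And>n. (LINT \<omega>|M. (X n \<omega>)\<^sup>2) \<le> c" and Y: "integrable M (\<lambda>\<omega>. (Y \<omega>)\<^sup>2)"
  shows "(LINT \<omega>|M. (Y \<omega>)\<^sup>2) \<le> c"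
proof -
  have [measurable]: "\<And>n. X n \<in> borel_measurable M" "Y \<in> borel_measurable M"
    using X unfolding tendsto_in_prob_def by auto
  \<comment> \<open>Convergence in probability becomes \<open>L1\<close> convergence of the
    truncated distance, and that yields an almost surely convergent subsequence.\<close>
  have lim: "(\<lambda>n. LINT \<omega>|M. norm (min 1 \<bar>X n \<omega> - Y \<omega>\<bar> - 0)) \<longlonglongrightarrow> 0"
  proof (rule LIMSEQ_I)
    fix e :: real assume "0 < e"
    then have "(\<lambda>n. measure M {\<omega> \<in> space M. e / 2 < \<bar>X n \<omega> - Y \<omega>\<bar>}) \<longlonglongrightarrow> 0"
      by (intro tendsto_in_probD[OF X]) simp
    from LIMSEQ_D[OF this, of "e / 2"] \<open>0 < e\<close>
    obtain N where N: "\<And>n. N \<le> n \<Longrightarrow> measure M {\<omega> \<in> space M. e / 2 < \<bar>X n \<omega> - Y \<omega>\<bar>} < e / 2"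
      by auto
    have "(LINT \<omega>|M. norm (min 1 \<bar>X n \<omega> - Y \<omega>\<bar> - 0)) < e" if "N \<le> n" for n
    proof -
      have "(LINT \<omega>|M. norm (min 1 \<bar>X n \<omega> - Y \<omega>\<bar> - 0)) \<le>
        (LINT \<omega>|M. e / 2 + indicator {\<omega> \<in> space M. e / 2 < \<bar>X n \<omega> - Y \<omega>\<bar>} \<omega>)"
      proof (rule integral_mono)
        show "integrable M (\<lambda>\<omega>. norm (min 1 \<bar>X n \<omega> - Y \<omega>\<bar> - 0))"
          by (rule integrable_const_bound[where B=1]) auto
        show "integrable M (\<lambda>\<omega>. e / 2 + indicator {\<omega> \<in> space M. e / 2 < \<bar>X n \<omega> - Y \<omega>\<bar>} \<omega>)"
          by (intro Bochner_Integration.integrable_add) (auto simp: emeasure_eq_measure)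
        fix \<omega> assume "\<omega> \<in> space M"
        then show "norm (min 1 \<bar>X n \<omega> - Y \<omega>\<bar> - 0) \<le> e / 2 + indicator {\<omega> \<in> space M. e / 2 < \<bar>X n \<omega> - Y \<omega>\<bar>} \<omega>"
          using \<open>0 < e\<close> by (cases "e / 2 < \<bar>X n \<omega> - Y \<omega>\<bar>") (auto simp: min_def)
      qed
      also have "\<dots> = e / 2 + measure M {\<omega> \<in> space M. e / 2 < \<bar>X n \<omega> - Y \<omega>\<bar>}"
        by (subst Bochner_Integration.integral_add)
          (auto simp: emeasure_eq_measure prob_space Int_absorb1 subset_eq)
      also have "\<dots> < e" using N[OF that] by simp
      finally show ?thesis .
    qed
    then show "\<exists>no. \<forall>n\<ge>no. norm ((LINT \<omega>|M. norm (min 1 \<bar>X n \<omega> - Y \<omega>\<bar> - 0)) - 0) < e"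
      by (intro exI[of _ N]) (auto intro!: integral_nonneg_AE)
  qed
  have "\<exists>r::nat\<Rightarrow>nat. strict_mono r \<and> (AE \<omega> in M. (\<lambda>n. min 1 \<bar>X (r n) \<omega> - Y \<omega>\<bar>) \<longlonglongrightarrow> 0)"
    by (rule tendsto_L1_AE_subseq[OF _ lim[unfolded diff_0_right]])
      (auto intro!: integrable_const_bound[where B=1])
  then obtain r where r: "strict_mono (r::nat\<Rightarrow>nat)" and ae: "AE \<omega> in M. (\<lambda>n. min 1 \<bar>X (r n) \<omega> - Y \<omega>\<bar>) \<longlonglongrightarrow> 0"
    by blast
  have conv: "AE \<omega> in M. (\<lambda>n. ennreal ((X (r n) \<omega>)\<^sup>2)) \<longlonglongrightarrow> ennreal ((Y \<omega>)\<^sup>2)"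
    using ae
  proof eventually_elim
    case (elim \<omega>)
    have "\<forall>\<^sub>F n in sequentially. min 1 \<bar>X (r n) \<omega> - Y \<omega>\<bar> < 1" using elim by (rule order_tendstoD) simp
    then have "\<forall>\<^sub>F n in sequentially. min 1 \<bar>X (r n) \<omega> - Y \<omega>\<bar> = \<bar>X (r n) \<omega> - Y \<omega>\<bar>"
      by eventually_elim (auto simp: min_def)
    from Lim_transform_eventually[OF elim this] have "(\<lambda>n. X (r n) \<omega> - Y \<omega>) \<longlonglongrightarrow> 0"
      by (rule tendsto_rabs_zero_cancel)
    then have "(\<lambda>n. X (r n) \<omega>) \<longlonglongrightarrow> Y \<omega>" by (simp add: LIM_zero_iff)
    then show ?case by (intro tendsto_ennrealI tendsto_intros)
  qed
  have "(\<integral>\<^sup>+\<omega>. ennreal ((Y \<omega>)\<^sup>2) \<partial>M) = (\<integral>\<^sup>+\<omega>. liminf (\<lambda>n. ennreal ((X (r n) \<omega>)\<^sup>2)) \<partial>M)"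
  proof (rule nn_integral_cong_AE)
    show "AE \<omega> in M. ennreal ((Y \<omega>)\<^sup>2) = liminf (\<lambda>n. ennreal ((X (r n) \<omega>)\<^sup>2))"
      using conv by eventually_elim (erule lim_imp_Liminf[OF trivial_limit_sequentially, symmetric])
  qed
  also have "\<dots> \<le> liminf (\<lambda>n. \<integral>\<^sup>+\<omega>. ennreal ((X (r n) \<omega>)\<^sup>2) \<partial>M)" by (rule nn_integral_liminf) measurable
  also have "\<dots> = liminf (\<lambda>n. ennreal (LINT \<omega>|M. (X (r n) \<omega>)\<^sup>2))"
    by (subst nn_integral_eq_integral[OF i]) auto
  also have "\<dots> \<le> liminf (\<lambda>n::nat. ennreal c)"
    by (intro Liminf_mono always_eventually allI ennreal_leI bd)
  also have "\<dots> = ennreal c" by (simp add: Liminf_const)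
  finally have "(\<integral>\<^sup>+\<omega>. ennreal ((Y \<omega>)\<^sup>2) \<partial>M) \<le> ennreal c" .
  moreover have "0 \<le> c"
  proof -
    have "0 \<le> (LINT \<omega>|M. (X 0 \<omega>)\<^sup>2)" by (intro Bochner_Integration.integral_nonneg) simp
    then show ?thesis using bd[of 0] by linarith
  qed
  ultimately show ?thesis using nn_integral_eq_integral[OF Y] by auto
qed

context wiener
begin

text \<open>The approximations in \<open>is_ito_integral\<close> are arbitrary, but path continuity
  makes the left-point processes approximate \<open>X\<close> in the same \<open>L2\<close> sense.
  The two families of step processes therefore approach each other, and the Lenglart inequality
  forces their integrals to a common limit. This is what makes an Ito integral computable.\<close>

lemma ito_left_point:
  assumes t: "0 < t" and I: "is_ito_integral P Ft W X t J"
  shows "tendsto_in_prob P (\<lambda>n \<omega>. \<Sum>i<Suc n. X (grid t n i) \<omega> * (W (grid t n (Suc i)) \<omega> - W (grid t n i) \<omega>)) J"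
proof -
  from I obtain k s \<xi> where
    XF: "\<And>q. q \<in> {0..t} \<Longrightarrow> X q \<in> borel_measurable (Ft (ennreal q))" and
    Xc: "AE \<omega> in P. continuous_on {0..t} (\<lambda>q. X q \<omega>)" and
    sp: "\<And>n. simple_process Ft (k n) (s n) (\<xi> n)" and
    H2: "tendsto_in_prob P (\<lambda>n \<omega>. LINT q:{0..t}|lborel. (simple_value (k n) (s n) (\<xi> n) q \<omega> - X q \<omega>)\<^sup>2) (\<lambda>_. 0)" and
    HI: "tendsto_in_prob P (\<lambda>n. simple_integral W (k n) (s n) (\<xi> n) t) J"
    unfolding is_ito_integral_def by blast
  define K where "K n q \<omega> = left_step t (\<lambda>q. X q \<omega>) n q" for n q \<omega>
  define S where "S n \<omega> = (\<Sum>i<Suc n. X (grid t n i) \<omega> * (W (grid t n (Suc i)) \<omega> - W (grid t n i) \<omega>))" for n \<omega>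
  have XgF: "X (grid t n i) \<in> borel_measurable (Ft (ennreal (grid t n i)))" if "i \<le> Suc n" for n i
    using XF grid_range[of t i n] t that by auto
  have XgP: "X (grid t n i) \<in> borel_measurable P" if "i \<le> Suc n" for n i
    by (rule measurable_Ft[OF XgF[OF that]])
  have Kval: "K n q \<omega> = simple_value (Suc n) (grid t n) (\<lambda>i. X (grid t n i)) q \<omega>" for n q \<omega>
    by (simp add: K_def left_step_def simple_value_def)
  have Kad: "adapted_step Ft (Suc n) (grid t n) (\<lambda>i. X (grid t n i))" for n
    using XgF t by (auto simp: adapted_step_def grid_simps less_imp_le grid_less)
  have Had: "adapted_step Ft (k n) (s n) (\<xi> n)" for n
    using sp[of n] by (auto simp: adapted_step_def simple_process_def)
  have Sval: "S n \<omega> = simple_integral W (Suc n) (grid t n) (\<lambda>i. X (grid t n i)) t \<omega>" for n \<omega>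
  proof -
    have "min t (grid t n i) = grid t n i" if "i \<le> Suc n" for i
      using grid_range[OF _ that, of t] t by (simp add: min_def)
    then show ?thesis unfolding S_def simple_integral_def by (intro sum.cong) auto
  qed
  have Smeas[measurable]: "S n \<in> borel_measurable P" for n
    unfolding S_def using grid_range[of t _ n] t
    by (intro borel_measurable_sum borel_measurable_times borel_measurable_diff XgP W_meas) auto
  have HImeas[measurable]: "simple_integral W (k n) (s n) (\<xi> n) t \<in> borel_measurable P" "J \<in> borel_measurable P" for n
    using HI unfolding tendsto_in_prob_def by auto
  have H2meas[measurable]: "(\<lambda>\<omega>. LINT q:{0..t}|lborel. (simple_value (k n) (s n) (\<xi> n) q \<omega> - X q \<omega>)\<^sup>2) \<in> borel_measurable P" for n
    using H2 unfolding tendsto_in_prob_def by auto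
  define D where "D n \<omega> = (LINT q:{0..t}|lborel. (K n q \<omega> - X q \<omega>)\<^sup>2)" for n \<omega>
  \<comment> \<open>Joint measurability of \<open>X\<close> is not part of the data.
    \<open>Xm\<close> is a limit of jointly measurable step processes and equals \<open>X\<close> on
    \<open>(0, t]\<close> along continuous paths, so \<open>D n\<close> is measurable up to a null
    set.\<close>
  define Xm where "Xm \<omega> q = lim (\<lambda>n. K n q \<omega>)" for \<omega> q
  have Dmeas[measurable]: "D n \<in> borel_measurable P" for n
  proof -
    have Kj: "(\<lambda>(\<omega>, q). K n q \<omega>) \<in> borel_measurable (P \<Otimes>\<^sub>M lborel)" for n
    proof -
      have "(\<lambda>x. X (grid t n i) (fst x) * indicator {grid t n i<..grid t n (Suc i)} (snd x)) \<in> borel_measurable (P \<Otimes>\<^sub>M lborel)"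
        if "i \<le> Suc n" for i
        using XgP[OF that] by measurable
      then show ?thesis unfolding K_def left_step_def case_prod_beta
        by (intro borel_measurable_sum) auto
    qed
    have "(\<lambda>x. lim (\<lambda>n. case x of (\<omega>, q) \<Rightarrow> K n q \<omega>)) \<in> borel_measurable (P \<Otimes>\<^sub>M lborel)"
      by (rule borel_measurable_lim_metric) (rule Kj)
    then have Xj: "(\<lambda>(\<omega>, q). Xm \<omega> q) \<in> borel_measurable (P \<Otimes>\<^sub>M lborel)"
      by (simp add: Xm_def case_prod_beta)
    have "(\<lambda>(\<omega>, q). indicator {0..t} q *\<^sub>R (K n q \<omega> - Xm \<omega> q)\<^sup>2) \<in> borel_measurable (P \<Otimes>\<^sub>M lborel)"
      using Kj[of n] Xj by (simp add: case_prod_beta)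
    then have m: "(\<lambda>\<omega>. LINT q|lborel. indicator {0..t} q *\<^sub>R (K n q \<omega> - Xm \<omega> q)\<^sup>2) \<in> borel_measurable P"
      by (rule lborel.borel_measurable_lebesgue_integral)
    show ?thesis
    proof (rule borel_measurable_AE_eq[OF m])
      show "AE \<omega> in P. (LINT q|lborel. indicator {0..t} q *\<^sub>R (K n q \<omega> - Xm \<omega> q)\<^sup>2) = D n \<omega>"
        using Xc
      proof eventually_elim
        case (elim \<omega>)
        have lim: "Xm \<omega> q = X q \<omega>" if "0 < q" "q \<le> t" for q
          unfolding Xm_def K_def using left_step_tendsto[OF elim that] by (rule limI)
        have "K n 0 \<omega> = 0"
        proof -
          have "indicator {grid t n i<..grid t n (Suc i)} 0 = (0::real)" for i
            using grid_mono[of t 0 i n] t by (auto simp: indicator_def grid_simps)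
          then show ?thesis by (simp add: K_def left_step_def)
        qed
        have fm: "(\<lambda>q. indicator {0..t} q * X q \<omega>) \<in> borel_measurable borel"
          using borel_measurable_continuous_on_indicator[OF _ elim] by simp
        have lm: "(\<lambda>q. indicator {0..t} q * K n q \<omega>) \<in> borel_measurable borel"
          using left_step_measurable[of t "\<lambda>q. X q \<omega>" n] unfolding K_def by measurable
        have d: "(\<lambda>q. indicator {0..t} q *\<^sub>R (K n q \<omega> - X q \<omega>)\<^sup>2) \<in> borel_measurable borel"
        proof -
          have "(\<lambda>q. indicator {0..t} q *\<^sub>R (K n q \<omega> - X q \<omega>)\<^sup>2) =
            (\<lambda>q. (indicator {0..t} q * K n q \<omega> - indicator {0..t} q * X q \<omega>)\<^sup>2)"
            by (auto simp: fun_eq_iff indicator_def)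
          then show ?thesis using fm lm by simp
        qed
        have eq: "(\<lambda>q. indicator {0..t} q *\<^sub>R (K n q \<omega> - Xm \<omega> q)\<^sup>2) =
            (\<lambda>q. if q = 0 then indicator {0..t} 0 *\<^sub>R (K n 0 \<omega> - Xm \<omega> 0)\<^sup>2 else indicator {0..t} q *\<^sub>R (K n q \<omega> - X q \<omega>)\<^sup>2)"
          using lim by (auto simp: fun_eq_iff indicator_def)
        have d': "(\<lambda>q. indicator {0..t} q *\<^sub>R (K n q \<omega> - Xm \<omega> q)\<^sup>2) \<in> borel_measurable borel"
          unfolding eq using d by (intro measurable_If) auto
        have AE0: "AE q in lborel. q \<noteq> (0::real)" by (rule AE_lborel_singleton)
        show ?case unfolding D_def set_lebesgue_integral_def
        proof (rule integral_cong_AE)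
          show "AE q in lborel. indicator {0..t} q *\<^sub>R (K n q \<omega> - Xm \<omega> q)\<^sup>2 = indicator {0..t} q *\<^sub>R (K n q \<omega> - X q \<omega>)\<^sup>2"
            using AE0 by eventually_elim (use lim in \<open>auto simp: indicator_def\<close>)
        qed (simp_all only: measurable_lborel2 d d')
      qed
    qed
  qed
  have D0: "tendsto_in_prob P D (\<lambda>_. 0)"
  proof (rule tendsto_in_prob_AE)
    show "AE \<omega> in P. (\<lambda>n. D n \<omega>) \<longlonglongrightarrow> 0"
      using Xc by eventually_elim (auto simp: D_def K_def intro: left_step_integrals(1) t)
  qed measurable
  have comb: "AE \<omega> in P. (LINT q:{0..t}|lborel. (K n q \<omega> - simple_value (k n) (s n) (\<xi> n) q \<omega>)\<^sup>2) \<le>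
      2 * D n \<omega> + 2 * (LINT q:{0..t}|lborel. (simple_value (k n) (s n) (\<xi> n) q \<omega> - X q \<omega>)\<^sup>2)" for n
    using Xc
  proof eventually_elim
    case (elim \<omega>)
    obtain R where R: "0 \<le> R" "\<And>x. x \<in> {0..t} \<Longrightarrow> \<bar>X x \<omega>\<bar> \<le> R"
      using continuous_on_bounded_interval[OF elim] by blast
    have fm: "(\<lambda>q. indicator {0..t} q * X q \<omega>) \<in> borel_measurable borel"
      using borel_measurable_continuous_on_indicator[OF _ elim] by simp
    have step: "set_integrable lborel {0..t} (\<lambda>q. ((\<Sum>i<k'. c i * indicator {s' i<..s' (Suc i)} q) - X q \<omega>)\<^sup>2)"
      for k' :: nat and c s' :: "nat \<Rightarrow> real"
    proof -
      let ?h = "\<lambda>q. \<Sum>i<k'. c i * indicator {s' i<..s' (Suc i)} q"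
      have hm: "?h \<in> borel_measurable borel" by measurable
      have hb: "\<bar>?h q\<bar> \<le> (\<Sum>i<k'. \<bar>c i\<bar>)" for q
        by (rule order_trans[OF sum_abs sum_mono]) (auto simp: indicator_def)
      have eq: "(\<lambda>q. indicator {0..t} q *\<^sub>R (?h q - X q \<omega>)\<^sup>2) = (\<lambda>q. (indicator {0..t} q * ?h q - indicator {0..t} q * X q \<omega>)\<^sup>2)"
        by (auto simp: fun_eq_iff indicator_def)
      show ?thesis unfolding set_integrable_def
      proof (rule Bochner_Integration.integrable_bound)
        show "integrable lborel (\<lambda>q. ((\<Sum>i<k'. \<bar>c i\<bar>) + R)\<^sup>2 * indicator {0..t} q :: real)"
          using t by (simp add: less_imp_le)
        show "(\<lambda>q. indicator {0..t} q *\<^sub>R (?h q - X q \<omega>)\<^sup>2) \<in> borel_measurable lborel"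
          unfolding eq using fm hm by simp
        show "AE q in lborel. norm (indicator {0..t} q *\<^sub>R (?h q - X q \<omega>)\<^sup>2) \<le> norm (((\<Sum>i<k'. \<bar>c i\<bar>) + R)\<^sup>2 * indicator {0..t} q)"
        proof (intro AE_I2)
          fix q
          show "norm (indicator {0..t} q *\<^sub>R (?h q - X q \<omega>)\<^sup>2) \<le> norm (((\<Sum>i<k'. \<bar>c i\<bar>) + R)\<^sup>2 * indicator {0..t} q)"
          proof (cases "q \<in> {0..t}")
            case True
            then have "\<bar>?h q - X q \<omega>\<bar> \<le> (\<Sum>i<k'. \<bar>c i\<bar>) + R" using hb[of q] R(2)[of q] by linarith
            then have "\<bar>?h q - X q \<omega>\<bar>\<^sup>2 \<le> ((\<Sum>i<k'. \<bar>c i\<bar>) + R)\<^sup>2" by (intro power_mono) auto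
            then show ?thesis using True by simp
          qed simp
        qed
      qed
    qed
    have i1: "set_integrable lborel {0..t} (\<lambda>q. (K n q \<omega> - X q \<omega>)\<^sup>2)"
      unfolding K_def left_step_def by (rule step)
    have i2: "set_integrable lborel {0..t} (\<lambda>q. (simple_value (k n) (s n) (\<xi> n) q \<omega> - X q \<omega>)\<^sup>2)"
      unfolding simple_value_def by (rule step)
    have "(LINT q:{0..t}|lborel. (K n q \<omega> - simple_value (k n) (s n) (\<xi> n) q \<omega>)\<^sup>2) \<le>
       (LINT q:{0..t}|lborel. 2 * (K n q \<omega> - X q \<omega>)\<^sup>2 + 2 * (simple_value (k n) (s n) (\<xi> n) q \<omega> - X q \<omega>)\<^sup>2)"
    proof (cases "set_integrable lborel {0..t} (\<lambda>q. (K n q \<omega> - simple_value (k n) (s n) (\<xi> n) q \<omega>)\<^sup>2)")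
      case True
      have "(a - b)\<^sup>2 \<le> 2 * (a - c)\<^sup>2 + 2 * (b - c)\<^sup>2" for a b c :: real
      proof -
        have "2 * (a - c)\<^sup>2 + 2 * (b - c)\<^sup>2 - (a - b)\<^sup>2 = (a + b - 2 * c)\<^sup>2"
          by (simp add: power2_eq_square algebra_simps)
        then show ?thesis by (smt (verit) zero_le_power2)
      qed
      then show ?thesis
        by (intro set_integral_mono True set_integral_add set_integrable_mult_right i1 i2)
    next
      \<comment> \<open>The Bochner integral of a nonintegrable function is 0, and the bound holds
        trivially.\<close>
      case False
      then have "(LINT q:{0..t}|lborel. (K n q \<omega> - simple_value (k n) (s n) (\<xi> n) q \<omega>)\<^sup>2) = 0"
        unfolding set_integrable_def set_lebesgue_integral_def by (rule not_integrable_integral_eq)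
      moreover have "0 \<le> (LINT q:{0..t}|lborel. 2 * (K n q \<omega> - X q \<omega>)\<^sup>2 + 2 * (simple_value (k n) (s n) (\<xi> n) q \<omega> - X q \<omega>)\<^sup>2)"
        unfolding set_lebesgue_integral_def by (intro integral_nonneg_AE) auto
      ultimately show ?thesis by simp
    qed
    also have "\<dots> = 2 * D n \<omega> + 2 * (LINT q:{0..t}|lborel. (simple_value (k n) (s n) (\<xi> n) q \<omega> - X q \<omega>)\<^sup>2)"
      unfolding D_def by (subst set_integral_add) (auto intro: set_integrable_mult_right i1 i2)
    finally show ?case .
  qed
  let ?H = "\<lambda>n. simple_integral W (k n) (s n) (\<xi> n) t"
  let ?E = "\<lambda>n \<omega>. LINT q:{0..t}|lborel. (simple_value (k n) (s n) (\<xi> n) q \<omega> - X q \<omega>)\<^sup>2"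
  have "tendsto_in_prob P (\<lambda>n \<omega>. S n \<omega> - ?H n \<omega>) (\<lambda>_. 0)"
    unfolding tendsto_in_prob_def
  proof (intro conjI allI impI)
    fix \<epsilon> :: real assume \<epsilon>: "0 < \<epsilon>"
    show "(\<lambda>n. prob {\<omega> \<in> space P. \<epsilon> < \<bar>S n \<omega> - ?H n \<omega> - 0\<bar>}) \<longlonglongrightarrow> 0"
    proof (rule LIMSEQ_I)
      fix e :: real assume e: "0 < e"
      \<comment> \<open>Chosen so that the error \<open>\<eta> / \<epsilon>\<^sup>2\<close> equals
        \<open>e / 4\<close>; the two remaining probabilities are eventually below
        \<open>e / 2\<close> together.\<close>
      define \<eta> where "\<eta> = \<epsilon>\<^sup>2 * e / 4"
      have \<eta>: "0 < \<eta>" "\<eta> / \<epsilon>\<^sup>2 = e / 4" using e \<epsilon> by (auto simp: \<eta>_def)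
      have le: "prob {\<omega> \<in> space P. \<epsilon> < \<bar>S n \<omega> - ?H n \<omega>\<bar>} \<le>
         prob {\<omega> \<in> space P. \<eta> / 4 < \<bar>D n \<omega> - 0\<bar>} + prob {\<omega> \<in> space P. \<eta> / 4 < \<bar>?E n \<omega> - 0\<bar>} + e / 4" for n
      proof -
        have "prob {\<omega> \<in> space P. \<epsilon> < \<bar>S n \<omega> - ?H n \<omega>\<bar>} \<le>
          prob {\<omega>\<in>space P. \<eta> < (LINT q:{0..t}|lborel. (K n q \<omega> - simple_value (k n) (s n) (\<xi> n) q \<omega>)\<^sup>2)} + \<eta> / \<epsilon>\<^sup>2"
          unfolding Sval Kval by (rule step_process_lenglart[OF Kad Had t \<epsilon> \<eta>(1)])
        also have "prob {\<omega>\<in>space P. \<eta> < (LINT q:{0..t}|lborel. (K n q \<omega> - simple_value (k n) (s n) (\<xi> n) q \<omega>)\<^sup>2)} \<le>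
          prob ({\<omega> \<in> space P. \<eta> / 4 < \<bar>D n \<omega> - 0\<bar>} \<union> {\<omega> \<in> space P. \<eta> / 4 < \<bar>?E n \<omega> - 0\<bar>})"
        proof (rule finite_measure_mono_AE)
          show "AE \<omega> in P. \<omega> \<in> {\<omega>\<in>space P. \<eta> < (LINT q:{0..t}|lborel. (K n q \<omega> - simple_value (k n) (s n) (\<xi> n) q \<omega>)\<^sup>2)} \<longrightarrow>
             \<omega> \<in> {\<omega> \<in> space P. \<eta> / 4 < \<bar>D n \<omega> - 0\<bar>} \<union> {\<omega> \<in> space P. \<eta> / 4 < \<bar>?E n \<omega> - 0\<bar>}"
            using comb[of n]
          proof eventually_elim
            case (elim \<omega>)
            show ?case
            proof (intro impI)
              assume "\<omega> \<in> {\<omega>\<in>space P. \<eta> < (LINT q:{0..t}|lborel. (K n q \<omega> - simple_value (k n) (s n) (\<xi> n) q \<omega>)\<^sup>2)}"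
              then have "\<omega> \<in> space P" "\<eta> < 2 * D n \<omega> + 2 * ?E n \<omega>" using elim by auto
              then show "\<omega> \<in> {\<omega> \<in> space P. \<eta> / 4 < \<bar>D n \<omega> - 0\<bar>} \<union> {\<omega> \<in> space P. \<eta> / 4 < \<bar>?E n \<omega> - 0\<bar>}"
                unfolding Un_iff mem_Collect_eq by linarith
            qed
          qed
        qed measurable
        also have "\<dots> \<le> prob {\<omega> \<in> space P. \<eta> / 4 < \<bar>D n \<omega> - 0\<bar>} + prob {\<omega> \<in> space P. \<eta> / 4 < \<bar>?E n \<omega> - 0\<bar>}"
          by (rule measure_Un_le) measurable
        finally show ?thesis using \<eta>(2) by simp
      qed
      have "(\<lambda>n. prob {\<omega> \<in> space P. \<eta> / 4 < \<bar>D n \<omega> - 0\<bar>} + prob {\<omega> \<in> space P. \<eta> / 4 < \<bar>?E n \<omega> - 0\<bar>}) \<longlonglongrightarrow> 0 + 0"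
        using \<eta>(1) by (intro tendsto_add tendsto_in_probD[OF D0] tendsto_in_probD[OF H2]) simp_all
      from LIMSEQ_D[OF this, of "e / 2"] e obtain N where N:
        "\<And>n. N \<le> n \<Longrightarrow> norm (prob {\<omega> \<in> space P. \<eta> / 4 < \<bar>D n \<omega> - 0\<bar>} + prob {\<omega> \<in> space P. \<eta> / 4 < \<bar>?E n \<omega> - 0\<bar>} - (0 + 0)) < e / 2"
        by auto
      show "\<exists>no. \<forall>n\<ge>no. norm (prob {\<omega> \<in> space P. \<epsilon> < \<bar>S n \<omega> - ?H n \<omega> - 0\<bar>} - 0) < e"
      proof (intro exI[of _ N] allI impI)
        fix n assume "N \<le> n"
        have "prob {\<omega> \<in> space P. \<epsilon> < \<bar>S n \<omega> - ?H n \<omega>\<bar>} < e"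
          using le[of n] N[OF \<open>N \<le> n\<close>] e unfolding real_norm_def by linarith
        then show "norm (prob {\<omega> \<in> space P. \<epsilon> < \<bar>S n \<omega> - ?H n \<omega> - 0\<bar>} - 0) < e" by simp
      qed
    qed
  qed measurable
  from tendsto_in_prob_add[OF this HI] show ?thesis by (simp add: S_def)
qed

end

text \<open>The convex power function lies above its tangent at the left endpoint.\<close>

lemma power_diff_ge:
  fixes a b :: real
  assumes "0 \<le> a" "a \<le> b"
  shows "real (Suc j) * (b - a) * a ^ j \<le> b ^ Suc j - a ^ Suc j"
proof (induction j)
  case (Suc j)
  have "real (Suc (Suc j)) * (b - a) * a ^ Suc j = a * (real (Suc j) * (b - a) * a ^ j) + a ^ Suc j * (b - a)"
    by (simp add: algebra_simps)
  also have "\<dots> \<le> b * (b ^ Suc j - a ^ Suc j) + a ^ Suc j * (b - a)"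
    using assms Suc by (intro add_right_mono mult_mono) (auto intro: power_mono)
  also have "\<dots> = b ^ Suc (Suc j) - a ^ Suc (Suc j)" by (simp add: algebra_simps)
  finally show ?case .
qed simp

text \<open>Left-point sums of the increasing function \<open>x ^ j\<close> stay below its integral,
  cell by cell. A bound of order \<open>s ^ j\<close> thus turns into one of order
  \<open>t ^ Suc j\<close>, which drives the iteration behind uniqueness.\<close>

lemma left_sum_power_le:
  assumes "0 \<le> t"
  shows "(\<Sum>i<Suc n. (t / real (Suc n)) * grid t n i ^ j) \<le> t ^ Suc j / real (Suc j)"
proof -
  have "(t / real (Suc n)) * grid t n i ^ j \<le> (grid t n (Suc i) ^ Suc j - grid t n i ^ Suc j) / real (Suc j)" for i
    using power_diff_ge[of "grid t n i" "grid t n (Suc i)" j] grid_mono[OF assms, of i "Suc i" n]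
      grid_mono[OF assms, of 0 i n] by (simp add: grid_simps field_simps)
  then have "(\<Sum>i<Suc n. (t / real (Suc n)) * grid t n i ^ j) \<le>
      (\<Sum>i<Suc n. (grid t n (Suc i) ^ Suc j - grid t n i ^ Suc j) / real (Suc j))" by (intro sum_mono) auto
  also have "\<dots> = (\<Sum>i<Suc n. grid t n (Suc i) ^ Suc j - grid t n i ^ Suc j) / real (Suc j)"
    by (rule sum_divide_distrib[symmetric])
  also have "(\<Sum>i<Suc n. grid t n (Suc i) ^ Suc j - grid t n i ^ Suc j) = t ^ Suc j"
    by (subst sum_lessThan_telescope) (simp add: grid_simps)
  finally show ?thesis .
qed

section \<open>Geometric Brownian motion\<close>

context wiener
begin

definition gbm :: "real \<Rightarrow> real \<Rightarrow> real \<Rightarrow> 'a \<Rightarrow> real" where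
  "gbm m \<sigma> t \<omega> = exp ((m - \<sigma>\<^sup>2 / 2) * t + \<sigma> * W t \<omega>)"

lemma gbm_pos[simp]: "0 < gbm m \<sigma> t \<omega>" "gbm m \<sigma> t \<omega> \<noteq> 0" "0 \<le> gbm m \<sigma> t \<omega>"
  by (simp_all add: gbm_def)

lemma gbm_adapted: "0 \<le> t \<Longrightarrow> gbm m \<sigma> t \<in> borel_measurable (Ft (ennreal t))"
  unfolding gbm_def using W_adapted[of t] by measurable

lemma gbm_measurable[measurable]: "0 \<le> t \<Longrightarrow> gbm m \<sigma> t \<in> borel_measurable P"
  using gbm_adapted measurable_Ft by blast

lemma gbm_0: "AE \<omega> in P. gbm m \<sigma> 0 \<omega> = 1"
  using W_0 by eventually_elim (simp add: gbm_def)

lemma gbm_cont: "AE \<omega> in P. continuous_on {0..} (\<lambda>t. gbm m \<sigma> t \<omega>)"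
  using W_cont by eventually_elim (auto simp: gbm_def intro!: continuous_intros)

lemma exp_W_integral:
  assumes "0 \<le> t"
  shows "has_bochner_integral P (\<lambda>\<omega>. exp (\<theta> * W t \<omega>)) (exp (\<theta>\<^sup>2 * t / 2))"
proof -
  have m: "has_bochner_integral P (\<lambda>\<omega>. exp (\<theta> * (W t \<omega> - W 0 \<omega>))) (exp (\<theta>\<^sup>2 * t / 2))"
    using increment_moments(3)[of 0 t \<theta>] assms by simp
  have [measurable]: "W t \<in> borel_measurable P" using assms by simp
  show ?thesis
    by (rule has_bochner_integralI_AE[OF m]) (use W_0 in \<open>auto elim!: eventually_mono\<close>)
qed

lemma gbm_square_integral:
  assumes "0 \<le> t"
  shows "integrable P (\<lambda>\<omega>. (gbm m \<sigma> t \<omega>)\<^sup>2)"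
    and "(LINT \<omega>|P. (gbm m \<sigma> t \<omega>)\<^sup>2) = exp ((2 * m + \<sigma>\<^sup>2) * t)"
proof -
  have eq: "(gbm m \<sigma> t \<omega>)\<^sup>2 = exp ((2 * m - \<sigma>\<^sup>2) * t) * exp (2 * \<sigma> * W t \<omega>)" for \<omega>
    unfolding gbm_def power2_eq_square exp_add[symmetric] by (simp add: algebra_simps power2_eq_square)
  have *: "has_bochner_integral P (\<lambda>\<omega>. exp ((2 * m - \<sigma>\<^sup>2) * t) * exp (2 * \<sigma> * W t \<omega>))
      (exp ((2 * m - \<sigma>\<^sup>2) * t) * exp ((2 * \<sigma>)\<^sup>2 * t / 2))"
    by (intro has_bochner_integral_mult_right exp_W_integral assms)
  show "integrable P (\<lambda>\<omega>. (gbm m \<sigma> t \<omega>)\<^sup>2)" unfolding eq using * by (simp add: has_bochner_integral_iff)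
  show "(LINT \<omega>|P. (gbm m \<sigma> t \<omega>)\<^sup>2) = exp ((2 * m + \<sigma>\<^sup>2) * t)"
  proof -
    have "(LINT \<omega>|P. (gbm m \<sigma> t \<omega>)\<^sup>2) = exp ((2 * m - \<sigma>\<^sup>2) * t) * exp ((2 * \<sigma>)\<^sup>2 * t / 2)"
      unfolding eq by (rule has_bochner_integral_integral_eq[OF *])
    also have "\<dots> = exp ((2 * m + \<sigma>\<^sup>2) * t)"
      unfolding exp_add[symmetric] by (simp add: algebra_simps power2_eq_square)
    finally show ?thesis .
  qed
qed

lemma gbm_increment:
  assumes "0 \<le> s" "s \<le> t"
  shows "gbm m \<sigma> t \<omega> = gbm m \<sigma> s \<omega> * exp ((m - \<sigma>\<^sup>2 / 2) * (t - s) + \<sigma> * (W t \<omega> - W s \<omega>))"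
  unfolding gbm_def exp_add[symmetric] by (simp add: field_simps)

subsection \<open>The stochastic exponential solves the equation\<close>

text \<open>The relative error of one Euler step of the linear equation, over a time
  \<open>d\<close> with Brownian increment \<open>y\<close>.\<close>

definition euler_rem :: "real \<Rightarrow> real \<Rightarrow> real \<Rightarrow> real \<Rightarrow> real" where
  "euler_rem m \<sigma> d y = exp ((m - \<sigma>\<^sup>2 / 2) * d + \<sigma> * y) - 1 - m * d - \<sigma> * y"

text \<open>The square expands into terms built from constants, powers and exponentials of
  \<open>y\<close>, all with explicit normal moments. Both right-hand sides are of order
  \<open>d\<^sup>2\<close>: in the second one, too, all terms up to first order in \<open>d\<close>
  cancel.\<close>

lemma euler_rem_moments:
  assumes "0 \<le> s" "s \<le> t" and d: "d = t - s"
  shows "has_bochner_integral P (\<lambda>\<omega>. euler_rem m \<sigma> d (W t \<omega> - W s \<omega>)) (exp (m * d) - 1 - m * d)"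
    and "has_bochner_integral P (\<lambda>\<omega>. (euler_rem m \<sigma> d (W t \<omega> - W s \<omega>))\<^sup>2)
      (exp ((2 * m + \<sigma>\<^sup>2) * d) + (1 + m * d)\<^sup>2 + \<sigma>\<^sup>2 * d - 2 * (1 + m * d) * exp (m * d) - 2 * (\<sigma>\<^sup>2 * d) * exp (m * d))"
proof -
  let ?c = "m - \<sigma>\<^sup>2 / 2" and ?D = "\<lambda>\<omega>. W t \<omega> - W s \<omega>"
  note M = increment_moments[OF assms(1,2), folded d]
  have e1: "has_bochner_integral P (\<lambda>\<omega>. exp (?c * d) * exp (\<sigma> * ?D \<omega>)) (exp (?c * d) * exp (\<sigma>\<^sup>2 * d / 2))"
    by (intro has_bochner_integral_mult_right M)
  have E1: "exp (?c * d) * exp (\<sigma>\<^sup>2 * d / 2) = exp (m * d)"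
    unfolding exp_add[symmetric] by (simp add: algebra_simps)
  have e2: "has_bochner_integral P (\<lambda>\<omega>. exp (2 * ?c * d) * exp (2 * \<sigma> * ?D \<omega>)) (exp (2 * ?c * d) * exp ((2 * \<sigma>)\<^sup>2 * d / 2))"
    by (intro has_bochner_integral_mult_right M)
  have E2: "exp (2 * ?c * d) * exp ((2 * \<sigma>)\<^sup>2 * d / 2) = exp ((2 * m + \<sigma>\<^sup>2) * d)"
    unfolding exp_add[symmetric] by (simp add: algebra_simps power2_eq_square)
  have e3: "has_bochner_integral P (\<lambda>\<omega>. exp (?c * d) * (?D \<omega> * exp (\<sigma> * ?D \<omega>))) (exp (?c * d) * (\<sigma> * d * exp (\<sigma>\<^sup>2 * d / 2)))"
    by (intro has_bochner_integral_mult_right M)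
  have E3: "exp (?c * d) * (\<sigma> * d * exp (\<sigma>\<^sup>2 * d / 2)) = \<sigma> * d * exp (m * d)"
    using E1 by (simp add: mult_ac)
  have c: "has_bochner_integral P (\<lambda>\<omega>. x) x" for x :: real
    by (simp add: has_bochner_integral_iff prob_space)
  have "has_bochner_integral P (\<lambda>\<omega>. exp (?c * d) * exp (\<sigma> * ?D \<omega>) - 1 - m * d - \<sigma> * ?D \<omega>) (exp (m * d) - 1 - m * d - \<sigma> * 0)"
    using e1[unfolded E1] by (intro has_bochner_integral_diff has_bochner_integral_mult_right M c)
  then show "has_bochner_integral P (\<lambda>\<omega>. euler_rem m \<sigma> d (?D \<omega>)) (exp (m * d) - 1 - m * d)"
    by (simp add: euler_rem_def exp_add)
  have I: "has_bochner_integral P (\<lambda>\<omega>. exp (2 * ?c * d) * exp (2 * \<sigma> * ?D \<omega>) + (1 + m * d)\<^sup>2 + \<sigma>\<^sup>2 * (?D \<omega>)\<^sup>2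
      - 2 * (1 + m * d) * (exp (?c * d) * exp (\<sigma> * ?D \<omega>)) - 2 * \<sigma> * (exp (?c * d) * (?D \<omega> * exp (\<sigma> * ?D \<omega>)))
      + 2 * (1 + m * d) * \<sigma> * ?D \<omega>)
     (exp ((2 * m + \<sigma>\<^sup>2) * d) + (1 + m * d)\<^sup>2 + \<sigma>\<^sup>2 * d - 2 * (1 + m * d) * exp (m * d) - 2 * \<sigma> * (\<sigma> * d * exp (m * d))
      + 2 * (1 + m * d) * \<sigma> * 0)"
    using e1[unfolded E1] e2[unfolded E2] e3[unfolded E3]
    by (intro has_bochner_integral_diff has_bochner_integral_add has_bochner_integral_mult_right M c)
  have sq: "exp (2 * ?c * d) * exp (2 * \<sigma> * y) + (1 + m * d)\<^sup>2 + \<sigma>\<^sup>2 * y\<^sup>2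
      - 2 * (1 + m * d) * (exp (?c * d) * exp (\<sigma> * y)) - 2 * \<sigma> * (exp (?c * d) * (y * exp (\<sigma> * y)))
      + 2 * (1 + m * d) * \<sigma> * y = (euler_rem m \<sigma> d y)\<^sup>2" for y
  proof -
    have "exp (2 * ?c * d) * exp (2 * \<sigma> * y) = (exp (?c * d + \<sigma> * y))\<^sup>2"
      unfolding power2_eq_square exp_add[symmetric] by (simp add: algebra_simps)
    moreover have "exp (?c * d) * exp (\<sigma> * y) = exp (?c * d + \<sigma> * y)" by (simp add: exp_add)
    moreover have "exp (?c * d) * (y * exp (\<sigma> * y)) = y * exp (?c * d + \<sigma> * y)" by (simp add: exp_add)
    ultimately show ?thesis
      unfolding euler_rem_def by (simp add: power2_eq_square algebra_simps)
  qed
  have val: "2 * \<sigma> * (\<sigma> * d * exp (m * d)) = 2 * (\<sigma>\<^sup>2 * d) * exp (m * d)" by (simp add: power2_eq_square)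
  show "has_bochner_integral P (\<lambda>\<omega>. (euler_rem m \<sigma> d (?D \<omega>))\<^sup>2)
      (exp ((2 * m + \<sigma>\<^sup>2) * d) + (1 + m * d)\<^sup>2 + \<sigma>\<^sup>2 * d - 2 * (1 + m * d) * exp (m * d) - 2 * (\<sigma>\<^sup>2 * d) * exp (m * d))"
    using I unfolding sq val mult_zero_right add_0_right .
qed

text \<open>Telescoping over the grid exhibits the error of the left-point sum as the sum of
  \<open>Y n i\<close> times the one-step errors. The means of these errors are collected in
  \<open>A\<close>, for which Cauchy-Schwarz is enough as they are of order
  \<open>1 / n\<^sup>2\<close>. The centred errors in \<open>B\<close> have variances of the same
  order and are orthogonal, so that their variances merely add.\<close>

lemma gbm_left_point:
  assumes t: "0 < t"
  shows "tendsto_in_prob P (\<lambda>n \<omega>. \<Sum>i<Suc n. gbm m \<sigma> (grid t n i) \<omega> *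
     (m * (t / real (Suc n)) + \<sigma> * (W (grid t n (Suc i)) \<omega> - W (grid t n i) \<omega>))) (\<lambda>\<omega>. gbm m \<sigma> t \<omega> - 1)"
proof -
  define d where "d n = t / real (Suc n)" for n
  define DW where "DW n i \<omega> = W (grid t n (Suc i)) \<omega> - W (grid t n i) \<omega>" for n i \<omega>
  define Y where "Y n i = gbm m \<sigma> (grid t n i)" for n i
  define \<rho> where "\<rho> n = exp (m * d n) - 1 - m * d n" for n
  define V where "V n = exp ((2 * m + \<sigma>\<^sup>2) * d n) + (1 + m * d n)\<^sup>2 + \<sigma>\<^sup>2 * d n - 2 * (1 + m * d n) * exp (m * d n) - 2 * (\<sigma>\<^sup>2 * d n) * exp (m * d n)" for n
  define C where "C = exp (\<bar>2 * m + \<sigma>\<^sup>2\<bar> * t)"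
  have gr: "0 \<le> grid t n i" "grid t n i \<le> grid t n (Suc i)" "d n = grid t n (Suc i) - grid t n i" for n i
    using grid_mono[of t 0 i n] grid_mono[of t i "Suc i" n] t by (auto simp: grid_simps d_def)
  have Ym[measurable]: "Y n i \<in> borel_measurable P" for n i unfolding Y_def using gr by simp
  have DWm[measurable]: "DW n i \<in> borel_measurable P" for n i
    unfolding DW_def using gr(1)[of n i] gr(1)[of n "Suc i"] by (intro borel_measurable_diff W_meas)
  have Y2: "integrable P (\<lambda>\<omega>. (Y n i \<omega>)\<^sup>2)" for n i unfolding Y_def by (rule gbm_square_integral gr)+
  have Y2C: "(LINT \<omega>|P. (Y n i \<omega>)\<^sup>2) \<le> C" if "i \<le> Suc n" for n i
  proof -
    have "(2 * m + \<sigma>\<^sup>2) * grid t n i \<le> \<bar>2 * m + \<sigma>\<^sup>2\<bar> * t"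
      using grid_range[of t i n] t that by (intro mult_mono) auto
    then show ?thesis unfolding Y_def C_def using gbm_square_integral(2)[OF gr(1)] by simp
  qed
  have rem: "has_bochner_integral P (\<lambda>\<omega>. euler_rem m \<sigma> (d n) (DW n i \<omega>)) (\<rho> n)"
    "has_bochner_integral P (\<lambda>\<omega>. (euler_rem m \<sigma> (d n) (DW n i \<omega>))\<^sup>2) (V n)" for n i
    using euler_rem_moments[OF gr] unfolding DW_def \<rho>_def V_def by auto
  define A where "A n \<omega> = \<rho> n * (\<Sum>i<Suc n. Y n i \<omega>)" for n \<omega>
  define B where "B n \<omega> = (\<Sum>i<Suc n. Y n i \<omega> * (euler_rem m \<sigma> (d n) (DW n i \<omega>) - \<rho> n))" for n \<omega>
  have [measurable]: "(\<lambda>y. euler_rem m \<sigma> x y) \<in> borel_measurable borel" for x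
    unfolding euler_rem_def by measurable
  have [measurable]: "A n \<in> borel_measurable P" "B n \<in> borel_measurable P" for n
    unfolding A_def B_def by measurable
  have tA: "tendsto_in_prob P A (\<lambda>_. 0)"
  proof (rule tendsto_in_prob_L2)
    have bd: "(A n \<omega>)\<^sup>2 \<le> (\<rho> n)\<^sup>2 * ((\<Sum>i<Suc n. (Y n i \<omega>)\<^sup>2) * real (Suc n))" for n \<omega>
      unfolding A_def power_mult_distrib
      using sum_squared_le_sum_of_squares[of "\<lambda>i. Y n i \<omega>" "{..<Suc n}"] by (intro mult_left_mono) auto
    have ib: "integrable P (\<lambda>\<omega>. (\<rho> n)\<^sup>2 * ((\<Sum>i<Suc n. (Y n i \<omega>)\<^sup>2) * real (Suc n)))" for n
      by (intro integrable_mult_right integrable_mult_left Bochner_Integration.integrable_sum Y2)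
    have iA: "integrable P (\<lambda>\<omega>. (A n \<omega>)\<^sup>2)" for n
    proof (rule Bochner_Integration.integrable_bound[OF ib[of n]])
      show "AE \<omega> in P. norm ((A n \<omega>)\<^sup>2) \<le> norm ((\<rho> n)\<^sup>2 * ((\<Sum>i<Suc n. (Y n i \<omega>)\<^sup>2) * real (Suc n)))"
        using bd[of n] by (intro AE_I2) (simp only: real_norm_def abs_power2, rule order_trans[OF _ abs_ge_self])
    qed measurable
    then show "integrable P (\<lambda>\<omega>. (A n \<omega> - 0)\<^sup>2)" for n by simp
    have "(LINT \<omega>|P. (A n \<omega>)\<^sup>2) \<le> (real (Suc n) * \<rho> n)\<^sup>2 * C" for n
    proof -
      have "(LINT \<omega>|P. (A n \<omega>)\<^sup>2) \<le> (LINT \<omega>|P. (\<rho> n)\<^sup>2 * ((\<Sum>i<Suc n. (Y n i \<omega>)\<^sup>2) * real (Suc n)))"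
        by (intro integral_mono iA ib bd)
      also have "\<dots> = (\<rho> n)\<^sup>2 * ((\<Sum>i<Suc n. LINT \<omega>|P. (Y n i \<omega>)\<^sup>2) * real (Suc n))"
        by (simp only: integral_mult_right_zero integral_mult_left_zero Bochner_Integration.integral_sum[OF Y2])
      also have "\<dots> \<le> (\<rho> n)\<^sup>2 * ((\<Sum>i<Suc n. C) * real (Suc n))"
        by (intro mult_left_mono mult_right_mono sum_mono Y2C) auto
      also have "\<dots> = (real (Suc n) * \<rho> n)\<^sup>2 * C" by (simp add: power2_eq_square)
      finally show ?thesis .
    qed
    moreover have "(\<lambda>n. (real (Suc n) * \<rho> n)\<^sup>2 * C) \<longlonglongrightarrow> 0"
    proof -
      have "(\<lambda>n. (real (Suc n) * (exp (m * t / real (Suc n)) - 1 - m * t / real (Suc n)))) \<longlonglongrightarrow> 0" by real_asymp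
      then have "(\<lambda>n. real (Suc n) * \<rho> n) \<longlonglongrightarrow> 0" by (simp add: \<rho>_def d_def del: of_nat_Suc)
      from tendsto_mult[OF tendsto_power[OF this, of 2] tendsto_const[of C]] show ?thesis by simp
    qed
    ultimately have "(\<lambda>n. LINT \<omega>|P. (A n \<omega>)\<^sup>2) \<longlonglongrightarrow> 0"
      by (intro tendsto_0_squeeze[of "\<lambda>n. LINT \<omega>|P. (A n \<omega>)\<^sup>2" "\<lambda>n. (real (Suc n) * \<rho> n)\<^sup>2 * C"]
           Bochner_Integration.integral_nonneg) auto
    then show "(\<lambda>n. LINT \<omega>|P. (A n \<omega> - 0)\<^sup>2) \<longlonglongrightarrow> 0" by simp
  qed measurable
  have tB: "tendsto_in_prob P B (\<lambda>_. 0)"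
  proof (rule tendsto_in_prob_L2)
    have h: "(\<lambda>y. euler_rem m \<sigma> (d n) y - \<rho> n) \<in> borel_measurable borel" for n by measurable
    have hb: "has_bochner_integral P (\<lambda>\<omega>. euler_rem m \<sigma> (d n) (DW n i \<omega>) - \<rho> n) 0" for n i
      using has_bochner_integral_diff[OF rem(1)[of n i], of "\<lambda>_. \<rho> n" "\<rho> n"]
      by (simp add: has_bochner_integral_iff prob_space)
    have hb2: "has_bochner_integral P (\<lambda>\<omega>. (euler_rem m \<sigma> (d n) (DW n i \<omega>) - \<rho> n)\<^sup>2) (V n - (\<rho> n)\<^sup>2)" for n i
    proof -
      have "has_bochner_integral P (\<lambda>\<omega>. (euler_rem m \<sigma> (d n) (DW n i \<omega>))\<^sup>2 - 2 * \<rho> n * euler_rem m \<sigma> (d n) (DW n i \<omega>) + (\<rho> n)\<^sup>2)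
         (V n - 2 * \<rho> n * \<rho> n + (\<rho> n)\<^sup>2)"
        by (intro has_bochner_integral_add has_bochner_integral_diff has_bochner_integral_mult_right rem)
          (simp add: has_bochner_integral_iff prob_space)
      then show ?thesis by (simp add: power2_eq_square algebra_simps)
    qed
    have iso: "B n \<in> borel_measurable (Ft (ennreal (grid t n (Suc n)))) \<and>
      integrable P (\<lambda>\<omega>. (B n \<omega>)\<^sup>2) \<and>
      (LINT \<omega>|P. (B n \<omega>)\<^sup>2) = (\<Sum>i<Suc n. (LINT \<omega>|P. (Y n i \<omega>)\<^sup>2) * (LINT \<omega>|P. (euler_rem m \<sigma> (d n) (DW n i \<omega>) - \<rho> n)\<^sup>2))" for n
      unfolding B_def DW_def
    proof (rule discrete_isometry)
      show "Y n i \<in> borel_measurable (Ft (ennreal (grid t n i)))" for i unfolding Y_def by (rule gbm_adapted[OF gr(1)])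
    qed (use gr Y2 h hb hb2 in \<open>auto simp: DW_def has_bochner_integral_iff\<close>)
    then show "integrable P (\<lambda>\<omega>. (B n \<omega> - 0)\<^sup>2)" for n by simp
    have "(LINT \<omega>|P. (B n \<omega>)\<^sup>2) \<le> real (Suc n) * V n * C" for n
    proof -
      have VR: "0 \<le> V n - (\<rho> n)\<^sup>2"
      proof -
        have "0 \<le> (LINT \<omega>|P. (euler_rem m \<sigma> (d n) (DW n 0 \<omega>) - \<rho> n)\<^sup>2)"
          by (intro Bochner_Integration.integral_nonneg) simp
        then show ?thesis using has_bochner_integral_integral_eq[OF hb2[of n 0]] by linarith
      qed
      have "(LINT \<omega>|P. (B n \<omega>)\<^sup>2) = (\<Sum>i<Suc n. (LINT \<omega>|P. (Y n i \<omega>)\<^sup>2) * (V n - (\<rho> n)\<^sup>2))"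
        using iso[of n] hb2[of n] by (simp only: has_bochner_integral_iff)
      also have "\<dots> \<le> (\<Sum>i<Suc n. C * V n)"
        using VR Y2C by (intro sum_mono mult_mono) (auto simp: C_def)
      also have "\<dots> = real (Suc n) * V n * C" by simp
      finally show ?thesis .
    qed
    moreover have "(\<lambda>n. real (Suc n) * V n * C) \<longlonglongrightarrow> 0"
    proof -
      have ra: "(\<lambda>n. real (Suc n) * (exp ((2 * a + b) / real (Suc n)) + (1 + a / real (Suc n))\<^sup>2 + b / real (Suc n)
          - 2 * (1 + a / real (Suc n)) * exp (a / real (Suc n)) - 2 * (b / real (Suc n)) * exp (a / real (Suc n)))) \<longlonglongrightarrow> 0"
        for a b :: real by real_asymp
      have "(\<lambda>n. real (Suc n) * V n) \<longlonglongrightarrow> 0"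
      proof -
        have e: "(2 * m + \<sigma>\<^sup>2) * (t / x) = (2 * (m * t) + \<sigma>\<^sup>2 * t) / x" "m * (t / x) = m * t / x"
          "\<sigma>\<^sup>2 * (t / x) = \<sigma>\<^sup>2 * t / x" for x
          by (simp_all add: algebra_simps add_divide_distrib)
        show ?thesis unfolding V_def d_def e by (rule ra)
      qed
      from tendsto_mult[OF this tendsto_const[of C]] show ?thesis by simp
    qed
    ultimately have "(\<lambda>n. LINT \<omega>|P. (B n \<omega>)\<^sup>2) \<longlonglongrightarrow> 0"
      by (intro tendsto_0_squeeze[of "\<lambda>n. LINT \<omega>|P. (B n \<omega>)\<^sup>2" "\<lambda>n. real (Suc n) * V n * C"]
           Bochner_Integration.integral_nonneg) auto
    then show "(\<lambda>n. LINT \<omega>|P. (B n \<omega> - 0)\<^sup>2) \<longlonglongrightarrow> 0" by simp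
  qed measurable
  define S where "S n \<omega> = (\<Sum>i<Suc n. Y n i \<omega> * (m * d n + \<sigma> * DW n i \<omega>))" for n \<omega>
  have [measurable]: "S n \<in> borel_measurable P" for n unfolding S_def by measurable
  have [measurable]: "gbm m \<sigma> t \<in> borel_measurable P" using t by simp
  have tel: "AE \<omega> in P. A n \<omega> + B n \<omega> = gbm m \<sigma> t \<omega> - 1 - S n \<omega>" for n
    using gbm_0[of m \<sigma>]
  proof eventually_elim
    case (elim \<omega>)
    have "gbm m \<sigma> t \<omega> - 1 = (\<Sum>i<Suc n. Y n (Suc i) \<omega> - Y n i \<omega>)"
      using elim by (subst sum_lessThan_telescope[of "\<lambda>i. Y n i \<omega>"]) (simp add: Y_def grid_simps)
    also have "\<dots> = (\<Sum>i<Suc n. Y n i \<omega> * (m * d n + \<sigma> * DW n i \<omega>) + Y n i \<omega> * euler_rem m \<sigma> (d n) (DW n i \<omega>))"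
    proof (intro sum.cong refl)
      fix i
      have "Y n (Suc i) \<omega> = Y n i \<omega> * exp ((m - \<sigma>\<^sup>2 / 2) * d n + \<sigma> * DW n i \<omega>)"
        unfolding Y_def DW_def gr(3)[of n i] by (rule gbm_increment[OF gr(1,2)])
      then show "Y n (Suc i) \<omega> - Y n i \<omega> = Y n i \<omega> * (m * d n + \<sigma> * DW n i \<omega>) + Y n i \<omega> * euler_rem m \<sigma> (d n) (DW n i \<omega>)"
        by (simp add: euler_rem_def algebra_simps)
    qed
    also have "\<dots> = S n \<omega> + (\<Sum>i<Suc n. Y n i \<omega> * euler_rem m \<sigma> (d n) (DW n i \<omega>))"
      unfolding S_def by (rule sum.distrib)
    also have "(\<Sum>i<Suc n. Y n i \<omega> * euler_rem m \<sigma> (d n) (DW n i \<omega>)) = A n \<omega> + B n \<omega>"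
      unfolding A_def B_def sum_distrib_left sum.distrib[symmetric]
      by (intro sum.cong) (auto simp: algebra_simps)
    finally show ?case by simp
  qed
  have "tendsto_in_prob P (\<lambda>n \<omega>. A n \<omega> + B n \<omega>) (\<lambda>_. 0)" using tendsto_in_prob_add[OF tA tB] by simp
  then have "tendsto_in_prob P (\<lambda>n \<omega>. gbm m \<sigma> t \<omega> - 1 - S n \<omega>) (\<lambda>_. 0)"
    by (rule tendsto_in_prob_AE_eq) (use tel in auto)
  then have "tendsto_in_prob P S (\<lambda>\<omega>. gbm m \<sigma> t \<omega> - 1)"
    unfolding tendsto_in_prob_def by (auto simp: abs_minus_commute)
  then show ?thesis unfolding S_def Y_def d_def DW_def .
qed

end

context wiener
begin

subsection \<open>Uniqueness for the linear equation\<close>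

text \<open>A discrete Gronwall argument for the square of the difference of two solutions, localised by
  the events that the path stays bounded by \<open>R\<close>; no a priori integrability is available.\<close>

lemma linear_sde_unique_0:
  fixes U :: "real \<Rightarrow> 'a \<Rightarrow> real"
  assumes ad: "\<And>t. 0 \<le> t \<Longrightarrow> U t \<in> borel_measurable (Ft (ennreal t))"
    and cont: "AE \<omega> in P. continuous_on {0..} (\<lambda>t. U t \<omega>)"
    and U0: "AE \<omega> in P. U 0 \<omega> = 0"
    and lim: "\<And>t. 0 < t \<Longrightarrow> tendsto_in_prob P (\<lambda>n \<omega>. \<Sum>i<Suc n. U (grid t n i) \<omega> *
     (m * (t / real (Suc n)) + \<sigma> * (W (grid t n (Suc i)) \<omega> - W (grid t n i) \<omega>))) (U t)"
    and t: "0 < T"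
  shows "AE \<omega> in P. U T \<omega> = 0"
proof -
  have Um[measurable]: "U t \<in> borel_measurable P" if "0 \<le> t" for t using ad measurable_Ft that by blast
  have zero: "AE \<omega> in P. U T \<omega> * indicator {\<omega> \<in> space P. \<forall>q\<in>\<rat>. 0 \<le> q \<and> q \<le> T \<longrightarrow> \<bar>U q \<omega>\<bar> \<le> R} \<omega> = 0"
    if R: "0 < R" for R :: real
  proof -
    \<comment> \<open>Rational times up to \<open>t\<close> suffice, so \<open>G t\<close> is known
      at time \<open>t\<close> without a stopping time. On \<open>G t\<close> all earlier
      \<open>X s\<close> equal \<open>U s\<close>, which keeps the grid sums of \<open>X\<close> and
      of \<open>U\<close> equal there.\<close>
    define G where "G t = {\<omega> \<in> space P. \<forall>q\<in>\<rat>. 0 \<le> q \<and> q \<le> t \<longrightarrow> \<bar>U q \<omega>\<bar> \<le> R}" for t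
    define X where "X t \<omega> = U t \<omega> * indicator (G t) \<omega>" for t \<omega>
    have GF: "G t \<in> sets (Ft (ennreal t))" for t
    proof -
      have "{\<omega> \<in> space (Ft (ennreal t)). 0 \<le> q \<and> q \<le> t \<longrightarrow> \<bar>U q \<omega>\<bar> \<le> R} \<in> sets (Ft (ennreal t))" for q
      proof (cases "0 \<le> q \<and> q \<le> t")
        case True
        then have "U q \<in> borel_measurable (Ft (ennreal t))"
          by (intro measurable_Ft_mono[OF _ ad] ennreal_leI) auto
        then show ?thesis using True by measurable
      next
        case False
        then have "{\<omega> \<in> space (Ft (ennreal t)). 0 \<le> q \<and> q \<le> t \<longrightarrow> \<bar>U q \<omega>\<bar> \<le> R} = space (Ft (ennreal t))" by auto
        then show ?thesis by (simp only: sets.top)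
      qed
      then have "{\<omega> \<in> space (Ft (ennreal t)). \<forall>q\<in>\<rat>. 0 \<le> q \<and> q \<le> t \<longrightarrow> \<bar>U q \<omega>\<bar> \<le> R} \<in> sets (Ft (ennreal t))"
      proof -
        assume *: "\<And>q. {\<omega> \<in> space (Ft (ennreal t)). 0 \<le> q \<and> q \<le> t \<longrightarrow> \<bar>U q \<omega>\<bar> \<le> R} \<in> sets (Ft (ennreal t))"
        have eq: "(\<forall>q\<in>\<rat>. 0 \<le> q \<and> q \<le> t \<longrightarrow> \<bar>U q \<omega>\<bar> \<le> R) = (\<forall>x::rat. 0 \<le> real_of_rat x \<and> real_of_rat x \<le> t \<longrightarrow> \<bar>U (real_of_rat x) \<omega>\<bar> \<le> R)" for \<omega>
          by (auto simp: Rats_def)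
        show ?thesis unfolding eq by (intro sets.sets_Collect_countable_All *)
      qed
      then show ?thesis by (simp add: G_def)
    qed
    have Gm[measurable]: "G t \<in> events" for t using GF sets_Ft by blast
    have Ganti: "\<omega> \<in> G s" if "\<omega> \<in> G t" "s \<le> t" for \<omega> s t using that by (auto simp: G_def)
    have XF: "X t \<in> borel_measurable (Ft (ennreal t))" if "0 \<le> t" for t
      unfolding X_def using ad[OF that] GF[of t] by measurable
    have Xm[measurable]: "X t \<in> borel_measurable P" if "0 \<le> t" for t using XF measurable_Ft that by blast
    have Xb: "AE \<omega> in P. \<bar>X t \<omega>\<bar> \<le> R" if "0 \<le> t" for t
      using cont AE_space
    proof eventually_elim
      case (elim \<omega>)
      show ?case
      proof (cases "\<omega> \<in> G t")
        case True
        have "\<bar>U t \<omega>\<bar> \<le> R"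
        proof (cases "t = 0")
          case True
          then show ?thesis using \<open>\<omega> \<in> G t\<close> by (auto simp: G_def)
        next
          case False
          then have t0: "0 < t" using that by simp
          have "\<exists>q. \<forall>n. q n \<in> \<rat> \<and> t - t / real (Suc n) < q n \<and> q n < t"
          proof (rule choice, rule allI)
            fix n
            have "t - t / real (Suc n) < t" using t0 by simp
            then show "\<exists>q. q \<in> \<rat> \<and> t - t / real (Suc n) < q \<and> q < t" using Rats_dense_in_real by blast
          qed
          then obtain q where q: "\<And>n. q n \<in> \<rat>" "\<And>n. t - t / real (Suc n) < q n" "\<And>n. q n < t" by auto
          have "t / real (Suc n) \<le> t" for n
          proof -
            have "t * 1 \<le> t * real (Suc n)" using t0 by (intro mult_left_mono) auto
            then show ?thesis by (simp add: field_simps)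
          qed
          then have q0: "0 \<le> q n" for n using q(2)[of n] by (smt (verit))
          have "(\<lambda>n. t / real (Suc n)) \<longlonglongrightarrow> 0" by (rule LIMSEQ_Suc) (rule lim_const_over_n)
          then have "(\<lambda>n. t - t / real (Suc n)) \<longlonglongrightarrow> t - 0" by (intro tendsto_intros)
          then have lim: "(\<lambda>n. t - t / real (Suc n)) \<longlonglongrightarrow> t" by simp
          have "q \<longlonglongrightarrow> t"
            by (rule tendsto_sandwich[OF always_eventually always_eventually lim tendsto_const])
              (use q(2,3) in \<open>simp_all add: less_imp_le del: of_nat_Suc\<close>)
          then have "(\<lambda>n. U (q n) \<omega>) \<longlonglongrightarrow> U t \<omega>"
            using elim(1) q0 that unfolding continuous_on_sequentially by (auto simp: o_def)
          then have "(\<lambda>n. \<bar>U (q n) \<omega>\<bar>) \<longlonglongrightarrow> \<bar>U t \<omega>\<bar>" by (rule tendsto_rabs)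
          moreover have "\<bar>U (q n) \<omega>\<bar> \<le> R" for n
            using \<open>\<omega> \<in> G t\<close> q(1,3)[of n] q0[of n] by (auto simp: G_def less_imp_le)
          ultimately show ?thesis by (intro LIMSEQ_le_const2) auto
        qed
        then show ?thesis using \<open>\<omega> \<in> G t\<close> by (simp add: X_def)
      qed (use R in \<open>simp add: X_def\<close>)
    qed
    have X2i: "integrable P (\<lambda>\<omega>. (X t \<omega>)\<^sup>2)" and X2R: "(LINT \<omega>|P. (X t \<omega>)\<^sup>2) \<le> R\<^sup>2" if "0 \<le> t" for t
    proof -
      have ae: "AE \<omega> in P. (X t \<omega>)\<^sup>2 \<le> R\<^sup>2" using Xb[OF that]
        by eventually_elim (use power_mono[of "\<bar>X t _\<bar>" R 2] in auto)
      have [measurable]: "X t \<in> borel_measurable P" using that by simp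
      show i: "integrable P (\<lambda>\<omega>. (X t \<omega>)\<^sup>2)"
        by (rule integrable_const_bound[where B="R\<^sup>2"]) (use ae in auto)
      have "(LINT \<omega>|P. (X t \<omega>)\<^sup>2) \<le> (LINT \<omega>|P. R\<^sup>2)" by (rule integral_mono_AE[OF i _ ae]) simp
      then show "(LINT \<omega>|P. (X t \<omega>)\<^sup>2) \<le> R\<^sup>2" by (simp add: prob_space)
    qed
    \<comment> \<open>From \<open>(x + y)\<^sup>2 \<le> 2 * x\<^sup>2 + 2 * y\<^sup>2\<close>: the
      drift sum contributes \<open>2 * m\<^sup>2 * t\<close> by Cauchy-Schwarz, with
      \<open>t \<le> T\<close>, and the orthogonal noise terms contribute
      \<open>2 * \<sigma>\<^sup>2\<close>.\<close>
    define C where "C = 2 * m\<^sup>2 * T + 2 * \<sigma>\<^sup>2"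
    have C0: "0 \<le> C" using t by (simp add: C_def)
    \<comment> \<open>One round of the iteration. The second moment of the grid sum
      \<open>V n\<close> is controlled by the moments of \<open>X\<close> at earlier times;
      restricted to \<open>G t\<close> these sums converge to \<open>X t\<close> in probability, and
      Fatou's lemma keeps the bound.\<close>
    have step: "(LINT \<omega>|P. (X t \<omega>)\<^sup>2) \<le> C * (B * t ^ Suc j / real (Suc j))"
      if B: "0 \<le> B" "\<And>s. 0 \<le> s \<Longrightarrow> s \<le> T \<Longrightarrow> (LINT \<omega>|P. (X s \<omega>)\<^sup>2) \<le> B * s ^ j" and tT: "0 < t" "t \<le> T" for B j t
    proof -
      define d where "d n = t / real (Suc n)" for n
      define DW where "DW n i \<omega> = W (grid t n (Suc i)) \<omega> - W (grid t n i) \<omega>" for n i \<omega>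
      define V where "V n \<omega> = (\<Sum>i<Suc n. X (grid t n i) \<omega> * (m * d n + \<sigma> * DW n i \<omega>))" for n \<omega>
      have gr: "0 \<le> grid t n i" "grid t n i \<le> grid t n (Suc i)" "d n = grid t n (Suc i) - grid t n i" for n i
        using grid_mono[of t 0 i n] grid_mono[of t i "Suc i" n] tT by (auto simp: grid_simps d_def)
      have Xg[measurable]: "X (grid t n i) \<in> borel_measurable P" for n i using gr by simp
      have DWm[measurable]: "DW n i \<in> borel_measurable P" for n i
        unfolding DW_def using gr(1)[of n i] gr(1)[of n "Suc i"] by (intro borel_measurable_diff W_meas)
      have [measurable]: "V n \<in> borel_measurable P" for n unfolding V_def by measurable
      have d0: "0 < d n" "real (Suc n) * d n = t" for n using tT by (auto simp: d_def simp del: of_nat_Suc)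
      define \<Phi> where "\<Phi> n = (\<Sum>i<Suc n. LINT \<omega>|P. (X (grid t n i) \<omega>)\<^sup>2)" for n
      define I where "I n \<omega> = (\<Sum>i<Suc n. X (grid t n i) \<omega> * DW n i \<omega>)" for n \<omega>
      have inc: "has_bochner_integral P (DW n i) 0" "has_bochner_integral P (\<lambda>\<omega>. (DW n i \<omega>)\<^sup>2) (d n)" for n i
        using increment_moments(1,2)[OF gr(1,2)[of n i]] gr(3)[of n i] unfolding DW_def by auto
      have incE: "(LINT \<omega>|P. W (grid t n (Suc i)) \<omega> - W (grid t n i) \<omega>) = 0" for n i
        using has_bochner_integral_integral_eq[OF inc(1)[of n i]] by (simp add: DW_def[abs_def])
      have iso: "I n \<in> borel_measurable (Ft (ennreal (grid t n (Suc n)))) \<and>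
         integrable P (\<lambda>\<omega>. (I n \<omega>)\<^sup>2) \<and>
        (LINT \<omega>|P. (I n \<omega>)\<^sup>2) = (\<Sum>i<Suc n. (LINT \<omega>|P. (X (grid t n i) \<omega>)\<^sup>2) * (LINT \<omega>|P. (DW n i \<omega>)\<^sup>2))" for n
        unfolding I_def DW_def
        by (rule discrete_isometry[where h="\<lambda>_ y. y"])
          (use gr X2i XF inc incE in \<open>auto simp: DW_def has_bochner_integral_iff\<close>)
      have I2: "(LINT \<omega>|P. (I n \<omega>)\<^sup>2) = d n * \<Phi> n" for n
        using iso[of n] has_bochner_integral_integral_eq[OF inc(2)]
        by (simp only: \<Phi>_def sum_distrib_left mult.commute)
      have [measurable]: "I n \<in> borel_measurable P" for n unfolding I_def by measurable
      have pt: "(V n \<omega>)\<^sup>2 \<le> 2 * m\<^sup>2 * (d n)\<^sup>2 * ((\<Sum>i<Suc n. (X (grid t n i) \<omega>)\<^sup>2) * real (Suc n)) + 2 * \<sigma>\<^sup>2 * (I n \<omega>)\<^sup>2" for n \<omega>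
      proof -
        have "V n \<omega> = m * d n * (\<Sum>i<Suc n. X (grid t n i) \<omega>) + \<sigma> * I n \<omega>"
          unfolding V_def I_def sum_distrib_left sum.distrib[symmetric] by (intro sum.cong) (auto simp: algebra_simps)
        moreover have "(a + b)\<^sup>2 \<le> 2 * a\<^sup>2 + 2 * b\<^sup>2" for a b :: real
          using sum_squares_bound[of a b] by (simp add: power2_sum)
        ultimately have "(V n \<omega>)\<^sup>2 \<le> 2 * (m * d n * (\<Sum>i<Suc n. X (grid t n i) \<omega>))\<^sup>2 + 2 * (\<sigma> * I n \<omega>)\<^sup>2" by metis
        also have "(m * d n * (\<Sum>i<Suc n. X (grid t n i) \<omega>))\<^sup>2 \<le> (m * d n)\<^sup>2 * ((\<Sum>i<Suc n. (X (grid t n i) \<omega>)\<^sup>2) * real (Suc n))"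
          unfolding power_mult_distrib[of "m * d n"]
          using sum_squared_le_sum_of_squares[of "\<lambda>i. X (grid t n i) \<omega>" "{..<Suc n}"] by (intro mult_left_mono) auto
        finally show ?thesis by (simp add: power_mult_distrib algebra_simps)
      qed
      have ibd: "integrable P (\<lambda>\<omega>. 2 * m\<^sup>2 * (d n)\<^sup>2 * ((\<Sum>i<Suc n. (X (grid t n i) \<omega>)\<^sup>2) * real (Suc n)) + 2 * \<sigma>\<^sup>2 * (I n \<omega>)\<^sup>2)" for n
        using iso[of n] X2i[OF gr(1)]
        by (intro Bochner_Integration.integrable_add integrable_mult_right integrable_mult_left Bochner_Integration.integrable_sum) auto
      have VI: "integrable P (\<lambda>\<omega>. (V n \<omega>)\<^sup>2)" for n
      proof (rule Bochner_Integration.integrable_bound[OF ibd[of n]])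
        show "AE \<omega> in P. norm ((V n \<omega>)\<^sup>2) \<le> norm (2 * m\<^sup>2 * (d n)\<^sup>2 * ((\<Sum>i<Suc n. (X (grid t n i) \<omega>)\<^sup>2) * real (Suc n)) + 2 * \<sigma>\<^sup>2 * (I n \<omega>)\<^sup>2)"
          using pt[of n] by (intro AE_I2) (simp only: real_norm_def abs_power2, rule order_trans[OF _ abs_ge_self])
      qed measurable
      have V2: "(LINT \<omega>|P. (V n \<omega>)\<^sup>2) \<le> C * (B * t ^ Suc j / real (Suc j))" for n
      proof -
        have "(LINT \<omega>|P. (V n \<omega>)\<^sup>2) \<le> (LINT \<omega>|P. 2 * m\<^sup>2 * (d n)\<^sup>2 * ((\<Sum>i<Suc n. (X (grid t n i) \<omega>)\<^sup>2) * real (Suc n)) + 2 * \<sigma>\<^sup>2 * (I n \<omega>)\<^sup>2)"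
          by (intro integral_mono VI ibd pt)
        also have "\<dots> = 2 * m\<^sup>2 * (d n)\<^sup>2 * (\<Phi> n * real (Suc n)) + 2 * \<sigma>\<^sup>2 * (d n * \<Phi> n)"
        proof -
          have s: "integrable P (\<lambda>\<omega>. \<Sum>i<Suc n. (X (grid t n i) \<omega>)\<^sup>2)" by (intro Bochner_Integration.integrable_sum X2i gr)
          have sI: "(LINT \<omega>|P. (\<Sum>i<Suc n. (X (grid t n i) \<omega>)\<^sup>2)) = \<Phi> n"
            unfolding \<Phi>_def by (rule Bochner_Integration.integral_sum) (intro X2i gr)
          have i1: "integrable P (\<lambda>\<omega>. 2 * m\<^sup>2 * (d n)\<^sup>2 * ((\<Sum>i<Suc n. (X (grid t n i) \<omega>)\<^sup>2) * real (Suc n)))"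
            by (intro integrable_mult_right integrable_mult_left s)
          have i2: "integrable P (\<lambda>\<omega>. 2 * \<sigma>\<^sup>2 * (I n \<omega>)\<^sup>2)" using iso[of n] by (intro integrable_mult_right) auto
          show ?thesis
            unfolding Bochner_Integration.integral_add[OF i1 i2]
            by (simp only: integral_mult_right_zero integral_mult_left_zero sI I2)
        qed
        also have "\<dots> = (2 * m\<^sup>2 * (real (Suc n) * d n) + 2 * \<sigma>\<^sup>2) * (d n * \<Phi> n)"
          by (simp add: power2_eq_square algebra_simps)
        also have "\<dots> \<le> C * (d n * \<Phi> n)"
        proof (rule mult_right_mono)
          show "2 * m\<^sup>2 * (real (Suc n) * d n) + 2 * \<sigma>\<^sup>2 \<le> C"
            unfolding d0(2) C_def using tT by (intro add_right_mono mult_left_mono) auto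
          show "0 \<le> d n * \<Phi> n" using I2[of n] Bochner_Integration.integral_nonneg[of P "\<lambda>\<omega>. (I n \<omega>)\<^sup>2"] by (metis zero_le_power2)
        qed
        also have "d n * \<Phi> n \<le> (\<Sum>i<Suc n. d n * (B * grid t n i ^ j))"
          unfolding \<Phi>_def sum_distrib_left
        proof (intro sum_mono mult_left_mono B(2))
          fix i assume "i \<in> {..<Suc n}"
          then have "grid t n i \<le> t" using grid_range[of t i n] tT by auto
          then show "grid t n i \<le> T" using tT by simp
        qed (use gr d0(1)[of n] in \<open>auto simp: less_imp_le\<close>)
        also have "\<dots> = B * (\<Sum>i<Suc n. (t / real (Suc n)) * grid t n i ^ j)"
          unfolding d_def sum_distrib_left by (intro sum.cong) auto
        also have "\<dots> \<le> B * (t ^ Suc j / real (Suc j))"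
          using left_sum_power_le[of t n j] tT B(1) by (intro mult_left_mono) auto
        finally show ?thesis using C0 by (simp add: mult_left_mono)
      qed
      have tip: "tendsto_in_prob P (\<lambda>n \<omega>. V n \<omega> * indicator (G t) \<omega>) (X t)"
        unfolding tendsto_in_prob_def
      proof (intro conjI allI impI)
        show "X t \<in> borel_measurable P" using tT by simp
        fix \<epsilon> :: real assume "0 < \<epsilon>"
        define S where "S n \<omega> = (\<Sum>i<Suc n. U (grid t n i) \<omega> * (m * d n + \<sigma> * DW n i \<omega>))" for n \<omega>
        have lim': "tendsto_in_prob P S (U t)" using lim[OF tT(1)] unfolding S_def d_def DW_def .
        then have [measurable]: "\<And>n. S n \<in> borel_measurable P" "U t \<in> borel_measurable P"
          unfolding tendsto_in_prob_def by auto
        have "prob {\<omega> \<in> space P. \<epsilon> < \<bar>V n \<omega> * indicator (G t) \<omega> - X t \<omega>\<bar>} \<le> prob {\<omega> \<in> space P. \<epsilon> < \<bar>S n \<omega> - U t \<omega>\<bar>}" for n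
        proof (rule finite_measure_mono)
          show "{\<omega> \<in> space P. \<epsilon> < \<bar>V n \<omega> * indicator (G t) \<omega> - X t \<omega>\<bar>} \<subseteq> {\<omega> \<in> space P. \<epsilon> < \<bar>S n \<omega> - U t \<omega>\<bar>}"
          proof safe
            fix \<omega> assume \<omega>: "\<epsilon> < \<bar>V n \<omega> * indicator (G t) \<omega> - X t \<omega>\<bar>"
            then have Gt: "\<omega> \<in> G t" using \<open>0 < \<epsilon>\<close> by (cases "\<omega> \<in> G t") (auto simp: X_def)
            have "V n \<omega> = S n \<omega>" unfolding V_def S_def
            proof (intro sum.cong refl)
              fix i assume "i \<in> {..<Suc n}"
              then have "grid t n i \<le> t" using grid_range[of t i n] tT by auto
              then show "X (grid t n i) \<omega> * (m * d n + \<sigma> * DW n i \<omega>) = U (grid t n i) \<omega> * (m * d n + \<sigma> * DW n i \<omega>)"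
                using Ganti[OF Gt] by (simp add: X_def)
            qed
            then show "\<epsilon> < \<bar>S n \<omega> - U t \<omega>\<bar>" using \<omega> Gt by (simp add: X_def)
          qed
        qed measurable
        then show "(\<lambda>n. prob {\<omega> \<in> space P. \<epsilon> < \<bar>V n \<omega> * indicator (G t) \<omega> - X t \<omega>\<bar>}) \<longlonglongrightarrow> 0"
          by (rule tendsto_0_squeeze[OF measure_nonneg _ tendsto_in_probD[OF lim' \<open>0 < \<epsilon>\<close>]])
      qed measurable
      have VG: "integrable P (\<lambda>\<omega>. (V n \<omega> * indicator (G t) \<omega>)\<^sup>2)" for n
        by (rule Bochner_Integration.integrable_bound[OF VI[of n]]) (auto simp: indicator_def)
      show ?thesis
      proof (rule integral_square_le_of_tendsto_in_prob[OF tip VG _ X2i])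
        show "(LINT \<omega>|P. (V n \<omega> * indicator (G t) \<omega>)\<^sup>2) \<le> C * (B * t ^ Suc j / real (Suc j))" for n
          using V2[of n] by (intro order_trans[OF integral_mono[OF VG VI]]) (auto simp: indicator_def)
      qed (use tT in simp)
    qed
    have bound: "(LINT \<omega>|P. (X s \<omega>)\<^sup>2) \<le> R\<^sup>2 * C ^ j / fact j * s ^ j" if "0 \<le> s" "s \<le> T" for s j
      using that
    proof (induction j arbitrary: s)
      case 0
      then show ?case using X2R by simp
    next
      case (Suc j)
      show ?case
      proof (cases "s = 0")
        case True
        have "AE \<omega> in P. (X 0 \<omega>)\<^sup>2 = 0" using U0 by eventually_elim (simp add: X_def)
        then have "(LINT \<omega>|P. (X 0 \<omega>)\<^sup>2) = (LINT \<omega>|P. 0)" by (intro integral_cong_AE) auto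
        then show ?thesis using True by simp
      next
        case False
        have "(LINT \<omega>|P. (X s \<omega>)\<^sup>2) \<le> C * (R\<^sup>2 * C ^ j / fact j * s ^ Suc j / real (Suc j))"
          by (rule step) (use Suc C0 False in auto)
        also have "\<dots> = R\<^sup>2 * C ^ Suc j / fact (Suc j) * s ^ Suc j" by (simp add: field_simps)
        finally show ?thesis .
      qed
    qed
    \<comment> \<open>The bound \<open>R\<^sup>2 * (C * T) ^ j / fact j\<close> reached after
      \<open>j\<close> rounds tends to zero.\<close>
    have "(\<lambda>j. (C * T) ^ j /\<^sub>R fact j) \<longlonglongrightarrow> 0" by (rule summable_LIMSEQ_zero[OF summable_exp_generic])
    then have "(\<lambda>j. R\<^sup>2 * ((C * T) ^ j /\<^sub>R fact j)) \<longlonglongrightarrow> R\<^sup>2 * 0" by (intro tendsto_intros)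
    moreover have "(LINT \<omega>|P. (X T \<omega>)\<^sup>2) \<le> R\<^sup>2 * ((C * T) ^ j /\<^sub>R fact j)" for j
      using bound[of T j] t by (simp add: power_mult_distrib field_simps)
    ultimately have "(LINT \<omega>|P. (X T \<omega>)\<^sup>2) \<le> 0" by (intro LIMSEQ_le_const[of _ 0]) auto
    moreover have "0 \<le> (LINT \<omega>|P. (X T \<omega>)\<^sup>2)" by (intro Bochner_Integration.integral_nonneg) simp
    ultimately have "(LINT \<omega>|P. (X T \<omega>)\<^sup>2) = 0" by simp
    then have "AE \<omega> in P. (X T \<omega>)\<^sup>2 = 0"
      using integral_nonneg_eq_0_iff_AE[OF X2i, of T] t by auto
    then show ?thesis by eventually_elim (simp add: X_def G_def)
  qed
  \<comment> \<open>A continuous path is bounded on \<open>[0, T]\<close>, so for large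
    \<open>n\<close> the localising event contains it.\<close>
  have "AE \<omega> in P. \<forall>n::nat. U T \<omega> * indicator {\<omega> \<in> space P. \<forall>q\<in>\<rat>. 0 \<le> q \<and> q \<le> T \<longrightarrow> \<bar>U q \<omega>\<bar> \<le> real (Suc n)} \<omega> = 0"
    unfolding AE_all_countable by (intro allI zero) simp
  then show ?thesis using cont AE_space
  proof eventually_elim
    case (elim \<omega>)
    obtain R where R: "\<And>x. x \<in> {0..T} \<Longrightarrow> \<bar>U x \<omega>\<bar> \<le> R"
      using continuous_on_bounded_interval[OF continuous_on_subset[OF elim(2), of "{0..T}"]] by auto
    obtain n where "R < real n" using reals_Archimedean2 by blast
    then have "\<forall>q\<in>\<rat>. 0 \<le> q \<and> q \<le> T \<longrightarrow> \<bar>U q \<omega>\<bar> \<le> real (Suc n)" using R by (fastforce intro: order_trans)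
    then show ?case using elim(1)[rule_format, of n] elim(3) by simp
  qed
qed

text \<open>Both \<open>X\<close> and \<open>z * gbm m \<sigma>\<close> arise as limits of
  left-point sums of the same linear form, hence so does their difference \<open>U\<close>, which
  starts at 0. Uniqueness gives equality at each positive time separately; countably many
  exceptional sets cover the rational times, and continuity covers the rest.\<close>

theorem solves_sde_gbm:
  assumes z: "solves_sde P Ft W (\<lambda>x. m * x) (\<lambda>x. \<sigma> * x) z X"
  shows "AE \<omega> in P. \<forall>t\<ge>0. X t \<omega> = z * gbm m \<sigma> t \<omega>"
proof -
  have ad: "\<And>t. 0 \<le> t \<Longrightarrow> X t \<in> borel_measurable (Ft (ennreal t))"
    and cont: "AE \<omega> in P. continuous_on {0..} (\<lambda>t. X t \<omega>)" and X0: "AE \<omega> in P. X 0 \<omega> = z"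
    and ito: "\<And>t. 0 \<le> t \<Longrightarrow> is_ito_integral P Ft W (\<lambda>q \<omega>. \<sigma> * X q \<omega>) t
        (\<lambda>\<omega>. X t \<omega> - z - (LINT q:{0..t}|lborel. m * X q \<omega>))"
    using z unfolding solves_sde_def by auto
  have Xm[measurable]: "X t \<in> borel_measurable P" if "0 \<le> t" for t using ad measurable_Ft that by blast
  define U where "U t \<omega> = X t \<omega> - z * gbm m \<sigma> t \<omega>" for t \<omega>
  have limX: "tendsto_in_prob P (\<lambda>n \<omega>. \<Sum>i<Suc n. X (grid t n i) \<omega> *
     (m * (t / real (Suc n)) + \<sigma> * (W (grid t n (Suc i)) \<omega> - W (grid t n i) \<omega>))) (\<lambda>\<omega>. X t \<omega> - z)" if t: "0 < t" for t
  proof -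
    let ?J = "\<lambda>\<omega>. X t \<omega> - z - (LINT q:{0..t}|lborel. m * X q \<omega>)"
    have 1: "tendsto_in_prob P (\<lambda>n \<omega>. \<Sum>i<Suc n. \<sigma> * X (grid t n i) \<omega> * (W (grid t n (Suc i)) \<omega> - W (grid t n i) \<omega>)) ?J"
      by (rule ito_left_point[OF t ito]) (use t in simp)
    then have [measurable]: "?J \<in> borel_measurable P" unfolding tendsto_in_prob_def by auto
    have "(\<lambda>\<omega>. X t \<omega> - z - ?J \<omega>) \<in> borel_measurable P"
      using t by (intro borel_measurable_diff Xm borel_measurable_const \<open>?J \<in> borel_measurable P\<close>) simp
    then have [measurable]: "(\<lambda>\<omega>. LINT q:{0..t}|lborel. m * X q \<omega>) \<in> borel_measurable P" by simp
    have gr: "0 \<le> grid t n i" for n i using grid_mono[of t 0 i n] t by (auto simp: grid_simps)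
    have [measurable]: "X (grid t n i) \<in> borel_measurable P" for n i using gr by simp
    have 2: "tendsto_in_prob P (\<lambda>n \<omega>. \<Sum>i<Suc n. m * X (grid t n i) \<omega> * (t / real (Suc n))) (\<lambda>\<omega>. LINT q:{0..t}|lborel. m * X q \<omega>)"
    proof (rule tendsto_in_prob_AE)
      show "AE \<omega> in P. (\<lambda>n. \<Sum>i<Suc n. m * X (grid t n i) \<omega> * (t / real (Suc n))) \<longlonglongrightarrow> (LINT q:{0..t}|lborel. m * X q \<omega>)"
        using cont
      proof eventually_elim
        case (elim \<omega>)
        have "continuous_on {0..t} (\<lambda>q. m * X q \<omega>)"
          by (intro continuous_intros continuous_on_subset[OF elim]) auto
        then show ?case using left_step_integrals(2)[OF _ t] by blast
      qed
    qed measurable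
    have "(\<Sum>i<Suc n. \<sigma> * X (grid t n i) \<omega> * (W (grid t n (Suc i)) \<omega> - W (grid t n i) \<omega>)) +
       (\<Sum>i<Suc n. m * X (grid t n i) \<omega> * (t / real (Suc n))) =
       (\<Sum>i<Suc n. X (grid t n i) \<omega> * (m * (t / real (Suc n)) + \<sigma> * (W (grid t n (Suc i)) \<omega> - W (grid t n i) \<omega>)))" for n \<omega>
      unfolding sum.distrib[symmetric] by (intro sum.cong) (auto simp: algebra_simps)
    then show ?thesis using tendsto_in_prob_add[OF 1 2] by simp
  qed
  have ae: "AE \<omega> in P. U t \<omega> = 0" if t: "0 < t" for t
  proof (rule linear_sde_unique_0[OF _ _ _ _ t])
    show "U t \<in> borel_measurable (Ft (ennreal t))" if "0 \<le> t" for t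
      unfolding U_def using ad[OF that] gbm_adapted[OF that] by measurable
    show "AE \<omega> in P. continuous_on {0..} (\<lambda>t. U t \<omega>)"
      using cont gbm_cont[of m \<sigma>] unfolding U_def by eventually_elim (intro continuous_intros)
    show "AE \<omega> in P. U 0 \<omega> = 0" using X0 gbm_0[of m \<sigma>] by eventually_elim (simp add: U_def)
    fix t :: real assume t: "0 < t"
    have gr: "0 \<le> grid t n i" for n i using grid_mono[of t 0 i n] t by (auto simp: grid_simps)
    let ?x = "\<lambda>n i \<omega>. m * (t / real (Suc n)) + \<sigma> * (W (grid t n (Suc i)) \<omega> - W (grid t n i) \<omega>)"
    have 3: "tendsto_in_prob P (\<lambda>n \<omega>. - z * (\<Sum>i<Suc n. gbm m \<sigma> (grid t n i) \<omega> * ?x n i \<omega>)) (\<lambda>\<omega>. - z * (gbm m \<sigma> t \<omega> - 1))"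
      unfolding tendsto_in_prob_def
    proof (intro conjI allI impI)
      have g: "tendsto_in_prob P (\<lambda>n \<omega>. \<Sum>i<Suc n. gbm m \<sigma> (grid t n i) \<omega> * ?x n i \<omega>) (\<lambda>\<omega>. gbm m \<sigma> t \<omega> - 1)"
        by (rule gbm_left_point[OF t])
      then have m: "\<And>n. (\<lambda>\<omega>. \<Sum>i<Suc n. gbm m \<sigma> (grid t n i) \<omega> * ?x n i \<omega>) \<in> borel_measurable P"
        "(\<lambda>\<omega>. gbm m \<sigma> t \<omega> - 1) \<in> borel_measurable P" unfolding tendsto_in_prob_def by auto
      show "\<And>n. (\<lambda>\<omega>. - z * (\<Sum>i<Suc n. gbm m \<sigma> (grid t n i) \<omega> * ?x n i \<omega>)) \<in> borel_measurable P"
        "(\<lambda>\<omega>. - z * (gbm m \<sigma> t \<omega> - 1)) \<in> borel_measurable P"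
        by (intro borel_measurable_times borel_measurable_const m)+
      fix \<epsilon> :: real assume "0 < \<epsilon>"
      show "(\<lambda>n. prob {\<omega> \<in> space P. \<epsilon> < \<bar>- z * (\<Sum>i<Suc n. gbm m \<sigma> (grid t n i) \<omega> * ?x n i \<omega>) - - z * (gbm m \<sigma> t \<omega> - 1)\<bar>}) \<longlonglongrightarrow> 0"
      proof (cases "z = 0")
        case True
        then show ?thesis using \<open>0 < \<epsilon>\<close> by simp
      next
        case False
        have "\<epsilon> < \<bar>- z * a - - z * b\<bar> \<longleftrightarrow> \<epsilon> / \<bar>z\<bar> < \<bar>a - b\<bar>" for a b :: real
        proof -
          have "\<bar>- z * a - - z * b\<bar> = \<bar>z\<bar> * \<bar>a - b\<bar>" unfolding abs_mult[symmetric] by (simp add: algebra_simps abs_minus_commute)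
          then show ?thesis using False by (simp add: field_simps)
        qed
        then show ?thesis using tendsto_in_probD[OF g, of "\<epsilon> / \<bar>z\<bar>"] False \<open>0 < \<epsilon>\<close> by simp
      qed
    qed
    have "(\<Sum>i<Suc n. X (grid t n i) \<omega> * ?x n i \<omega>) + - z * (\<Sum>i<Suc n. gbm m \<sigma> (grid t n i) \<omega> * ?x n i \<omega>) =
      (\<Sum>i<Suc n. U (grid t n i) \<omega> * ?x n i \<omega>)" for n \<omega>
      unfolding sum_distrib_left sum.distrib[symmetric] U_def by (intro sum.cong) (auto simp: algebra_simps)
    moreover have "X t \<omega> - z + - z * (gbm m \<sigma> t \<omega> - 1) = U t \<omega>" for \<omega> by (simp add: U_def algebra_simps)
    ultimately show "tendsto_in_prob P (\<lambda>n \<omega>. \<Sum>i<Suc n. U (grid t n i) \<omega> * ?x n i \<omega>) (U t)"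
      using tendsto_in_prob_add[OF limX[OF t] 3] by presburger
  qed
  have "AE \<omega> in P. \<forall>q\<in>{q\<in>\<rat>. 0 < q}. U q \<omega> = 0"
    by (rule AE_ball_countable') (use ae in \<open>auto intro: countable_subset[OF _ countable_rat]\<close>)
  then show ?thesis using cont gbm_cont[of m \<sigma>]
  proof eventually_elim
    case (elim \<omega>)
    have cU: "continuous_on {0..} (\<lambda>t. U t \<omega>)" unfolding U_def using elim by (intro continuous_intros)
    show ?case
    proof (intro allI impI)
      fix t :: real assume t: "0 \<le> t"
      have "\<exists>q. \<forall>n. q n \<in> \<rat> \<and> t < q n \<and> q n < t + 1 / real (Suc n)"
        by (intro choice allI) (metis Rats_dense_in_real less_add_same_cancel1 of_nat_0_less_iff zero_less_Suc zero_less_divide_1_iff)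
      then obtain q where q: "\<And>n. q n \<in> \<rat>" "\<And>n. t < q n" "\<And>n. q n < t + 1 / real (Suc n)" by auto
      have "(\<lambda>n. 1 / real (Suc n)) \<longlonglongrightarrow> 0" by (rule LIMSEQ_Suc) (rule lim_const_over_n)
      then have "(\<lambda>n. t + 1 / real (Suc n)) \<longlonglongrightarrow> t + 0" by (intro tendsto_intros)
      then have lim: "(\<lambda>n. t + 1 / real (Suc n)) \<longlonglongrightarrow> t" by simp
      have "q \<longlonglongrightarrow> t"
        by (rule tendsto_sandwich[OF always_eventually always_eventually tendsto_const lim])
          (use q(2,3) in \<open>simp_all add: less_imp_le del: of_nat_Suc\<close>)
      moreover have "0 \<le> q n" for n using q(2)[of n] t by simp
      ultimately have "(\<lambda>n. U (q n) \<omega>) \<longlonglongrightarrow> U t \<omega>"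
        using cU t unfolding continuous_on_sequentially by (auto simp: o_def)
      moreover have "U (q n) \<omega> = 0" for n using elim(1) q(1,2)[of n] t by auto
      ultimately have "U t \<omega> = 0" using LIMSEQ_unique[OF _ tendsto_const] by fastforce
      then show "X t \<omega> = z * gbm m \<sigma> t \<omega>" by (simp add: U_def)
    qed
  qed
qed

end

subsection \<open>Optional stopping of exponential martingales\<close>

lemma grid_stop_exists:
  fixes \<tau> :: ennreal
  assumes t: "0 < t"
  shows "\<exists>k\<le>Suc n. (\<forall>i<Suc n. ennreal (grid t n i) < \<tau> \<longleftrightarrow> i < k)"
proof -
  define k where "k = (LEAST k. k = Suc n \<or> \<tau> \<le> ennreal (grid t n k))"
  have k: "k = Suc n \<or> \<tau> \<le> ennreal (grid t n k)"
    unfolding k_def by (rule LeastI[of _ "Suc n"]) simp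
  have k_le: "k \<le> Suc n" unfolding k_def by (rule Least_le) simp
  have "ennreal (grid t n i) < \<tau> \<longleftrightarrow> i < k" if "i < Suc n" for i
  proof
    assume "i < k"
    then have "\<not> (i = Suc n \<or> \<tau> \<le> ennreal (grid t n i))" unfolding k_def by (rule not_less_Least)
    then show "ennreal (grid t n i) < \<tau>" by (simp add: not_le)
  next
    assume a: "ennreal (grid t n i) < \<tau>"
    show "i < k"
    proof (rule ccontr)
      assume "\<not> i < k"
      then have "\<tau> \<le> ennreal (grid t n k)" "k \<le> i" using k that by auto
      moreover have "ennreal (grid t n k) \<le> ennreal (grid t n i)" using grid_mono[of t k i n] t \<open>k \<le> i\<close> by (simp add: ennreal_leI)
      ultimately show False using a by simp
    qed
  qed
  then show ?thesis using k_le by blast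
qed

text \<open>The first grid index whose time is at least \<open>\<tau>\<close>, capped at
  \<open>Suc n\<close>. It is pinned down by the events \<open>grid t n i < \<tau>\<close>, each of
  which is decided at time \<open>grid t n i\<close>.\<close>

definition stop_index :: "real \<Rightarrow> nat \<Rightarrow> ennreal \<Rightarrow> nat" where
  "stop_index t n \<tau> = (SOME k. k \<le> Suc n \<and> (\<forall>i<Suc n. ennreal (grid t n i) < \<tau> \<longleftrightarrow> i < k))"

lemma stop_index:
  assumes "0 < t"
  shows "stop_index t n \<tau> \<le> Suc n" "i < Suc n \<Longrightarrow> ennreal (grid t n i) < \<tau> \<longleftrightarrow> i < stop_index t n \<tau>"
  using someI_ex[OF grid_stop_exists[OF assms, of n \<tau>]] unfolding stop_index_def by auto

definition capped :: "real \<Rightarrow> ennreal \<Rightarrow> real" where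
  "capped t \<tau> = enn2real (min \<tau> (ennreal t))"

lemma capped_simps:
  assumes "0 \<le> t"
  shows "0 \<le> capped t \<tau>" "capped t \<tau> \<le> t" "\<tau> \<le> ennreal t \<Longrightarrow> capped t \<tau> = enn2real \<tau>"
    "ennreal t \<le> \<tau> \<Longrightarrow> capped t \<tau> = t" "ennreal (capped t \<tau>) = min \<tau> (ennreal t)"
proof -
  have lt: "min \<tau> (ennreal t) < \<infinity>" by (auto simp: min_less_iff_disj)
  then show e: "ennreal (capped t \<tau>) = min \<tau> (ennreal t)" unfolding capped_def by (intro ennreal_enn2real) auto
  show "0 \<le> capped t \<tau>" by (simp add: capped_def)
  then show "capped t \<tau> \<le> t" using e assms by (metis ennreal_le_iff min.cobounded2)
  show "\<tau> \<le> ennreal t \<Longrightarrow> capped t \<tau> = enn2real \<tau>" by (simp add: capped_def min_def)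
  show "ennreal t \<le> \<tau> \<Longrightarrow> capped t \<tau> = t" using assms by (simp add: capped_def min_absorb2)
qed

lemma stop_grid_near:
  assumes t: "0 < t"
  shows "\<bar>grid t n (stop_index t n \<tau>) - capped t \<tau>\<bar> \<le> t / real (Suc n)"
proof -
  let ?k = "stop_index t n \<tau>"
  have g0: "0 \<le> grid t n i" for i using grid_mono[of t 0 i n] t by (simp add: grid_simps)
  have up: "capped t \<tau> \<le> grid t n ?k"
  proof (cases "?k = Suc n")
    case True
    then show ?thesis using capped_simps(2)[of t \<tau>] t by (simp add: grid_simps)
  next
    case False
    then have "?k < Suc n" using stop_index(1)[OF t, of n \<tau>] by simp
    then have "\<tau> \<le> ennreal (grid t n ?k)" using stop_index(2)[OF t, of ?k n \<tau>] by simp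
    then have "ennreal (capped t \<tau>) \<le> ennreal (grid t n ?k)"
      using capped_simps(5)[of t \<tau>] t by (simp add: min.coboundedI1)
    then show ?thesis using g0 by simp
  qed
  have low: "grid t n ?k - t / real (Suc n) \<le> capped t \<tau>"
  proof (cases ?k)
    case 0
    then show ?thesis using capped_simps(1)[of t \<tau>] t by (simp add: grid_simps) (smt (verit) divide_nonneg_nonneg of_nat_0_le_iff)
  next
    case (Suc j)
    then have "j < Suc n" using stop_index(1)[OF t, of n \<tau>] by simp
    then have "ennreal (grid t n j) < \<tau>" using stop_index(2)[OF t, of j n \<tau>] Suc by simp
    moreover have "ennreal (grid t n j) \<le> ennreal t"
      using grid_range[of t j n] t \<open>j < Suc n\<close> by (intro ennreal_leI) auto
    ultimately have "ennreal (grid t n j) \<le> ennreal (capped t \<tau>)"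
      using capped_simps(5)[of t \<tau>] t by simp
    then have "grid t n j \<le> capped t \<tau>" using capped_simps(1)[of t \<tau>] t by simp
    then show ?thesis using grid_simps(3)[of t n j] Suc by simp
  qed
  show ?thesis using up low by simp
qed

lemma stop_grid_tendsto:
  assumes t: "0 < t" and f: "continuous_on {0..} f"
  shows "(\<lambda>n. f (grid t n (stop_index t n \<tau>))) \<longlonglongrightarrow> (f (capped t \<tau>) :: real)"
proof -
  have "(\<lambda>n. t / real (Suc n)) \<longlonglongrightarrow> 0" by (rule LIMSEQ_Suc) (rule lim_const_over_n)
  then have "(\<lambda>n. grid t n (stop_index t n \<tau>) - capped t \<tau>) \<longlonglongrightarrow> 0"
    by (rule Lim_null_comparison[rotated]) (use stop_grid_near[OF t] in \<open>simp del: of_nat_Suc\<close>)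
  then have "(\<lambda>n. grid t n (stop_index t n \<tau>)) \<longlonglongrightarrow> capped t \<tau>" by (simp add: LIM_zero_iff)
  moreover have "0 \<le> grid t n i" for n i using grid_mono[of t 0 i n] t by (simp add: grid_simps)
  ultimately show ?thesis
    using f capped_simps(1)[of t \<tau>] t unfolding continuous_on_sequentially by (auto simp: o_def)
qed

context wiener
begin

lemma stopping_time_events:
  assumes "stopping_time Ft \<tau>"
  shows "{\<omega> \<in> space P. s < \<tau> \<omega>} \<in> sets (Ft s)" "\<tau> \<in> borel_measurable P"
  using stopping_timeD2[OF assms, of s] measurable_stopping_time[OF assms, of P] sets_Ft
  by (auto simp: pred_def)

text \<open>A process at the discretised stopping time is a sum of increments, each switched on or
  off by an event known at the left end of its interval; martingale increments then drop out in the
  mean.\<close>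

lemma stop_grid_sum:
  fixes X :: "real \<Rightarrow> 'a \<Rightarrow> real"
  assumes t: "0 < t" and "\<omega> \<in> space P"
  shows "X (grid t n (stop_index t n (\<tau> \<omega>))) \<omega> = X 0 \<omega> +
    (\<Sum>i<Suc n. indicator {\<omega> \<in> space P. ennreal (grid t n i) < \<tau> \<omega>} \<omega> * (X (grid t n (Suc i)) \<omega> - X (grid t n i) \<omega>))"
proof -
  let ?k = "stop_index t n (\<tau> \<omega>)"
  have "(\<Sum>i<Suc n. indicator {\<omega> \<in> space P. ennreal (grid t n i) < \<tau> \<omega>} \<omega> * (X (grid t n (Suc i)) \<omega> - X (grid t n i) \<omega>)) =
     (\<Sum>i<?k. X (grid t n (Suc i)) \<omega> - X (grid t n i) \<omega>)"
    using stop_index(1)[OF t, of n "\<tau> \<omega>"] stop_index(2)[OF t, where n=n and \<tau>="\<tau> \<omega>"] assms(2)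
    by (intro sum.mono_neutral_cong_right) (auto simp: indicator_def)
  also have "\<dots> = X (grid t n ?k) \<omega> - X 0 \<omega>"
    using sum_lessThan_telescope[of "\<lambda>i. X (grid t n i) \<omega>" ?k] by (simp add: grid_simps)
  finally show ?thesis by simp
qed

lemma stop_grid_measurable:
  fixes X :: "real \<Rightarrow> 'a \<Rightarrow> real"
  assumes t: "0 < t" and \<tau>: "stopping_time Ft \<tau>" and X: "\<And>s. 0 \<le> s \<Longrightarrow> X s \<in> borel_measurable P"
  shows "(\<lambda>\<omega>. X (grid t n (stop_index t n (\<tau> \<omega>))) \<omega>) \<in> borel_measurable P"
proof -
  have [measurable]: "{\<omega> \<in> space P. s < \<tau> \<omega>} \<in> events" for s
    using stopping_time_events(1)[OF \<tau>] sets_Ft by blast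
  have [measurable]: "X (grid t n i) \<in> borel_measurable P" for i
    using grid_mono[of t 0 i n] t by (intro X) (simp add: grid_simps)
  have [measurable]: "X 0 \<in> borel_measurable P" by (rule X) simp
  have "(\<lambda>\<omega>. X 0 \<omega> + (\<Sum>i<Suc n. indicator {\<omega> \<in> space P. ennreal (grid t n i) < \<tau> \<omega>} \<omega> * (X (grid t n (Suc i)) \<omega> - X (grid t n i) \<omega>))) \<in> borel_measurable P"
    by measurable
  then show ?thesis using stop_grid_sum[OF t, of _ X n \<tau>] by (subst measurable_cong) auto
qed

text \<open>The value is an almost sure limit along discretised stopping times, and completeness of
  \<open>P\<close> takes care of the discontinuous paths; no progressive measurability
  enters.\<close>

lemma capped_measurable:
  fixes X :: "real \<Rightarrow> 'a \<Rightarrow> real"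
  assumes t: "0 < t" and \<tau>: "stopping_time Ft \<tau>" and X: "\<And>s. 0 \<le> s \<Longrightarrow> X s \<in> borel_measurable P"
    and c: "AE \<omega> in P. continuous_on {0..} (\<lambda>s. X s \<omega>)"
  shows "(\<lambda>\<omega>. X (capped t (\<tau> \<omega>)) \<omega>) \<in> borel_measurable P"
proof (rule borel_measurable_AE_eq)
  show "(\<lambda>\<omega>. lim (\<lambda>n. X (grid t n (stop_index t n (\<tau> \<omega>))) \<omega>)) \<in> borel_measurable P"
    by (intro borel_measurable_lim_metric stop_grid_measurable[OF t \<tau> X])
  show "AE \<omega> in P. lim (\<lambda>n. X (grid t n (stop_index t n (\<tau> \<omega>))) \<omega>) = X (capped t (\<tau> \<omega>)) \<omega>"
    using c by eventually_elim (intro limI stop_grid_tendsto[OF t])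
qed

text \<open>The Wald martingale with parameter \<open>\<theta>\<close>.\<close>

definition emart :: "real \<Rightarrow> real \<Rightarrow> 'a \<Rightarrow> real" where
  "emart \<theta> t \<omega> = exp (\<theta> * W t \<omega> - \<theta>\<^sup>2 * t / 2)"

lemma emart_pos[simp]: "0 < emart \<theta> t \<omega>" "0 \<le> emart \<theta> t \<omega>"
  by (simp_all add: emart_def)

lemma emart_adapted: "0 \<le> t \<Longrightarrow> emart \<theta> t \<in> borel_measurable (Ft (ennreal t))"
  unfolding emart_def using W_adapted[of t] by measurable

lemma emart_measurable[measurable]: "0 \<le> t \<Longrightarrow> emart \<theta> t \<in> borel_measurable P"
  using emart_adapted measurable_Ft by blast

lemma emart_cont: "AE \<omega> in P. continuous_on {0..} (\<lambda>t. emart \<theta> t \<omega>)"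
  using W_cont by eventually_elim (auto simp: emart_def intro!: continuous_intros)

lemma emart_integral: "0 \<le> t \<Longrightarrow> has_bochner_integral P (emart \<theta> t) 1"
proof -
  assume "0 \<le> t"
  have "has_bochner_integral P (\<lambda>\<omega>. exp (- (\<theta>\<^sup>2 * t / 2)) * exp (\<theta> * W t \<omega>)) (exp (- (\<theta>\<^sup>2 * t / 2)) * exp (\<theta>\<^sup>2 * t / 2))"
    by (intro has_bochner_integral_mult_right exp_W_integral \<open>0 \<le> t\<close>)
  moreover have "exp (- (\<theta>\<^sup>2 * t / 2)) * exp (\<theta>\<^sup>2 * t / 2) = 1" by (simp add: exp_minus_inverse mult.commute)
  moreover have "(\<lambda>\<omega>. exp (- (\<theta>\<^sup>2 * t / 2)) * exp (\<theta> * W t \<omega>)) = emart \<theta> t"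
    unfolding emart_def exp_add[symmetric] by (simp add: fun_eq_iff)
  ultimately show ?thesis by simp
qed

lemma emart_martingale:
  assumes st: "0 \<le> s" "s \<le> t" and A: "A \<in> sets (Ft (ennreal s))"
  shows "integrable P (\<lambda>\<omega>. indicator A \<omega> * (emart \<theta> t \<omega> - emart \<theta> s \<omega>))"
    "(LINT \<omega>|P. indicator A \<omega> * (emart \<theta> t \<omega> - emart \<theta> s \<omega>)) = 0"
proof -
  let ?h = "\<lambda>y. exp (\<theta> * y - \<theta>\<^sup>2 * (t - s) / 2)"
  have AP[measurable]: "A \<in> events" using A sets_Ft by blast
  have F: "(\<lambda>\<omega>. indicator A \<omega> * emart \<theta> s \<omega>) \<in> borel_measurable (Ft (ennreal s))"
    using A emart_adapted[OF st(1)] by measurable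
  have im: "integrable P (emart \<theta> s)" "integrable P (emart \<theta> t)"
    using emart_integral st by (auto simp: has_bochner_integral_iff)
  have iA: "integrable P (\<lambda>\<omega>. indicator A \<omega> * emart \<theta> s \<omega>)" "integrable P (\<lambda>\<omega>. indicator A \<omega> * emart \<theta> t \<omega>)"
    using integrable_real_mult_indicator[OF AP im(1)] integrable_real_mult_indicator[OF AP im(2)] by (simp_all add: mult.commute)
  have hh: "has_bochner_integral P (\<lambda>\<omega>. ?h (W t \<omega> - W s \<omega>)) 1"
  proof -
    have "has_bochner_integral P (\<lambda>\<omega>. exp (- (\<theta>\<^sup>2 * (t - s) / 2)) * exp (\<theta> * (W t \<omega> - W s \<omega>))) (exp (- (\<theta>\<^sup>2 * (t - s) / 2)) * exp (\<theta>\<^sup>2 * (t - s) / 2))"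
      by (intro has_bochner_integral_mult_right increment_moments st)
    moreover have "exp (- (\<theta>\<^sup>2 * (t - s) / 2)) * exp (\<theta>\<^sup>2 * (t - s) / 2) = 1" unfolding exp_add[symmetric] by simp
    moreover have "(\<lambda>\<omega>. exp (- (\<theta>\<^sup>2 * (t - s) / 2)) * exp (\<theta> * (W t \<omega> - W s \<omega>))) = (\<lambda>\<omega>. ?h (W t \<omega> - W s \<omega>))"
      unfolding exp_add[symmetric] by (simp add: fun_eq_iff)
    ultimately show ?thesis by simp
  qed
  have hm: "?h \<in> borel_measurable borel" by measurable
  have eq: "indicator A \<omega> * emart \<theta> s \<omega> * ?h (W t \<omega> - W s \<omega>) = indicator A \<omega> * emart \<theta> t \<omega>" for \<omega>
  proof -
    have "emart \<theta> s \<omega> * ?h (W t \<omega> - W s \<omega>) = emart \<theta> t \<omega>"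
      unfolding emart_def exp_add[symmetric] by (simp add: field_simps)
    then show ?thesis by simp
  qed
  have "(LINT \<omega>|P. indicator A \<omega> * emart \<theta> t \<omega>) = (LINT \<omega>|P. indicator A \<omega> * emart \<theta> s \<omega>) * (LINT \<omega>|P. ?h (W t \<omega> - W s \<omega>))"
    using integral_mult_increment(2)[OF st F hm iA(1)] hh unfolding eq by (simp add: has_bochner_integral_iff)
  then have "(LINT \<omega>|P. indicator A \<omega> * emart \<theta> t \<omega>) = (LINT \<omega>|P. indicator A \<omega> * emart \<theta> s \<omega>)"
    using hh by (simp add: has_bochner_integral_iff)
  then show "(LINT \<omega>|P. indicator A \<omega> * (emart \<theta> t \<omega> - emart \<theta> s \<omega>)) = 0"
    unfolding right_diff_distrib using iA by simp
  show "integrable P (\<lambda>\<omega>. indicator A \<omega> * (emart \<theta> t \<omega> - emart \<theta> s \<omega>))"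
    unfolding right_diff_distrib using iA by simp
qed

lemma emart_stop_grid:
  assumes t: "0 < t" and \<tau>: "stopping_time Ft \<tau>"
  shows "has_bochner_integral P (\<lambda>\<omega>. emart \<theta> (grid t n (stop_index t n (\<tau> \<omega>))) \<omega>) 1"
proof -
  have gr: "0 \<le> grid t n i" "grid t n i \<le> grid t n (Suc i)" for i
    using grid_mono[of t 0 i n] grid_mono[of t i "Suc i" n] t by (auto simp: grid_simps)
  have "has_bochner_integral P (\<lambda>\<omega>. emart \<theta> 0 \<omega> + (\<Sum>i<Suc n. indicator {\<omega> \<in> space P. ennreal (grid t n i) < \<tau> \<omega>} \<omega> *
      (emart \<theta> (grid t n (Suc i)) \<omega> - emart \<theta> (grid t n i) \<omega>))) (1 + (\<Sum>i<Suc n. 0))"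
    using emart_martingale[OF gr stopping_time_events(1)[OF \<tau>]]
    by (intro has_bochner_integral_add has_bochner_integral_sum emart_integral) (auto simp: has_bochner_integral_iff)
  then show ?thesis
    using stop_grid_sum[OF t, of _ "emart \<theta>" n \<tau>] by (subst has_bochner_integral_cong[OF refl _ refl]) auto
qed

text \<open>At discretised times the mean is exactly 1, and Fatou's lemma gives one inequality in
  the limit. For the other no mass may escape: the square of the martingale is at most
  \<open>exp (\<theta>\<^sup>2 * t)\<close> times the Wald martingale with parameter
  \<open>2 * \<theta>\<close>, so second moments are uniformly bounded and truncation at level
  \<open>K\<close> loses at most \<open>exp (\<theta>\<^sup>2 * t) / K\<close>.\<close>

lemma emart_capped:
  assumes t: "0 < t" and \<tau>: "stopping_time Ft \<tau>"
  shows "has_bochner_integral P (\<lambda>\<omega>. emart \<theta> (capped t (\<tau> \<omega>)) \<omega>) 1"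
proof -
  define X where "X n \<omega> = emart \<theta> (grid t n (stop_index t n (\<tau> \<omega>))) \<omega>" for n \<omega>
  define Y where "Y \<omega> = emart \<theta> (capped t (\<tau> \<omega>)) \<omega>" for \<omega>
  have Xm[measurable]: "X n \<in> borel_measurable P" for n
    unfolding X_def by (rule stop_grid_measurable[OF t \<tau>]) simp
  have Ym[measurable]: "Y \<in> borel_measurable P"
    unfolding Y_def by (rule capped_measurable[OF t \<tau> _ emart_cont]) simp
  have X1: "has_bochner_integral P (X n) 1" for n unfolding X_def by (rule emart_stop_grid[OF t \<tau>])
  have lim: "AE \<omega> in P. (\<lambda>n. X n \<omega>) \<longlonglongrightarrow> Y \<omega>"
    using emart_cont[of \<theta>] unfolding X_def Y_def by eventually_elim (rule stop_grid_tendsto[OF t])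
  have pos: "0 \<le> X n \<omega>" "0 \<le> Y \<omega>" for n \<omega> by (simp_all add: X_def Y_def)
  have X2: "integrable P (\<lambda>\<omega>. (X n \<omega>)\<^sup>2) \<and> (LINT \<omega>|P. (X n \<omega>)\<^sup>2) \<le> exp (\<theta>\<^sup>2 * t)" for n
  proof -
    let ?Z = "\<lambda>\<omega>. emart (2 * \<theta>) (grid t n (stop_index t n (\<tau> \<omega>))) \<omega>"
    have Z: "has_bochner_integral P ?Z 1" by (rule emart_stop_grid[OF t \<tau>])
    have le: "(X n \<omega>)\<^sup>2 \<le> exp (\<theta>\<^sup>2 * t) * ?Z \<omega>" for \<omega>
    proof -
      let ?s = "grid t n (stop_index t n (\<tau> \<omega>))"
      have "?s \<le> t" using grid_range[OF _ stop_index(1)[OF t]] t by auto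
      then have "\<theta>\<^sup>2 * ?s \<le> \<theta>\<^sup>2 * t" by (intro mult_left_mono) auto
      moreover have "(X n \<omega>)\<^sup>2 = exp (\<theta>\<^sup>2 * ?s) * ?Z \<omega>"
        unfolding X_def emart_def power2_eq_square exp_add[symmetric] by (simp add: field_simps)
      ultimately show ?thesis by (simp add: mult_right_mono)
    qed
    have iZ: "integrable P (\<lambda>\<omega>. exp (\<theta>\<^sup>2 * t) * ?Z \<omega>)" using Z by (auto simp: has_bochner_integral_iff)
    have i: "integrable P (\<lambda>\<omega>. (X n \<omega>)\<^sup>2)"
      by (rule Bochner_Integration.integrable_bound[OF iZ]) (use le in \<open>auto intro!: AE_I2\<close>)
    have "(LINT \<omega>|P. (X n \<omega>)\<^sup>2) \<le> (LINT \<omega>|P. exp (\<theta>\<^sup>2 * t) * ?Z \<omega>)"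
      by (intro integral_mono i iZ le)
    also have "\<dots> = exp (\<theta>\<^sup>2 * t)" using Z by (simp add: has_bochner_integral_iff)
    finally show ?thesis using i by simp
  qed
  have fatou: "(\<integral>\<^sup>+\<omega>. ennreal (Y \<omega>) \<partial>P) \<le> 1"
  proof -
    have "(\<integral>\<^sup>+\<omega>. ennreal (Y \<omega>) \<partial>P) = (\<integral>\<^sup>+\<omega>. liminf (\<lambda>n. ennreal (X n \<omega>)) \<partial>P)"
    proof (rule nn_integral_cong_AE)
      show "AE \<omega> in P. ennreal (Y \<omega>) = liminf (\<lambda>n. ennreal (X n \<omega>))"
        using lim by eventually_elim (rule lim_imp_Liminf[OF trivial_limit_sequentially tendsto_ennrealI, symmetric])
    qed
    also have "\<dots> \<le> liminf (\<lambda>n. \<integral>\<^sup>+\<omega>. ennreal (X n \<omega>) \<partial>P)" by (rule nn_integral_liminf) measurable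
    also have "(\<lambda>n. \<integral>\<^sup>+\<omega>. ennreal (X n \<omega>) \<partial>P) = (\<lambda>n. 1)"
      using X1 pos by (auto simp: fun_eq_iff has_bochner_integral_iff nn_integral_eq_integral)
    finally show ?thesis by (simp add: Liminf_const)
  qed
  then have iY: "integrable P Y"
    using pos by (intro integrableI_nonneg) (auto simp: top.extremum_strict order_le_less_trans[of _ 1])
  have "(LINT \<omega>|P. Y \<omega>) \<le> 1"
    using fatou pos iY nn_integral_eq_integral[OF iY] by (auto simp: ennreal_le_1)
  moreover have "1 \<le> (LINT \<omega>|P. Y \<omega>)"
  proof -
    have K: "1 - exp (\<theta>\<^sup>2 * t) / K \<le> (LINT \<omega>|P. Y \<omega>)" if K: "0 < K" for K :: real
    proof -
      have imin: "integrable P (\<lambda>\<omega>. min (f \<omega>) K)" if [measurable]: "f \<in> borel_measurable P" and "\<And>\<omega>. 0 \<le> f \<omega>" for f :: "'a \<Rightarrow> real"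
        by (rule integrable_const_bound[where B=K]) (use that K in auto)
      have "(\<lambda>n. LINT \<omega>|P. min (X n \<omega>) K) \<longlonglongrightarrow> (LINT \<omega>|P. min (Y \<omega>) K)"
      proof (rule integral_dominated_convergence[where w="\<lambda>_. K"])
        show "AE \<omega> in P. (\<lambda>n. min (X n \<omega>) K) \<longlonglongrightarrow> min (Y \<omega>) K"
          using lim by eventually_elim (intro tendsto_intros)
        show "AE \<omega> in P. norm (min (X n \<omega>) K) \<le> K" for n using pos K by auto
      qed auto
      moreover have "1 - exp (\<theta>\<^sup>2 * t) / K \<le> (LINT \<omega>|P. min (X n \<omega>) K)" for n
      proof -
        have le: "X n \<omega> \<le> min (X n \<omega>) K + (X n \<omega>)\<^sup>2 / K" for \<omega>
        proof (cases "X n \<omega> \<le> K")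
          case False
          then have "X n \<omega> * K \<le> X n \<omega> * X n \<omega>" using pos(1)[of n \<omega>] by (intro mult_left_mono) auto
          then have "X n \<omega> \<le> (X n \<omega>)\<^sup>2 / K" using K by (simp add: field_simps power2_eq_square)
          then show ?thesis using False K by simp
        qed (use K in simp)
        have "1 = (LINT \<omega>|P. X n \<omega>)" using X1 by (simp add: has_bochner_integral_iff)
        also have "\<dots> \<le> (LINT \<omega>|P. min (X n \<omega>) K + (X n \<omega>)\<^sup>2 / K)"
          using X1[of n] X2[of n] imin[of "X n"] pos
          by (intro integral_mono le Bochner_Integration.integrable_add) (auto simp: has_bochner_integral_iff)
        also have "\<dots> = (LINT \<omega>|P. min (X n \<omega>) K) + (LINT \<omega>|P. (X n \<omega>)\<^sup>2) / K"
          using X2[of n] imin[of "X n"] pos by (subst Bochner_Integration.integral_add) auto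
        also have "(LINT \<omega>|P. (X n \<omega>)\<^sup>2) / K \<le> exp (\<theta>\<^sup>2 * t) / K"
          using X2[of n] K by (intro divide_right_mono) auto
        finally show ?thesis by simp
      qed
      ultimately have "1 - exp (\<theta>\<^sup>2 * t) / K \<le> (LINT \<omega>|P. min (Y \<omega>) K)"
        by (intro LIMSEQ_le_const) auto
      also have "\<dots> \<le> (LINT \<omega>|P. Y \<omega>)"
        by (intro integral_mono imin iY) (use pos in auto)
      finally show ?thesis .
    qed
    have "(\<lambda>n. exp (\<theta>\<^sup>2 * t) / real (Suc n)) \<longlonglongrightarrow> 0" by (rule LIMSEQ_Suc) (rule lim_const_over_n)
    then have "(\<lambda>n. 1 - exp (\<theta>\<^sup>2 * t) / real (Suc n)) \<longlonglongrightarrow> 1 - 0" by (intro tendsto_intros)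
    then show ?thesis using K[of "real (Suc _)"] by (intro LIMSEQ_le_const2[where X="\<lambda>n. 1 - exp (\<theta>\<^sup>2 * t) / real (Suc n)"]) auto
  qed
  ultimately show ?thesis using iY unfolding Y_def has_bochner_integral_iff by auto
qed

text \<open>Fatou's lemma along the truncations at growing times. Mass may be lost on the event that
  \<open>\<tau>\<close> is infinite, where the value is set to 0, so only an inequality is
  left.\<close>

lemma emart_stopped:
  assumes \<tau>: "stopping_time Ft \<tau>"
  shows "integrable P (\<lambda>\<omega>. if \<tau> \<omega> = \<infinity> then 0 else emart \<theta> (enn2real (\<tau> \<omega>)) \<omega>)"
    "(LINT \<omega>|P. (if \<tau> \<omega> = \<infinity> then 0 else emart \<theta> (enn2real (\<tau> \<omega>)) \<omega>)) \<le> 1"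
proof -
  define Y where "Y \<omega> = (if \<tau> \<omega> = \<infinity> then 0 else emart \<theta> (enn2real (\<tau> \<omega>)) \<omega>)" for \<omega>
  define X where "X n \<omega> = emart \<theta> (capped (real (Suc n)) (\<tau> \<omega>)) \<omega> * indicator {\<omega> \<in> space P. \<tau> \<omega> \<le> ennreal (real (Suc n))} \<omega>" for n \<omega>
  have [measurable]: "\<tau> \<in> borel_measurable P" using stopping_time_events(2)[OF \<tau>] .
  have [measurable]: "(\<lambda>\<omega>. emart \<theta> (capped (real (Suc n)) (\<tau> \<omega>)) \<omega>) \<in> borel_measurable P" for n
    using emart_capped[OF _ \<tau>, of "real (Suc n)"] by (auto simp: has_bochner_integral_iff simp del: of_nat_Suc)
  have Xm[measurable]: "X n \<in> borel_measurable P" for n unfolding X_def by measurable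
  have ev: "\<forall>\<^sub>F n in sequentially. X n \<omega> = Y \<omega>" if "\<omega> \<in> space P" for \<omega>
  proof (cases "\<tau> \<omega> = \<infinity>")
    case True
    then show ?thesis by (simp add: X_def Y_def top_unique del: of_nat_Suc)
  next
    case False
    then obtain r where r: "\<tau> \<omega> = ennreal r" "0 \<le> r" by (cases "\<tau> \<omega>") auto
    obtain N where N: "r \<le> real N" using real_arch_simple by blast
    show ?thesis
    proof (rule eventually_sequentiallyI[of N])
      fix n assume "N \<le> n"
      then have "r \<le> real (Suc n)" using N by simp
      then have "\<tau> \<omega> \<le> ennreal (real (Suc n))" unfolding r by (rule ennreal_leI)
      then show "X n \<omega> = Y \<omega>" using that False capped_simps(3)[of "real (Suc n)" "\<tau> \<omega>"]
        by (simp add: X_def Y_def del: of_nat_Suc)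
    qed
  qed
  have Ym: "Y \<in> borel_measurable P"
  proof (rule borel_measurable_LIMSEQ_real)
    show "(\<lambda>n. X n \<omega>) \<longlonglongrightarrow> Y \<omega>" if "\<omega> \<in> space P" for \<omega> using ev[OF that] by (rule tendsto_eventually)
  qed (rule Xm)
  have pos: "0 \<le> X n \<omega>" "0 \<le> Y \<omega>" for n \<omega> by (simp_all add: X_def Y_def)
  have "(\<integral>\<^sup>+\<omega>. ennreal (X n \<omega>) \<partial>P) \<le> 1" for n
  proof -
    have "(\<integral>\<^sup>+\<omega>. ennreal (X n \<omega>) \<partial>P) \<le> (\<integral>\<^sup>+\<omega>. ennreal (emart \<theta> (capped (real (Suc n)) (\<tau> \<omega>)) \<omega>) \<partial>P)"
      by (intro nn_integral_mono ennreal_leI) (auto simp: X_def indicator_def)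
    also have "\<dots> = 1"
      using emart_capped[OF _ \<tau>, of "real (Suc n)" \<theta>] by (simp add: has_bochner_integral_iff nn_integral_eq_integral del: of_nat_Suc)
    finally show ?thesis .
  qed
  note X1 = this
  have "(\<integral>\<^sup>+\<omega>. ennreal (Y \<omega>) \<partial>P) = (\<integral>\<^sup>+\<omega>. liminf (\<lambda>n. ennreal (X n \<omega>)) \<partial>P)"
  proof (rule nn_integral_cong)
    fix \<omega> assume "\<omega> \<in> space P"
    then have "(\<lambda>n. ennreal (X n \<omega>)) \<longlonglongrightarrow> ennreal (Y \<omega>)" by (intro tendsto_ennrealI tendsto_eventually ev)
    then show "ennreal (Y \<omega>) = liminf (\<lambda>n. ennreal (X n \<omega>))" by (rule lim_imp_Liminf[OF trivial_limit_sequentially, symmetric])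
  qed
  also have "\<dots> \<le> liminf (\<lambda>n. \<integral>\<^sup>+\<omega>. ennreal (X n \<omega>) \<partial>P)" by (rule nn_integral_liminf) measurable
  also have "\<dots> \<le> liminf (\<lambda>n::nat. 1)" by (intro Liminf_mono always_eventually allI X1)
  finally have le: "(\<integral>\<^sup>+\<omega>. ennreal (Y \<omega>) \<partial>P) \<le> 1" by (simp add: Liminf_const)
  have iY: "integrable P Y"
    using pos le Ym by (intro integrableI_nonneg) (auto simp: order_le_less_trans[of _ 1])
  have "(LINT \<omega>|P. Y \<omega>) \<le> 1"
    using le pos iY nn_integral_eq_integral[OF iY] by (auto simp: ennreal_le_1)
  then show "integrable P (\<lambda>\<omega>. if \<tau> \<omega> = \<infinity> then 0 else emart \<theta> (enn2real (\<tau> \<omega>)) \<omega>)"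
    "(LINT \<omega>|P. (if \<tau> \<omega> = \<infinity> then 0 else emart \<theta> (enn2real (\<tau> \<omega>)) \<omega>)) \<le> 1"
    using iY unfolding Y_def by auto
qed

end

subsection \<open>Stopped discounted payoffs\<close>

text \<open>\<open>\<alpha> > 1\<close> and \<open>- \<beta> < 0\<close> are the roots of the characteristic equation of the generator
  \<open>L - \<delta>\<close>, so that \<open>x powr \<alpha>\<close> and \<open>x powr (- \<beta>)\<close> span the solutions of \<open>L f = \<delta> f\<close>.\<close>

lemma ex_characteristic_roots:
  fixes m \<sigma> \<delta> :: real
  assumes "0 < \<sigma>" "0 < \<delta>" "m < \<delta>"
  shows "\<exists>\<alpha> \<beta>. 1 < \<alpha> \<and> \<alpha> * (m - \<sigma>\<^sup>2 / 2) + \<alpha>\<^sup>2 * \<sigma>\<^sup>2 / 2 = \<delta> \<and>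
    0 < \<beta> \<and> - \<beta> * (m - \<sigma>\<^sup>2 / 2) + \<beta>\<^sup>2 * \<sigma>\<^sup>2 / 2 = \<delta>"
proof -
  define A where "A = \<sigma>\<^sup>2 / 2"
  define B where "B = m - A"
  define q where "q x = x * B + x\<^sup>2 * A - \<delta>" for x
  have A: "0 < A" using assms by (simp add: A_def)
  \<comment> \<open>Large enough for the quadratic to be nonnegative at \<open>R\<close> and
    \<open>- R\<close>. It is negative at 0 and at 1, with values \<open>- \<delta>\<close> and
    \<open>m - \<delta>\<close>, so the roots lie below 0 and above 1.\<close>
  define R where "R = 1 + (\<bar>B\<bar> + \<delta>) / A"
  have R: "1 \<le> R" "A * R = A + \<bar>B\<bar> + \<delta>" using A assms by (auto simp: R_def field_simps)
  have AR: "\<delta> \<le> A * R - \<bar>B\<bar>" using R(2) A by simp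
  have "\<delta> * 1 \<le> \<delta> * R" using R(1) assms by (intro mult_left_mono) auto
  also have "\<dots> \<le> (A * R - \<bar>B\<bar>) * R" using AR R(1) by (intro mult_right_mono) auto
  finally have big: "\<delta> \<le> R\<^sup>2 * A - \<bar>B\<bar> * R" by (simp add: power2_eq_square algebra_simps)
  have BR: "\<bar>B * R\<bar> = \<bar>B\<bar> * R" using R(1) by (simp add: abs_mult)
  have qR: "0 \<le> q R" "0 \<le> q (- R)" using big BR unfolding q_def by (auto simp: abs_le_iff abs_if mult.commute split: if_splits)
  have cont: "continuous_on S q" for S unfolding q_def by (intro continuous_intros)
  have "\<exists>x\<ge>1. x \<le> R \<and> q x = 0"
    by (rule IVT') (use cont qR R assms in \<open>auto simp: q_def B_def\<close>)
  then obtain a where a: "1 \<le> a" "q a = 0" by auto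
  have "\<exists>x\<ge>-R. x \<le> 0 \<and> q x = 0"
    by (rule IVT2') (use cont qR R assms in \<open>auto simp: q_def\<close>)
  then obtain b where b: "b \<le> 0" "q b = 0" by auto
  have "q 1 \<noteq> 0" "q 0 \<noteq> 0" using assms by (auto simp: q_def B_def)
  then have "1 < a" "b < 0" using a b by (auto simp: less_le)
  then show ?thesis using a b
    by (intro exI[of _ a] exI[of _ "- b"]) (auto simp: q_def B_def A_def)
qed

lemma rational_approx_unit:
  fixes s :: real
  assumes "0 \<le> s" "s \<le> 1"
  shows "\<exists>q::nat \<Rightarrow> rat. (\<forall>n. 0 \<le> real_of_rat (q n) \<and> real_of_rat (q n) \<le> 1) \<and> (\<lambda>n. real_of_rat (q n)) \<longlonglongrightarrow> s"
proof (cases "s = 0")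
  case True
  then show ?thesis by (intro exI[of _ "\<lambda>_. 0"]) auto
next
  case False
  have "\<exists>q. \<forall>n. s - s / real (Suc n) < real_of_rat (q n) \<and> real_of_rat (q n) < s"
  proof (rule choice, rule allI)
    fix n
    have "s - s / real (Suc n) < s" using assms False by simp
    then show "\<exists>q. s - s / real (Suc n) < real_of_rat q \<and> real_of_rat q < s"
      using of_rat_dense by blast
  qed
  then obtain q where q: "\<And>n. s - s / real (Suc n) < real_of_rat (q n)" "\<And>n. real_of_rat (q n) < s" by auto
  have "s / real (Suc n) \<le> s" for n
  proof -
    have "s * 1 \<le> s * real (Suc n)" using assms by (intro mult_left_mono) auto
    then show ?thesis by (simp add: field_simps)
  qed
  then have q0: "0 \<le> real_of_rat (q n)" for n using q(1)[of n] by (smt (verit))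
  have "(\<lambda>n. s / real (Suc n)) \<longlonglongrightarrow> 0" by (rule LIMSEQ_Suc) (rule lim_const_over_n)
  then have "(\<lambda>n. s - s / real (Suc n)) \<longlonglongrightarrow> s - 0" by (intro tendsto_intros)
  then have lim: "(\<lambda>n. s - s / real (Suc n)) \<longlonglongrightarrow> s" by simp
  have "(\<lambda>n. real_of_rat (q n)) \<longlonglongrightarrow> s"
    by (rule tendsto_sandwich[OF always_eventually always_eventually lim tendsto_const])
      (use q in \<open>simp_all add: less_imp_le del: of_nat_Suc\<close>)
  moreover have "real_of_rat (q n) \<le> 1" for n using q(2)[of n] assms(2) by linarith
  ultimately show ?thesis using q0 by blast
qed

locale gbm_stopping = wiener P Ft W for P :: "'a measure" and Ft W +
  fixes m \<sigma> \<delta> \<alpha> \<beta> :: real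
  assumes \<sigma>: "0 < \<sigma>" and \<delta>: "0 < \<delta>" and m_less: "m < \<delta>"
    and \<alpha>: "1 < \<alpha>" "\<alpha> * (m - \<sigma>\<^sup>2 / 2) + \<alpha>\<^sup>2 * \<sigma>\<^sup>2 / 2 = \<delta>"
    and \<beta>: "0 < \<beta>" "- \<beta> * (m - \<sigma>\<^sup>2 / 2) + \<beta>\<^sup>2 * \<sigma>\<^sup>2 / 2 = \<delta>"
begin

definition is_root :: "real \<Rightarrow> bool" where
  "is_root \<gamma> \<longleftrightarrow> \<gamma> * (m - \<sigma>\<^sup>2 / 2) + \<gamma>\<^sup>2 * \<sigma>\<^sup>2 / 2 = \<delta>"

lemma roots: "is_root \<alpha>" "is_root (- \<beta>)"
  using \<alpha> \<beta> by (auto simp: is_root_def)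

text \<open>The weight for growth bounds and for the contraction. It dominates both 1 and
  \<open>x\<close>, and being a sum of root powers it does not grow in discounted mean under
  stopping.\<close>

definition H :: "real \<Rightarrow> real" where
  "H x = x powr \<alpha> + x powr (- \<beta>)"

text \<open>The explicit solution, positive for every outcome and every time; \<open>Z\<close>
  agrees with it only off a null set.\<close>

definition X :: "real \<Rightarrow> real \<Rightarrow> 'a \<Rightarrow> real" where
  "X z t \<omega> = z * gbm m \<sigma> t \<omega>"

lemma X_pos: "0 < z \<Longrightarrow> 0 < X z t \<omega>"
  by (simp add: X_def)

lemma H_ge: "0 < x \<Longrightarrow> 1 \<le> H x" "0 < x \<Longrightarrow> x \<le> H x"
proof -
  assume x: "0 < x"
  consider "1 \<le> x" | "x \<le> 1" by linarith
  then show "1 \<le> H x"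
  proof cases
    case 1
    then have "1 \<le> x powr \<alpha>" using \<alpha>(1) by (intro ge_one_powr_ge_zero) auto
    then show ?thesis by (simp add: H_def add_increasing2)
  next
    case 2
    then have "1 powr (-\<beta>) \<le> x powr (-\<beta>)" using \<beta>(1) x by (intro powr_mono2') auto
    then show ?thesis by (simp add: H_def add_increasing)
  qed
  show "x \<le> H x"
  proof (cases "1 \<le> x")
    case True
    then have "x powr 1 \<le> x powr \<alpha>" using \<alpha>(1) by (intro powr_mono) auto
    then show ?thesis using x by (simp add: H_def add_increasing2)
  next
    case False
    then show ?thesis using \<open>1 \<le> H x\<close> by simp
  qed
qed

lemma H_pos: "0 < x \<Longrightarrow> 0 < H x"
  using H_ge(1)[of x] by linarith

text \<open>The characteristic equation says precisely that discounting cancels the drift of the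
  power, leaving the Wald martingale with parameter \<open>\<gamma> * \<sigma>\<close>.\<close>

lemma discounted_powr:
  assumes "0 < z" "is_root \<gamma>"
  shows "discounted \<delta> (\<lambda>y. y powr \<gamma>) (X z) \<tau> \<omega> = z powr \<gamma> * (if \<tau> \<omega> = \<infinity> then 0 else emart (\<gamma> * \<sigma>) (enn2real (\<tau> \<omega>)) \<omega>)"
proof -
  have "exp (- \<delta> * t) * (X z t \<omega>) powr \<gamma> = z powr \<gamma> * emart (\<gamma> * \<sigma>) t \<omega>" for t
  proof -
    have "(X z t \<omega>) powr \<gamma> = z powr \<gamma> * exp (\<gamma> * ((m - \<sigma>\<^sup>2 / 2) * t + \<sigma> * W t \<omega>))"
      using assms(1) unfolding X_def gbm_def by (simp add: powr_mult exp_powr_real mult.commute)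
    moreover have "exp (- \<delta> * t) * exp (\<gamma> * ((m - \<sigma>\<^sup>2 / 2) * t + \<sigma> * W t \<omega>)) = emart (\<gamma> * \<sigma>) t \<omega>"
    proof -
      have "\<delta> * t = (\<gamma> * (m - \<sigma>\<^sup>2 / 2) + \<gamma>\<^sup>2 * \<sigma>\<^sup>2 / 2) * t" using assms(2) unfolding is_root_def by simp
      then have "- \<delta> * t + \<gamma> * ((m - \<sigma>\<^sup>2 / 2) * t + \<sigma> * W t \<omega>) = \<gamma> * \<sigma> * W t \<omega> - (\<gamma> * \<sigma>)\<^sup>2 * t / 2"
        by (simp add: field_simps power2_eq_square)
      then show ?thesis unfolding emart_def exp_add[symmetric] by (rule arg_cong)
    qed
    ultimately show ?thesis by simp
  qed
  then show ?thesis by (simp add: discounted_def)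
qed

lemma discounted_linear:
  "discounted \<delta> (\<lambda>y. a * f y + b * g y) Z \<tau> \<omega> = a * discounted \<delta> f Z \<tau> \<omega> + b * discounted \<delta> g Z \<tau> \<omega>"
  by (simp add: discounted_def algebra_simps)

lemma discounted_mono:
  "0 < z \<Longrightarrow> (\<And>y. 0 < y \<Longrightarrow> f y \<le> g y) \<Longrightarrow> discounted \<delta> f (X z) \<tau> \<omega> \<le> discounted \<delta> g (X z) \<tau> \<omega>"
  by (auto simp: discounted_def X_pos)

lemma discounted_powr_integral:
  assumes z: "0 < z" and \<tau>: "stopping_time Ft \<tau>" and "is_root \<gamma>"
  shows "integrable P (discounted \<delta> (\<lambda>y. y powr \<gamma>) (X z) \<tau>)"
    "(LINT \<omega>|P. discounted \<delta> (\<lambda>y. y powr \<gamma>) (X z) \<tau> \<omega>) \<le> z powr \<gamma>"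
proof -
  have eq: "discounted \<delta> (\<lambda>y. y powr \<gamma>) (X z) \<tau> = (\<lambda>\<omega>. z powr \<gamma> * (if \<tau> \<omega> = \<infinity> then 0 else emart (\<gamma> * \<sigma>) (enn2real (\<tau> \<omega>)) \<omega>))"
    using discounted_powr[OF z assms(3)] by (simp add: fun_eq_iff)
  note em = emart_stopped[OF \<tau>, of "\<gamma> * \<sigma>"]
  show "integrable P (discounted \<delta> (\<lambda>y. y powr \<gamma>) (X z) \<tau>)" unfolding eq by (intro integrable_mult_right em)
  have "(LINT \<omega>|P. z powr \<gamma> * (if \<tau> \<omega> = \<infinity> then 0 else emart (\<gamma> * \<sigma>) (enn2real (\<tau> \<omega>)) \<omega>)) \<le> z powr \<gamma> * 1"
    unfolding integral_mult_right_zero by (intro mult_left_mono em) simp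
  then show "(LINT \<omega>|P. discounted \<delta> (\<lambda>y. y powr \<gamma>) (X z) \<tau> \<omega>) \<le> z powr \<gamma>" unfolding eq by simp
qed

lemma discounted_hfun_integral:
  assumes z: "0 < z" and \<tau>: "stopping_time Ft \<tau>" and AB: "0 \<le> A" "0 \<le> B"
  shows "integrable P (discounted \<delta> (\<lambda>y. A * y powr \<alpha> + B * y powr (- \<beta>)) (X z) \<tau>)"
    "(LINT \<omega>|P. discounted \<delta> (\<lambda>y. A * y powr \<alpha> + B * y powr (- \<beta>)) (X z) \<tau> \<omega>) \<le> A * z powr \<alpha> + B * z powr (- \<beta>)"
proof -
  note a = discounted_powr_integral[OF z \<tau> roots(1)] and b = discounted_powr_integral[OF z \<tau> roots(2)]
  have eq: "discounted \<delta> (\<lambda>y. A * y powr \<alpha> + B * y powr (- \<beta>)) (X z) \<tau> =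
     (\<lambda>\<omega>. A * discounted \<delta> (\<lambda>y. y powr \<alpha>) (X z) \<tau> \<omega> + B * discounted \<delta> (\<lambda>y. y powr (- \<beta>)) (X z) \<tau> \<omega>)"
    by (simp add: fun_eq_iff discounted_linear)
  show "integrable P (discounted \<delta> (\<lambda>y. A * y powr \<alpha> + B * y powr (- \<beta>)) (X z) \<tau>)"
    unfolding eq using a b by auto
  have "(LINT \<omega>|P. A * discounted \<delta> (\<lambda>y. y powr \<alpha>) (X z) \<tau> \<omega> + B * discounted \<delta> (\<lambda>y. y powr (- \<beta>)) (X z) \<tau> \<omega>) =
      A * (LINT \<omega>|P. discounted \<delta> (\<lambda>y. y powr \<alpha>) (X z) \<tau> \<omega>) + B * (LINT \<omega>|P. discounted \<delta> (\<lambda>y. y powr (- \<beta>)) (X z) \<tau> \<omega>)"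
    using a b by simp
  also have "\<dots> \<le> A * z powr \<alpha> + B * z powr (- \<beta>)"
    using a b AB by (intro add_mono mult_left_mono)
  finally show "(LINT \<omega>|P. discounted \<delta> (\<lambda>y. A * y powr \<alpha> + B * y powr (- \<beta>)) (X z) \<tau> \<omega>) \<le> A * z powr \<alpha> + B * z powr (- \<beta>)"
    unfolding eq .
qed

lemma discounted_measurable:
  assumes z: "0 < z" and \<tau>: "stopping_time Ft \<tau>" and f: "(\<lambda>y. indicator {0<..} y * f y) \<in> borel_measurable borel"
  shows "discounted \<delta> f (X z) \<tau> \<in> borel_measurable P"
proof -
  have [measurable]: "\<tau> \<in> borel_measurable P" using stopping_time_events(2)[OF \<tau>] .
  \<comment> \<open>The value 1 for infinite \<open>\<tau>\<close> is arbitrary but positive, which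
    keeps \<open>G\<close> inside the half-line where \<open>f\<close> is controlled.\<close>
  define G where "G \<omega> = (if \<tau> \<omega> = \<infinity> then 1 else X z (enn2real (\<tau> \<omega>)) \<omega>)" for \<omega>
  define Gn where "Gn n \<omega> = (if \<tau> \<omega> \<le> ennreal (real (Suc n)) then X z (capped (real (Suc n)) (\<tau> \<omega>)) \<omega> else 1)" for n \<omega>
  have [measurable]: "(\<lambda>\<omega>. X z (capped (real (Suc n)) (\<tau> \<omega>)) \<omega>) \<in> borel_measurable P" for n
  proof (rule capped_measurable[OF _ \<tau>])
    show "AE \<omega> in P. continuous_on {0..} (\<lambda>s. X z s \<omega>)"
      using gbm_cont[of m \<sigma>] unfolding X_def by eventually_elim (intro continuous_intros)
  qed (simp_all add: X_def[abs_def])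
  have Gnm: "Gn n \<in> borel_measurable P" for n unfolding Gn_def by measurable
  have [measurable]: "G \<in> borel_measurable P"
  proof (rule borel_measurable_LIMSEQ_real)
    fix \<omega>
    show "(\<lambda>n. Gn n \<omega>) \<longlonglongrightarrow> G \<omega>"
    proof (cases "\<tau> \<omega> = \<infinity>")
      case True
      then show ?thesis by (simp add: Gn_def G_def top_unique del: of_nat_Suc)
    next
      case False
      then obtain r where r: "\<tau> \<omega> = ennreal r" "0 \<le> r" by (cases "\<tau> \<omega>") auto
      obtain N where N: "r \<le> real N" using real_arch_simple by blast
      have "\<forall>\<^sub>F n in sequentially. Gn n \<omega> = G \<omega>"
      proof (rule eventually_sequentiallyI[of N])
        fix n assume "N \<le> n"
        then have "r \<le> real (Suc n)" using N by simp
        then have "\<tau> \<omega> \<le> ennreal (real (Suc n))" unfolding r by (rule ennreal_leI)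
        then show "Gn n \<omega> = G \<omega>" using False capped_simps(3)[of "real (Suc n)" "\<tau> \<omega>"]
          by (simp add: Gn_def G_def del: of_nat_Suc)
      qed
      then show ?thesis by (rule tendsto_eventually)
    qed
  qed (rule Gnm)
  have "(\<lambda>\<omega>. indicator {0<..} (G \<omega>) * f (G \<omega>)) \<in> borel_measurable P"
    using measurable_compose[OF \<open>G \<in> borel_measurable P\<close> f] .
  moreover have "indicator {0<..} (G \<omega>) * f (G \<omega>) = f (G \<omega>)" for \<omega>
    using X_pos[OF z] by (simp add: G_def)
  ultimately have fG: "(\<lambda>\<omega>. f (G \<omega>)) \<in> borel_measurable P" by simp
  have "discounted \<delta> f (X z) \<tau> = (\<lambda>\<omega>. if \<tau> \<omega> = \<infinity> then 0 else exp (- \<delta> * enn2real (\<tau> \<omega>)) * f (G \<omega>))"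
    by (simp add: discounted_def G_def fun_eq_iff)
  also have "\<dots> \<in> borel_measurable P"
    using fG by measurable
  finally show ?thesis .
qed

lemma discounted_integrable:
  assumes z: "0 < z" and \<tau>: "stopping_time Ft \<tau>" and f: "(\<lambda>y. indicator {0<..} y * f y) \<in> borel_measurable borel"
    and bd: "\<And>y. 0 < y \<Longrightarrow> \<bar>f y\<bar> \<le> C * H y"
  shows "integrable P (discounted \<delta> f (X z) \<tau>)"
proof (rule Bochner_Integration.integrable_bound)
  have C: "0 \<le> C" using bd[of 1] H_pos[of 1] by (smt (verit) mult_nonneg_nonneg zero_le_mult_iff)
  show "integrable P (discounted \<delta> (\<lambda>y. C * y powr \<alpha> + C * y powr (- \<beta>)) (X z) \<tau>)"
    by (rule discounted_hfun_integral[OF z \<tau> C C])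
  show "AE \<omega> in P. norm (discounted \<delta> f (X z) \<tau> \<omega>) \<le> norm (discounted \<delta> (\<lambda>y. C * y powr \<alpha> + C * y powr (- \<beta>)) (X z) \<tau> \<omega>)"
  proof (intro AE_I2)
    fix \<omega>
    have "\<bar>f y\<bar> \<le> \<bar>C * y powr \<alpha> + C * y powr (- \<beta>)\<bar>" if "0 < y" for y
      using bd[OF that] by (simp add: H_def algebra_simps)
    then show "norm (discounted \<delta> f (X z) \<tau> \<omega>) \<le> norm (discounted \<delta> (\<lambda>y. C * y powr \<alpha> + C * y powr (- \<beta>)) (X z) \<tau> \<omega>)"
      using X_pos[OF z] by (auto simp: discounted_def abs_mult intro!: mult_left_mono)
  qed
qed (rule discounted_measurable[OF z \<tau> f])

text \<open>The discounted state is \<open>exp (- (\<delta> - m) * t)\<close> times a Wald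
  martingale, so \<open>m < \<delta>\<close> gives a bound with the same affine coefficients.
  Passing through \<open>H\<close> would lose the linear form on which the Lipschitz estimate for
  \<open>u\<close> depends.\<close>

lemma discounted_affine_integral:
  assumes z: "0 < z" and \<tau>: "stopping_time Ft \<tau>" and ab: "0 \<le> a" "0 \<le> b"
  shows "integrable P (discounted \<delta> (\<lambda>y. a + b * y) (X z) \<tau>)"
    "(LINT \<omega>|P. discounted \<delta> (\<lambda>y. a + b * y) (X z) \<tau> \<omega>) \<le> a + b * z"
proof -
  have 1: "discounted \<delta> (\<lambda>y. a + b * y) (X z) \<tau> \<omega> \<le> a + b * z * (if \<tau> \<omega> = \<infinity> then 0 else emart \<sigma> (enn2real (\<tau> \<omega>)) \<omega>)" for \<omega>
  proof (cases "\<tau> \<omega> = \<infinity>")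
    case False
    define t where "t = enn2real (\<tau> \<omega>)"
    have t: "0 \<le> t" by (simp add: t_def)
    have "exp (- \<delta> * t) \<le> 1" using t \<delta> by simp
    then have "exp (- \<delta> * t) * a \<le> 1 * a" using ab by (intro mult_right_mono) auto
    moreover have "exp (- \<delta> * t) * X z t \<omega> \<le> z * emart \<sigma> t \<omega>"
    proof -
      have "exp (- \<delta> * t) * gbm m \<sigma> t \<omega> = exp (- (\<delta> - m) * t) * emart \<sigma> t \<omega>"
        unfolding gbm_def emart_def exp_add[symmetric] by (simp add: field_simps)
      also have "\<dots> \<le> 1 * emart \<sigma> t \<omega>" using t m_less by (intro mult_right_mono) (auto simp: mult_nonpos_nonneg)
      finally show ?thesis using z by (simp add: X_def mult.left_commute)
    qed
    then have "b * (exp (- \<delta> * t) * X z t \<omega>) \<le> b * (z * emart \<sigma> t \<omega>)" using ab by (intro mult_left_mono)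
    ultimately show ?thesis using False by (simp add: discounted_def t_def[symmetric] algebra_simps)
  qed (use ab in \<open>simp add: discounted_def\<close>)
  note em = emart_stopped[OF \<tau>, of \<sigma>]
  have "\<bar>a + b * y\<bar> \<le> (a + b) * H y" if "0 < y" for y
  proof -
    have "a * 1 + b * y \<le> a * H y + b * H y" using H_ge[OF that] ab by (intro add_mono mult_left_mono) auto
    then show ?thesis using that ab by (simp add: algebra_simps)
  qed
  then show i: "integrable P (discounted \<delta> (\<lambda>y. a + b * y) (X z) \<tau>)"
    by (intro discounted_integrable[OF z \<tau>]) auto
  have "(LINT \<omega>|P. discounted \<delta> (\<lambda>y. a + b * y) (X z) \<tau> \<omega>) \<le> (LINT \<omega>|P. a + b * z * (if \<tau> \<omega> = \<infinity> then 0 else emart \<sigma> (enn2real (\<tau> \<omega>)) \<omega>))"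
    by (intro integral_mono i 1 Bochner_Integration.integrable_add integrable_mult_right em) simp
  also have "\<dots> = a + b * z * (LINT \<omega>|P. (if \<tau> \<omega> = \<infinity> then 0 else emart \<sigma> (enn2real (\<tau> \<omega>)) \<omega>))"
    using em(1) by (subst Bochner_Integration.integral_add) (simp_all add: prob_space)
  also have "\<dots> \<le> a + b * z * 1" using em(2) ab z by (intro add_left_mono mult_left_mono) auto
  finally show "(LINT \<omega>|P. discounted \<delta> (\<lambda>y. a + b * y) (X z) \<tau> \<omega>) \<le> a + b * z" by simp
qed

subsection \<open>Exit times from intervals\<close>

text \<open>The first time in the closed set outside \<open>(c, d)\<close>, set to infinity on the
  null set of paths that are discontinuous or start elsewhere; null sets belong to every
  \<open>Ft t\<close>. That a continuous path has not left by time \<open>r\<close> is rewritten as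
  a countable condition on its values up to \<open>r\<close>.\<close>

lemma ex_exit_time:
  assumes cd: "0 < c" "c < z" "z < d"
  shows "\<exists>\<tau>. stopping_time Ft \<tau> \<and> (AE \<omega> in P. (\<forall>t\<ge>0. ennreal t \<le> \<tau> \<omega> \<longrightarrow> X z t \<omega> \<in> {c..d}) \<and>
     (\<tau> \<omega> \<noteq> \<infinity> \<longrightarrow> X z (enn2real (\<tau> \<omega>)) \<omega> \<in> {c, d}))"
proof -
  define good where "good \<omega> \<longleftrightarrow> continuous_on {0..} (\<lambda>t. X z t \<omega>) \<and> X z 0 \<omega> = z" for \<omega>
  define S where "S \<omega> = {t. 0 \<le> t \<and> X z t \<omega> \<notin> {c<..<d}}" for \<omega>
  define \<tau> where "\<tau> \<omega> = (if good \<omega> \<and> S \<omega> \<noteq> {} then ennreal (Inf (S \<omega>)) else \<infinity>)" for \<omega>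
  have good: "AE \<omega> in P. good \<omega>"
    using gbm_cont[of m \<sigma>] gbm_0[of m \<sigma>]
  proof eventually_elim
    case (elim \<omega>)
    then show ?case unfolding good_def X_def by (intro conjI continuous_intros) auto
  qed
  then have "{\<omega> \<in> space P. \<not> good \<omega>} \<in> null_sets P" by (simp add: AE_iff_null_sets)
  then have bad: "{\<omega> \<in> space P. \<not> good \<omega>} \<in> sets (Ft t)" for t by (rule null_Ft)
  have goodF: "{\<omega> \<in> space P. good \<omega>} \<in> sets (Ft t)" for t
  proof -
    have "space (Ft t) - {\<omega> \<in> space P. \<not> good \<omega>} \<in> sets (Ft t)" using bad by (intro sets.Diff sets.top)
    also have "space (Ft t) - {\<omega> \<in> space P. \<not> good \<omega>} = {\<omega> \<in> space P. good \<omega>}" by auto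
    finally show ?thesis .
  qed
  have SI: "Inf (S \<omega>) \<in> S \<omega>" "\<And>t. t \<in> S \<omega> \<Longrightarrow> Inf (S \<omega>) \<le> t" "bdd_below (S \<omega>)" if "good \<omega>" "S \<omega> \<noteq> {}" for \<omega>
  proof -
    have "closed ({0..} \<inter> (\<lambda>t. X z t \<omega>) -` (- {c<..<d}))"
      using that(1) unfolding good_def by (intro continuous_closed_preimage) auto
    also have "{0..} \<inter> (\<lambda>t. X z t \<omega>) -` (- {c<..<d}) = S \<omega>" by (auto simp: S_def)
    finally have cl: "closed (S \<omega>)" .
    show bb: "bdd_below (S \<omega>)" by (rule bdd_belowI[of _ 0]) (auto simp: S_def)
    show "Inf (S \<omega>) \<in> S \<omega>" by (rule closed_contains_Inf[OF that(2) bb cl])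
    show "\<And>t. t \<in> S \<omega> \<Longrightarrow> Inf (S \<omega>) \<le> t" by (rule cInf_lower[OF _ bb])
  qed
  have le_iff: "\<tau> \<omega> \<le> ennreal r \<longleftrightarrow> (\<exists>s. 0 \<le> s \<and> s \<le> r \<and> X z s \<omega> \<notin> {c<..<d})" if g: "good \<omega>" and r: "0 \<le> r" for \<omega> r
  proof
    assume a: "\<tau> \<omega> \<le> ennreal r"
    then have ne: "S \<omega> \<noteq> {}" by (auto simp: \<tau>_def top_unique split: if_splits)
    then have "Inf (S \<omega>) \<le> r" using a g r by (simp add: \<tau>_def)
    then show "\<exists>s. 0 \<le> s \<and> s \<le> r \<and> X z s \<omega> \<notin> {c<..<d}"
      using SI(1)[OF g ne] by (intro exI[of _ "Inf (S \<omega>)"]) (auto simp: S_def)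
  next
    assume "\<exists>s. 0 \<le> s \<and> s \<le> r \<and> X z s \<omega> \<notin> {c<..<d}"
    then obtain s where s: "s \<in> S \<omega>" "s \<le> r" by (auto simp: S_def)
    then have ne: "S \<omega> \<noteq> {}" by auto
    then show "\<tau> \<omega> \<le> ennreal r" using SI(2)[OF g ne s(1)] s(2) g by (auto simp: \<tau>_def intro: ennreal_leI)
  qed
  \<comment> \<open>By compactness a path inside the open interval on \<open>[0, r]\<close> keeps a
    distance \<open>1 / (k + 1)\<close> from its ends, and closed conditions can be tested at dense
    times. These are taken as rational fractions of \<open>r\<close>, so that the endpoint
    \<open>r\<close> itself is among them.\<close>
  have inside_iff: "(\<forall>s. 0 \<le> s \<and> s \<le> r \<longrightarrow> X z s \<omega> \<in> {c<..<d}) \<longleftrightarrow>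
      (\<exists>k::nat. \<forall>x::rat. 0 \<le> real_of_rat x \<and> real_of_rat x \<le> 1 \<longrightarrow>
        c + 1 / real (Suc k) \<le> X z (r * real_of_rat x) \<omega> \<and> X z (r * real_of_rat x) \<omega> \<le> d - 1 / real (Suc k))"
    if g: "good \<omega>" and r: "0 \<le> r" for \<omega> r
  proof
    assume a: "\<forall>s. 0 \<le> s \<and> s \<le> r \<longrightarrow> X z s \<omega> \<in> {c<..<d}"
    have cont: "continuous_on {0..r} (\<lambda>t. X z t \<omega>)"
      using g unfolding good_def by (auto intro: continuous_on_subset)
    obtain s1 where s1: "s1 \<in> {0..r}" "\<And>s. s \<in> {0..r} \<Longrightarrow> X z s1 \<omega> \<le> X z s \<omega>"
      using continuous_attains_inf[OF _ _ cont] r by auto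
    obtain s2 where s2: "s2 \<in> {0..r}" "\<And>s. s \<in> {0..r} \<Longrightarrow> X z s \<omega> \<le> X z s2 \<omega>"
      using continuous_attains_sup[OF _ _ cont] r by auto
    have "0 < min (X z s1 \<omega> - c) (d - X z s2 \<omega>)" using a s1(1) s2(1) by auto
    then obtain k :: nat where k: "1 / real (Suc k) < min (X z s1 \<omega> - c) (d - X z s2 \<omega>)"
      by (metis reals_Archimedean inverse_eq_divide)
    show "\<exists>k::nat. \<forall>x::rat. 0 \<le> real_of_rat x \<and> real_of_rat x \<le> 1 \<longrightarrow>
        c + 1 / real (Suc k) \<le> X z (r * real_of_rat x) \<omega> \<and> X z (r * real_of_rat x) \<omega> \<le> d - 1 / real (Suc k)"
    proof (intro exI[of _ k] allI impI)
      fix x :: rat assume x: "0 \<le> real_of_rat x \<and> real_of_rat x \<le> 1"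
      then have "r * real_of_rat x \<in> {0..r}" using r mult_left_mono[of "real_of_rat x" 1 r] by auto
      then show "c + 1 / real (Suc k) \<le> X z (r * real_of_rat x) \<omega> \<and> X z (r * real_of_rat x) \<omega> \<le> d - 1 / real (Suc k)"
        using s1(2)[of "r * real_of_rat x"] s2(2)[of "r * real_of_rat x"] k by linarith
    qed
  next
    assume "\<exists>k::nat. \<forall>x::rat. 0 \<le> real_of_rat x \<and> real_of_rat x \<le> 1 \<longrightarrow>
        c + 1 / real (Suc k) \<le> X z (r * real_of_rat x) \<omega> \<and> X z (r * real_of_rat x) \<omega> \<le> d - 1 / real (Suc k)"
    then obtain k :: nat where k: "\<And>x::rat. 0 \<le> real_of_rat x \<Longrightarrow> real_of_rat x \<le> 1 \<Longrightarrow>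
        c + 1 / real (Suc k) \<le> X z (r * real_of_rat x) \<omega> \<and> X z (r * real_of_rat x) \<omega> \<le> d - 1 / real (Suc k)" by blast
    show "\<forall>s. 0 \<le> s \<and> s \<le> r \<longrightarrow> X z s \<omega> \<in> {c<..<d}"
    proof (intro allI impI)
      fix s assume s: "0 \<le> s \<and> s \<le> r"
      define s' where "s' = (if r = 0 then 0 else s / r)"
      have s': "0 \<le> s'" "s' \<le> 1" "r * s' = s" using s r by (auto simp: s'_def)
      obtain q :: "nat \<Rightarrow> rat" where q: "\<And>n. 0 \<le> real_of_rat (q n)" "\<And>n. real_of_rat (q n) \<le> 1" "(\<lambda>n. real_of_rat (q n)) \<longlonglongrightarrow> s'"
        using rational_approx_unit[OF s'(1,2)] by auto
      have "(\<lambda>n. r * real_of_rat (q n)) \<longlonglongrightarrow> s" using tendsto_mult[OF tendsto_const[of r] q(3)] s'(3) by simp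
      moreover have "0 \<le> r * real_of_rat (q n)" for n using q(1)[of n] r by simp
      ultimately have lim: "(\<lambda>n. X z (r * real_of_rat (q n)) \<omega>) \<longlonglongrightarrow> X z s \<omega>"
        using g s unfolding good_def continuous_on_sequentially by (auto simp: o_def)
      have "c + 1 / real (Suc k) \<le> X z s \<omega>" using k[OF q(1,2)] by (intro LIMSEQ_le_const[OF lim]) blast
      moreover have "X z s \<omega> \<le> d - 1 / real (Suc k)" using k[OF q(1,2)] by (intro LIMSEQ_le_const2[OF lim]) blast
      moreover have "0 < 1 / real (Suc k)" by simp
      ultimately show "X z s \<omega> \<in> {c<..<d}" unfolding greaterThanLessThan_iff by linarith
    qed
  qed
  have st: "stopping_time Ft \<tau>"
  proof
    fix t :: ennreal
    show "Measurable.pred (Ft t) (\<lambda>\<omega>. \<tau> \<omega> \<le> t)"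
    proof (cases "t = \<infinity>")
      case True
      then show ?thesis by simp
    next
      case False
      then obtain r where r: "t = ennreal r" "0 \<le> r" by (cases t) auto
      define Q where "Q k x \<omega> \<longleftrightarrow> 0 \<le> real_of_rat x \<and> real_of_rat x \<le> 1 \<longrightarrow>
        c + 1 / real (Suc k) \<le> X z (r * real_of_rat x) \<omega> \<and> X z (r * real_of_rat x) \<omega> \<le> d - 1 / real (Suc k)" for k x \<omega>
      have Qm: "{\<omega> \<in> space (Ft t). Q k x \<omega>} \<in> sets (Ft t)" for k x
      proof (cases "0 \<le> real_of_rat x \<and> real_of_rat x \<le> 1")
        case True
        then have rx: "0 \<le> r * real_of_rat x" "r * real_of_rat x \<le> r" using r mult_left_mono[of "real_of_rat x" 1 r] by auto
        have "gbm m \<sigma> (r * real_of_rat x) \<in> borel_measurable (Ft t)"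
          unfolding r(1) by (rule measurable_Ft_mono[OF ennreal_leI[OF rx(2)] gbm_adapted[OF rx(1)]])
        then show ?thesis using True unfolding Q_def X_def by measurable
      next
        case False
        then have "{\<omega> \<in> space (Ft t). Q k x \<omega>} = space (Ft t)" by (auto simp: Q_def)
        then show ?thesis by (simp only: sets.top)
      qed
      have "{\<omega> \<in> space (Ft t). \<exists>k. \<forall>x. Q k x \<omega>} \<in> sets (Ft t)"
        by (intro sets.sets_Collect_countable_Ex sets.sets_Collect_countable_All Qm)
      then have "{\<omega> \<in> space P. good \<omega>} - {\<omega> \<in> space (Ft t). \<exists>k. \<forall>x. Q k x \<omega>} \<in> sets (Ft t)"
        using goodF by (intro sets.Diff)
      also have "{\<omega> \<in> space P. good \<omega>} - {\<omega> \<in> space (Ft t). \<exists>k. \<forall>x. Q k x \<omega>} = {\<omega> \<in> space (Ft t). \<tau> \<omega> \<le> t}"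
      proof -
        have "\<tau> \<omega> \<le> t \<longleftrightarrow> good \<omega> \<and> \<not> (\<exists>k. \<forall>x. Q k x \<omega>)" for \<omega>
        proof (cases "good \<omega>")
          case True
          show ?thesis unfolding r(1) le_iff[OF True r(2)] Q_def inside_iff[OF True r(2), symmetric] using True by auto
        next
          case False
          then show ?thesis using \<open>t \<noteq> \<infinity>\<close> by (auto simp: \<tau>_def top_unique)
        qed
        then show ?thesis by auto
      qed
      finally show ?thesis by (simp add: pred_def)
    qed
  qed
  have "AE \<omega> in P. (\<forall>t\<ge>0. ennreal t \<le> \<tau> \<omega> \<longrightarrow> X z t \<omega> \<in> {c..d}) \<and>
     (\<tau> \<omega> \<noteq> \<infinity> \<longrightarrow> X z (enn2real (\<tau> \<omega>)) \<omega> \<in> {c, d})"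
    using good
  proof eventually_elim
    case g: (elim \<omega>)
    have before: "X z t \<omega> \<in> {c<..<d}" if "0 \<le> t" "ennreal t < \<tau> \<omega>" for t
    proof (rule ccontr)
      assume "X z t \<omega> \<notin> {c<..<d}"
      then have "\<tau> \<omega> \<le> ennreal t" using le_iff[OF g that(1)] that(1) by auto
      then show False using that(2) by simp
    qed
    have at: "X z t \<omega> \<in> {c..d}" if t: "0 \<le> t" "ennreal t \<le> \<tau> \<omega>" for t
    proof (cases "t = 0")
      case True
      then show ?thesis using g cd by (simp add: good_def)
    next
      case False
      define q where "q n = t - t / real (Suc n)" for n
      have "t / real (Suc n) \<le> t" for n
      proof -
        have "t * 1 \<le> t * real (Suc n)" using t by (intro mult_left_mono) auto
        then show ?thesis by (simp add: field_simps)
      qed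
      then have q0: "0 \<le> q n" for n by (simp add: q_def)
      have q1: "q n < t" for n using False t by (simp add: q_def)
      have "(\<lambda>n. t / real (Suc n)) \<longlonglongrightarrow> 0" by (rule LIMSEQ_Suc) (rule lim_const_over_n)
      then have "q \<longlonglongrightarrow> t - 0" unfolding q_def by (intro tendsto_intros)
      then have lim: "(\<lambda>n. X z (q n) \<omega>) \<longlonglongrightarrow> X z t \<omega>"
        using g t q0 unfolding good_def continuous_on_sequentially by (auto simp: o_def)
      have "X z (q n) \<omega> \<in> {c<..<d}" for n
      proof (rule before[OF q0])
        have "ennreal (q n) < ennreal t" using q0[of n] q1[of n] by (simp add: ennreal_lessI)
        then show "ennreal (q n) < \<tau> \<omega>" using t(2) by (rule order.strict_trans2)
      qed
      then have "\<And>n. c \<le> X z (q n) \<omega>" "\<And>n. X z (q n) \<omega> \<le> d" by (auto simp: less_imp_le)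
      then show ?thesis using LIMSEQ_le_const[OF lim] LIMSEQ_le_const2[OF lim] by auto
    qed
    have "X z (enn2real (\<tau> \<omega>)) \<omega> \<in> {c, d}" if "\<tau> \<omega> \<noteq> \<infinity>"
    proof -
      have ne: "S \<omega> \<noteq> {}" "\<tau> \<omega> = ennreal (Inf (S \<omega>))" using that by (auto simp: \<tau>_def split: if_splits)
      have "Inf (S \<omega>) \<in> S \<omega>" by (rule SI(1)[OF g ne(1)])
      then have "0 \<le> Inf (S \<omega>)" "X z (Inf (S \<omega>)) \<omega> \<notin> {c<..<d}" by (auto simp: S_def)
      then show ?thesis using at[of "Inf (S \<omega>)"] ne(2) by auto
    qed
    then show ?case using at by blast
  qed
  then show ?thesis using st by blast
qed

text \<open>Until the exit the process stays in \<open>[c, d]\<close>, so the stopped martingale is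
  bounded and dominated convergence turns the inequality of optional stopping into an equality.
  Where the exit never happens, the discount factor drives it to 0, in agreement with the payoff
  convention.\<close>

lemma ex_exit_time_integral:
  assumes cd: "0 < c" "c < z" "z < d"
  shows "\<exists>\<tau>. stopping_time Ft \<tau> \<and> (AE \<omega> in P. \<tau> \<omega> \<noteq> \<infinity> \<longrightarrow> X z (enn2real (\<tau> \<omega>)) \<omega> \<in> {c, d}) \<and>
    (\<forall>A B. (LINT \<omega>|P. discounted \<delta> (\<lambda>y. A * y powr \<alpha> + B * y powr (- \<beta>)) (X z) \<tau> \<omega>) = A * z powr \<alpha> + B * z powr (- \<beta>))"
proof -
  obtain \<tau> where \<tau>: "stopping_time Ft \<tau>" and
    ex: "AE \<omega> in P. (\<forall>t\<ge>0. ennreal t \<le> \<tau> \<omega> \<longrightarrow> X z t \<omega> \<in> {c..d}) \<and> (\<tau> \<omega> \<noteq> \<infinity> \<longrightarrow> X z (enn2real (\<tau> \<omega>)) \<omega> \<in> {c, d})"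
    using ex_exit_time[OF cd] by blast
  have z: "0 < z" using cd by simp
  have "(LINT \<omega>|P. discounted \<delta> (\<lambda>y. y powr \<gamma>) (X z) \<tau> \<omega>) = z powr \<gamma>" if \<gamma>: "is_root \<gamma>" for \<gamma>
  proof -
    define Y where "Y \<omega> = (if \<tau> \<omega> = \<infinity> then 0 else emart (\<gamma> * \<sigma>) (enn2real (\<tau> \<omega>)) \<omega>)" for \<omega>
    define V where "V n \<omega> = emart (\<gamma> * \<sigma>) (capped (real (Suc n)) (\<tau> \<omega>)) \<omega>" for n \<omega>
    have V1: "has_bochner_integral P (V n) 1" for n
      unfolding V_def by (rule emart_capped[OF _ \<tau>]) simp
    \<comment> \<open>A power is monotone in a direction that depends on the sign of its exponent;
      the sum of both end values bounds it on \<open>[c, d]\<close> in either case.\<close>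
    define K where "K = (c powr \<gamma> + d powr \<gamma>) / z powr \<gamma>"
    have emX: "emart (\<gamma> * \<sigma>) t \<omega> = exp (- \<delta> * t) * (X z t \<omega>) powr \<gamma> / z powr \<gamma>" if "0 \<le> t" for t \<omega>
      using discounted_powr[OF z \<gamma>, of "\<lambda>_. ennreal t" \<omega>] that z by (simp add: discounted_def)
    have bd: "emart (\<gamma> * \<sigma>) t \<omega> \<le> exp (- \<delta> * t) * K" if "0 \<le> t" "X z t \<omega> \<in> {c..d}" for t \<omega>
    proof -
      have "(X z t \<omega>) powr \<gamma> \<le> c powr \<gamma> + d powr \<gamma>"
      proof (cases "0 \<le> \<gamma>")
        case True
        then have "(X z t \<omega>) powr \<gamma> \<le> d powr \<gamma>" using that cd by (intro powr_mono2) auto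
        then show ?thesis by (simp add: add_increasing)
      next
        case False
        then have "(X z t \<omega>) powr \<gamma> \<le> c powr \<gamma>" using that cd by (intro powr_mono2') auto
        then show ?thesis by (simp add: add_increasing2)
      qed
      then show ?thesis unfolding emX[OF that(1)] K_def
        by (simp add: divide_right_mono mult_left_mono)
    qed
    have K0: "0 \<le> K" by (simp add: K_def)
    have "(\<lambda>n. LINT \<omega>|P. V n \<omega>) \<longlonglongrightarrow> (LINT \<omega>|P. Y \<omega>)"
    proof (rule integral_dominated_convergence[where w="\<lambda>_. K"])
      show "Y \<in> borel_measurable P" using emart_stopped(1)[OF \<tau>, of "\<gamma> * \<sigma>"] unfolding Y_def by (rule borel_measurable_integrable)
      show "V n \<in> borel_measurable P" for n using V1[of n] by (auto simp: has_bochner_integral_iff)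
      show "AE \<omega> in P. (\<lambda>n. V n \<omega>) \<longlonglongrightarrow> Y \<omega>"
        using ex
      proof eventually_elim
        case (elim \<omega>)
        show ?case
        proof (cases "\<tau> \<omega> = \<infinity>")
          case True
          have "V n \<omega> \<le> exp (- \<delta> * real (Suc n)) * K" for n
            unfolding V_def using True elim capped_simps(4)[of "real (Suc n)" "\<tau> \<omega>"] bd[of "real (Suc n)" \<omega>]
            by (simp del: of_nat_Suc)
          moreover have "(\<lambda>n. exp (- \<delta> * real (Suc n)) * K) \<longlonglongrightarrow> 0" using \<delta> by real_asymp
          ultimately have "(\<lambda>n. V n \<omega>) \<longlonglongrightarrow> 0"
            by (rule tendsto_0_squeeze[rotated]) (simp add: V_def)
          then show ?thesis using True by (simp add: Y_def)
        next
          case False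
          then obtain r where r: "\<tau> \<omega> = ennreal r" "0 \<le> r" by (cases "\<tau> \<omega>") auto
          obtain N where N: "r \<le> real N" using real_arch_simple by blast
          have "\<forall>\<^sub>F n in sequentially. V n \<omega> = Y \<omega>"
          proof (rule eventually_sequentiallyI[of N])
            fix n assume "N \<le> n"
            then have "r \<le> real (Suc n)" using N by simp
            then have "\<tau> \<omega> \<le> ennreal (real (Suc n))" unfolding r by (rule ennreal_leI)
            then show "V n \<omega> = Y \<omega>" using False capped_simps(3)[of "real (Suc n)" "\<tau> \<omega>"]
              by (simp add: V_def Y_def del: of_nat_Suc)
          qed
          then show ?thesis by (rule tendsto_eventually)
        qed
      qed
      show "AE \<omega> in P. norm (V n \<omega>) \<le> K" for n
        using ex
      proof eventually_elim
        case (elim \<omega>)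
        let ?t = "capped (real (Suc n)) (\<tau> \<omega>)"
        have t: "0 \<le> ?t" "ennreal ?t \<le> \<tau> \<omega>" using capped_simps[of "real (Suc n)" "\<tau> \<omega>"] by auto
        have "V n \<omega> \<le> exp (- \<delta> * ?t) * K" unfolding V_def using elim t by (intro bd) auto
        also have "\<dots> \<le> 1 * K" using t \<delta> K0 by (intro mult_right_mono) auto
        finally show ?case by (simp add: V_def)
      qed
    qed simp
    then have "(LINT \<omega>|P. Y \<omega>) = 1"
      using V1 by (simp add: has_bochner_integral_iff LIMSEQ_const_iff)
    then show ?thesis unfolding discounted_powr[OF z \<gamma>] Y_def by simp
  qed
  note * = this[OF roots(1)] this[OF roots(2)]
  have "(LINT \<omega>|P. discounted \<delta> (\<lambda>y. A * y powr \<alpha> + B * y powr (- \<beta>)) (X z) \<tau> \<omega>) = A * z powr \<alpha> + B * z powr (- \<beta>)" for A B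
    unfolding discounted_linear using * discounted_powr_integral(1)[OF z \<tau> roots(1)] discounted_powr_integral(1)[OF z \<tau> roots(2)]
    by simp
  moreover have "AE \<omega> in P. \<tau> \<omega> \<noteq> \<infinity> \<longrightarrow> X z (enn2real (\<tau> \<omega>)) \<omega> \<in> {c, d}" using ex by eventually_elim auto
  ultimately show ?thesis using \<tau> by blast
qed

end

subsection \<open>Minimal majorants\<close>

text \<open>Without a contact on \<open>[z, \<infinity>)\<close> the majorant can be tilted: lower
  \<open>A\<close> by \<open>\<epsilon>\<close> and raise \<open>B\<close> so that nothing changes
  at a point \<open>z'\<close> slightly left of \<open>z\<close>. To the left of \<open>z'\<close>
  the function rises, to the right it falls, in particular at \<open>z\<close>. There is room for
  this because the gap divided by \<open>x powr \<alpha>\<close> stays away from 0: on compact sets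
  by continuity, at infinity because \<open>G\<close> is of smaller order and
  \<open>A > 0\<close>.\<close>

lemma perturb_majorant_right:
  fixes G :: "real \<Rightarrow> real" and \<alpha> \<beta> :: real
  assumes \<alpha>\<beta>: "0 < \<alpha>" "0 < \<beta>" and G: "continuous_on {0<..} G"
    and maj: "\<And>x. 0 < x \<Longrightarrow> G x \<le> A * x powr \<alpha> + B * x powr (- \<beta>)"
    and A: "0 < A" and B: "0 \<le> B" and z: "0 < z"
    and lim: "((\<lambda>x. G x / x powr \<alpha>) \<longlongrightarrow> 0) at_top"
    and noc: "\<And>x. z \<le> x \<Longrightarrow> G x < A * x powr \<alpha> + B * x powr (- \<beta>)"
  shows "\<exists>A' B'. 0 \<le> A' \<and> 0 \<le> B' \<and> (\<forall>x>0. G x \<le> A' * x powr \<alpha> + B' * x powr (- \<beta>)) \<and>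
    A' * z powr \<alpha> + B' * z powr (- \<beta>) < A * z powr \<alpha> + B * z powr (- \<beta>)"
proof -
  define h where "h x = A * x powr \<alpha> + B * x powr (- \<beta>)" for x
  define \<phi> where "\<phi> x = (h x - G x) / x powr \<alpha>" for x
  have cont: "continuous_on {0<..} \<phi>" unfolding \<phi>_def h_def
    by (intro continuous_intros G) auto
  have "isCont \<phi> z" using cont z by (simp add: continuous_on_eq_continuous_at)
  moreover have "0 < \<phi> z" using noc[of z] z by (simp add: \<phi>_def h_def)
  ultimately have "\<forall>\<^sub>F x in at z. 0 < \<phi> x" by (intro order_tendstoD) (auto simp: isCont_def)
  then obtain e where e: "0 < e" "\<And>x. x \<noteq> z \<Longrightarrow> dist x z < e \<Longrightarrow> 0 < \<phi> x" by (auto simp: eventually_at)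
  \<comment> \<open>Having no contact is an open condition, so the contact-free region reaches a
    little to the left of \<open>z\<close>.\<close>
  define z' where "z' = max (z / 2) (z - e / 2)"
  have z': "0 < z'" "z' < z" using z e by (auto simp: z'_def)
  have pos: "0 < \<phi> x" if "z' \<le> x" for x
  proof (cases "z \<le> x")
    case True
    then show ?thesis using noc[of x] z by (simp add: \<phi>_def h_def)
  next
    case False
    then have "dist x z < e" using that e(1) by (auto simp: z'_def dist_real_def)
    then show ?thesis using e(2)[of x] False by simp
  qed
  have "((\<lambda>x. A + B * x powr (- \<beta> - \<alpha>) - G x / x powr \<alpha>) \<longlongrightarrow> A + B * 0 - 0) at_top"
    using \<alpha>\<beta> by (intro tendsto_intros lim tendsto_neg_powr filterlim_ident) auto
  moreover have "\<forall>\<^sub>F x in at_top. A + B * x powr (- \<beta> - \<alpha>) - G x / x powr \<alpha> = \<phi> x"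
    using eventually_gt_at_top[of 0]
  proof eventually_elim
    case (elim x)
    have "x powr (- \<beta> - \<alpha>) = x powr (- \<beta>) / x powr \<alpha>" by (rule powr_diff)
    then show ?case using elim by (simp add: \<phi>_def h_def diff_divide_distrib add_divide_distrib)
  qed
  ultimately have "(\<phi> \<longlongrightarrow> A + B * 0 - 0) at_top" by (rule Lim_transform_eventually)
  then have "(\<phi> \<longlongrightarrow> A) at_top" by simp
  then have "\<forall>\<^sub>F x in at_top. A / 2 < \<phi> x" using A by (intro order_tendstoD) auto
  then obtain M where M: "\<And>x. M \<le> x \<Longrightarrow> A / 2 < \<phi> x" by (auto simp: eventually_at_top_linorder)
  have cp: "compact {z'..max M z}" "{z'..max M z} \<noteq> {}" using z' by auto
  have "continuous_on {z'..max M z} \<phi>" using z' by (intro continuous_on_subset[OF cont]) auto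
  from continuous_attains_inf[OF cp this]
  obtain x0 where x0: "x0 \<in> {z'..max M z}" "\<And>x. x \<in> {z'..max M z} \<Longrightarrow> \<phi> x0 \<le> \<phi> x" by auto
  define \<epsilon> where "\<epsilon> = min (\<phi> x0) (A / 2)"
  have \<epsilon>: "0 < \<epsilon>" "\<epsilon> \<le> A" using pos[of x0] x0(1) A by (auto simp: \<epsilon>_def)
  have low: "\<epsilon> \<le> \<phi> x" if "z' \<le> x" for x
  proof (cases "x \<le> max M z")
    case True
    then show ?thesis using x0(2)[of x] that by (auto simp: \<epsilon>_def)
  next
    case False
    then have "M \<le> x" by simp
    then show ?thesis using M[of x] by (auto simp: \<epsilon>_def)
  qed
  \<comment> \<open>The coefficient for which
    \<open>x powr \<alpha> - \<kappa> * x powr (- \<beta>)\<close> changes sign exactly at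
    \<open>z'\<close>.\<close>
  define \<kappa> where "\<kappa> = z' powr (\<alpha> + \<beta>)"
  have kle: "x powr \<alpha> \<le> \<kappa> * x powr (- \<beta>) \<longleftrightarrow> x \<le> z'" if "0 < x" for x
  proof -
    have "x powr \<alpha> \<le> \<kappa> * x powr (- \<beta>) \<longleftrightarrow> x powr (\<alpha> + \<beta>) \<le> z' powr (\<alpha> + \<beta>)"
      using that by (simp add: \<kappa>_def powr_minus powr_add field_simps)
    also have "\<dots> \<longleftrightarrow> x \<le> z'" 
    proof
      assume "x powr (\<alpha> + \<beta>) \<le> z' powr (\<alpha> + \<beta>)"
      then show "x \<le> z'" using powr_less_mono2[of "\<alpha> + \<beta>" z' x] z' \<alpha>\<beta> by (cases "x \<le> z'") auto
    next
      assume "x \<le> z'"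
      then show "x powr (\<alpha> + \<beta>) \<le> z' powr (\<alpha> + \<beta>)" using that \<alpha>\<beta> by (intro powr_mono2) auto
    qed
    finally show ?thesis .
  qed
  have eq: "(A - \<epsilon>) * x powr \<alpha> + (B + \<epsilon> * \<kappa>) * x powr (- \<beta>) = h x - \<epsilon> * (x powr \<alpha> - \<kappa> * x powr (- \<beta>))" for x
    by (simp add: h_def algebra_simps)
  have "G x \<le> (A - \<epsilon>) * x powr \<alpha> + (B + \<epsilon> * \<kappa>) * x powr (- \<beta>)" if x: "0 < x" for x
  proof (cases "x \<le> z'")
    case True
    then have "x powr \<alpha> - \<kappa> * x powr (- \<beta>) \<le> 0" using kle[OF x] by simp
    then have "\<epsilon> * (x powr \<alpha> - \<kappa> * x powr (- \<beta>)) \<le> 0" using \<epsilon> by (simp add: mult_nonneg_nonpos)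
    then show ?thesis unfolding eq using maj[OF x] by (simp add: h_def)
  next
    case False
    then have "\<epsilon> \<le> (h x - G x) / x powr \<alpha>" using low[of x] by (simp add: \<phi>_def)
    then have "\<epsilon> * x powr \<alpha> \<le> h x - G x" using x by (simp add: field_simps)
    moreover have "0 \<le> \<epsilon> * (\<kappa> * x powr (- \<beta>))" using \<epsilon> by (simp add: \<kappa>_def)
    ultimately show ?thesis unfolding eq by (simp add: algebra_simps)
  qed
  moreover have "(A - \<epsilon>) * z powr \<alpha> + (B + \<epsilon> * \<kappa>) * z powr (- \<beta>) < h z"
  proof -
    have "0 < z powr \<alpha> - \<kappa> * z powr (- \<beta>)" using kle[OF z] z' by auto
    then have "0 < \<epsilon> * (z powr \<alpha> - \<kappa> * z powr (- \<beta>))" using \<epsilon> by simp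
    then show ?thesis unfolding eq by simp
  qed
  moreover have "0 \<le> B + \<epsilon> * \<kappa>" using B \<epsilon> by (simp add: \<kappa>_def)
  ultimately show ?thesis using \<epsilon> unfolding h_def by (intro exI[of _ "A - \<epsilon>"] exI[of _ "B + \<epsilon> * \<kappa>"]) auto
qed

text \<open>With \<open>A = 0\<close> the right-hand side would tend to 0 at infinity.\<close>

lemma majorant_coeff_pos:
  fixes A B :: real
  assumes \<alpha>\<beta>: "0 < \<alpha>" "0 < \<beta>" and AB: "0 \<le> A" and ge: "\<And>x. 0 < x \<Longrightarrow> 1 \<le> A * x powr \<alpha> + B * x powr (- \<beta>)"
  shows "0 < A"
proof (rule ccontr)
  assume "\<not> 0 < A"
  then have "A = 0" using AB by simp
  have "((\<lambda>x. B * x powr (- \<beta>)) \<longlongrightarrow> B * 0) at_top"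
    using \<alpha>\<beta> by (intro tendsto_intros tendsto_neg_powr filterlim_ident) auto
  then have "\<forall>\<^sub>F x in at_top. B * x powr (- \<beta>) < 1" by (intro order_tendstoD) auto
  then have "\<forall>\<^sub>F x::real in at_top. False"
    using eventually_gt_at_top[of 0] by eventually_elim (use ge \<open>A = 0\<close> in fastforce)
  then show False by simp
qed

text \<open>Majorants form an intersection of closed half-planes in the coefficients, and those with
  value at most \<open>R\<close> at \<open>z\<close> lie in a compact rectangle, so the value at
  \<open>z\<close> attains its minimum.\<close>

lemma ex_minimal_majorant:
  fixes G :: "real \<Rightarrow> real"
  assumes z: "0 < z" and C: "\<And>x. 0 < x \<Longrightarrow> G x \<le> C * x powr \<alpha> + C * x powr (- \<beta>)" "0 \<le> C"
  shows "\<exists>A B. 0 \<le> A \<and> 0 \<le> B \<and> (\<forall>x>0. G x \<le> A * x powr \<alpha> + B * x powr (- \<beta>)) \<and>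
    (\<forall>A' B'. 0 \<le> A' \<longrightarrow> 0 \<le> B' \<longrightarrow> (\<forall>x>0. G x \<le> A' * x powr \<alpha> + B' * x powr (- \<beta>)) \<longrightarrow>
      A * z powr \<alpha> + B * z powr (- \<beta>) \<le> A' * z powr \<alpha> + B' * z powr (- \<beta>))"
proof -
  define l where "l p = fst p * z powr \<alpha> + snd p * z powr (- \<beta>)" for p :: "real \<times> real"
  define K where "K = (\<Inter>x\<in>{0<..}. {p::real\<times>real. G x \<le> fst p * x powr \<alpha> + snd p * x powr (- \<beta>)})"
  define R where "R = l (C, C)"
  define Q where "Q = {0..R / z powr \<alpha>} \<times> {0..R / z powr (- \<beta>)}"
  have "closed K" unfolding K_def by (intro closed_INT ballI closed_Collect_le continuous_intros)
  moreover have "compact Q" unfolding Q_def by (intro compact_Times compact_Icc)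
  ultimately have "compact (K \<inter> Q)" by (simp add: closed_Int_compact)
  moreover have CC: "(C, C) \<in> K \<inter> Q" using C z by (auto simp: K_def Q_def R_def l_def field_simps)
  moreover have "continuous_on (K \<inter> Q) l" unfolding l_def by (intro continuous_intros)
  ultimately obtain p where p: "p \<in> K \<inter> Q" "\<And>q. q \<in> K \<inter> Q \<Longrightarrow> l p \<le> l q"
    using continuous_attains_inf[of "K \<inter> Q" l] by blast
  have "l p \<le> l (A', B')" if "0 \<le> A'" "0 \<le> B'" "\<forall>x>0. G x \<le> A' * x powr \<alpha> + B' * x powr (- \<beta>)" for A' B'
  proof (cases "l (A', B') \<le> R")
    case True
    have "A' * z powr \<alpha> \<le> R" "B' * z powr (- \<beta>) \<le> R"
      using True that z by (auto simp: l_def intro: order_trans[rotated])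
    then have "(A', B') \<in> K \<inter> Q" using that z by (auto simp: K_def Q_def field_simps)
    then show ?thesis by (rule p(2))
  next
    case False
    then show ?thesis using p(2)[OF CC] by (simp add: R_def)
  qed
  then show ?thesis using p(1)
    by (intro exI[of _ "fst p"] exI[of _ "snd p"]) (auto simp: K_def Q_def l_def)
qed

text \<open>Minimality forces contacts: if one side of \<open>z\<close>, with \<open>z\<close>
  included, had none, a tilt would lower the value at \<open>z\<close>. Since
  \<open>1 \<le> G\<close>, both coefficients are positive, which the tilt requires.\<close>

lemma ex_majorant_with_contacts:
  fixes G :: "real \<Rightarrow> real"
  assumes \<alpha>\<beta>: "1 < \<alpha>" "0 < \<beta>" and G: "continuous_on {0<..} G" and G1: "\<And>x. 0 < x \<Longrightarrow> 1 \<le> G x"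
    and growth: "\<And>x. 0 < x \<Longrightarrow> G x \<le> C * (1 + x)" and z: "0 < z"
  shows "\<exists>A B. 0 \<le> A \<and> 0 \<le> B \<and> (\<forall>x>0. G x \<le> A * x powr \<alpha> + B * x powr (- \<beta>)) \<and>
    (A * z powr \<alpha> + B * z powr (- \<beta>) = G z \<or>
     (\<exists>c d. 0 < c \<and> c < z \<and> z < d \<and> A * c powr \<alpha> + B * c powr (- \<beta>) = G c \<and> A * d powr \<alpha> + B * d powr (- \<beta>) = G d))"
proof -
  have C: "0 \<le> C" using G1[of 1] growth[of 1] by simp
  have "G x \<le> (2 * C) * x powr \<alpha> + (2 * C) * x powr (- \<beta>)" if x: "0 < x" for x
  proof -
    have "1 + x \<le> 2 * (x powr \<alpha> + x powr (- \<beta>))"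
    proof (cases "1 \<le> x")
      case True
      then have "x powr 1 \<le> x powr \<alpha>" using \<alpha>\<beta> by (intro powr_mono) auto
      then have "1 + x \<le> 2 * x powr \<alpha>" using True by simp
      then show ?thesis by (simp add: distrib_left add_increasing2)
    next
      case False
      then have "1 powr (- \<beta>) \<le> x powr (- \<beta>)" using \<alpha>\<beta> x by (intro powr_mono2') auto
      then have "1 + x \<le> 2 * x powr (- \<beta>)" using False by simp
      then show ?thesis by (simp add: distrib_left add_increasing)
    qed
    then have "C * (1 + x) \<le> C * (2 * (x powr \<alpha> + x powr (- \<beta>)))" using C by (rule mult_left_mono)
    then show ?thesis using growth[OF x] by (simp add: algebra_simps)
  qed
  from ex_minimal_majorant[OF z this] C obtain A B where AB: "0 \<le> A" "0 \<le> B"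
    and maj: "\<And>x. 0 < x \<Longrightarrow> G x \<le> A * x powr \<alpha> + B * x powr (- \<beta>)"
    and min: "\<And>A' B'. 0 \<le> A' \<Longrightarrow> 0 \<le> B' \<Longrightarrow> (\<forall>x>0. G x \<le> A' * x powr \<alpha> + B' * x powr (- \<beta>)) \<Longrightarrow>
      A * z powr \<alpha> + B * z powr (- \<beta>) \<le> A' * z powr \<alpha> + B' * z powr (- \<beta>)"
    by (metis mult_nonneg_nonneg zero_le_numeral)
  have ge1: "1 \<le> A * x powr \<alpha> + B * x powr (- \<beta>)" if "0 < x" for x
    using G1[OF that] maj[OF that] by simp
  have A: "0 < A" by (rule majorant_coeff_pos[OF _ \<alpha>\<beta>(2) AB(1) ge1]) (use \<alpha>\<beta> in auto)
  have inv: "(1 / x) powr c = x powr (- c)" if "0 < x" for x c :: real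
    using that by (simp add: powr_divide powr_minus_divide)
  have B: "0 < B"
  proof (rule majorant_coeff_pos[of \<beta> \<alpha> B A])
    show "1 \<le> B * x powr \<beta> + A * x powr (- \<alpha>)" if "0 < x" for x
      using ge1[of "1 / x"] inv[OF that] that by (simp add: algebra_simps)
  qed (use \<alpha>\<beta> AB in auto)
  show ?thesis
  proof (cases "A * z powr \<alpha> + B * z powr (- \<beta>) = G z")
    case True
    then show ?thesis using AB maj by blast
  next
    case False
    then have gz: "G z < A * z powr \<alpha> + B * z powr (- \<beta>)" using maj[OF z] by simp
    have right: "\<exists>d\<ge>z. A * d powr \<alpha> + B * d powr (- \<beta>) = G d"
    proof (rule ccontr)
      assume no: "\<not> ?thesis"
      have noc: "G x < A * x powr \<alpha> + B * x powr (- \<beta>)" if "z \<le> x" for x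
        using no maj[of x] that z by (metis less_le order_less_le_trans)
      have "((\<lambda>x. G x / x powr \<alpha>) \<longlongrightarrow> 0) at_top"
      proof (rule Lim_null_comparison)
        show "\<forall>\<^sub>F x in at_top. norm (G x / x powr \<alpha>) \<le> C * (1 + x) / x powr \<alpha>"
          using eventually_gt_at_top[of 0]
        proof eventually_elim
          case (elim x)
          then have "\<bar>G x\<bar> \<le> C * (1 + x)" using G1[of x] growth[of x] by simp
          then show ?case by (simp add: divide_right_mono)
        qed
        show "((\<lambda>x. C * (1 + x) / x powr \<alpha>) \<longlongrightarrow> 0) at_top" using \<alpha>\<beta>(1) by real_asymp
      qed
      from perturb_majorant_right[OF _ \<alpha>\<beta>(2) G maj A AB(2) z this noc] \<alpha>\<beta>(1)
      obtain A' B' where "0 \<le> A'" "0 \<le> B'" "\<forall>x>0. G x \<le> A' * x powr \<alpha> + B' * x powr (- \<beta>)"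
        "A' * z powr \<alpha> + B' * z powr (- \<beta>) < A * z powr \<alpha> + B * z powr (- \<beta>)" by auto
      then show False using min[of A' B'] by simp
    qed
    have left: "\<exists>c>0. c \<le> z \<and> A * c powr \<alpha> + B * c powr (- \<beta>) = G c"
    proof (rule ccontr)
      assume no: "\<not> ?thesis"
      \<comment> \<open>The inversion of \<open>x\<close> to \<open>1 / x\<close> exchanges
        \<open>\<alpha>\<close> with \<open>\<beta>\<close> and \<open>A\<close> with
        \<open>B\<close>, and reduces the left side to the right one.\<close>
      define G' where "G' x = G (1 / x)" for x
      have cG': "continuous_on {0<..} G'" unfolding G'_def
        by (rule continuous_on_compose2[OF G]) (auto intro!: continuous_intros)
      have maj': "G' x \<le> B * x powr \<beta> + A * x powr (- \<alpha>)" if "0 < x" for x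
        using maj[of "1 / x"] inv[OF that] that by (simp add: G'_def algebra_simps)
      have noc: "G' x < B * x powr \<beta> + A * x powr (- \<alpha>)" if "1 / z \<le> x" for x
      proof -
        have x: "0 < x" using that z by (meson less_le_trans zero_less_divide_1_iff)
        then have "0 < 1 / x" "1 / x \<le> z" using that z by (auto simp: field_simps)
        then have "G (1 / x) < A * (1 / x) powr \<alpha> + B * (1 / x) powr (- \<beta>)"
          using no maj[of "1 / x"] by (metis less_le)
        then show ?thesis using inv[OF x] by (simp add: G'_def algebra_simps)
      qed
      have lim: "((\<lambda>x. G' x / x powr \<beta>) \<longlongrightarrow> 0) at_top"
      proof (rule Lim_null_comparison)
        show "\<forall>\<^sub>F x in at_top. norm (G' x / x powr \<beta>) \<le> C * (1 + 1 / x) / x powr \<beta>"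
          using eventually_gt_at_top[of 0]
        proof eventually_elim
          case (elim x)
          then have "\<bar>G' x\<bar> \<le> C * (1 + 1 / x)" using G1[of "1 / x"] growth[of "1 / x"] by (simp add: G'_def)
          then show ?case by (simp add: divide_right_mono)
        qed
        show "((\<lambda>x. C * (1 + 1 / x) / x powr \<beta>) \<longlongrightarrow> 0) at_top" using \<alpha>\<beta>(2) by real_asymp
      qed
      have "0 < 1 / z" using z by simp
      from perturb_majorant_right[OF \<alpha>\<beta>(2) _ cG' maj' B AB(1) this lim noc] \<alpha>\<beta>(1)
      obtain B' A' where *: "0 \<le> B'" "0 \<le> A'" "\<forall>x>0. G' x \<le> B' * x powr \<beta> + A' * x powr (- \<alpha>)"
        "B' * (1 / z) powr \<beta> + A' * (1 / z) powr (- \<alpha>) < B * (1 / z) powr \<beta> + A * (1 / z) powr (- \<alpha>)" by auto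
      have "G x \<le> A' * x powr \<alpha> + B' * x powr (- \<beta>)" if "0 < x" for x
        using *(3)[rule_format, of "1 / x"] inv[OF that] that by (simp add: G'_def algebra_simps)
      then show False using min[OF *(2,1)] *(4) inv[OF z] by (simp add: algebra_simps)
    qed
    obtain d where d: "z \<le> d" "A * d powr \<alpha> + B * d powr (- \<beta>) = G d" using right by blast
    obtain c where c: "0 < c" "c \<le> z" "A * c powr \<alpha> + B * c powr (- \<beta>) = G c" using left by blast
    have "c \<noteq> z" "d \<noteq> z" using c d gz by auto
    then have "c < z" "z < d" using c d by auto
    then have "\<exists>c d. 0 < c \<and> c < z \<and> z < d \<and> A * c powr \<alpha> + B * c powr (- \<beta>) = G c \<and> A * d powr \<alpha> + B * d powr (- \<beta>) = G d"
      using c d by blast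
    then show ?thesis using AB maj by blast
  qed
qed

subsection \<open>The Euler equation\<close>

text \<open>With \<open>\<theta>\<close> for \<open>x\<close> times differentiation, the operator
  factors as \<open>(\<theta> - \<alpha>) (\<theta> + \<beta>)\<close>. Hence \<open>k\<close>, the
  second factor applied to \<open>f\<close>, is a multiple of \<open>x powr \<alpha>\<close>, and a
  second first-order equation remains for \<open>f\<close>.\<close>

lemma euler_ode_solution:
  fixes f f1 f2 :: "real \<Rightarrow> real"
  assumes ab: "0 < a" "a < b" and v: "0 < v"
    and \<alpha>: "1 < \<alpha>" "\<alpha> * (m - v / 2) + \<alpha>\<^sup>2 * v / 2 = \<delta>"
    and \<beta>: "0 < \<beta>" "- \<beta> * (m - v / 2) + \<beta>\<^sup>2 * v / 2 = \<delta>"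
    and f1: "\<And>x. x \<in> {a<..<b} \<Longrightarrow> (f has_real_derivative f1 x) (at x)"
    and f2: "\<And>x. x \<in> {a<..<b} \<Longrightarrow> (f1 has_real_derivative f2 x) (at x)"
    and ode: "\<And>x. x \<in> {a<..<b} \<Longrightarrow> 1/2 * v * x\<^sup>2 * f2 x + m * x * f1 x - \<delta> * f x = 0"
  shows "\<exists>A B. \<forall>x\<in>{a<..<b}. f x = A * x powr \<alpha> + B * x powr (- \<beta>)"
proof -
  \<comment> \<open>Vieta's relations: \<open>m\<close> and \<open>\<delta>\<close> are expressed
    through the two roots.\<close>
  have "(\<alpha> + \<beta>) * (m - v / 2 + (\<alpha> - \<beta>) * v / 2) =
      (\<alpha> * (m - v / 2) + \<alpha>\<^sup>2 * v / 2) - (- \<beta> * (m - v / 2) + \<beta>\<^sup>2 * v / 2)"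
    by (simp add: field_simps power2_eq_square)
  then have "(\<alpha> + \<beta>) * (m - v / 2 + (\<alpha> - \<beta>) * v / 2) = 0" unfolding \<alpha>(2) \<beta>(2) by simp
  then have s: "m - v / 2 + (\<alpha> - \<beta>) * v / 2 = 0" using \<alpha>(1) \<beta>(1) by simp
  then have m: "m = v / 2 * (1 - \<alpha> + \<beta>)" by (simp add: field_simps)
  have d: "\<delta> = \<alpha> * \<beta> * v / 2"
  proof -
    have "\<delta> = \<alpha> * (m - v / 2 + (\<alpha> - \<beta>) * v / 2) + \<alpha> * \<beta> * v / 2"
      unfolding \<alpha>(2)[symmetric] by (simp add: field_simps power2_eq_square)
    then show ?thesis using s by simp
  qed
  define k where "k x = x * f1 x + \<beta> * f x" for x
  have x2: "x\<^sup>2 * f2 x = \<alpha> * \<beta> * f x - (1 - \<alpha> + \<beta>) * x * f1 x" if "x \<in> {a<..<b}" for x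
  proof -
    have "v / 2 * (x\<^sup>2 * f2 x - (\<alpha> * \<beta> * f x - (1 - \<alpha> + \<beta>) * x * f1 x)) = 0"
      using ode[OF that] unfolding m d by (simp add: field_simps)
    then show ?thesis using v by simp
  qed
  have "((\<lambda>x. k x * x powr (- \<alpha>)) has_real_derivative 0) (at x within {a<..<b})" if x: "x \<in> {a<..<b}" for x
  proof -
    have x0: "0 < x" using x ab by auto
    have "((\<lambda>x. k x * x powr (- \<alpha>)) has_real_derivative
        (f1 x + x * f2 x + \<beta> * f1 x) * x powr (- \<alpha>) + k x * (- \<alpha> * x powr (- \<alpha> - 1))) (at x)"
      unfolding k_def using x0 by (auto intro!: derivative_eq_intros f1[OF x] f2[OF x] simp: algebra_simps)
    moreover have "(f1 x + x * f2 x + \<beta> * f1 x) * x powr (- \<alpha>) + k x * (- \<alpha> * x powr (- \<alpha> - 1)) = 0"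
    proof -
      have "x powr (- \<alpha>) = x * x powr (- \<alpha> - 1)" using x0 by (simp add: powr_diff)
      then have "(f1 x + x * f2 x + \<beta> * f1 x) * x powr (- \<alpha>) + k x * (- \<alpha> * x powr (- \<alpha> - 1)) =
         (x * f1 x + x\<^sup>2 * f2 x + \<beta> * x * f1 x - \<alpha> * k x) * x powr (- \<alpha> - 1)"
        by (simp add: algebra_simps power2_eq_square)
      also have "x * f1 x + x\<^sup>2 * f2 x + \<beta> * x * f1 x - \<alpha> * k x = 0"
        unfolding x2[OF x] k_def by (simp add: algebra_simps)
      finally show ?thesis by simp
    qed
    ultimately show ?thesis by (simp add: has_field_derivative_at_within)
  qed
  then have "\<exists>c. \<forall>x\<in>{a<..<b}. k x * x powr (- \<alpha>) = c" by (intro has_field_derivative_zero_constant) auto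
  then obtain c where c: "\<And>x. x \<in> {a<..<b} \<Longrightarrow> k x * x powr (- \<alpha>) = c" by blast
  define A where "A = c / (\<alpha> + \<beta>)"
  have "((\<lambda>x. f x * x powr \<beta> - A * x powr (\<alpha> + \<beta>)) has_real_derivative 0) (at x within {a<..<b})" if x: "x \<in> {a<..<b}" for x
  proof -
    have x0: "0 < x" using x ab by auto
    have "((\<lambda>x. f x * x powr \<beta> - A * x powr (\<alpha> + \<beta>)) has_real_derivative
        f1 x * x powr \<beta> + f x * (\<beta> * x powr (\<beta> - 1)) - A * ((\<alpha> + \<beta>) * x powr (\<alpha> + \<beta> - 1))) (at x)"
      using x0 by (auto intro!: derivative_eq_intros f1[OF x] simp: algebra_simps)
    moreover have "f1 x * x powr \<beta> + f x * (\<beta> * x powr (\<beta> - 1)) - A * ((\<alpha> + \<beta>) * x powr (\<alpha> + \<beta> - 1)) = 0"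
    proof -
      have "x powr \<beta> = x * x powr (\<beta> - 1)" using x0 by (simp add: powr_diff)
      then have "f1 x * x powr \<beta> + f x * (\<beta> * x powr (\<beta> - 1)) = k x * x powr (\<beta> - 1)"
        by (simp add: k_def algebra_simps)
      also have "k x = c * x powr \<alpha>" using c[OF x] x0 by (simp add: powr_minus field_simps)
      also have "c * x powr \<alpha> * x powr (\<beta> - 1) = c * x powr (\<alpha> + \<beta> - 1)" by (simp add: powr_add[symmetric] add_diff_eq mult.assoc)
      also have "c = A * (\<alpha> + \<beta>)" using \<alpha>(1) \<beta>(1) by (simp add: A_def)
      finally show ?thesis by simp
    qed
    ultimately show ?thesis by (simp add: has_field_derivative_at_within)
  qed
  then have "\<exists>B. \<forall>x\<in>{a<..<b}. f x * x powr \<beta> - A * x powr (\<alpha> + \<beta>) = B" by (intro has_field_derivative_zero_constant) auto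
  then obtain B where B: "\<And>x. x \<in> {a<..<b} \<Longrightarrow> f x * x powr \<beta> - A * x powr (\<alpha> + \<beta>) = B" by blast
  have "f x = A * x powr \<alpha> + B * x powr (- \<beta>)" if x: "x \<in> {a<..<b}" for x
  proof -
    have x0: "0 < x" using x ab by auto
    have "f x * x powr \<beta> = A * x powr \<alpha> * x powr \<beta> + B" using B[OF x] by (simp add: powr_add algebra_simps)
    then show ?thesis using x0 by (simp add: powr_minus field_simps)
  qed
  then show ?thesis by blast
qed

subsection \<open>Differentiation under the integral sign\<close>

text \<open>Dominated convergence for difference quotients. The domination is a Lipschitz bound
  centred at \<open>x0\<close>, so differentiability of the integrand is asked for at that single
  point.\<close>

lemma has_real_derivative_integral:
  fixes f :: "real \<Rightarrow> 'a \<Rightarrow> real"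
  assumes e: "0 < e" and i: "\<And>x. \<bar>x - x0\<bar> < e \<Longrightarrow> integrable M (f x)"
    and lip: "\<And>x \<omega>. \<omega> \<in> space M \<Longrightarrow> \<bar>x - x0\<bar> < e \<Longrightarrow> \<bar>f x \<omega> - f x0 \<omega>\<bar> \<le> w \<omega> * \<bar>x - x0\<bar>"
    and w: "integrable M w" and m: "f' \<in> borel_measurable M"
    and d: "\<And>\<omega>. \<omega> \<in> space M \<Longrightarrow> ((\<lambda>x. f x \<omega>) has_real_derivative f' \<omega>) (at x0)"
  shows "((\<lambda>x. LINT \<omega>|M. f x \<omega>) has_real_derivative (LINT \<omega>|M. f' \<omega>)) (at x0)"
  unfolding has_field_derivative_iff
proof (unfold tendsto_at_iff_sequentially)
  show "\<forall>X. (\<forall>i. X i \<in> UNIV - {x0}) \<longrightarrow> X \<longlonglongrightarrow> x0 \<longrightarrow>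
     ((\<lambda>y. ((LINT \<omega>|M. f y \<omega>) - (LINT \<omega>|M. f x0 \<omega>)) / (y - x0)) \<circ> X) \<longlonglongrightarrow> (LINT \<omega>|M. f' \<omega>)"
  proof (intro allI impI)
    fix X assume X: "\<forall>i. X i \<in> UNIV - {x0}" "X \<longlonglongrightarrow> x0"
    have "\<forall>\<^sub>F n in sequentially. dist (X n) x0 < e" using X(2) e by (rule tendstoD)
    then obtain N where N: "\<And>n. N \<le> n \<Longrightarrow> \<bar>X n - x0\<bar> < e" by (auto simp: eventually_sequentially dist_real_def)
    define Y where "Y n = X (n + N)" for n
    have Y: "\<bar>Y n - x0\<bar> < e" "Y n \<noteq> x0" for n using N[of "n + N"] X(1) by (auto simp: Y_def)
    have Ylim: "Y \<longlonglongrightarrow> x0" unfolding Y_def using X(2) by (rule LIMSEQ_ignore_initial_segment)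
    have ix0: "integrable M (f x0)" by (rule i) (use e in simp)
    have lim: "(\<lambda>n. LINT \<omega>|M. (f (Y n) \<omega> - f x0 \<omega>) / (Y n - x0)) \<longlonglongrightarrow> (LINT \<omega>|M. f' \<omega>)"
    proof (rule integral_dominated_convergence[OF m _ w])
      show "(\<lambda>\<omega>. (f (Y n) \<omega> - f x0 \<omega>) / (Y n - x0)) \<in> borel_measurable M" for n
        using i[OF Y(1)] ix0 by (intro borel_measurable_divide borel_measurable_diff) auto
      show "AE \<omega> in M. (\<lambda>n. (f (Y n) \<omega> - f x0 \<omega>) / (Y n - x0)) \<longlonglongrightarrow> f' \<omega>"
      proof (intro AE_I2)
        fix \<omega> assume "\<omega> \<in> space M"
        from d[OF this] have "((\<lambda>y. (f y \<omega> - f x0 \<omega>) / (y - x0)) \<longlongrightarrow> f' \<omega>) (at x0)" by (simp add: has_field_derivative_iff)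
        then show "(\<lambda>n. (f (Y n) \<omega> - f x0 \<omega>) / (Y n - x0)) \<longlonglongrightarrow> f' \<omega>"
          using Y(2) Ylim unfolding tendsto_at_iff_sequentially by (auto simp: o_def)
      qed
      show "AE \<omega> in M. norm ((f (Y n) \<omega> - f x0 \<omega>) / (Y n - x0)) \<le> w \<omega>" for n
      proof (intro AE_I2)
        fix \<omega> assume "\<omega> \<in> space M"
        from lip[OF this Y(1)[of n]] show "norm ((f (Y n) \<omega> - f x0 \<omega>) / (Y n - x0)) \<le> w \<omega>"
          using Y(2)[of n] by (simp add: field_simps)
      qed
    qed
    have eq: "(LINT \<omega>|M. (f (Y n) \<omega> - f x0 \<omega>) / (Y n - x0)) = ((LINT \<omega>|M. f (Y n) \<omega>) - (LINT \<omega>|M. f x0 \<omega>)) / (Y n - x0)" for n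
      using i[OF Y(1)[of n]] ix0 by simp
    show "((\<lambda>y. ((LINT \<omega>|M. f y \<omega>) - (LINT \<omega>|M. f x0 \<omega>)) / (y - x0)) \<circ> X) \<longlonglongrightarrow> (LINT \<omega>|M. f' \<omega>)"
    proof (rule LIMSEQ_offset[of _ N])
      show "(\<lambda>n. ((\<lambda>y. ((LINT \<omega>|M. f y \<omega>) - (LINT \<omega>|M. f x0 \<omega>)) / (y - x0)) \<circ> X) (n + N)) \<longlonglongrightarrow> (LINT \<omega>|M. f' \<omega>)"
        using lim[unfolded eq] unfolding Y_def o_def .
    qed
  qed
qed

lemma lipschitz_derivative_bound:
  fixes f :: "real \<Rightarrow> real"
  assumes d: "(f has_real_derivative D) (at x0)" and e: "0 < e"
    and lip: "\<And>x. \<bar>x - x0\<bar> < e \<Longrightarrow> \<bar>f x - f x0\<bar> \<le> L * \<bar>x - x0\<bar>"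
  shows "\<bar>D\<bar> \<le> L"
proof -
  have "((\<lambda>y. \<bar>(f y - f x0) / (y - x0)\<bar>) \<longlongrightarrow> \<bar>D\<bar>) (at x0)"
    using d unfolding has_field_derivative_iff by (rule tendsto_rabs)
  moreover have "\<forall>\<^sub>F y in at x0. \<bar>(f y - f x0) / (y - x0)\<bar> \<le> L"
    unfolding eventually_at using e lip by (intro exI[of _ e]) (auto simp: dist_real_def field_simps)
  ultimately show ?thesis by (intro tendsto_upperbound[of _ "\<bar>D\<bar>" "at x0" L]) auto
qed

subsection \<open>Gaussian smoothing\<close>

definition gauss :: "real measure" where
  "gauss = density lborel (\<lambda>x. ennreal (std_normal_density x))"

lemma prob_space_gauss: "prob_space gauss"
  unfolding gauss_def by (rule prob_space_normal_density) simp

lemma sets_gauss[measurable_cong, simp]: "sets gauss = sets borel"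
  by (simp add: gauss_def)

lemma space_gauss[simp]: "space gauss = UNIV"
  by (simp add: gauss_def)

lemma integrable_gauss: "f \<in> borel_measurable borel \<Longrightarrow> integrable gauss f \<longleftrightarrow> integrable lborel (\<lambda>x. std_normal_density x * (f x :: real))"
  unfolding gauss_def by (subst integrable_real_density) auto

lemma integral_gauss: "f \<in> borel_measurable borel \<Longrightarrow> (LINT x|gauss. f x) = (LINT x|lborel. std_normal_density x * (f x :: real))"
  unfolding gauss_def by (subst integral_real_density) auto

lemma gauss_exp: "has_bochner_integral gauss (\<lambda>x. exp (\<theta> * x)) (exp (\<theta>\<^sup>2 / 2))"
  using has_bochner_integral_normal_exp(1)[of 1 \<theta>]
  by (simp add: has_bochner_integral_iff integrable_gauss integral_gauss)

lemma gauss_exp_abs: "integrable gauss (\<lambda>x. exp (\<theta> * \<bar>x\<bar>))"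
proof (rule Bochner_Integration.integrable_bound)
  show "integrable gauss (\<lambda>x. exp (\<theta> * x) + exp (- \<theta> * x))"
    using gauss_exp[of \<theta>] gauss_exp[of "- \<theta>"] by (auto simp: has_bochner_integral_iff)
  show "AE x in gauss. norm (exp (\<theta> * \<bar>x\<bar>)) \<le> norm (exp (\<theta> * x) + exp (- \<theta> * x))"
  proof (intro AE_I2)
    fix x
    have "exp (\<theta> * \<bar>x\<bar>) \<le> exp (\<theta> * x) + exp (- \<theta> * x)"
      by (cases "0 \<le> x") (auto simp: add_increasing add_increasing2)
    also have "\<dots> \<le> \<bar>exp (\<theta> * x) + exp (- \<theta> * x)\<bar>" by (rule abs_ge_self)
    finally show "norm (exp (\<theta> * \<bar>x\<bar>)) \<le> norm (exp (\<theta> * x) + exp (- \<theta> * x))" by simp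
  qed
qed measurable

text \<open>The Cameron-Martin formula in dimension one.\<close>

lemma gauss_shift:
  fixes f :: "real \<Rightarrow> real"
  assumes [measurable]: "f \<in> borel_measurable borel"
  shows "(LINT x|gauss. f (x + b)) = (LINT x|gauss. f x * exp (b * x - b\<^sup>2 / 2))"
proof -
  have den: "std_normal_density x * exp (b * x - b\<^sup>2 / 2) = std_normal_density (x - b)" for x
  proof -
    have "- x\<^sup>2 / 2 + (b * x - b\<^sup>2 / 2) = - (x - b)\<^sup>2 / 2" by (simp add: power2_eq_square field_simps)
    then show ?thesis unfolding std_normal_density_def mult.assoc exp_add[symmetric] by simp
  qed
  have "(LINT x|gauss. f x * exp (b * x - b\<^sup>2 / 2)) = (LINT x|lborel. std_normal_density (x - b) * f x)"
    by (subst integral_gauss) (auto simp: den[symmetric] mult_ac)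
  also have "\<dots> = \<bar>1\<bar> *\<^sub>R (LINT x|lborel. std_normal_density (b + 1 * x - b) * f (b + 1 * x))"
    by (rule lborel_integral_real_affine) simp
  also have "\<dots> = (LINT x|gauss. f (x + b))" by (subst integral_gauss) (auto simp: add.commute)
  finally show ?thesis by simp
qed

lemma abs_exp_minus_one_le: "\<bar>exp y - 1\<bar> \<le> \<bar>y\<bar> * exp \<bar>y\<bar>" for y :: real
proof (cases "0 \<le> y")
  case True
  have "(1 - y) * exp y \<le> exp (- y) * exp y" using exp_ge_add_one_self[of "- y"] by (intro mult_right_mono) auto
  then have "exp y - 1 \<le> y * exp y" by (simp add: algebra_simps exp_minus_inverse mult.commute)
  then show ?thesis using True by simp
next
  case False
  have "1 - exp y \<le> - y" using exp_ge_add_one_self[of y] by linarith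
  also have "- y * 1 \<le> - y * exp (- y)" using False by (intro mult_left_mono) auto
  finally show ?thesis using False by simp
qed

lemma pos_measurable:
  fixes g :: "real \<Rightarrow> real"
  assumes "(\<lambda>y. indicator {0<..} y * g y) \<in> borel_measurable borel" and f: "f \<in> borel_measurable M" and "\<And>x. x \<in> space M \<Longrightarrow> 0 < f x"
  shows "(\<lambda>x. g (f x)) \<in> borel_measurable M"
proof -
  have "(\<lambda>x. indicator {0<..} (f x) * g (f x)) \<in> borel_measurable M"
    using measurable_compose[OF f assms(1)] .
  then show ?thesis by (rule measurable_cong[THEN iffD1, rotated]) (use assms(3) in auto)
qed

text \<open>\<open>g\<close> is merely measurable, so the derivative has to fall on the density.
  Replacing \<open>z0\<close> by \<open>z\<close> shifts the Gaussian variable by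
  \<open>b = ln (z / z0) / s\<close>; the shift formula moves this into the weight
  \<open>exp (b * x - b\<^sup>2 / 2)\<close>, whose derivative at \<open>b = 0\<close> is
  \<open>x\<close>.\<close>

lemma gauss_smoothing_derivative:
  fixes g :: "real \<Rightarrow> real"
  assumes g: "(\<lambda>y. indicator {0<..} y * g y) \<in> borel_measurable borel"
    and bd: "\<And>y. 0 < y \<Longrightarrow> \<bar>g y\<bar> \<le> C * (1 + y)" and s: "0 < s" and z0: "0 < z0"
  shows "((\<lambda>z. LINT x|gauss. g (z * exp (c + s * x))) has_real_derivative
     (1 / (s * z0)) * (LINT x|gauss. g (z0 * exp (c + s * x)) * x)) (at z0)"
proof -
  have C: "0 \<le> C" using bd[of 1] by simp
  define G where "G x = g (z0 * exp (c + s * x))" for x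
  have Gm[measurable]: "G \<in> borel_measurable borel"
    unfolding G_def by (rule pos_measurable[OF g]) (use z0 in auto)
  have Gb: "\<bar>G x\<bar> \<le> C * (1 + z0 * exp c) * exp (s * \<bar>x\<bar>)" for x
  proof -
    have "\<bar>G x\<bar> \<le> C * (1 + z0 * exp (c + s * x))" unfolding G_def using z0 by (intro bd) simp
    also have "z0 * exp (c + s * x) \<le> z0 * exp c * exp (s * \<bar>x\<bar>)"
      using z0 s unfolding mult.assoc exp_add[symmetric] by (intro mult_left_mono) auto
    then have "C * (1 + z0 * exp (c + s * x)) \<le> C * (1 * exp (s * \<bar>x\<bar>) + z0 * exp c * exp (s * \<bar>x\<bar>))"
      using C s by (intro mult_left_mono add_mono) auto
    finally show ?thesis by (simp add: algebra_simps)
  qed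
  define F where "F b x = G x * exp (b * x - b\<^sup>2 / 2)" for b x
  \<comment> \<open>\<open>G\<close> grows at most like \<open>exp (s * \<bar>x\<bar>)\<close>, and
    for \<open>\<bar>b\<bar> < 1\<close> the weight differs from 1 by at most
    \<open>\<bar>b\<bar> * exp 1 * exp (2 * \<bar>x\<bar>)\<close>.\<close>
  define w where "w x = C * (1 + z0 * exp c) * exp 1 * exp ((s + 2) * \<bar>x\<bar>)" for x
  have wi: "integrable gauss w" unfolding w_def by (intro integrable_mult_right gauss_exp_abs)
  have expb: "\<bar>b * x - b\<^sup>2 / 2\<bar> \<le> \<bar>b\<bar> * (\<bar>x\<bar> + 1)" if "\<bar>b\<bar> < 1" for b x :: real
  proof -
    have "b\<^sup>2 / 2 \<le> \<bar>b\<bar> * 1"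
    proof -
      have "b\<^sup>2 = \<bar>b\<bar> * \<bar>b\<bar>" by (simp add: power2_eq_square abs_mult_self_eq)
      also have "\<dots> \<le> \<bar>b\<bar> * 1" using that by (intro mult_left_mono) auto
      finally show ?thesis by simp
    qed
    then show ?thesis using abs_triangle_ineq4[of "b * x" "b\<^sup>2 / 2"] by (simp add: abs_mult algebra_simps)
  qed
  have lip: "\<bar>F b x - F 0 x\<bar> \<le> w x * \<bar>b - 0\<bar>" if b: "\<bar>b - 0\<bar> < 1" for b x
  proof -
    let ?y = "b * x - b\<^sup>2 / 2"
    have "\<bar>exp ?y - 1\<bar> \<le> \<bar>?y\<bar> * exp \<bar>?y\<bar>" by (rule abs_exp_minus_one_le)
    also have "\<dots> \<le> (\<bar>b\<bar> * (\<bar>x\<bar> + 1)) * exp (\<bar>x\<bar> + 1)"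
    proof (intro mult_mono)
      show "\<bar>?y\<bar> \<le> \<bar>b\<bar> * (\<bar>x\<bar> + 1)" using expb b by simp
      also have "\<dots> \<le> 1 * (\<bar>x\<bar> + 1)" using b by (intro mult_right_mono) auto
      finally show "exp \<bar>?y\<bar> \<le> exp (\<bar>x\<bar> + 1)" by simp
    qed auto
    also have "\<dots> \<le> \<bar>b\<bar> * exp \<bar>x\<bar> * exp (\<bar>x\<bar> + 1)"
    proof (intro mult_right_mono mult_left_mono)
      show "\<bar>x\<bar> + 1 \<le> exp \<bar>x\<bar>" using exp_ge_add_one_self[of "\<bar>x\<bar>"] by linarith
    qed auto
    also have "\<dots> = \<bar>b\<bar> * (exp 1 * exp (2 * \<bar>x\<bar>))" by (simp add: exp_add[symmetric] algebra_simps)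
    finally have "\<bar>G x\<bar> * \<bar>exp ?y - 1\<bar> \<le> (C * (1 + z0 * exp c) * exp (s * \<bar>x\<bar>)) * (\<bar>b\<bar> * (exp 1 * exp (2 * \<bar>x\<bar>)))"
      using Gb[of x] by (intro mult_mono) (auto intro: order_trans[OF abs_ge_zero])
    also have "\<dots> = w x * \<bar>b\<bar>"
      unfolding w_def distrib_right exp_add by (simp add: mult_ac)
    finally show ?thesis by (simp add: F_def abs_mult[symmetric] algebra_simps)
  qed
  have iG: "integrable gauss G"
  proof (rule Bochner_Integration.integrable_bound)
    show "integrable gauss (\<lambda>x. C * (1 + z0 * exp c) * exp (s * \<bar>x\<bar>))" by (intro integrable_mult_right gauss_exp_abs)
    show "AE x in gauss. norm (G x) \<le> norm (C * (1 + z0 * exp c) * exp (s * \<bar>x\<bar>))"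
      using Gb by (intro AE_I2) (metis order_trans abs_ge_self real_norm_def)
  qed simp
  have Fm[measurable]: "F b \<in> borel_measurable borel" for b unfolding F_def by measurable
  have iF: "integrable gauss (F b)" if "\<bar>b - 0\<bar> < 1" for b
  proof (rule Bochner_Integration.integrable_bound)
    show "integrable gauss (\<lambda>x. \<bar>G x\<bar> + w x)" using iG wi by auto
    have "\<bar>F b x\<bar> \<le> \<bar>\<bar>G x\<bar> + w x\<bar>" for x
    proof -
      have "0 \<le> w x" using C z0 by (simp add: w_def)
      then have "w x * \<bar>b - 0\<bar> \<le> w x * 1" using that by (intro mult_left_mono) auto
      then show ?thesis using lip[OF that, of x] by (simp add: F_def)
    qed
    then show "AE x in gauss. norm (F b x) \<le> norm (\<bar>G x\<bar> + w x)" by auto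
  qed simp
  have "((\<lambda>b. LINT x|gauss. F b x) has_real_derivative (LINT x|gauss. G x * x)) (at 0)"
  proof (rule has_real_derivative_integral[OF zero_less_one iF lip wi])
    show "((\<lambda>b. F b x) has_real_derivative G x * x) (at 0)" for x
      unfolding F_def by (auto intro!: derivative_eq_intros)
  qed auto
  then have dF: "((\<lambda>b. LINT x|gauss. F b x) has_real_derivative (LINT x|gauss. G x * x)) (at (ln (z0 / z0) / s))"
    using z0 by simp
  have dl: "((\<lambda>z. ln (z / z0) / s) has_real_derivative 1 / (s * z0)) (at z0)"
    using z0 s by (auto intro!: derivative_eq_intros simp: field_simps)
  have der: "((\<lambda>z. LINT x|gauss. F (ln (z / z0) / s) x) has_real_derivative (LINT x|gauss. G x * x) * (1 / (s * z0))) (at z0)"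
    by (rule DERIV_chain2[OF dF dl])
  have val: "(LINT x|gauss. F (ln (z / z0) / s) x) = (LINT x|gauss. g (z * exp (c + s * x)))" if z: "z \<in> {0<..}" for z
  proof -
    let ?b = "ln (z / z0) / s"
    have "(LINT x|gauss. F ?b x) = (LINT x|gauss. G (x + ?b))"
      unfolding F_def by (rule gauss_shift[symmetric]) simp
    also have "\<dots> = (LINT x|gauss. g (z * exp (c + s * x)))"
    proof (rule Bochner_Integration.integral_cong)
      fix x
      have "s * (x + ?b) = s * x + ln (z / z0)" using s by (simp add: field_simps)
      then have "exp (c + s * (x + ?b)) = exp (c + s * x) * (z / z0)"
        using z z0 by (simp add: exp_add)
      then show "G (x + ?b) = g (z * exp (c + s * x))" using z0 by (simp add: G_def mult.commute)
    qed simp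
    finally show ?thesis .
  qed
  have "((\<lambda>z. LINT x|gauss. g (z * exp (c + s * x))) has_real_derivative (LINT x|gauss. G x * x) * (1 / (s * z0))) (at z0)"
    by (rule has_field_derivative_transform_within_open[OF der open_greaterThan _ val]) (use z0 in auto)
  then show ?thesis by (simp add: G_def mult.commute)
qed

lemma measure_gauss[simp]: "measure gauss UNIV = 1"
  using prob_space.prob_space[OF prob_space_gauss] by simp

context gbm_stopping
begin

text \<open>For standard normal \<open>x\<close>, \<open>z * gk t x\<close> has the law of
  \<open>X z t\<close>. Time and noise are separate arguments so that both can be integrated over a
  product measure.\<close>

definition gk :: "real \<Rightarrow> real \<Rightarrow> real" where
  "gk t x = exp ((m - \<sigma>\<^sup>2 / 2) * t + \<sigma> * sqrt t * x)"

lemma gk_pos[simp]: "0 < gk t x" "0 \<le> gk t x" by (simp_all add: gk_def)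

lemma gk_0[simp]: "gk 0 x = 1" by (simp add: gk_def)

lemma gk_measurable[measurable]: "(\<lambda>q. gk (fst q) (snd q)) \<in> borel_measurable (borel \<Otimes>\<^sub>M borel)"
  "gk t \<in> borel_measurable borel"
  unfolding gk_def by measurable

lemma gk_powr: "gk t x powr \<gamma> = exp (\<gamma> * (m - \<sigma>\<^sup>2 / 2) * t) * exp (\<gamma> * \<sigma> * sqrt t * x)"
  unfolding gk_def by (simp add: exp_powr_real exp_add[symmetric] algebra_simps)

lemma gk_powr_integral:
  assumes "0 \<le> t"
  shows "has_bochner_integral gauss (\<lambda>x. gk t x powr \<gamma>) (exp ((\<gamma> * (m - \<sigma>\<^sup>2 / 2) + \<gamma>\<^sup>2 * \<sigma>\<^sup>2 / 2) * t))"
proof -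
  have "has_bochner_integral gauss (\<lambda>x. exp (\<gamma> * (m - \<sigma>\<^sup>2 / 2) * t) * exp (\<gamma> * \<sigma> * sqrt t * x))
    (exp (\<gamma> * (m - \<sigma>\<^sup>2 / 2) * t) * exp ((\<gamma> * \<sigma> * sqrt t)\<^sup>2 / 2))"
    by (intro has_bochner_integral_mult_right gauss_exp)
  moreover have "exp (\<gamma> * (m - \<sigma>\<^sup>2 / 2) * t) * exp ((\<gamma> * \<sigma> * sqrt t)\<^sup>2 / 2) = exp ((\<gamma> * (m - \<sigma>\<^sup>2 / 2) + \<gamma>\<^sup>2 * \<sigma>\<^sup>2 / 2) * t)"
    unfolding exp_add[symmetric] using assms by (simp add: power_mult_distrib algebra_simps)
  ultimately show ?thesis by (simp add: gk_powr)
qed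

lemma gk_integral: "0 \<le> t \<Longrightarrow> has_bochner_integral gauss (gk t) (exp (m * t))"
  using gk_powr_integral[of t 1] by (simp add: algebra_simps)

lemma gk_root_integral: "0 \<le> t \<Longrightarrow> is_root \<gamma> \<Longrightarrow> has_bochner_integral gauss (\<lambda>x. gk t x powr \<gamma>) (exp (\<delta> * t))"
  using gk_powr_integral[of t \<gamma>] by (simp add: is_root_def)

lemma W_law:
  fixes h :: "real \<Rightarrow> real"
  assumes t: "0 \<le> t" and h: "h \<in> borel_measurable borel"
  shows "(LINT \<omega>|P. h (W t \<omega>)) = (LINT x|gauss. h (sqrt t * x))"
proof (cases "t = 0")
  case True
  have [measurable]: "h \<in> borel_measurable borel" by (rule h)
  have "(LINT \<omega>|P. h (W t \<omega>)) = (LINT \<omega>|P. h 0)"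
  proof (rule integral_cong_AE)
    show "(\<lambda>\<omega>. h (W t \<omega>)) \<in> borel_measurable P" using measurable_compose[OF W_meas[OF t] h] .
    show "AE \<omega> in P. h (W t \<omega>) = h 0" using W_0 by eventually_elim (simp add: True)
  qed simp
  then show ?thesis by (simp add: True prob_space measure_gauss)
next
  case False
  then have t0: "0 < t" using t by simp
  have d: "distributed P lborel (\<lambda>\<omega>. W t \<omega> - W 0 \<omega>) (normal_density 0 (sqrt t))"
    using W_normal[of 0 t] t0 by simp
  have "distributed P lborel (\<lambda>\<omega>. (W t \<omega> - W 0 \<omega> - 0) / sqrt t) std_normal_density"
    using normal_standard_normal_convert[of "sqrt t" "\<lambda>\<omega>. W t \<omega> - W 0 \<omega>" 0] d t0 by simp
  then have "(LINT x|lborel. std_normal_density x * h (sqrt t * x)) = (LINT \<omega>|P. h (sqrt t * ((W t \<omega> - W 0 \<omega> - 0) / sqrt t)))"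
    by (rule distributed_integral) (use h in auto)
  also have "\<dots> = (LINT \<omega>|P. h (W t \<omega>))"
  proof (rule integral_cong_AE)
    show "(\<lambda>\<omega>. h (W t \<omega>)) \<in> borel_measurable P" using measurable_compose[OF W_meas[OF t] h] .
    show "(\<lambda>\<omega>. h (sqrt t * ((W t \<omega> - W 0 \<omega> - 0) / sqrt t))) \<in> borel_measurable P"
      by (rule measurable_compose[OF _ h]) (use t in \<open>intro borel_measurable_times borel_measurable_divide borel_measurable_diff borel_measurable_const W_meas; simp\<close>)
    show "AE \<omega> in P. h (sqrt t * ((W t \<omega> - W 0 \<omega> - 0) / sqrt t)) = h (W t \<omega>)"
      using W_0 by eventually_elim (use t0 in simp)
  qed
  finally show ?thesis using h by (subst integral_gauss) auto
qed

lemma X_law: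
  fixes f :: "real \<Rightarrow> real"
  assumes t: "0 \<le> t" and z: "0 < z" and f: "(\<lambda>y. indicator {0<..} y * f y) \<in> borel_measurable borel"
  shows "(LINT \<omega>|P. f (X z t \<omega>)) = (LINT x|gauss. f (z * gk t x))"
proof -
  have h: "(\<lambda>w. f (z * exp ((m - \<sigma>\<^sup>2 / 2) * t + \<sigma> * w))) \<in> borel_measurable borel"
    by (rule pos_measurable[OF f]) (use z in auto)
  show ?thesis using W_law[OF t h] by (simp add: X_def gbm_def gk_def mult.assoc)
qed

end

section \<open>The operator Pi as an average over delay and noise\<close>

locale gbm_problem = gbm_stopping P Ft W m \<sigma> \<delta> \<alpha> \<beta> + D: real_distribution D
  for P :: "'a measure" and Ft W m \<sigma> \<delta> \<alpha> \<beta> and D :: "real measure" +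
  fixes p :: real
  assumes p: "0 < p" "p < 1" and D_nonneg: "AE t in D. 0 \<le> t"
begin

sublocale G: prob_space gauss by (rule prob_space_gauss)
sublocale DG: pair_prob_space D gauss ..

text \<open>The joint law of the delay and an independent standard normal variable; one integral
  over \<open>Q\<close> replaces the iterated integral in \<open>Pi_op\<close>.\<close>

definition Q :: "(real \<times> real) measure" where "Q = D \<Otimes>\<^sub>M gauss"

definition disc :: "real \<Rightarrow> real" where "disc t = indicator {0..} t * exp (- \<delta> * t)"

lemma disc_measurable[measurable]: "disc \<in> borel_measurable borel"
  unfolding disc_def by measurable

lemma disc_bounds: "0 \<le> disc t" "disc t \<le> 1"
  using \<delta> by (auto simp: disc_def indicator_def)

lemma Q_measurable_cong[measurable_cong]: "sets Q = sets (borel \<Otimes>\<^sub>M borel)"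
  unfolding Q_def by (intro sets_pair_measure_cong) auto

lemma space_Q[simp]: "space Q = UNIV"
  by (simp add: Q_def space_pair_measure)

lemma Q_integrable:
  assumes f: "f \<in> borel_measurable (borel \<Otimes>\<^sub>M borel)" and nn: "\<And>t x. 0 \<le> f (t, x)"
    and i: "\<And>t. 0 \<le> t \<Longrightarrow> has_bochner_integral gauss (\<lambda>x. f (t, x)) (h t)"
    and i0: "\<And>t x. t < 0 \<Longrightarrow> f (t, x) = 0"
    and b: "\<And>t. 0 \<le> t \<Longrightarrow> h t \<le> (1 :: real)"
  shows "integrable Q f" "(LINT q|Q. f q) \<le> 1"
proof -
  have fm[measurable]: "f \<in> borel_measurable (D \<Otimes>\<^sub>M gauss)"
    using f Q_measurable_cong unfolding Q_def by (auto cong: measurable_cong_sets)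
  have I: "(LINT x|gauss. f (t, x)) = (if 0 \<le> t then h t else 0)" for t
    using i[of t] i0[of t] by (auto simp: has_bochner_integral_iff)
  have hb: "0 \<le> (LINT x|gauss. f (t, x))" "(LINT x|gauss. f (t, x)) \<le> 1" for t
  proof -
    show "0 \<le> (LINT x|gauss. f (t, x))" by (intro Bochner_Integration.integral_nonneg nn)
    show "(LINT x|gauss. f (t, x)) \<le> 1" unfolding I using b[of t] by auto
  qed
  have mI: "(\<lambda>t. LINT x|gauss. f (t, x)) \<in> borel_measurable D" by measurable
  have iI: "integrable D (\<lambda>t. LINT x|gauss. f (t, x))"
    by (rule D.integrable_const_bound[where B=1]) (use hb mI in auto)
  show int: "integrable Q f" unfolding Q_def
  proof (rule DG.Fubini_integrable[OF fm])
    show "integrable D (\<lambda>t. LINT x|gauss. norm (f (t, x)))" using iI nn by simp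
    show "AE t in D. integrable gauss (\<lambda>x. f (t, x))"
    proof (intro AE_I2)
      fix t show "integrable gauss (\<lambda>x. f (t, x))"
      proof (cases "0 \<le> t")
        case True
        then show ?thesis using i[OF True] by (simp add: has_bochner_integral_iff)
      next
        case False
        then have "(\<lambda>x. f (t, x)) = (\<lambda>x. 0)" using i0 by (simp add: fun_eq_iff)
        then show ?thesis by simp
      qed
    qed
  qed
  have "(LINT q|Q. f q) = (LINT t|D. LINT x|gauss. f (t, x))"
    using DG.integral_fst'[OF int[unfolded Q_def]] by (simp add: Q_def)
  also have "\<dots> \<le> (LINT t|D. 1)" by (intro integral_mono iI) (use hb in auto)
  finally show "(LINT q|Q. f q) \<le> 1" using D.prob_space by simp
qed

text \<open>The discounted mean of \<open>f\<close> at the state reached from 1 after the random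
  delay. Other starting points enter by scaling, because \<open>X\<close> is linear in its starting
  point.\<close>

definition Ex :: "(real \<Rightarrow> real) \<Rightarrow> real" where
  "Ex f = (LINT q|Q. disc (fst q) * f (gk (fst q) (snd q)))"

definition Exi :: "(real \<Rightarrow> real) \<Rightarrow> bool" where
  "Exi f \<longleftrightarrow> integrable Q (\<lambda>q. disc (fst q) * f (gk (fst q) (snd q)))"

text \<open>The discount outweighs the mean \<open>exp (m * t)\<close> of \<open>k\<close>, since
  \<open>m < \<delta>\<close>, and exactly cancels the mean \<open>exp (\<delta> * t)\<close> of a
  root power.\<close>

lemma Ex_basic:
  "Exi (\<lambda>_. 1)" "Ex (\<lambda>_. 1) \<le> 1" "Exi (\<lambda>k. k)" "Ex (\<lambda>k. k) \<le> 1"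
  "is_root \<gamma> \<Longrightarrow> Exi (\<lambda>k. k powr \<gamma>)" "is_root \<gamma> \<Longrightarrow> Ex (\<lambda>k. k powr \<gamma>) \<le> 1"
proof -
  have 1: "has_bochner_integral gauss (\<lambda>x. disc (fst (t, x)) * 1) (disc t)" for t
    by (simp add: has_bochner_integral_iff measure_gauss)
  have 2: "has_bochner_integral gauss (\<lambda>x. disc (fst (t, x)) * gk (fst (t, x)) (snd (t, x))) (disc t * exp (m * t))" if "0 \<le> t" for t
    using gk_integral[OF that] by (simp add: has_bochner_integral_mult_right)
  have 3: "has_bochner_integral gauss (\<lambda>x. disc (fst (t, x)) * gk (fst (t, x)) (snd (t, x)) powr \<gamma>) (disc t * exp (\<delta> * t))" if "0 \<le> t" "is_root \<gamma>" for t \<gamma>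
    using gk_root_integral[OF that] by (simp add: has_bochner_integral_mult_right)
  have b2: "disc t * exp (m * t) \<le> 1" if "0 \<le> t" for t
    using that m_less by (simp add: disc_def exp_add[symmetric] mult_right_mono)
  have b3: "disc t * exp (\<delta> * t) \<le> 1" if "0 \<le> t" for t
    using that by (simp add: disc_def exp_add[symmetric])
  have m3: "(\<lambda>q. disc (fst q) * gk (fst q) (snd q) powr \<gamma>) \<in> borel_measurable (borel \<Otimes>\<^sub>M borel)" for \<gamma>
    by measurable
  have z: "disc t = 0" if "t < 0" for t using that by (simp add: disc_def)
  have m1: "(\<lambda>q. disc (fst q) * 1) \<in> borel_measurable (borel \<Otimes>\<^sub>M borel)"
    and m2: "(\<lambda>q. disc (fst q) * gk (fst q) (snd q)) \<in> borel_measurable (borel \<Otimes>\<^sub>M borel)" by measurable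
  note I1 = Q_integrable[where f="\<lambda>q. disc (fst q) * 1" and h=disc, OF m1 _ 1 _ disc_bounds(2)]
  show "Exi (\<lambda>_. 1)" unfolding Exi_def by (rule I1(1)) (simp_all add: z disc_bounds)
  show "Ex (\<lambda>_. 1) \<le> 1" unfolding Ex_def by (rule I1(2)) (simp_all add: z disc_bounds)
  note I2 = Q_integrable[where f="\<lambda>q. disc (fst q) * gk (fst q) (snd q)" and h="\<lambda>t. disc t * exp (m * t)", OF m2 _ 2 _ b2]
  show "Exi (\<lambda>k. k)" unfolding Exi_def by (rule I2(1)) (simp_all add: z disc_bounds)
  show "Ex (\<lambda>k. k) \<le> 1" unfolding Ex_def by (rule I2(2)) (simp_all add: z disc_bounds)
  note I3 = Q_integrable[where f="\<lambda>q. disc (fst q) * gk (fst q) (snd q) powr \<gamma>" and h="\<lambda>t. disc t * exp (\<delta> * t)", OF m3 _ 3 _ b3]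
  show "Exi (\<lambda>k. k powr \<gamma>)" if "is_root \<gamma>" unfolding Exi_def by (rule I3(1)) (simp_all add: z disc_bounds that)
  show "Ex (\<lambda>k. k powr \<gamma>) \<le> 1" if "is_root \<gamma>" unfolding Ex_def by (rule I3(2)) (simp_all add: z disc_bounds that)
qed

lemma Ex_linear: "Exi f \<Longrightarrow> Exi g \<Longrightarrow> Exi (\<lambda>k. a * f k + b * g k)"
  "Exi f \<Longrightarrow> Exi g \<Longrightarrow> Ex (\<lambda>k. a * f k + b * g k) = a * Ex f + b * Ex g"
proof -
  assume fg: "Exi f" "Exi g"
  have eq: "(\<lambda>q. disc (fst q) * (a * f (gk (fst q) (snd q)) + b * g (gk (fst q) (snd q)))) =
     (\<lambda>q. a * (disc (fst q) * f (gk (fst q) (snd q))) + b * (disc (fst q) * g (gk (fst q) (snd q))))"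
    by (simp add: fun_eq_iff algebra_simps)
  show "Exi (\<lambda>k. a * f k + b * g k)" using fg unfolding Exi_def eq by auto
  show "Ex (\<lambda>k. a * f k + b * g k) = a * Ex f + b * Ex g" using fg unfolding Exi_def Ex_def eq by simp
qed

lemma Ex_mono: "Exi f \<Longrightarrow> Exi g \<Longrightarrow> (\<And>k. 0 < k \<Longrightarrow> f k \<le> g k) \<Longrightarrow> Ex f \<le> Ex g"
  unfolding Exi_def Ex_def by (intro integral_mono mult_left_mono) (auto simp: disc_bounds)

lemma Exi_bound:
  assumes f: "(\<lambda>y. indicator {0<..} y * f y) \<in> borel_measurable borel" and g: "Exi g" and le: "\<And>k. 0 < k \<Longrightarrow> \<bar>f k\<bar> \<le> g k"
  shows "Exi f"
  unfolding Exi_def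
proof (rule Bochner_Integration.integrable_bound)
  show "integrable Q (\<lambda>q. disc (fst q) * g (gk (fst q) (snd q)))" using g by (simp add: Exi_def)
  have "(\<lambda>q. f (gk (fst q) (snd q))) \<in> borel_measurable (borel \<Otimes>\<^sub>M borel)"
    by (rule pos_measurable[OF f gk_measurable(1)]) simp
  then have "(\<lambda>q. disc (fst q) * f (gk (fst q) (snd q))) \<in> borel_measurable (borel \<Otimes>\<^sub>M borel)" by measurable
  then show "(\<lambda>q. disc (fst q) * f (gk (fst q) (snd q))) \<in> borel_measurable Q" by (simp cong: measurable_cong_sets add: Q_measurable_cong)
  show "AE q in Q. norm (disc (fst q) * f (gk (fst q) (snd q))) \<le> norm (disc (fst q) * g (gk (fst q) (snd q)))"
  proof (intro AE_I2)
    fix q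
    have "\<bar>f (gk (fst q) (snd q))\<bar> \<le> \<bar>g (gk (fst q) (snd q))\<bar>" using le[of "gk (fst q) (snd q)"] by simp
    then show "norm (disc (fst q) * f (gk (fst q) (snd q))) \<le> norm (disc (fst q) * g (gk (fst q) (snd q)))"
      by (simp add: abs_mult mult_left_mono)
  qed
qed

lemma Ex_H: "Exi H" "0 < z \<Longrightarrow> Exi (\<lambda>k. H (z * k))" "0 < z \<Longrightarrow> Ex (\<lambda>k. H (z * k)) \<le> H z"
proof -
  have H1: "H = (\<lambda>k. 1 * k powr \<alpha> + 1 * k powr (- \<beta>))" by (simp add: H_def fun_eq_iff)
  show "Exi H" unfolding H1 by (intro Ex_linear Ex_basic roots)
  assume z: "0 < z"
  define f where "f k = z powr \<alpha> * k powr \<alpha> + z powr (- \<beta>) * k powr (- \<beta>)" for k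
  have fi: "Exi f" unfolding f_def by (intro Ex_linear Ex_basic roots)
  have eq: "disc (fst q) * H (z * gk (fst q) (snd q)) = disc (fst q) * f (gk (fst q) (snd q))" for q
    using z by (simp add: H_def f_def powr_mult)
  show "Exi (\<lambda>k. H (z * k))" using fi unfolding Exi_def eq .
  have "Ex (\<lambda>k. H (z * k)) = Ex f" unfolding Ex_def eq ..
  also have "\<dots> = z powr \<alpha> * Ex (\<lambda>k. k powr \<alpha>) + z powr (- \<beta>) * Ex (\<lambda>k. k powr (- \<beta>))"
    unfolding f_def by (intro Ex_linear Ex_basic roots)
  also have "\<dots> \<le> z powr \<alpha> * 1 + z powr (- \<beta>) * 1"
    by (intro add_mono mult_left_mono Ex_basic roots) auto
  finally show "Ex (\<lambda>k. H (z * k)) \<le> H z" by (simp add: H_def)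
qed

definition Pi_fun :: "(real \<Rightarrow> real) \<Rightarrow> real \<Rightarrow> real" where
  "Pi_fun g z = Ex (\<lambda>k. p * (1 + z * k) + (1 - p) * g (z * k))"

text \<open>The space with weight \<open>H\<close> on which the averaging is a contraction; values
  off the positive half-line are kept out of both conditions.\<close>

definition admissible :: "(real \<Rightarrow> real) \<Rightarrow> bool" where
  "admissible g \<longleftrightarrow> (\<lambda>y. indicator {0<..} y * g y) \<in> borel_measurable borel \<and> (\<exists>C. \<forall>y>0. \<bar>g y\<bar> \<le> C * H y)"

lemma admissible_scale:
  assumes g: "admissible g" and z: "0 < z"
  shows "Exi (\<lambda>k. g (z * k))"
proof -
  obtain C where C: "\<And>y. 0 < y \<Longrightarrow> \<bar>g y\<bar> \<le> C * H y" using g by (auto simp: admissible_def)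
  show ?thesis
  proof (rule Exi_bound)
    have gm: "(\<lambda>y. indicator {0<..} y * g y) \<in> borel_measurable borel" using g by (simp add: admissible_def)
    have "(\<lambda>k. indicator {0<..} (z * k) * g (z * k)) \<in> borel_measurable borel"
      by (rule measurable_compose[OF _ gm]) simp
    moreover have "indicator {0<..} (z * k) = (indicator {0<..} k :: real)" for k
      using z by (simp add: indicator_def zero_less_mult_iff)
    ultimately show "(\<lambda>y. indicator {0<..} y * g (z * y)) \<in> borel_measurable borel" by simp
    show "Exi (\<lambda>k. C * H (z * k) + 0 * H (z * k))" by (intro Ex_linear Ex_H z)
    show "\<bar>g (z * k)\<bar> \<le> C * H (z * k) + 0 * H (z * k)" if "0 < k" for k using C[of "z * k"] z that by simp
  qed
qed

lemma Exi_affine: "Exi (\<lambda>k. a + b * k)" "Ex (\<lambda>k. a + b * k) = a * Ex (\<lambda>_. 1) + b * Ex (\<lambda>k. k)"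
  using Ex_linear[OF Ex_basic(1,3), of a b] by simp_all

lemma Pi_fun_integrand:
  assumes "admissible g" "0 < z"
  shows "Exi (\<lambda>k. p * (1 + z * k) + (1 - p) * g (z * k))"
  using Ex_linear(1)[OF Exi_affine(1)[of 1 z] admissible_scale[OF assms], of p "1 - p"] .

text \<open>An error \<open>a + b * k\<close> averages to at most \<open>a + b\<close>, and only the
  share \<open>1 - p\<close> of the payoff feels it. The maximum with 0 appears because the mean of
  \<open>k\<close> is bounded by 1 only from above, while \<open>p * (x - y)\<close> may be
  negative.\<close>

lemma Pi_fun_compare:
  assumes g: "admissible g1" "admissible g2" and xy: "0 < x" "0 < y" and ab: "0 \<le> a" "0 \<le> b"
    and le: "\<And>k. 0 < k \<Longrightarrow> g1 (x * k) \<le> g2 (y * k) + a + b * k"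
  shows "Pi_fun g1 x \<le> Pi_fun g2 y + (1 - p) * a + max 0 (p * (x - y) + (1 - p) * b)"
proof -
  let ?c = "max 0 (p * (x - y) + (1 - p) * b)"
  have "Pi_fun g1 x \<le> Ex (\<lambda>k. 1 * (p * (1 + y * k) + (1 - p) * g2 (y * k)) + 1 * ((1 - p) * a + ?c * k))"
    unfolding Pi_fun_def
  proof (rule Ex_mono)
    show "Exi (\<lambda>k. p * (1 + x * k) + (1 - p) * g1 (x * k))" by (rule Pi_fun_integrand[OF g(1) xy(1)])
    show "Exi (\<lambda>k. 1 * (p * (1 + y * k) + (1 - p) * g2 (y * k)) + 1 * ((1 - p) * a + ?c * k))"
      by (intro Ex_linear(1) Pi_fun_integrand g xy Exi_affine)
    fix k :: real assume k: "0 < k"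
    have "(1 - p) * g1 (x * k) \<le> (1 - p) * (g2 (y * k) + a + b * k)" using le[OF k] p by (intro mult_left_mono) auto
    moreover have "(p * (x - y) + (1 - p) * b) * k \<le> ?c * k" using k by (intro mult_right_mono) auto
    ultimately show "p * (1 + x * k) + (1 - p) * g1 (x * k) \<le> 1 * (p * (1 + y * k) + (1 - p) * g2 (y * k)) + 1 * ((1 - p) * a + ?c * k)"
      by (simp add: algebra_simps)
  qed
  also have "\<dots> = 1 * Pi_fun g2 y + 1 * Ex (\<lambda>k. (1 - p) * a + ?c * k)"
    unfolding Pi_fun_def by (intro Ex_linear(2) Pi_fun_integrand g xy Exi_affine)
  also have "Ex (\<lambda>k. (1 - p) * a + ?c * k) \<le> (1 - p) * a * 1 + ?c * 1"
    unfolding Exi_affine(2) using p ab by (intro add_mono mult_left_mono Ex_basic) auto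
  finally show ?thesis by simp
qed

text \<open>The contraction: only the share \<open>1 - p\<close> of the payoff depends on the
  function, and averaging does not increase \<open>H\<close>.\<close>

lemma Pi_fun_compare_H:
  assumes g: "admissible g1" "admissible g2" and z: "0 < z" and c: "0 \<le> c"
    and le: "\<And>y. 0 < y \<Longrightarrow> g1 y \<le> g2 y + c * H y"
  shows "Pi_fun g1 z \<le> Pi_fun g2 z + (1 - p) * c * H z"
proof -
  have "Pi_fun g1 z \<le> Ex (\<lambda>k. 1 * (p * (1 + z * k) + (1 - p) * g2 (z * k)) + ((1 - p) * c) * H (z * k))"
    unfolding Pi_fun_def
  proof (rule Ex_mono)
    show "Exi (\<lambda>k. p * (1 + z * k) + (1 - p) * g1 (z * k))" by (rule Pi_fun_integrand[OF g(1) z])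
    show "Exi (\<lambda>k. 1 * (p * (1 + z * k) + (1 - p) * g2 (z * k)) + ((1 - p) * c) * H (z * k))"
      by (intro Ex_linear(1) Pi_fun_integrand g z Ex_H)
    fix k :: real assume k: "0 < k"
    have "(1 - p) * g1 (z * k) \<le> (1 - p) * (g2 (z * k) + c * H (z * k))" using le[of "z * k"] z k p by (intro mult_left_mono) auto
    then show "p * (1 + z * k) + (1 - p) * g1 (z * k) \<le> 1 * (p * (1 + z * k) + (1 - p) * g2 (z * k)) + ((1 - p) * c) * H (z * k)"
      by (simp add: algebra_simps)
  qed
  also have "\<dots> = 1 * Pi_fun g2 z + ((1 - p) * c) * Ex (\<lambda>k. H (z * k))"
    unfolding Pi_fun_def by (intro Ex_linear(2) Pi_fun_integrand g z Ex_H)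
  also have "\<dots> \<le> 1 * Pi_fun g2 z + ((1 - p) * c) * H z" using p c by (intro add_left_mono mult_left_mono Ex_H z) auto
  finally show ?thesis by simp
qed

lemma Pi_fun_measurable:
  assumes g: "admissible g"
  shows "(\<lambda>z. indicator {0<..} z * Pi_fun g z) \<in> borel_measurable borel"
proof -
  define g' where "g' y = indicator {0<..} y * g y" for y
  have [measurable]: "g' \<in> borel_measurable borel" using g unfolding admissible_def g'_def by simp
  have "prob_space Q" unfolding Q_def using D.prob_space_axioms G.prob_space_axioms by (rule prob_space_pair)
  then interpret DGQ: prob_space Q .
  have "(\<lambda>(z, q). disc (fst q) * (p * (1 + z * gk (fst q) (snd q)) + (1 - p) * g' (z * gk (fst q) (snd q)))) \<in> borel_measurable (borel \<Otimes>\<^sub>M Q)"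
  proof -
    have [measurable]: "(\<lambda>x. gk (fst (snd x)) (snd (snd x))) \<in> borel_measurable (borel \<Otimes>\<^sub>M Q)"
      by (rule measurable_compose[OF measurable_snd]) (simp cong: measurable_cong_sets add: Q_measurable_cong)
    have [measurable]: "(\<lambda>x. disc (fst (snd x))) \<in> borel_measurable (borel \<Otimes>\<^sub>M Q)"
      by (rule measurable_compose[OF measurable_snd]) (simp cong: measurable_cong_sets add: Q_measurable_cong)
    show ?thesis unfolding case_prod_beta by measurable
  qed
  from DGQ.borel_measurable_lebesgue_integral[OF this]
  have [measurable]: "(\<lambda>z. LINT q|Q. disc (fst q) * (p * (1 + z * gk (fst q) (snd q)) + (1 - p) * g' (z * gk (fst q) (snd q)))) \<in> borel_measurable borel" .
  have "(\<lambda>z. indicator {0<..} z * Pi_fun g z) =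
     (\<lambda>z. indicator {0<..} z * (LINT q|Q. disc (fst q) * (p * (1 + z * gk (fst q) (snd q)) + (1 - p) * g' (z * gk (fst q) (snd q)))))"
  proof
    fix z
    show "indicator {0<..} z * Pi_fun g z =
     indicator {0<..} z * (LINT q|Q. disc (fst q) * (p * (1 + z * gk (fst q) (snd q)) + (1 - p) * g' (z * gk (fst q) (snd q))))"
    proof (cases "0 < z")
      case True
      then have "g' (z * gk (fst q) (snd q)) = g (z * gk (fst q) (snd q))" for q by (simp add: g'_def)
      then show ?thesis by (simp add: Pi_fun_def Ex_def)
    qed simp
  qed
  then show ?thesis by simp
qed

lemma Pi_fun_bound:
  assumes g: "admissible g"
  shows "\<exists>C. \<forall>z>0. \<bar>Pi_fun g z\<bar> \<le> C * H z"
proof -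
  obtain C where C: "\<And>y. 0 < y \<Longrightarrow> \<bar>g y\<bar> \<le> C * H y" using g by (auto simp: admissible_def)
  have C0: "0 \<le> C" using C[of 1] H_pos[of 1] by (smt (verit) zero_le_mult_iff)
  have "\<bar>Pi_fun g z\<bar> \<le> (2 * p + C) * H z" if z: "0 < z" for z
  proof -
    have b: "\<bar>p * (1 + y) + (1 - p) * g y\<bar> \<le> (2 * p + C) * H y" if y: "0 < y" for y
    proof -
      have "\<bar>p * (1 + y) + (1 - p) * g y\<bar> \<le> p * (1 + y) + (1 - p) * \<bar>g y\<bar>"
        using p y by (intro order_trans[OF abs_triangle_ineq]) (simp add: abs_mult)
      also have "\<dots> \<le> p * (2 * H y) + 1 * (C * H y)"
        using H_ge[OF y] C[OF y] p C0 H_pos[OF y] by (intro add_mono mult_left_mono mult_mono) auto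
      finally show ?thesis by (simp add: algebra_simps)
    qed
    have i: "Exi (\<lambda>k. p * (1 + z * k) + (1 - p) * g (z * k))" by (rule Pi_fun_integrand[OF g z])
    have iH: "Exi (\<lambda>k. (2 * p + C) * H (z * k) + 0 * H (z * k))" "Exi (\<lambda>k. (- (2 * p + C)) * H (z * k) + 0 * H (z * k))"
      by (intro Ex_linear Ex_H z)+
    have E: "Ex (\<lambda>k. c * H (z * k) + 0 * H (z * k)) = c * Ex (\<lambda>k. H (z * k)) + 0 * Ex (\<lambda>k. H (z * k))" for c
      by (intro Ex_linear Ex_H z)
    have up: "Pi_fun g z \<le> (2 * p + C) * Ex (\<lambda>k. H (z * k))"
      proof -
      have "p * (1 + z * k) + (1 - p) * g (z * k) \<le> (2 * p + C) * H (z * k) + 0 * H (z * k)" if "0 < k" for k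
        using b[of "z * k"] z that by (simp add: abs_le_iff)
      from Ex_mono[OF i iH(1) this] show ?thesis unfolding E Pi_fun_def by simp
    qed
    have low: "- (2 * p + C) * Ex (\<lambda>k. H (z * k)) \<le> Pi_fun g z"
    proof -
      have "- (2 * p + C) * H (z * k) + 0 * H (z * k) \<le> p * (1 + z * k) + (1 - p) * g (z * k)" if "0 < k" for k
        using b[of "z * k"] z that by (smt (verit, best) mult_minus_left mult_pos_pos mult_zero_left)
      from Ex_mono[OF iH(2) i this] show ?thesis unfolding E Pi_fun_def by simp
    qed
    have "(2 * p + C) * Ex (\<lambda>k. H (z * k)) \<le> (2 * p + C) * H z" using p C0 by (intro mult_left_mono Ex_H z) auto
    moreover have "- (2 * p + C) * Ex (\<lambda>k. H (z * k)) = - ((2 * p + C) * Ex (\<lambda>k. H (z * k)))" by (simp add: algebra_simps)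
    ultimately show ?thesis using up low by linarith
  qed
  then show ?thesis by blast
qed

text \<open>Otherwise the discount factor would vanish almost surely, although it is positive on
  \<open>[0, \<infinity>)\<close>, where the delay lives.\<close>

lemma Ex_pos: "0 < Ex (\<lambda>k. k)"
proof -
  have nn: "0 \<le> disc (fst q) * gk (fst q) (snd q)" for q by (simp add: disc_bounds)
  have i: "integrable Q (\<lambda>q. disc (fst q) * gk (fst q) (snd q))" using Ex_basic(3) by (simp add: Exi_def)
  have "Ex (\<lambda>k. k) \<noteq> 0"
  proof
    assume "Ex (\<lambda>k. k) = 0"
    then have "AE q in Q. disc (fst q) * gk (fst q) (snd q) = 0"
      using integral_nonneg_eq_0_iff_AE[OF i] nn by (simp add: Ex_def)
    then have z: "AE q in Q. disc (fst q) = 0" by eventually_elim (simp add: less_imp_neq[symmetric] neq_iff)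
    have "Ex (\<lambda>_. 1) = 0" unfolding Ex_def using z by (subst integral_cong_AE[of _ _ "\<lambda>_. 0"]) (auto simp: Q_measurable_cong cong: measurable_cong_sets)
    moreover have "Ex (\<lambda>_. 1) = (LINT t|D. disc t)"
    proof -
      have "Ex (\<lambda>_. 1) = (LINT t|D. LINT x|gauss. disc t * 1)"
        using DG.integral_fst'[of "\<lambda>q. disc (fst q) * 1"] Ex_basic(1) unfolding Ex_def Exi_def Q_def by simp
      then show ?thesis by (simp add: measure_gauss)
    qed
    ultimately have "(LINT t|D. disc t) = 0" by simp
    moreover have "integrable D disc" by (rule D.integrable_const_bound[where B=1]) (use disc_bounds in auto)
    ultimately have "AE t in D. disc t = 0" using integral_nonneg_eq_0_iff_AE[of D disc] disc_bounds by auto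
    then have "AE t in D. False" using D_nonneg by eventually_elim (simp add: disc_def)
    then show False using D.AE_False by simp
  qed
  moreover have "0 \<le> Ex (\<lambda>k. k)" unfolding Ex_def by (intro Bochner_Integration.integral_nonneg nn)
  ultimately show ?thesis by simp
qed

end

subsection \<open>Differentiability of the averaged payoff\<close>

lemma integral_abs_le:
  fixes f g :: "'a \<Rightarrow> real"
  assumes "integrable M f" "integrable M g" "\<And>x. \<bar>f x\<bar> \<le> g x"
  shows "\<bar>LINT x|M. f x\<bar> \<le> (LINT x|M. g x)"
proof -
  have "(LINT x|M. f x) \<le> (LINT x|M. g x)"
    by (rule integral_mono[OF assms(1,2) abs_le_D1[OF assms(3)]])
  moreover have "(LINT x|M. - f x) \<le> (LINT x|M. g x)"
    by (rule integral_mono[OF integrable_minus[OF assms(1)] assms(2) abs_le_D2[OF assms(3)]])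
  ultimately show ?thesis by simp
qed

context gbm_problem
begin

lemma Ex_iterated:
  assumes "Exi f"
  shows "Ex f = (LINT t|D. disc t * (LINT x|gauss. f (gk t x)))"
  using DG.integral_fst'[of "\<lambda>q. disc (fst q) * f (gk (fst q) (snd q))"] assms
  unfolding Ex_def Exi_def Q_def by simp

definition psi :: "(real \<Rightarrow> real) \<Rightarrow> real \<Rightarrow> real \<Rightarrow> real" where
  "psi f t z = (LINT x|gauss. f (z * gk t x))"

text \<open>The contribution of strictly positive delays, where Gaussian smoothing takes
  place.\<close>

definition S :: "(real \<Rightarrow> real) \<Rightarrow> real \<Rightarrow> real" where
  "S f z = (LINT t|D. indicator {0<..} t * exp (- \<delta> * t) * psi f t z)"

text \<open>Functions that get smoothed, not smooth ones. The Lipschitz constant is fixed to 1, the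
  one that the payoff built from \<open>u\<close> will have.\<close>

definition smooth_class :: "(real \<Rightarrow> real) \<Rightarrow> bool" where
  "smooth_class f \<longleftrightarrow> (\<lambda>y. indicator {0<..} y * f y) \<in> borel_measurable borel \<and>
     (\<forall>x>0. \<forall>y>0. \<bar>f x - f y\<bar> \<le> \<bar>x - y\<bar>) \<and> (\<exists>C. \<forall>y>0. \<bar>f y\<bar> \<le> C * (1 + y))"

lemma smooth_class_measurable:
  assumes f: "smooth_class f" and z: "0 < z"
  shows "(\<lambda>q. f (z * gk (fst q) (snd q))) \<in> borel_measurable (D \<Otimes>\<^sub>M gauss)"
    "(\<lambda>x. f (z * gk t x)) \<in> borel_measurable borel"
proof -
  have m: "(\<lambda>y. indicator {0<..} y * f y) \<in> borel_measurable borel" using f by (simp add: smooth_class_def)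
  have "(\<lambda>q. f (z * gk (fst q) (snd q))) \<in> borel_measurable (borel \<Otimes>\<^sub>M borel)"
    by (rule pos_measurable[OF m]) (use z in auto)
  then show "(\<lambda>q. f (z * gk (fst q) (snd q))) \<in> borel_measurable (D \<Otimes>\<^sub>M gauss)"
    using Q_measurable_cong unfolding Q_def by (auto cong: measurable_cong_sets)
  show "(\<lambda>x. f (z * gk t x)) \<in> borel_measurable borel" by (rule pos_measurable[OF m]) (use z in auto)
qed

lemma gk_integrable: "0 \<le> t \<Longrightarrow> integrable gauss (gk t)" "0 \<le> t \<Longrightarrow> (LINT x|gauss. gk t x) = exp (m * t)"
  using gk_integral by (auto simp: has_bochner_integral_iff)

lemma psi_bounds:
  assumes f: "smooth_class f" and t: "0 \<le> t"
  shows "0 < z \<Longrightarrow> integrable gauss (\<lambda>x. f (z * gk t x))"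
    and "0 < z \<Longrightarrow> 0 < y \<Longrightarrow> \<bar>psi f t z - psi f t y\<bar> \<le> exp (m * t) * \<bar>z - y\<bar>"
proof -
  obtain C where C: "\<And>y. 0 < y \<Longrightarrow> \<bar>f y\<bar> \<le> C * (1 + y)" using f by (auto simp: smooth_class_def)
  have i: "integrable gauss (\<lambda>x. f (z * gk t x))" if z: "0 < z" for z
  proof (rule Bochner_Integration.integrable_bound)
    show "integrable gauss (\<lambda>x. C * (1 + z * gk t x))" using gk_integrable(1)[OF t] by simp
    show "(\<lambda>x. f (z * gk t x)) \<in> borel_measurable gauss" using smooth_class_measurable(2)[OF f z] by simp
    show "AE x in gauss. norm (f (z * gk t x)) \<le> norm (C * (1 + z * gk t x))"
    proof (intro AE_I2)
      fix x
      have "\<bar>f (z * gk t x)\<bar> \<le> C * (1 + z * gk t x)" using z by (intro C) simp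
      then show "norm (f (z * gk t x)) \<le> norm (C * (1 + z * gk t x))" by simp
    qed
  qed
  show "0 < z \<Longrightarrow> integrable gauss (\<lambda>x. f (z * gk t x))" by (rule i)
  assume z: "0 < z" and y: "0 < y"
  have "\<bar>psi f t z - psi f t y\<bar> = \<bar>LINT x|gauss. f (z * gk t x) - f (y * gk t x)\<bar>"
    unfolding psi_def using i[OF z] i[OF y] by simp
  also have "\<dots> \<le> (LINT x|gauss. \<bar>z - y\<bar> * gk t x)"
  proof (rule integral_abs_le)
    show "integrable gauss (\<lambda>x. f (z * gk t x) - f (y * gk t x))" using i[OF z] i[OF y] by simp
    show "integrable gauss (\<lambda>x. \<bar>z - y\<bar> * gk t x)" using gk_integrable(1)[OF t] by simp
    fix x
    have "\<bar>f (z * gk t x) - f (y * gk t x)\<bar> \<le> \<bar>z * gk t x - y * gk t x\<bar>"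
      using f z y by (simp add: smooth_class_def)
    also have "\<dots> = \<bar>z - y\<bar> * gk t x" by (simp add: left_diff_distrib[symmetric] abs_mult)
    finally show "\<bar>f (z * gk t x) - f (y * gk t x)\<bar> \<le> \<bar>z - y\<bar> * gk t x" .
  qed
  also have "\<dots> = exp (m * t) * \<bar>z - y\<bar>" using gk_integrable(2)[OF t] by simp
  finally show "\<bar>psi f t z - psi f t y\<bar> \<le> exp (m * t) * \<bar>z - y\<bar>" .
qed

definition psi' :: "(real \<Rightarrow> real) \<Rightarrow> real \<Rightarrow> real \<Rightarrow> real" where
  "psi' f t z = (1 / (\<sigma> * sqrt t * z)) * (LINT x|gauss. f (z * gk t x) * x)"

text \<open>The formula for \<open>psi'\<close> contains the factor \<open>1 / sqrt t\<close>. The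
  bound \<open>exp (m * t)\<close>, read off from the Lipschitz constant of \<open>psi\<close>,
  stays finite as \<open>t\<close> tends to 0 and allows integration over any delay law.\<close>

lemma psi_derivative:
  assumes f: "smooth_class f" and t: "0 < t" and z: "0 < z"
  shows "(psi f t has_real_derivative psi' f t z) (at z)" "\<bar>psi' f t z\<bar> \<le> exp (m * t)"
proof -
  obtain C where C: "\<And>y. 0 < y \<Longrightarrow> \<bar>f y\<bar> \<le> C * (1 + y)" using f by (auto simp: smooth_class_def)
  have m: "(\<lambda>y. indicator {0<..} y * f y) \<in> borel_measurable borel" using f by (simp add: smooth_class_def)
  have s: "0 < \<sigma> * sqrt t" using \<sigma> t by simp
  show d: "(psi f t has_real_derivative psi' f t z) (at z)"
    using gauss_smoothing_derivative[OF m C s z, of "(m - \<sigma>\<^sup>2 / 2) * t"]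
    unfolding psi_def[abs_def] psi'_def gk_def .
  show "\<bar>psi' f t z\<bar> \<le> exp (m * t)"
  proof (rule lipschitz_derivative_bound[OF d z])
    fix x assume "\<bar>x - z\<bar> < z"
    then have "0 < x" by linarith
    then show "\<bar>psi f t x - psi f t z\<bar> \<le> exp (m * t) * \<bar>x - z\<bar>" using psi_bounds(2)[OF f _ _ z] t by simp
  qed
qed

lemma psi'_continuous:
  assumes f: "smooth_class f" and t: "0 < t"
  shows "continuous_on {0<..} (psi' f t)"
proof -
  obtain C where C: "\<And>y. 0 < y \<Longrightarrow> \<bar>f y\<bar> \<le> C * (1 + y)" using f by (auto simp: smooth_class_def)
  define L where "L = (LINT x|gauss. gk t x * \<bar>x\<bar>)"
  define J where "J z = (LINT x|gauss. f (z * gk t x) * x)" for z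
  have gb: "gk t x * \<bar>x\<bar> \<le> exp ((m - \<sigma>\<^sup>2 / 2) * t) * exp ((\<sigma> * sqrt t + 1) * \<bar>x\<bar>)"
    "\<bar>x\<bar> \<le> exp (1 * \<bar>x\<bar>)" for x
  proof -
    have "\<sigma> * sqrt t * x \<le> \<sigma> * sqrt t * \<bar>x\<bar>" using \<sigma> t by (intro mult_left_mono) auto
    then have 1: "gk t x \<le> exp ((m - \<sigma>\<^sup>2 / 2) * t) * exp (\<sigma> * sqrt t * \<bar>x\<bar>)"
      unfolding gk_def exp_add[symmetric] by simp
    have 2: "\<bar>x\<bar> \<le> exp \<bar>x\<bar>" using exp_ge_add_one_self[of "\<bar>x\<bar>"] by linarith
    then show "\<bar>x\<bar> \<le> exp (1 * \<bar>x\<bar>)" by simp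
    have "gk t x * \<bar>x\<bar> \<le> (exp ((m - \<sigma>\<^sup>2 / 2) * t) * exp (\<sigma> * sqrt t * \<bar>x\<bar>)) * exp \<bar>x\<bar>"
      using 1 2 by (intro mult_mono) auto
    then show "gk t x * \<bar>x\<bar> \<le> exp ((m - \<sigma>\<^sup>2 / 2) * t) * exp ((\<sigma> * sqrt t + 1) * \<bar>x\<bar>)"
      by (simp add: mult.assoc exp_add[symmetric] distrib_right add.assoc)
  qed
  have ix: "integrable gauss (\<lambda>x. \<bar>x\<bar>)"
    by (rule Bochner_Integration.integrable_bound[OF gauss_exp_abs[of 1]]) (use gb(2) in auto)
  have ig: "integrable gauss (\<lambda>x. gk t x * \<bar>x\<bar>)"
  proof (rule Bochner_Integration.integrable_bound)
    show "integrable gauss (\<lambda>x. exp ((m - \<sigma>\<^sup>2 / 2) * t) * exp ((\<sigma> * sqrt t + 1) * \<bar>x\<bar>))"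
      by (intro integrable_mult_right gauss_exp_abs)
    have "(\<lambda>x. gk t x * \<bar>x\<bar>) \<in> borel_measurable borel" by measurable
    then show "(\<lambda>x. gk t x * \<bar>x\<bar>) \<in> borel_measurable gauss" by simp
    show "AE x in gauss. norm (gk t x * \<bar>x\<bar>) \<le> norm (exp ((m - \<sigma>\<^sup>2 / 2) * t) * exp ((\<sigma> * sqrt t + 1) * \<bar>x\<bar>))"
      using gb(1) by (intro AE_I2) (simp add: abs_mult)
  qed
  have i: "integrable gauss (\<lambda>x. f (z * gk t x) * x)" if z: "0 < z" for z
  proof (rule Bochner_Integration.integrable_bound)
    show "integrable gauss (\<lambda>x. C * \<bar>x\<bar> + C * z * (gk t x * \<bar>x\<bar>))" using ix ig by simp
    have "(\<lambda>x. f (z * gk t x) * x) \<in> borel_measurable borel" using smooth_class_measurable(2)[OF f z] by measurable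
    then show "(\<lambda>x. f (z * gk t x) * x) \<in> borel_measurable gauss" by simp
    show "AE x in gauss. norm (f (z * gk t x) * x) \<le> norm (C * \<bar>x\<bar> + C * z * (gk t x * \<bar>x\<bar>))"
    proof (intro AE_I2)
      fix x
      have "\<bar>f (z * gk t x)\<bar> * \<bar>x\<bar> \<le> C * (1 + z * gk t x) * \<bar>x\<bar>" using z by (intro mult_right_mono C) auto
      then show "norm (f (z * gk t x) * x) \<le> norm (C * \<bar>x\<bar> + C * z * (gk t x * \<bar>x\<bar>))"
        by (simp add: abs_mult algebra_simps)
    qed
  qed
  have lip: "\<bar>J z - J y\<bar> \<le> L * \<bar>z - y\<bar>" if z: "0 < z" and y: "0 < y" for z y
  proof -
    have "\<bar>J z - J y\<bar> = \<bar>LINT x|gauss. f (z * gk t x) * x - f (y * gk t x) * x\<bar>"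
      unfolding J_def using i[OF z] i[OF y] by simp
    also have "\<dots> \<le> (LINT x|gauss. \<bar>z - y\<bar> * (gk t x * \<bar>x\<bar>))"
    proof (rule integral_abs_le)
      show "integrable gauss (\<lambda>x. f (z * gk t x) * x - f (y * gk t x) * x)" using i[OF z] i[OF y] by simp
      show "integrable gauss (\<lambda>x. \<bar>z - y\<bar> * (gk t x * \<bar>x\<bar>))" using ig by simp
      fix x
      have "\<bar>f (z * gk t x) - f (y * gk t x)\<bar> \<le> \<bar>z * gk t x - y * gk t x\<bar>"
        using f z y by (simp add: smooth_class_def)
      also have "\<dots> = \<bar>z - y\<bar> * gk t x" by (simp add: left_diff_distrib[symmetric] abs_mult)
      finally have "\<bar>f (z * gk t x) - f (y * gk t x)\<bar> * \<bar>x\<bar> \<le> \<bar>z - y\<bar> * gk t x * \<bar>x\<bar>" by (intro mult_right_mono) auto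
      then show "\<bar>f (z * gk t x) * x - f (y * gk t x) * x\<bar> \<le> \<bar>z - y\<bar> * (gk t x * \<bar>x\<bar>)"
        by (simp add: abs_mult[symmetric] left_diff_distrib mult.assoc)
    qed
    finally show ?thesis by (simp add: L_def mult.commute)
  qed
  have "0 \<le> L" unfolding L_def by (intro Bochner_Integration.integral_nonneg) simp
  then have "L-lipschitz_on {0<..} J" using lip by (intro lipschitz_onI) (auto simp: dist_real_def)
  then have "continuous_on {0<..} J" by (rule lipschitz_on_continuous_on)
  then show ?thesis unfolding psi'_def[abs_def] J_def using \<sigma> t by (intro continuous_intros) auto
qed

text \<open>Since \<open>exp (- \<delta> * t) * exp (m * t) \<le> 1\<close>, the discounted
  integrand is 1-Lipschitz in \<open>z\<close> with derivative at most 1 in modulus, for every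
  delay. The constant 1 is integrable, so dominated convergence gives both the derivative and its
  continuity.\<close>

lemma S_C1:
  assumes f: "smooth_class f"
  shows "\<exists>S'. continuous_on {0<..} S' \<and> (\<forall>z>0. (S f has_real_derivative S' z) (at z))"
    "0 < z \<Longrightarrow> integrable D (\<lambda>t. indicator {0<..} t * exp (- \<delta> * t) * psi f t z)"
proof -
  obtain C where C: "\<And>y. 0 < y \<Longrightarrow> \<bar>f y\<bar> \<le> C * (1 + y)" using f by (auto simp: smooth_class_def)
  have C0: "0 \<le> C" using C[of 1] by simp
  define phi where "phi z t = indicator {0<..} t * exp (- \<delta> * t) * psi f t z" for z t :: real
  define phi' where "phi' z t = indicator {0<..} t * exp (- \<delta> * t) * psi' f t z" for z t :: real
  have e1: "exp (- \<delta> * t) * exp (m * t) \<le> 1" if "0 < t" for t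
    using that m_less by (simp add: exp_add[symmetric] mult_right_mono)
  have psim: "(\<lambda>t. psi f t z) \<in> borel_measurable D" if z: "0 < z" for z
    using G.borel_measurable_lebesgue_integral[of "\<lambda>t x. f (z * gk t x)" D] smooth_class_measurable(1)[OF f z]
    unfolding psi_def by (simp add: case_prod_beta')
  have psi'm: "(\<lambda>t. psi' f t z) \<in> borel_measurable D" if z: "0 < z" for z
  proof -
    have "(\<lambda>q. f (z * gk (fst q) (snd q)) * snd q) \<in> borel_measurable (D \<Otimes>\<^sub>M gauss)"
      using smooth_class_measurable(1)[OF f z] by measurable
    then have [measurable]: "(\<lambda>t. LINT x|gauss. f (z * gk t x) * x) \<in> borel_measurable D"
      using G.borel_measurable_lebesgue_integral[of "\<lambda>t x. f (z * gk t x) * x" D] by (simp add: case_prod_beta')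
    show ?thesis unfolding psi'_def by measurable
  qed
  have phim: "phi z \<in> borel_measurable D" if z: "0 < z" for z
    unfolding phi_def using psim[OF z] by measurable
  have phi'm: "phi' z \<in> borel_measurable D" if z: "0 < z" for z
    unfolding phi'_def using psi'm[OF z] by measurable
  have phi'b: "\<bar>phi' z t\<bar> \<le> 1" if z: "0 < z" for z t
  proof (cases "0 < t")
    case True
    have "exp (- \<delta> * t) * \<bar>psi' f t z\<bar> \<le> exp (- \<delta> * t) * exp (m * t)"
      using psi_derivative(2)[OF f True z] by (intro mult_left_mono) auto
    also have "\<dots> \<le> 1" by (rule e1[OF True])
    finally show ?thesis using True by (simp add: phi'_def abs_mult)
  qed (simp add: phi'_def)
  have lip: "\<bar>phi z t - phi y t\<bar> \<le> 1 * \<bar>z - y\<bar>" if z: "0 < z" and y: "0 < y" for z y t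
  proof (cases "0 < t")
    case True
    have "exp (- \<delta> * t) * \<bar>psi f t z - psi f t y\<bar> \<le> exp (- \<delta> * t) * (exp (m * t) * \<bar>z - y\<bar>)"
      using psi_bounds(2)[OF f _ z y] True by (intro mult_left_mono) auto
    also have "\<dots> \<le> 1 * \<bar>z - y\<bar>" unfolding mult.assoc[symmetric] using e1[OF True] by (intro mult_right_mono) auto
    finally have "\<bar>exp (- \<delta> * t) * (psi f t z - psi f t y)\<bar> \<le> 1 * \<bar>z - y\<bar>" by (simp add: abs_mult)
    then show ?thesis using True by (simp add: phi_def right_diff_distrib)
  qed (simp add: phi_def)
  have phi_i: "integrable D (phi z)" if z: "0 < z" for z
  proof (rule D.integrable_const_bound[where B="C * (1 + z)"])
    show "AE t in D. norm (phi z t) \<le> C * (1 + z)"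
    proof (intro AE_I2)
      fix t
      show "norm (phi z t) \<le> C * (1 + z)"
      proof (cases "0 < t")
        case True
        have "\<bar>psi f t z\<bar> \<le> (LINT x|gauss. C * (1 + z * gk t x))" unfolding psi_def
        proof (rule integral_abs_le)
          show "integrable gauss (\<lambda>x. f (z * gk t x))" using psi_bounds(1)[OF f _ z] True by simp
          show "integrable gauss (\<lambda>x. C * (1 + z * gk t x))" using gk_integrable(1)[of t] True by simp
          show "\<bar>f (z * gk t x)\<bar> \<le> C * (1 + z * gk t x)" for x using z by (intro C) simp
        qed
        also have "\<dots> = C * (1 + z * exp (m * t))" using gk_integrable[of t] True by simp
        finally have "exp (- \<delta> * t) * \<bar>psi f t z\<bar> \<le> exp (- \<delta> * t) * (C * (1 + z * exp (m * t)))" by (intro mult_left_mono) auto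
        also have "\<dots> = C * (exp (- \<delta> * t) + z * (exp (- \<delta> * t) * exp (m * t)))" by (simp add: algebra_simps)
        also have "\<dots> \<le> C * (1 + z * 1)" using True \<delta> z e1[OF True] C0 by (intro mult_left_mono add_mono) auto
        finally show ?thesis using True by (simp add: phi_def abs_mult)
      qed (use C0 z in \<open>simp add: phi_def\<close>)
    qed
  qed (rule phim[OF z])
  show "0 < z \<Longrightarrow> integrable D (\<lambda>t. indicator {0<..} t * exp (- \<delta> * t) * psi f t z)"
    using phi_i unfolding phi_def .
  have S_eq: "S f = (\<lambda>z. LINT t|D. phi z t)" by (simp add: S_def phi_def fun_eq_iff)
  show "\<exists>S'. continuous_on {0<..} S' \<and> (\<forall>z>0. (S f has_real_derivative S' z) (at z))"
  proof (intro exI[of _ "\<lambda>z. LINT t|D. phi' z t"] conjI allI impI)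
    fix z :: real assume z: "0 < z"
    show "(S f has_real_derivative (LINT t|D. phi' z t)) (at z)" unfolding S_eq
    proof (rule has_real_derivative_integral[OF z, where w="\<lambda>_. 1"])
      fix x assume x: "\<bar>x - z\<bar> < z"
      then have x0: "0 < x" by linarith
      show "integrable D (phi x)" by (rule phi_i[OF x0])
      show "\<bar>phi x t - phi z t\<bar> \<le> 1 * \<bar>x - z\<bar>" for t by (rule lip[OF x0 z])
    next
      fix t
      show "((\<lambda>x. phi x t) has_real_derivative phi' z t) (at z)"
      proof (cases "0 < t")
        case True
        show ?thesis unfolding phi_def phi'_def using psi_derivative(1)[OF f True z] by (intro DERIV_cmult)
      qed (simp add: phi_def phi'_def)
    qed (use phi'm[OF z] in auto)
  next
    show "continuous_on {0<..} (\<lambda>z. LINT t|D. phi' z t)"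
      unfolding continuous_on_sequentially
    proof (intro allI ballI impI)
      fix Y a assume a: "a \<in> {0::real<..}" and Y: "(\<forall>n. Y n \<in> {0<..}) \<and> Y \<longlonglongrightarrow> a"
      have "(\<lambda>n. LINT t|D. phi' (Y n) t) \<longlonglongrightarrow> (LINT t|D. phi' a t)"
      proof (rule integral_dominated_convergence[where w="\<lambda>_. 1"])
        show "AE t in D. (\<lambda>n. phi' (Y n) t) \<longlonglongrightarrow> phi' a t"
        proof (intro AE_I2)
          fix t
          show "(\<lambda>n. phi' (Y n) t) \<longlonglongrightarrow> phi' a t"
          proof (cases "0 < t")
            case True
            have "((psi' f t) \<circ> Y) \<longlonglongrightarrow> psi' f t a"
              using psi'_continuous[OF f True] Y a unfolding continuous_on_sequentially by blast
            then show ?thesis unfolding phi'_def o_def by (intro tendsto_intros)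
          qed (simp add: phi'_def)
        qed
      qed (use phi'm phi'b a Y in auto)
      then show "((\<lambda>z. LINT t|D. phi' z t) \<circ> Y) \<longlonglongrightarrow> (LINT t|D. phi' a t)" by (simp add: o_def)
    qed
  qed
qed

text \<open>An atom of the delay law at 0 returns the payoff unaveraged, as
  \<open>gk 0 x = 1\<close>; this is the part of \<open>Pi_fun g\<close> that is no smoother than
  \<open>g\<close>.\<close>

lemma Pi_fun_decomp:
  assumes g: "admissible g" and f: "smooth_class (\<lambda>y. p * (1 + y) + (1 - p) * g y)" and z: "0 < z"
  shows "Pi_fun g z = D.prob {0} * (p * (1 + z) + (1 - p) * g z) + S (\<lambda>y. p * (1 + y) + (1 - p) * g y) z"
proof -
  let ?f = "\<lambda>y. p * (1 + y) + (1 - p) * g y"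
  have "Pi_fun g z = (LINT t|D. disc t * psi ?f t z)"
    unfolding Pi_fun_def psi_def by (rule Ex_iterated[OF Pi_fun_integrand[OF g z]])
  also have "\<dots> = (LINT t|D. indicator {0} t * ?f z + indicator {0<..} t * exp (- \<delta> * t) * psi ?f t z)"
  proof (rule Bochner_Integration.integral_cong)
    fix t
    show "disc t * psi ?f t z = indicator {0} t * ?f z + indicator {0<..} t * exp (- \<delta> * t) * psi ?f t z"
      by (cases "t = 0") (auto simp: disc_def psi_def indicator_def)
  qed simp
  also have "\<dots> = (LINT t|D. indicator {0} t * ?f z) + (LINT t|D. indicator {0<..} t * exp (- \<delta> * t) * psi ?f t z)"
    by (intro Bochner_Integration.integral_add S_C1(2)[OF f z] integrable_mult_left integrable_real_indicator)
      (auto simp: D.emeasure_eq_measure)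
  finally show ?thesis by (simp add: S_def)
qed

end

context gbm_stopping
begin

lemma discounted_cong: "0 < z \<Longrightarrow> (\<And>y. 0 < y \<Longrightarrow> f y = g y) \<Longrightarrow> discounted \<delta> f (X z) \<tau> \<omega> = discounted \<delta> g (X z) \<tau> \<omega>"
  by (auto simp: discounted_def X_pos)

end

section \<open>Transfer from the given solution to the explicit process\<close>

locale stopping_problem = gbm_problem P Ft W m \<sigma> \<delta> \<alpha> \<beta> D p
  for P :: "'a measure" and Ft W m \<sigma> \<delta> \<alpha> \<beta> D p +
  fixes M :: "'a measure" and Z :: "real \<Rightarrow> real \<Rightarrow> 'a \<Rightarrow> real" and F :: "real \<Rightarrow> real"
  assumes P_eq: "P = completion M" and F_eq: "F = cdf D"
    and Z_sde: "\<And>z. 0 < z \<Longrightarrow> solves_sde P Ft W (\<lambda>x. m * x) (\<lambda>x. \<sigma> * x) z (Z z)"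
begin

lemma Z_eq: "0 < z \<Longrightarrow> AE \<omega> in P. \<forall>t\<ge>0. Z z t \<omega> = X z t \<omega>"
  using solves_sde_gbm[OF Z_sde] unfolding X_def .

lemma integral_AE_eq:
  fixes f g :: "'a \<Rightarrow> real"
  assumes "f \<in> borel_measurable P" "AE \<omega> in P. f \<omega> = g \<omega>"
  shows "(LINT \<omega>|P. g \<omega>) = (LINT \<omega>|P. f \<omega>)" "integrable P g \<longleftrightarrow> integrable P f"
proof -
  have g: "g \<in> borel_measurable P" by (rule borel_measurable_AE_eq[OF assms])
  show "(LINT \<omega>|P. g \<omega>) = (LINT \<omega>|P. f \<omega>)" using assms g by (intro integral_cong_AE) auto
  show "integrable P g \<longleftrightarrow> integrable P f" using assms g by (intro integrable_cong_AE) auto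
qed

lemma discounted_Z:
  assumes z: "0 < z" and \<tau>: "stopping_time Ft \<tau>" and f: "(\<lambda>y. indicator {0<..} y * f y) \<in> borel_measurable borel"
  shows "(LINT \<omega>|P. discounted \<delta> f (Z z) \<tau> \<omega>) = (LINT \<omega>|P. discounted \<delta> f (X z) \<tau> \<omega>)"
    "integrable P (discounted \<delta> f (Z z) \<tau>) \<longleftrightarrow> integrable P (discounted \<delta> f (X z) \<tau>)"
proof -
  have "AE \<omega> in P. discounted \<delta> f (X z) \<tau> \<omega> = discounted \<delta> f (Z z) \<tau> \<omega>"
    using Z_eq[OF z] by eventually_elim (simp add: discounted_def)
  note * = integral_AE_eq[OF discounted_measurable[OF z \<tau> f] this]
  show "(LINT \<omega>|P. discounted \<delta> f (Z z) \<tau> \<omega>) = (LINT \<omega>|P. discounted \<delta> f (X z) \<tau> \<omega>)"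
    "integrable P (discounted \<delta> f (Z z) \<tau>) \<longleftrightarrow> integrable P (discounted \<delta> f (X z) \<tau>)" by (fact *)+
qed

text \<open>\<open>Pi_op\<close> integrates against the measure rebuilt from \<open>F\<close>; a
  real distribution is determined by its distribution function.\<close>

lemma interval_measure_F: "interval_measure F = D"
proof -
  note c = D.cdf_nondecreasing D.cdf_is_right_cont D.cdf_lim_at_top_prob D.cdf_lim_at_bot
  have "real_distribution (interval_measure (cdf D))" "cdf (interval_measure (cdf D)) = cdf D"
    using c by (auto intro!: real_distribution_interval_measure cdf_interval_measure)
  then show ?thesis unfolding F_eq using D.real_distribution_axioms by (intro cdf_unique)
qed

lemma Pi_op_eq:
  assumes g: "admissible g" and z: "0 < z"
  shows "Pi_op M \<delta> p F Z g z = Pi_fun g z"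
proof -
  let ?f = "\<lambda>y. p * (1 + y) + (1 - p) * g y"
  have f: "(\<lambda>y. indicator {0<..} y * ?f y) \<in> borel_measurable borel"
  proof -
    have [measurable]: "(\<lambda>y. indicator {0<..} y * g y) \<in> borel_measurable borel" using g by (simp add: admissible_def)
    have "(\<lambda>y. indicator {0<..} y * ?f y) = (\<lambda>y. indicator {0<..} y * (p * (1 + y)) + (1 - p) * (indicator {0<..} y * g y))"
      by (simp add: fun_eq_iff algebra_simps)
    then show ?thesis by simp
  qed
  have inner: "(LINT \<omega>|P. ?f (Z z t \<omega>)) = (LINT x|gauss. ?f (z * gk t x))" if t: "0 \<le> t" for t
  proof -
    have "(LINT \<omega>|P. ?f (Z z t \<omega>)) = (LINT \<omega>|P. ?f (X z t \<omega>))"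
    proof (rule integral_AE_eq(1))
      show "(\<lambda>\<omega>. ?f (X z t \<omega>)) \<in> borel_measurable P"
        by (rule pos_measurable[OF f]) (use X_pos[OF z] t in \<open>auto simp: X_def\<close>)
      show "AE \<omega> in P. ?f (X z t \<omega>) = ?f (Z z t \<omega>)" using Z_eq[OF z] by eventually_elim (simp add: t)
    qed
    also have "\<dots> = (LINT x|gauss. ?f (z * gk t x))" by (rule X_law[OF t z f])
    finally show ?thesis .
  qed
  have "Pi_op M \<delta> p F Z g z = (LINT t|D. disc t * (LINT x|gauss. ?f (z * gk t x)))"
    unfolding Pi_op_def interval_measure_F P_eq[symmetric] set_lebesgue_integral_def
  proof (rule Bochner_Integration.integral_cong)
    fix t
    show "indicator {0..} t *\<^sub>R (exp (- \<delta> * t) * (LINT \<omega>|P. ?f (Z z t \<omega>))) = disc t * (LINT x|gauss. ?f (z * gk t x))"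
      by (cases "0 \<le> t") (simp_all add: inner disc_def)
  qed simp
  also have "\<dots> = Pi_fun g z" unfolding Pi_fun_def by (rule Ex_iterated[OF Pi_fun_integrand[OF g z], symmetric])
  finally show ?thesis .
qed

definition super :: "(real \<Rightarrow> real) \<Rightarrow> bool" where
  "super f \<longleftrightarrow> (\<forall>\<tau> z. stopping_time Ft \<tau> \<and> 0 < z \<longrightarrow>
     integrable P (discounted \<delta> f (X z) \<tau>) \<and> (LINT \<omega>|P. discounted \<delta> f (X z) \<tau> \<omega>) \<le> f z)"

lemma superharmonic_iff:
  "(\<lambda>y. indicator {0<..} y * f y) \<in> borel_measurable borel \<Longrightarrow> superharmonic M Ft \<delta> Z f \<longleftrightarrow> super f"
  unfolding superharmonic_def super_def P_eq[symmetric] using discounted_Z[of _ _ f] by metis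

definition gain :: "(real \<Rightarrow> real) \<Rightarrow> real \<Rightarrow> real" where
  "gain g y = max 1 (Pi_fun g y)"

lemma gain_measurable:
  assumes g: "admissible g"
  shows "(\<lambda>z. indicator {0<..} z * gain g z) \<in> borel_measurable borel"
proof -
  note [measurable] = Pi_fun_measurable[OF g]
  have "(\<lambda>z. indicator {0<..} z * gain g z) = (\<lambda>z. indicator {0<..} z * max 1 (indicator {0<..} z * Pi_fun g z))"
    by (auto simp: gain_def indicator_def fun_eq_iff)
  then show ?thesis by simp
qed

lemma admissible_gain:
  assumes g: "admissible g"
  shows "admissible (gain g)"
proof -
  obtain C where C: "\<And>z. 0 < z \<Longrightarrow> \<bar>Pi_fun g z\<bar> \<le> C * H z" using Pi_fun_bound[OF g] by blast
  have "\<bar>gain g z\<bar> \<le> (1 + C) * H z" if z: "0 < z" for z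
  proof -
    have "\<bar>gain g z\<bar> \<le> 1 + \<bar>Pi_fun g z\<bar>" by (simp add: gain_def)
    also have "\<dots> \<le> H z + C * H z" using C[OF z] H_ge(1)[OF z] by simp
    finally show ?thesis by (simp add: distrib_right)
  qed
  then show ?thesis using gain_measurable[OF g] by (auto simp: admissible_def)
qed

lemma integral_discounted_gain:
  assumes g: "admissible g" and z: "0 < z" and \<tau>: "stopping_time Ft \<tau>"
  shows "(LINT \<omega>|P. discounted \<delta> (\<lambda>y. max 1 (Pi_op M \<delta> p F Z g y)) (Z z) \<tau> \<omega>) =
    (LINT \<omega>|P. discounted \<delta> (gain g) (X z) \<tau> \<omega>)"
proof -
  have eq: "(\<lambda>y. indicator {0<..} y * max 1 (Pi_op M \<delta> p F Z g y)) = (\<lambda>y. indicator {0<..} y * gain g y)"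
    by (auto simp: gain_def Pi_op_eq[OF g] indicator_def fun_eq_iff)
  have "(LINT \<omega>|P. discounted \<delta> (\<lambda>y. max 1 (Pi_op M \<delta> p F Z g y)) (Z z) \<tau> \<omega>) =
      (LINT \<omega>|P. discounted \<delta> (\<lambda>y. max 1 (Pi_op M \<delta> p F Z g y)) (X z) \<tau> \<omega>)"
    by (rule discounted_Z(1)[OF z \<tau>]) (unfold eq, rule gain_measurable[OF g])
  also have "\<dots> = (LINT \<omega>|P. discounted \<delta> (gain g) (X z) \<tau> \<omega>)"
    by (intro Bochner_Integration.integral_cong refl discounted_cong[OF z]) (simp add: gain_def Pi_op_eq[OF g])
  finally show ?thesis .
qed

lemma discounted_admissible:
  assumes "admissible g" "0 < z" "stopping_time Ft \<tau>"
  shows "integrable P (discounted \<delta> g (X z) \<tau>)"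
  using assms discounted_integrable unfolding admissible_def by blast

lemma integral_discounted_zero:
  assumes f: "(\<lambda>y. indicator {0<..} y * f y) \<in> borel_measurable borel" and z: "0 < z"
  shows "(LINT \<omega>|P. discounted \<delta> f (X z) (\<lambda>_. 0) \<omega>) = f z"
proof -
  have st: "stopping_time Ft (\<lambda>_. 0)" by (rule stopping_time_const)
  have "(LINT \<omega>|P. discounted \<delta> f (X z) (\<lambda>_. 0) \<omega>) = (LINT \<omega>|P. f z)"
  proof (rule integral_cong_AE)
    show "discounted \<delta> f (X z) (\<lambda>_. 0) \<in> borel_measurable P" by (rule discounted_measurable[OF z st f])
    show "AE \<omega> in P. discounted \<delta> f (X z) (\<lambda>_. 0) \<omega> = f z"
      using W_0 by eventually_elim (simp add: discounted_def X_def gbm_def)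
  qed simp
  then show ?thesis by (simp add: prob_space)
qed

lemma continuous_measurable:
  fixes f :: "real \<Rightarrow> real"
  assumes "continuous_on {0<..} f"
  shows "(\<lambda>y. indicator {0<..} y * f y) \<in> borel_measurable borel"
  using borel_measurable_continuous_on_indicator[of "{0<..}" f] assms by simp

text \<open>\<open>h - l\<close> has a local minimum at \<open>x0\<close>, so the two derivatives
  agree. The difference quotient of \<open>u\<close> lies between those of \<open>l\<close> and
  \<open>h\<close>, whose order depends on the side of \<open>x0\<close>; hence the minimum and
  maximum in the proof.\<close>

lemma squeeze_derivative:
  fixes u l h :: "real \<Rightarrow> real"
  assumes e: "0 < e" and le: "\<And>x. \<bar>x - x0\<bar> < e \<Longrightarrow> l x \<le> u x" "\<And>x. \<bar>x - x0\<bar> < e \<Longrightarrow> u x \<le> h x"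
    and eq: "l x0 = u x0" "h x0 = u x0"
    and d: "(l has_real_derivative D1) (at x0)" "(h has_real_derivative D2) (at x0)"
  shows "D1 = D2" "(u has_real_derivative D1) (at x0)"
proof -
  have "((\<lambda>x. h x - l x) has_real_derivative D2 - D1) (at x0)" by (intro DERIV_diff d)
  moreover have "\<forall>y. \<bar>x0 - y\<bar> < e \<longrightarrow> h x0 - l x0 \<le> h y - l y"
    using le eq by (simp add: abs_minus_commute) (meson order_trans)
  ultimately have "D2 - D1 = 0" by (rule DERIV_local_min[OF _ e])
  then show D: "D1 = D2" by simp
  define a where "a x = (l x - l x0) / (x - x0)" for x
  define b where "b x = (h x - h x0) / (x - x0)" for x
  have a: "(a \<longlongrightarrow> D1) (at x0)" and b: "(b \<longlongrightarrow> D1) (at x0)"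
    using d D by (auto simp: has_field_derivative_iff a_def[abs_def] b_def[abs_def])
  have "\<forall>\<^sub>F x in at x0. min (a x) (b x) \<le> (u x - u x0) / (x - x0) \<and> (u x - u x0) / (x - x0) \<le> max (a x) (b x)"
    unfolding eventually_at
  proof (intro exI[of _ e] conjI ballI impI e)
    fix x assume "x \<noteq> x0 \<and> dist x x0 < e"
    then have x: "x \<noteq> x0" "\<bar>x - x0\<bar> < e" by (auto simp: dist_real_def)
    note lu = le[OF x(2)]
    show "min (a x) (b x) \<le> (u x - u x0) / (x - x0)" "(u x - u x0) / (x - x0) \<le> max (a x) (b x)"
      using lu x(1) eq by (cases "x0 < x"; auto simp: a_def b_def min_le_iff_disj le_max_iff_disj intro: divide_right_mono divide_right_mono_neg)+
  qed
  then have ev: "\<forall>\<^sub>F x in at x0. min (a x) (b x) \<le> (u x - u x0) / (x - x0)"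
    "\<forall>\<^sub>F x in at x0. (u x - u x0) / (x - x0) \<le> max (a x) (b x)" by (auto elim: eventually_mono)
  have "((\<lambda>x. (u x - u x0) / (x - x0)) \<longlongrightarrow> D1) (at x0)"
    by (rule tendsto_sandwich[OF ev]) (use tendsto_min[OF a b] tendsto_max[OF a b] in auto)
  then show "(u has_real_derivative D1) (at x0)" by (simp add: has_field_derivative_iff)
qed

end

subsection \<open>The value function\<close>

locale value_problem = stopping_problem P Ft W m \<sigma> \<delta> \<alpha> \<beta> D p M Z F
  for P :: "'a measure" and Ft W m \<sigma> \<delta> \<alpha> \<beta> D p M Z F +
  fixes u :: "real \<Rightarrow> real"
  assumes fixed_point: "value_fixed_point M Ft \<delta> p F Z u"
begin

lemma u_cont: "continuous_on {0<..} u" and u_nonneg: "0 < z \<Longrightarrow> 0 \<le> u z"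
  using fixed_point by (auto simp: value_fixed_point_def A1_plus_def)

lemma u_growth: "\<exists>C\<ge>0. \<forall>z>0. u z \<le> C * (1 + z)"
proof -
  obtain K where K: "\<And>z. 0 < z \<Longrightarrow> \<bar>u z\<bar>\<^sup>2 / (1 + z\<^sup>2) \<le> K"
    using fixed_point unfolding value_fixed_point_def A1_plus_def bdd_above_def by blast
  have K0: "0 \<le> K" using K[of 1] by (smt (verit) zero_le_divide_iff zero_le_power2)
  have "u z \<le> sqrt K * (1 + z)" if z: "0 < z" for z
  proof (rule power2_le_imp_le)
    have "0 < 1 + z\<^sup>2" by (simp add: add_pos_nonneg)
    then have "(u z)\<^sup>2 \<le> K * (1 + z\<^sup>2)" using K[OF z] by (simp add: field_simps)
    also have "\<dots> \<le> K * (1 + z)\<^sup>2" using K0 z by (intro mult_left_mono) (auto simp: power2_eq_square algebra_simps)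
    finally show "(u z)\<^sup>2 \<le> (sqrt K * (1 + z))\<^sup>2" using K0 by (simp add: power_mult_distrib)
  qed (use K0 z in simp)
  then show ?thesis using K0 by (intro exI[of _ "sqrt K"]) simp
qed

lemma linear_growth_admissible:
  assumes "continuous_on {0<..} g" "\<And>z. 0 < z \<Longrightarrow> 0 \<le> g z" "\<And>z. 0 < z \<Longrightarrow> g z \<le> C * (1 + z)" "0 \<le> C"
  shows "admissible g"
proof -
  have "\<bar>g z\<bar> \<le> (2 * C) * H z" if z: "0 < z" for z
  proof -
    have "g z \<le> C * (H z + H z)"
      using H_ge[OF z] assms(4) by (intro order_trans[OF assms(3)[OF z]] mult_left_mono) auto
    then show ?thesis using assms(2)[OF z] by simp
  qed
  then show ?thesis using continuous_measurable[OF assms(1)] by (auto simp: admissible_def)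
qed

lemma u_admissible: "admissible u"
  using u_growth linear_growth_admissible[OF u_cont u_nonneg] by blast

abbreviation "G \<equiv> gain u"

definition val :: "real \<Rightarrow> ('a \<Rightarrow> ennreal) \<Rightarrow> real" where
  "val z \<tau> = (LINT \<omega>|P. discounted \<delta> G (X z) \<tau> \<omega>)"

lemma u_sup: "0 < z \<Longrightarrow> u z = (SUP \<tau>\<in>{\<tau>. stopping_time Ft \<tau>}. val z \<tau>)"
  using fixed_point integral_discounted_gain[OF u_admissible]
  unfolding value_fixed_point_def P_eq[symmetric] val_def by (auto intro!: SUP_cong)

lemma u_le: "0 < z \<Longrightarrow> (\<And>\<tau>. stopping_time Ft \<tau> \<Longrightarrow> val z \<tau> \<le> c) \<Longrightarrow> u z \<le> c"
  unfolding u_sup using stopping_time_const[of Ft 0] by (intro cSUP_least) auto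

text \<open>Linear growth passes from \<open>u\<close> to its gain. It bounds the family of stopping
  values, so that the supremum is a genuine one, and it is of smaller order than
  \<open>x powr \<alpha>\<close>, as the contact argument demands.\<close>

lemma G_growth: "\<exists>C\<ge>0. \<forall>z>0. G z \<le> C * (1 + z)"
proof -
  obtain C where C: "0 \<le> C" "\<And>z. 0 < z \<Longrightarrow> u z \<le> C * (1 + z)" using u_growth by blast
  have a0: "admissible (\<lambda>_. 0)" by (rule linear_growth_admissible[of _ 0]) auto
  have "G z \<le> (1 + C) * (1 + z)" if z: "0 < z" for z
  proof -
    have "Pi_fun u z \<le> Pi_fun (\<lambda>_. 0) z + (1 - p) * C + max 0 (p * (z - z) + (1 - p) * (C * z))"
    proof (rule Pi_fun_compare[OF u_admissible a0 z z C(1)])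
      fix k :: real assume k: "0 < k"
      show "u (z * k) \<le> 0 + C + C * z * k" using C(2)[of "z * k"] z k by (simp add: algebra_simps)
    qed (use C z in simp)
    moreover have "Pi_fun (\<lambda>_. 0) z \<le> p * (1 + z)"
    proof -
      have "Pi_fun (\<lambda>_. 0) z = Ex (\<lambda>k. p + (p * z) * k)" unfolding Pi_fun_def by (simp add: algebra_simps)
      also have "\<dots> \<le> p * 1 + p * z * 1" unfolding Exi_affine(2) using p z by (intro add_mono mult_left_mono Ex_basic) auto
      finally show ?thesis by (simp add: algebra_simps)
    qed
    moreover have "p * (1 + z) \<le> 1 * (1 + z)" "(1 - p) * (C * (1 + z)) \<le> 1 * (C * (1 + z))"
      using p z C(1) by (intro mult_right_mono; simp)+
    moreover have "0 \<le> (1 - p) * (C * z)" "0 \<le> C * (1 + z)" using p C z by auto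
    ultimately have "Pi_fun u z \<le> (1 + z) + C * (1 + z)" by (simp add: algebra_simps)
    moreover have "1 \<le> (1 + z) + C * (1 + z)" using z \<open>0 \<le> C * (1 + z)\<close> by simp
    ultimately show ?thesis by (simp add: gain_def distrib_right)
  qed
  then show ?thesis using C by (intro exI[of _ "1 + C"]) auto
qed

lemma G_admissible: "admissible G" by (rule admissible_gain[OF u_admissible])

lemma val_le_u:
  assumes z: "0 < z" and \<tau>: "stopping_time Ft \<tau>"
  shows "val z \<tau> \<le> u z"
  unfolding u_sup[OF z]
proof (rule cSUP_upper)
  obtain C where C: "0 \<le> C" "\<And>z. 0 < z \<Longrightarrow> G z \<le> C * (1 + z)" using G_growth by blast
  show "bdd_above (val z ` {\<tau>. stopping_time Ft \<tau>})"
  proof (rule bdd_aboveI2)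
    fix \<rho> assume "\<rho> \<in> {\<tau>. stopping_time Ft \<tau>}"
    then have \<rho>: "stopping_time Ft \<rho>" by simp
    have "val z \<rho> \<le> (LINT \<omega>|P. discounted \<delta> (\<lambda>y. C + C * y) (X z) \<rho> \<omega>)"
      unfolding val_def using C
      by (intro integral_mono discounted_admissible[OF G_admissible z \<rho>] discounted_affine_integral[OF z \<rho>] discounted_mono[OF z])
        (auto simp: algebra_simps)
    also have "\<dots> \<le> C + C * z" by (intro discounted_affine_integral z \<rho> C)
    finally show "val z \<rho> \<le> C + C * z" .
  qed
qed (use \<tau> in simp)

lemma G_le_u: "0 < z \<Longrightarrow> G z \<le> u z"
  using val_le_u[OF _ stopping_time_const[of Ft 0], of z] integral_discounted_zero[OF gain_measurable[OF u_admissible], of z]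
  by (simp add: val_def)

lemma max_mult: "0 \<le> (k :: real) \<Longrightarrow> max 0 (x * k - y * k) = max 0 (x - y) * k"
  by (simp add: max_def left_diff_distrib[symmetric] zero_le_mult_iff mult_le_0_iff)

text \<open>One pass through the fixed-point equation. Discounted means of 1 and \<open>k\<close>
  are at most 1, so \<open>max 0 (x - y)\<close> is reproduced without growth, whereas the error
  \<open>C * (1 + x)\<close> sits in the continuation part of the payoff and comes back multiplied
  by \<open>1 - p\<close>. The one-sided form makes monotonicity part of the Lipschitz
  estimate.\<close>

lemma u_lipschitz_step:
  assumes C: "0 \<le> C"
    and IH: "\<And>x y. 0 < x \<Longrightarrow> 0 < y \<Longrightarrow> u x \<le> u y + max 0 (x - y) + C * (1 + x)"
    and x: "0 < x" and y: "0 < y"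
  shows "u x \<le> u y + max 0 (x - y) + (1 - p) * C * (1 + x)"
proof -
  have q: "0 \<le> 1 - p" using p by simp
  let ?a = "(1 - p) * C" and ?b = "max 0 (x - y) + (1 - p) * C * x"
  have ab: "0 \<le> ?a" "0 \<le> ?b" using C q x by (auto intro!: add_nonneg_nonneg)
  have GG: "G (x * k) \<le> G (y * k) + (?a + ?b * k)" if k: "0 < k" for k
  proof -
    let ?d = "max 0 (x - y)"
    have "Pi_fun u (x * k) \<le> Pi_fun u (y * k) + (1 - p) * C + max 0 (p * (x * k - y * k) + (1 - p) * (?d * k + C * x * k))"
    proof (rule Pi_fun_compare[OF u_admissible u_admissible])
      fix l :: real assume l: "0 < l"
      have "u (x * k * l) \<le> u (y * k * l) + max 0 (x * k * l - y * k * l) + C * (1 + x * k * l)"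
        using x y k l by (intro IH) auto
      also have "max 0 (x * k * l - y * k * l) = ?d * (k * l)"
        using max_mult[of "k * l" x y] k l by (simp add: mult.assoc)
      finally show "u (x * k * l) \<le> u (y * k * l) + C + (?d * k + C * x * k) * l" by (simp add: algebra_simps)
    qed (use x y k C in \<open>auto intro!: add_nonneg_nonneg\<close>)
    moreover have "max 0 (p * (x * k - y * k) + (1 - p) * (?d * k + C * x * k)) \<le> ?b * k"
    proof -
      have "p * (x * k - y * k) \<le> p * (?d * k)"
        using max_mult[of k x y] p k by (intro mult_left_mono) auto
      then have "p * (x * k - y * k) + (1 - p) * (?d * k + C * x * k) \<le> ?b * k" by (simp add: algebra_simps)
      moreover have "0 \<le> ?b * k" using ab(2) k by simp
      ultimately show ?thesis by simp
    qed
    ultimately have "Pi_fun u (x * k) \<le> Pi_fun u (y * k) + (?a + ?b * k)" by linarith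
    moreover have "0 \<le> ?a + ?b * k" using ab k by (intro add_nonneg_nonneg) auto
    ultimately show ?thesis by (auto simp: gain_def)
  qed
  show ?thesis
  proof (rule u_le[OF x])
    fix \<tau> assume \<tau>: "stopping_time Ft \<tau>"
    note i = discounted_admissible[OF G_admissible y \<tau>] discounted_affine_integral[OF zero_less_one \<tau> ab]
    have "discounted \<delta> G (X x) \<tau> \<omega> \<le> discounted \<delta> G (X y) \<tau> \<omega> + discounted \<delta> (\<lambda>k. ?a + ?b * k) (X 1) \<tau> \<omega>" for \<omega>
    proof (cases "\<tau> \<omega> = \<infinity>")
      case False
      let ?t = "enn2real (\<tau> \<omega>)"
      have "exp (- \<delta> * ?t) * G (x * gbm m \<sigma> ?t \<omega>) \<le> exp (- \<delta> * ?t) * (G (y * gbm m \<sigma> ?t \<omega>) + (?a + ?b * gbm m \<sigma> ?t \<omega>))"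
        by (intro mult_left_mono GG) auto
      then show ?thesis using False by (simp add: discounted_def X_def distrib_left)
    qed (simp add: discounted_def)
    then have "val x \<tau> \<le> (LINT \<omega>|P. discounted \<delta> G (X y) \<tau> \<omega> + discounted \<delta> (\<lambda>k. ?a + ?b * k) (X 1) \<tau> \<omega>)"
      unfolding val_def using i by (intro integral_mono discounted_admissible[OF G_admissible x \<tau>]) auto
    also have "\<dots> = val y \<tau> + (LINT \<omega>|P. discounted \<delta> (\<lambda>k. ?a + ?b * k) (X 1) \<tau> \<omega>)"
      unfolding val_def using i by (intro Bochner_Integration.integral_add) auto
    also have "\<dots> \<le> u y + (?a + ?b * 1)" by (intro add_mono val_le_u[OF y \<tau>] i)
    finally show "val x \<tau> \<le> u y + max 0 (x - y) + (1 - p) * C * (1 + x)" by (simp add: algebra_simps)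
  qed
qed

text \<open>Linear growth and \<open>0 \<le> u\<close> provide a first error
  \<open>C * (1 + x)\<close>; repeated passes remove it.\<close>

lemma u_lipschitz:
  assumes x: "0 < x" and y: "0 < y"
  shows "u x \<le> u y + max 0 (x - y)"
proof -
  obtain C where C: "0 \<le> C" "\<And>z. 0 < z \<Longrightarrow> u z \<le> C * (1 + z)" using u_growth by blast
  have *: "u x \<le> u y + max 0 (x - y) + (1 - p) ^ n * C * (1 + x)" if "0 < x" "0 < y" for n x y
    using that
  proof (induction n arbitrary: x y)
    case 0
    then show ?case using C(2)[of x] u_nonneg[of y] by simp
  next
    case (Suc n)
    have "0 \<le> (1 - p) ^ n * C" using C(1) p by simp
    from u_lipschitz_step[OF this Suc.IH Suc.prems] show ?case by (simp add: mult.assoc)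
  qed
  have "(\<lambda>n. u y + max 0 (x - y) + (1 - p) ^ n * C * (1 + x)) \<longlonglongrightarrow> u y + max 0 (x - y) + 0 * C * (1 + x)"
    using p by (intro tendsto_intros LIMSEQ_realpow_zero) auto
  then show ?thesis using *[OF x y] by (intro LIMSEQ_le_const[of _ "u y + max 0 (x - y)"]) auto
qed

lemma Pi_lipschitz:
  assumes x: "0 < x" and y: "0 < y"
  shows "Pi_fun u x \<le> Pi_fun u y + max 0 (x - y)"
proof -
  have "Pi_fun u x \<le> Pi_fun u y + (1 - p) * 0 + max 0 (p * (x - y) + (1 - p) * max 0 (x - y))"
  proof (rule Pi_fun_compare[OF u_admissible u_admissible x y])
    fix k :: real assume k: "0 < k"
    show "u (x * k) \<le> u (y * k) + 0 + max 0 (x - y) * k"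
      using u_lipschitz[of "x * k" "y * k"] x y k max_mult[of k x y] by simp
  qed auto
  also have "p * (x - y) + (1 - p) * max 0 (x - y) \<le> p * max 0 (x - y) + (1 - p) * max 0 (x - y)"
    using p by (intro add_right_mono mult_left_mono) auto
  then have "max 0 (p * (x - y) + (1 - p) * max 0 (x - y)) \<le> max 0 (x - y)" by (simp add: algebra_simps)
  finally show ?thesis by simp
qed

lemma Pi_mono: "0 < x \<Longrightarrow> x \<le> y \<Longrightarrow> Pi_fun u x \<le> Pi_fun u y"
  using Pi_lipschitz[of x y] by simp

lemma lipschitz_continuous:
  fixes f :: "real \<Rightarrow> real"
  assumes "\<And>x y. 0 < x \<Longrightarrow> 0 < y \<Longrightarrow> f x \<le> f y + max 0 (x - y)"
  shows "\<And>x y. 0 < x \<Longrightarrow> 0 < y \<Longrightarrow> \<bar>f x - f y\<bar> \<le> \<bar>x - y\<bar>" "continuous_on {0<..} f"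
proof -
  show *: "\<bar>f x - f y\<bar> \<le> \<bar>x - y\<bar>" if "0 < x" "0 < y" for x y
    using assms[of x y] assms[of y x] that by linarith
  then have "1-lipschitz_on {0<..} f" by (intro lipschitz_onI) (auto simp: dist_real_def)
  then show "continuous_on {0<..} f" by (rule lipschitz_on_continuous_on)
qed

lemma G_cont: "continuous_on {0<..} G"
  unfolding gain_def[abs_def] by (intro continuous_intros lipschitz_continuous Pi_lipschitz)

definition hf :: "real \<Rightarrow> real \<Rightarrow> real \<Rightarrow> real" where "hf A B y = A * y powr \<alpha> + B * y powr (- \<beta>)"

lemma hf_measurable: "(\<lambda>y. indicator {0<..} y * hf A B y) \<in> borel_measurable borel"
  unfolding hf_def by measurable

lemma hf_integrable:
  assumes z: "0 < z" and \<tau>: "stopping_time Ft \<tau>"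
  shows "integrable P (discounted \<delta> (hf A B) (X z) \<tau>)"
proof (rule discounted_integrable[OF z \<tau> hf_measurable])
  fix y :: real assume "0 < y"
  have "\<bar>hf A B y\<bar> \<le> \<bar>A\<bar> * y powr \<alpha> + \<bar>B\<bar> * y powr (- \<beta>)"
    unfolding hf_def by (rule order_trans[OF abs_triangle_ineq]) (simp add: abs_mult)
  also have "\<dots> \<le> (\<bar>A\<bar> + \<bar>B\<bar>) * H y" by (simp add: H_def algebra_simps)
  finally show "\<bar>hf A B y\<bar> \<le> (\<bar>A\<bar> + \<bar>B\<bar>) * H y" .
qed

text \<open>At the exit time the expectation of \<open>hf A B\<close> is its value at
  \<open>z\<close>, and the process then sits at \<open>c\<close> or \<open>d\<close>, where
  \<open>f\<close> is larger. The coefficients may have any sign, which the growth bound for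
  candidates exploits.\<close>

lemma exit_compare:
  assumes cd: "0 < c" "c < z" "z < d" and f: "(\<lambda>y. indicator {0<..} y * f y) \<in> borel_measurable borel"
    and fi: "\<And>\<tau>. stopping_time Ft \<tau> \<Longrightarrow> integrable P (discounted \<delta> f (X z) \<tau>)"
    and le: "hf A B c \<le> f c" "hf A B d \<le> f d"
  shows "\<exists>\<tau>. stopping_time Ft \<tau> \<and> hf A B z \<le> (LINT \<omega>|P. discounted \<delta> f (X z) \<tau> \<omega>)"
proof -
  obtain \<tau> where \<tau>: "stopping_time Ft \<tau>" and ex: "AE \<omega> in P. \<tau> \<omega> \<noteq> \<infinity> \<longrightarrow> X z (enn2real (\<tau> \<omega>)) \<omega> \<in> {c, d}"
    and I: "\<And>A B. (LINT \<omega>|P. discounted \<delta> (\<lambda>y. A * y powr \<alpha> + B * y powr (- \<beta>)) (X z) \<tau> \<omega>) = A * z powr \<alpha> + B * z powr (- \<beta>)"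
    using ex_exit_time_integral[OF cd] by blast
  have z: "0 < z" using cd by simp
  have "hf A B z = (LINT \<omega>|P. discounted \<delta> (hf A B) (X z) \<tau> \<omega>)" using I[of A B] by (simp add: hf_def[abs_def])
  also have "\<dots> \<le> (LINT \<omega>|P. discounted \<delta> f (X z) \<tau> \<omega>)"
  proof (rule integral_mono_AE[OF hf_integrable[OF z \<tau>] fi[OF \<tau>]])
    show "AE \<omega> in P. discounted \<delta> (hf A B) (X z) \<tau> \<omega> \<le> discounted \<delta> f (X z) \<tau> \<omega>"
      using ex by eventually_elim (use le in \<open>auto simp: discounted_def\<close>)
  qed
  finally show ?thesis using \<tau> by blast
qed

text \<open>A majorant of the gain with nonnegative coefficients dominates all stopping values,
  hence \<open>u\<close>. Between two contacts the exit time attains it, and a contact at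
  \<open>z\<close> itself is the case of immediate stopping.\<close>

lemma ex_majorant:
  assumes z: "0 < z"
  shows "\<exists>A B. 0 \<le> A \<and> 0 \<le> B \<and> (\<forall>x>0. u x \<le> hf A B x) \<and> u z = hf A B z \<and>
    (G z < u z \<longrightarrow> (\<exists>c d. 0 < c \<and> c < z \<and> z < d \<and> u c = G c \<and> u d = G d \<and> (\<forall>x\<in>{c..d}. u x = hf A B x)))"
proof -
  obtain C where C: "0 \<le> C" "\<And>z. 0 < z \<Longrightarrow> G z \<le> C * (1 + z)" using G_growth by blast
  have "\<exists>A B. 0 \<le> A \<and> 0 \<le> B \<and> (\<forall>x>0. G x \<le> A * x powr \<alpha> + B * x powr (- \<beta>)) \<and>
    (A * z powr \<alpha> + B * z powr (- \<beta>) = G z \<or>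
     (\<exists>c d. 0 < c \<and> c < z \<and> z < d \<and> A * c powr \<alpha> + B * c powr (- \<beta>) = G c \<and> A * d powr \<alpha> + B * d powr (- \<beta>) = G d))"
    by (rule ex_majorant_with_contacts[OF \<alpha>(1) \<beta>(1) G_cont _ C(2) z]) (simp_all add: gain_def)
  then obtain A B where AB: "0 \<le> A" "0 \<le> B" and maj: "\<And>x. 0 < x \<Longrightarrow> G x \<le> hf A B x"
    and alt: "hf A B z = G z \<or> (\<exists>c d. 0 < c \<and> c < z \<and> z < d \<and> hf A B c = G c \<and> hf A B d = G d)"
    unfolding hf_def by metis
  have le: "u x \<le> hf A B x" if x: "0 < x" for x
  proof (rule u_le[OF x])
    fix \<tau> assume \<tau>: "stopping_time Ft \<tau>"
    have "val x \<tau> \<le> (LINT \<omega>|P. discounted \<delta> (hf A B) (X x) \<tau> \<omega>)" unfolding val_def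
      by (intro integral_mono discounted_admissible[OF G_admissible x \<tau>] hf_integrable[OF x \<tau>] discounted_mono[OF x] maj)
    also have "\<dots> \<le> hf A B x" using discounted_hfun_integral(2)[OF x \<tau> AB] by (simp add: hf_def[abs_def])
    finally show "val x \<tau> \<le> hf A B x" .
  qed
  have contact: "u c = G c \<and> u c = hf A B c" if "0 < c" "hf A B c = G c" for c
    using le[OF that(1)] G_le_u[OF that(1)] that by simp
  show ?thesis using alt
  proof
    assume "hf A B z = G z"
    then show ?thesis using contact[OF z] AB le by (intro exI[of _ A] exI[of _ B]) auto
  next
    assume "\<exists>c d. 0 < c \<and> c < z \<and> z < d \<and> hf A B c = G c \<and> hf A B d = G d"
    then obtain c d where cd: "0 < c" "c < z" "z < d" and con: "hf A B c = G c" "hf A B d = G d" by blast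
    have d: "0 < d" using cd by simp
    have eq: "u x = hf A B x" if x: "x \<in> {c..d}" for x
    proof -
      consider "x = c" | "x = d" | "c < x" "x < d" using x by fastforce
      then show ?thesis
      proof cases
        case 3
        then have x0: "0 < x" using cd by simp
        obtain \<tau> where \<tau>: "stopping_time Ft \<tau>" and h: "hf A B x \<le> val x \<tau>"
          using exit_compare[OF cd(1) 3 gain_measurable[OF u_admissible] discounted_admissible[OF G_admissible x0], of A B] con
          unfolding val_def by auto
        then show ?thesis using val_le_u[OF x0 \<tau>] le[OF x0] by simp
      qed (use contact cd(1) d con in auto)
    qed
    have "\<exists>c d. 0 < c \<and> c < z \<and> z < d \<and> u c = G c \<and> u d = G d \<and> (\<forall>x\<in>{c..d}. u x = hf A B x)"
      using cd eq contact[OF cd(1) con(1)] contact[OF d con(2)] by blast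
    moreover have "u z = hf A B z" using eq[of z] cd by simp
    ultimately show ?thesis using AB le by blast
  qed
qed

lemma u_measurable: "(\<lambda>y. indicator {0<..} y * u y) \<in> borel_measurable borel"
  by (rule continuous_measurable[OF u_cont])

text \<open>At each \<open>z\<close> some majorant of \<open>u\<close> agrees with \<open>u\<close>
  at \<open>z\<close> and does not grow in discounted mean, so superharmonicity is checked one point
  at a time.\<close>

lemma u_super: "super u"
  unfolding super_def
proof (intro allI impI conjI; elim conjE)
  fix \<tau> z assume \<tau>: "stopping_time Ft \<tau>" and z: "0 < (z::real)"
  show i: "integrable P (discounted \<delta> u (X z) \<tau>)" by (rule discounted_admissible[OF u_admissible z \<tau>])
  obtain A B where AB: "0 \<le> A" "0 \<le> B" and le: "\<And>x. 0 < x \<Longrightarrow> u x \<le> hf A B x" and eq: "u z = hf A B z"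
    using ex_majorant[OF z] by blast
  have "(LINT \<omega>|P. discounted \<delta> u (X z) \<tau> \<omega>) \<le> (LINT \<omega>|P. discounted \<delta> (hf A B) (X z) \<tau> \<omega>)"
    by (intro integral_mono i hf_integrable[OF z \<tau>] discounted_mono[OF z] le)
  also have "\<dots> \<le> u z" unfolding eq using discounted_hfun_integral(2)[OF z \<tau> AB] by (simp add: hf_def[abs_def])
  finally show "(LINT \<omega>|P. discounted \<delta> u (X z) \<tau> \<omega>) \<le> u z" .
qed

end

section \<open>The free boundary problem for the value function\<close>

context value_problem
begin

definition hf1 :: "real \<Rightarrow> real \<Rightarrow> real \<Rightarrow> real" where
  "hf1 A B y = A * (\<alpha> * y powr (\<alpha> - 1)) + B * (- \<beta> * y powr (- \<beta> - 1))"

definition hf2 :: "real \<Rightarrow> real \<Rightarrow> real \<Rightarrow> real" where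
  "hf2 A B y = A * (\<alpha> * ((\<alpha> - 1) * y powr (\<alpha> - 1 - 1))) + B * (- \<beta> * ((- \<beta> - 1) * y powr (- \<beta> - 1 - 1)))"

lemma hf_derivatives:
  assumes "0 < y"
  shows "(hf A B has_real_derivative hf1 A B y) (at y)" "(hf1 A B has_real_derivative hf2 A B y) (at y)"
  unfolding hf_def[abs_def] hf1_def[abs_def] hf2_def
  by (intro DERIV_add DERIV_cmult has_real_derivative_powr assms)+

lemma hf_ode:
  assumes y: "0 < y"
  shows "1/2 * \<sigma>\<^sup>2 * y\<^sup>2 * hf2 A B y + m * y * hf1 A B y - \<delta> * hf A B y = 0"
proof -
  have e: "y * y powr (c - 1) = y powr c" "y\<^sup>2 * y powr (c - 1 - 1) = y powr c" for c
    using y by (simp_all add: powr_diff power2_eq_square)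
  have 1: "y * hf1 A B y = A * \<alpha> * y powr \<alpha> - B * \<beta> * y powr (- \<beta>)"
  proof -
    have "y * hf1 A B y = A * \<alpha> * (y * y powr (\<alpha> - 1)) - B * \<beta> * (y * y powr (- \<beta> - 1))"
      unfolding hf1_def by (simp add: algebra_simps)
    then show ?thesis unfolding e .
  qed
  have 2: "y\<^sup>2 * hf2 A B y = A * \<alpha> * (\<alpha> - 1) * y powr \<alpha> + B * \<beta> * (\<beta> + 1) * y powr (- \<beta>)"
  proof -
    have "y\<^sup>2 * hf2 A B y = A * \<alpha> * (\<alpha> - 1) * (y\<^sup>2 * y powr (\<alpha> - 1 - 1)) + B * \<beta> * (\<beta> + 1) * (y\<^sup>2 * y powr (- \<beta> - 1 - 1))"
      unfolding hf2_def by (simp add: algebra_simps)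
    then show ?thesis unfolding e .
  qed
  have "1/2 * \<sigma>\<^sup>2 * y\<^sup>2 * hf2 A B y + m * y * hf1 A B y - \<delta> * hf A B y =
      \<sigma>\<^sup>2 / 2 * (y\<^sup>2 * hf2 A B y) + m * (y * hf1 A B y) - \<delta> * hf A B y" by simp
  also have "\<dots> = A * y powr \<alpha> * (\<alpha> * (m - \<sigma>\<^sup>2 / 2) + \<alpha>\<^sup>2 * \<sigma>\<^sup>2 / 2 - \<delta>) +
      B * y powr (- \<beta>) * (- \<beta> * (m - \<sigma>\<^sup>2 / 2) + \<beta>\<^sup>2 * \<sigma>\<^sup>2 / 2 - \<delta>)"
    unfolding 1 2 hf_def by (simp add: field_simps power2_eq_square)
  also have "\<dots> = 0" using \<alpha>(2) \<beta>(2) by simp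
  finally show ?thesis .
qed

text \<open>At this \<open>z\<close> the linear part of the payoff alone averages to 2. The set
  whose infimum is \<open>z_0\<close> is therefore nonempty, and its \<open>Inf\<close> is
  meaningful.\<close>

lemma Pi_unbounded: "\<exists>z>0. 1 < Pi_fun u z"
proof -
  let ?z = "2 / (p * Ex (\<lambda>k. k))"
  have z: "0 < ?z" using p Ex_pos by simp
  have "Ex (\<lambda>k. 0 + (p * ?z) * k) \<le> Pi_fun u ?z"
    unfolding Pi_fun_def
  proof (rule Ex_mono[OF Exi_affine(1) Pi_fun_integrand[OF u_admissible z]])
    fix k :: real assume "0 < k"
    then have "0 \<le> (1 - p) * u (?z * k)" using p z by (intro mult_nonneg_nonneg u_nonneg) auto
    then show "0 + (p * ?z) * k \<le> p * (1 + ?z * k) + (1 - p) * u (?z * k)" using p by (simp add: distrib_left mult.assoc)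
  qed
  moreover have "Ex (\<lambda>k. 0 + (p * ?z) * k) = 2" unfolding Exi_affine(2) using p Ex_pos by simp
  ultimately show ?thesis using z by (intro exI[of _ ?z]) simp
qed

abbreviation (input) "payoff \<equiv> \<lambda>y. p * (1 + y) + (1 - p) * u y"

lemma payoff_smooth: "smooth_class payoff"
  unfolding smooth_class_def
proof (intro conjI allI impI)
  have "continuous_on {0<..} payoff" by (intro continuous_intros u_cont)
  then show "(\<lambda>y. indicator {0<..} y * payoff y) \<in> borel_measurable borel" by (rule continuous_measurable)
  fix x y :: real assume xy: "0 < x" "0 < y"
  have "\<bar>payoff x - payoff y\<bar> = \<bar>p * (x - y) + (1 - p) * (u x - u y)\<bar>" by (simp add: algebra_simps)
  also have "\<dots> \<le> p * \<bar>x - y\<bar> + (1 - p) * \<bar>u x - u y\<bar>"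
    using p by (intro order_trans[OF abs_triangle_ineq]) (simp add: abs_mult)
  also have "\<dots> \<le> p * \<bar>x - y\<bar> + (1 - p) * \<bar>x - y\<bar>"
    using p by (intro add_left_mono mult_left_mono lipschitz_continuous(1)[OF u_lipschitz] xy) auto
  finally show "\<bar>payoff x - payoff y\<bar> \<le> \<bar>x - y\<bar>" by (simp add: algebra_simps)
next
  obtain C where C: "0 \<le> C" "\<And>z. 0 < z \<Longrightarrow> u z \<le> C * (1 + z)" using u_growth by blast
  have "\<bar>payoff y\<bar> \<le> (p + (1 - p) * C) * (1 + y)" if y: "0 < y" for y
  proof -
    have "(1 - p) * u y \<le> (1 - p) * (C * (1 + y))" using C y p by (intro mult_left_mono) auto
    moreover have "0 \<le> (1 - p) * u y" "0 \<le> p * (1 + y)" using p y u_nonneg[OF y] by auto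
    ultimately show ?thesis by (simp add: algebra_simps)
  qed
  then show "\<exists>C. \<forall>y>0. \<bar>payoff y\<bar> \<le> C * (1 + y)" by blast
qed

definition q :: real where "q = (1 - p) * D.prob {0}"

definition V :: "real \<Rightarrow> real" where
  "V x = (D.prob {0} * (p * (1 + x)) + S payoff x) / (1 - q)"

lemma q_less: "q < 1"
proof -
  have "q \<le> (1 - p) * 1" unfolding q_def using p D.prob_le_1 by (intro mult_left_mono) auto
  then have "q \<le> 1 - p" by simp
  then show ?thesis by (rule le_less_trans) (use p in simp)
qed

text \<open>The atom puts \<open>q * u\<close> into \<open>Pi_fun u\<close>, a term not yet known to
  be differentiable; the remainder is \<open>(1 - q)\<close> times the C1 function \<open>V\<close>.
  Since \<open>q < 1\<close>, the inequality \<open>Pi_fun u \<le> u\<close> and equality in it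
  carry over to \<open>V\<close>, which can stand in for the reward near \<open>b\<close>.\<close>

lemma Pi_fun_u: "0 < x \<Longrightarrow> Pi_fun u x = (1 - q) * V x + q * u x"
proof -
  assume x: "0 < x"
  have "(1 - q) * V x = D.prob {0} * (p * (1 + x)) + S payoff x" using q_less by (simp add: V_def)
  then show ?thesis using Pi_fun_decomp[OF u_admissible payoff_smooth x] by (simp add: q_def algebra_simps)
qed

lemma V_le_u: "0 < x \<Longrightarrow> V x \<le> u x"
proof -
  assume x: "0 < x"
  have "(1 - q) * V x + q * u x \<le> u x" using G_le_u[OF x] Pi_fun_u[OF x] by (simp add: gain_def)
  then have "(1 - q) * V x \<le> (1 - q) * u x" by (simp add: algebra_simps)
  then show ?thesis using q_less by simp
qed

lemma V_eq_u: "0 < x \<Longrightarrow> u x = Pi_fun u x \<Longrightarrow> V x = u x"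
proof -
  assume x: "0 < x" "u x = Pi_fun u x"
  then have "(1 - q) * V x = (1 - q) * u x" using Pi_fun_u[OF x(1)] by (simp add: algebra_simps)
  then show ?thesis using q_less by simp
qed

lemma V_C1: "\<exists>V'. continuous_on {0<..} V' \<and> (\<forall>z>0. (V has_real_derivative V' z) (at z))"
proof -
  obtain S' where S': "continuous_on {0<..} S'" "\<And>z. 0 < z \<Longrightarrow> (S payoff has_real_derivative S' z) (at z)"
    using S_C1(1)[OF payoff_smooth] by blast
  have "(V has_real_derivative (D.prob {0} * p + S' z) / (1 - q)) (at z)" if "0 < z" for z
    unfolding V_def[abs_def] using S'(2)[OF that] q_less by (auto intro!: derivative_eq_intros)
  moreover have "continuous_on {0<..} (\<lambda>z. (D.prob {0} * p + S' z) / (1 - q))"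
    using q_less by (intro continuous_intros S'(1)) auto
  ultimately show ?thesis by blast
qed

text \<open>The position of \<open>z_0\<close> inside \<open>(a, b)\<close> decides which reward is
  active: up to \<open>a\<close> the function \<open>Pi_fun u\<close> is at most 1, so stopping pays
  1; from \<open>b\<close> on it exceeds 1 by monotonicity, so stopping pays
  \<open>Pi_fun u\<close>.\<close>

theorem free_boundary_solution_u:
  assumes ab: "{z. 0 < z \<and> G z < u z} = {a<..<b}" and a: "0 < a"
    and a_less: "a < Inf {z. 0 < z \<and> 1 < Pi_fun u z}" and b_greater: "Inf {z. 0 < z \<and> 1 < Pi_fun u z} < b"
  shows "free_boundary_solution M Ft \<delta> p F m (\<sigma>\<^sup>2) Z u a b"
proof -
  let ?N = "{z. 0 < z \<and> 1 < Pi_fun u z}"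
  have N: "?N \<noteq> {}" "bdd_below ?N" using Pi_unbounded by (auto intro!: bdd_belowI[of _ 0])
  have lt: "a < b" using a_less b_greater by simp
  have b: "0 < b" using a lt by simp
  have iff: "G z < u z \<longleftrightarrow> z \<in> {a<..<b}" if "0 < z" for z using ab that by blast
  have stop: "u z = G z" if "0 < z" "z \<notin> {a<..<b}" for z
  proof -
    have "\<not> G z < u z" using iff that by blast
    then show ?thesis using G_le_u[OF that(1)] by simp
  qed
  have low: "u z = 1" if z: "0 < z" "z \<le> a" for z
  proof -
    have "\<not> 1 < Pi_fun u z" using cInf_lower[OF _ N(2), of z] a_less z by auto
    then show ?thesis using stop[of z] z by (simp add: gain_def)
  qed
  obtain z1 where z1: "0 < z1" "1 < Pi_fun u z1" "z1 < b" using cInf_lessD[OF N(1) b_greater] by blast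
  have high: "u z = Pi_fun u z" if z: "b \<le> z" for z
    using Pi_mono[OF z1(1), of z] z z1 stop[of z] by (simp add: gain_def)
  \<comment> \<open>One majorant serves the whole interval: its contacts on either side of the
    midpoint lie in the stopping set, hence outside \<open>(a, b)\<close>, and \<open>u\<close>
    coincides with it between them.\<close>
  define z2 where "z2 = (a + b) / 2"
  have z2: "0 < z2" "z2 \<in> {a<..<b}" using a lt by (auto simp: z2_def field_simps)
  obtain A B where maj: "\<And>x. 0 < x \<Longrightarrow> u x \<le> hf A B x" and
    ex: "G z2 < u z2 \<longrightarrow> (\<exists>c d. 0 < c \<and> c < z2 \<and> z2 < d \<and> u c = G c \<and> u d = G d \<and> (\<forall>x\<in>{c..d}. u x = hf A B x))"
    using ex_majorant[OF z2(1)] by blast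
  obtain c d where cd: "0 < c" "c < z2" "z2 < d" "u c = G c" "u d = G d" and eqcd: "\<And>x. x \<in> {c..d} \<Longrightarrow> u x = hf A B x"
    using ex iff[OF z2(1)] z2(2) by blast
  have "c \<le> a" "b \<le> d" using iff[of c] iff[of d] cd z2 by auto
  then have mid: "u x = hf A B x" if "x \<in> {a..b}" for x using that by (intro eqcd) auto
  obtain V' where V': "continuous_on {0<..} V'" "\<And>z. 0 < z \<Longrightarrow> (V has_real_derivative V' z) (at z)"
    using V_C1 by blast
  have u_ge1: "1 \<le> u x" if "0 < x" for x using G_le_u[OF that] by (simp add: gain_def)
  have pos: "0 < x" if "\<bar>x - x0\<bar> < x0" for x x0 :: real using that by linarith
  have at_a: "0 = hf1 A B a" "(u has_real_derivative 0) (at a)"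
  proof -
    have "1 \<le> u x" "u x \<le> hf A B x" if "\<bar>x - a\<bar> < a" for x using u_ge1 maj pos[OF that] by auto
    note sq = squeeze_derivative[where l="\<lambda>_. 1", OF a this _ _ DERIV_const hf_derivatives(1)[OF a]]
    show "0 = hf1 A B a" by (rule sq(1)) (use low[of a] mid[of a] a lt in auto)
    show "(u has_real_derivative 0) (at a)" by (rule sq(2)) (use low[of a] mid[of a] a lt in auto)
  qed
  have at_b: "V' b = hf1 A B b" "(u has_real_derivative V' b) (at b)"
  proof -
    have "V x \<le> u x" "u x \<le> hf A B x" if "\<bar>x - b\<bar> < b" for x using V_le_u maj pos[OF that] by auto
    note sq = squeeze_derivative[OF b this _ _ V'(2)[OF b] hf_derivatives(1)[OF b]]
    show "V' b = hf1 A B b" by (rule sq(1)) (use V_eq_u[OF b] high[of b] mid[of b] lt in auto)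
    show "(u has_real_derivative V' b) (at b)" by (rule sq(2)) (use V_eq_u[OF b] high[of b] mid[of b] lt in auto)
  qed
  \<comment> \<open>The slopes computed at \<open>a\<close> and \<open>b\<close> make the three
    pieces agree at the seams, so this derivative is continuous.\<close>
  define u' where "u' x = (if x \<le> a then 0 else if x \<le> b then hf1 A B x else V' x)" for x
  have inner: "(u has_real_derivative hf1 A B x) (at x)" if x: "x \<in> {a<..<b}" for x
    by (rule has_field_derivative_transform_within_open[OF hf_derivatives(1) open_greaterThanLessThan x]) (use x a mid in auto)
  have du: "(u has_real_derivative u' x) (at x)" if x: "0 < x" for x
  proof -
    consider "x < a" | "x = a" | "x \<in> {a<..<b}" | "x = b" | "b < x" by fastforce
    then show ?thesis
    proof cases
      case 1
      have "(u has_real_derivative 0) (at x)"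
        by (rule has_field_derivative_transform_within_open[OF DERIV_const open_greaterThanLessThan, of x 0 a 1]) (use 1 x low in auto)
      then show ?thesis using 1 by (simp add: u'_def)
    next
      case 5
      have "(u has_real_derivative V' x) (at x)"
        by (rule has_field_derivative_transform_within_open[OF V'(2)[OF x] open_greaterThan, of b]) (use 5 b V_eq_u high in auto)
      then show ?thesis using 5 lt by (simp add: u'_def)
    qed (use at_a at_b inner lt in \<open>auto simp: u'_def\<close>)
  qed
  have hf1_cont: "continuous_on {0<..} (hf1 A B)"
    by (intro continuous_at_imp_continuous_on ballI DERIV_isCont) (use hf_derivatives(2) in auto)
  have "continuous_on {0<..} u'"
    unfolding u'_def
  proof (rule continuous_on_cases_le)
    show "continuous_on {x \<in> {0<..}. a \<le> x} (\<lambda>x. if x \<le> b then hf1 A B x else V' x)"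
      by (rule continuous_on_cases_le) (use at_b in \<open>auto intro!: continuous_intros continuous_on_subset[OF hf1_cont] continuous_on_subset[OF V'(1)]\<close>)
  qed (use at_a lt in \<open>auto intro!: continuous_intros\<close>)
  then have C1: "u C1_differentiable_on {0<..}"
    unfolding C1_differentiable_on_def using du by (auto simp: has_real_derivative_iff_has_vector_derivative)
  have C2: "C2_on_interval u a b"
    unfolding C2_on_interval_def
  proof (rule exI[of _ "hf1 A B"], rule exI[of _ "hf2 A B"], intro conjI ballI)
    fix x assume x: "x \<in> {a..b}"
    then have x0: "0 < x" using a by simp
    show "(u has_real_derivative hf1 A B x) (at x within {a..b})"
      by (rule has_field_derivative_transform_within[OF has_field_derivative_at_within[OF hf_derivatives(1)[OF x0]] zero_less_one x]) (use mid in auto)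
    show "(hf1 A B has_real_derivative hf2 A B x) (at x within {a..b})"
      by (rule has_field_derivative_at_within[OF hf_derivatives(2)[OF x0]])
  next
    show "continuous_on {a..b} (hf2 A B)"
      unfolding hf2_def[abs_def] using a by (intro continuous_intros) auto
  qed
  have du': "deriv u x = u' x" if "0 < x" for x using du[OF that] by (rule DERIV_imp_deriv)
  have gen: "generator m (\<sigma>\<^sup>2) u z - \<delta> * u z = 0" if z: "z \<in> {a<..<b}" for z
  proof -
    have z0: "0 < z" using z a by simp
    have "(deriv u has_real_derivative hf2 A B z) (at z)"
      by (rule has_field_derivative_transform_within_open[OF hf_derivatives(2)[OF z0] open_greaterThanLessThan z])
        (use a in \<open>auto simp: du' u'_def\<close>)
    then have "deriv (deriv u) z = hf2 A B z" by (rule DERIV_imp_deriv)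
    moreover have "deriv u z = hf1 A B z" using inner[OF z] by (rule DERIV_imp_deriv)
    ultimately show ?thesis using hf_ode[OF z0, of A B] mid[of z] z by (simp add: generator_def)
  qed
  have dPi: "(Pi_op M \<delta> p F Z u has_real_derivative deriv u b) (at b)"
  proof -
    have db: "deriv u b = V' b" using at_b(2) by (rule DERIV_imp_deriv)
    \<comment> \<open>\<open>Pi_fun u\<close> is a combination of \<open>V\<close> and
      \<open>u\<close> with weights of sum 1, and both have slope \<open>V' b\<close> at
      \<open>b\<close>.\<close>
    have "((\<lambda>x. (1 - q) * V x + q * u x) has_real_derivative (1 - q) * V' b + q * V' b) (at b)"
      by (intro DERIV_add DERIV_cmult V'(2) at_b b)
    then have "((\<lambda>x. (1 - q) * V x + q * u x) has_real_derivative deriv u b) (at b)" by (simp add: db algebra_simps)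
    then show ?thesis
      by (rule has_field_derivative_transform_within_open[OF _ open_greaterThan, of _ _ _ 0]) (use b in \<open>auto simp: Pi_op_eq[OF u_admissible] Pi_fun_u\<close>)
  qed
  show ?thesis
    unfolding free_boundary_solution_def
  proof (intro conjI allI impI ballI)
    show "superharmonic M Ft \<delta> Z u" using superharmonic_iff[OF u_measurable] u_super by simp
    show "max 1 (Pi_op M \<delta> p F Z u z) \<le> u z" if "0 < z" for z
      using G_le_u[OF that] by (simp add: gain_def Pi_op_eq[OF u_admissible that])
    show "max 1 (Pi_op M \<delta> p F Z u z) < u z \<longleftrightarrow> z \<in> {a<..<b}" if "0 < z" for z
      using iff[OF that] by (simp add: gain_def Pi_op_eq[OF u_admissible that])
    show "u a = 1" using low[of a] a by simp
    show "u b = Pi_op M \<delta> p F Z u b" using high[of b] by (simp add: Pi_op_eq[OF u_admissible b])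
    show "deriv u a = 0" using at_a(2) by (rule DERIV_imp_deriv)
  qed (use a lt C1 C2 gen dPi in auto)
qed

end

subsection \<open>Uniqueness\<close>

context stopping_problem
begin

text \<open>The contraction at the level of stopping values: averaging reduces the error to
  \<open>(1 - p) * c * H\<close>, and stopping cannot increase a multiple of \<open>H\<close> in
  discounted mean.\<close>

lemma gain_compare:
  assumes g: "admissible g1" "admissible g2" and c: "0 \<le> c" and le: "\<And>y. 0 < y \<Longrightarrow> g1 y \<le> g2 y + c * H y"
    and z: "0 < z" and \<tau>: "stopping_time Ft \<tau>"
  shows "(LINT \<omega>|P. discounted \<delta> (gain g1) (X z) \<tau> \<omega>) \<le> (LINT \<omega>|P. discounted \<delta> (gain g2) (X z) \<tau> \<omega>) + (1 - p) * c * H z"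
proof -
  let ?e = "(1 - p) * c"
  have e: "0 \<le> ?e" using c p by simp
  have G: "gain g1 y \<le> 1 * gain g2 y + 1 * (?e * y powr \<alpha> + ?e * y powr (- \<beta>))" if y: "0 < y" for y
  proof -
    have "0 \<le> ?e * H y" using e H_pos[OF y] by simp
    then show ?thesis using Pi_fun_compare_H[OF g y c le] by (auto simp: gain_def H_def algebra_simps)
  qed
  note i = discounted_admissible[OF admissible_gain[OF g(2)] z \<tau>] discounted_hfun_integral[OF z \<tau> e e]
  have "(LINT \<omega>|P. discounted \<delta> (gain g1) (X z) \<tau> \<omega>) \<le>
      (LINT \<omega>|P. 1 * discounted \<delta> (gain g2) (X z) \<tau> \<omega> + 1 * discounted \<delta> (\<lambda>y. ?e * y powr \<alpha> + ?e * y powr (- \<beta>)) (X z) \<tau> \<omega>)"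
  proof (rule integral_mono[OF discounted_admissible[OF admissible_gain[OF g(1)] z \<tau>]])
    show "integrable P (\<lambda>\<omega>. 1 * discounted \<delta> (gain g2) (X z) \<tau> \<omega> + 1 * discounted \<delta> (\<lambda>y. ?e * y powr \<alpha> + ?e * y powr (- \<beta>)) (X z) \<tau> \<omega>)"
      using i by auto
    show "discounted \<delta> (gain g1) (X z) \<tau> \<omega> \<le>
      1 * discounted \<delta> (gain g2) (X z) \<tau> \<omega> + 1 * discounted \<delta> (\<lambda>y. ?e * y powr \<alpha> + ?e * y powr (- \<beta>)) (X z) \<tau> \<omega>" for \<omega>
      unfolding discounted_linear[symmetric] by (rule discounted_mono[OF z G])
  qed
  also have "\<dots> = (LINT \<omega>|P. discounted \<delta> (gain g2) (X z) \<tau> \<omega>) + (LINT \<omega>|P. discounted \<delta> (\<lambda>y. ?e * y powr \<alpha> + ?e * y powr (- \<beta>)) (X z) \<tau> \<omega>)"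
    using i by simp
  also have "\<dots> \<le> (LINT \<omega>|P. discounted \<delta> (gain g2) (X z) \<tau> \<omega>) + ?e * H z"
    using i(3) by (simp add: H_def distrib_left)
  finally show ?thesis .
qed

end

context value_problem
begin

text \<open>Start at 1 and suppose that \<open>f\<close> is large at some \<open>z < 1\<close>. The
  solution of the Euler equation that matches the singular growth at \<open>z\<close> and vanishes
  at 2 lies below \<open>f\<close> at both ends of \<open>(z, 2)\<close>, up to a favourable term at
  \<open>z\<close>; the exit from this interval and superharmonicity bound its size by a multiple of
  \<open>f 1\<close>. For \<open>z > 1\<close> the interval \<open>(1/2, z)\<close> plays the same
  role.\<close>

lemma super_growth:
  assumes f: "super f" "(\<lambda>y. indicator {0<..} y * f y) \<in> borel_measurable borel" and pos: "\<And>y. 0 < y \<Longrightarrow> 1 \<le> f y"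
  shows "admissible f"
proof -
  have half: "(1/2) powr c = 2 powr (- c)" for c :: real by (simp add: powr_divide powr_minus_divide)
  \<comment> \<open>The ratio of coefficients for which the comparison functions vanish at 2 and at
    \<open>1/2\<close> respectively. At 1 they have the value \<open>(1 - e) * B\<close> or
    \<open>(1 - e) * A\<close>.\<close>
  define e :: real where "e = 2 powr (- (\<alpha> + \<beta>))"
  have "2 powr (- (\<alpha> + \<beta>)) < 2 powr (0 :: real)" using \<alpha>(1) \<beta>(1) by (intro powr_less_mono) auto
  then have e: "0 < e" "e < 1" by (simp_all add: e_def)
  have e1: "e * (1/2) powr (- \<beta>) = (1/2) powr \<alpha>" "e * 2 powr \<alpha> = 2 powr (- \<beta>)"
    unfolding e_def half powr_add[symmetric] by simp_all
  have fi: "\<And>\<tau>. stopping_time Ft \<tau> \<Longrightarrow> integrable P (discounted \<delta> f (X 1) \<tau>)"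
    and fl: "\<And>\<tau>. stopping_time Ft \<tau> \<Longrightarrow> (LINT \<omega>|P. discounted \<delta> f (X 1) \<tau> \<omega>) \<le> f 1"
    using f(1) by (auto simp: super_def)
  let ?C = "f 1 / (1 - e)"
  have C: "0 \<le> ?C" using e pos[of 1] by simp
  have "\<bar>f z\<bar> \<le> ?C * H z" if z: "0 < z" for z
  proof -
    consider "z < 1" | "z = 1" | "1 < z" by linarith
    then have "f z \<le> ?C * H z"
    proof cases
      case 1
      define B where "B = f z / z powr (- \<beta>)"
      have B: "0 \<le> B" "B * z powr (- \<beta>) = f z" using pos[OF z] z by (auto simp: B_def)
      have "0 \<le> e * B * z powr \<alpha>" using e B(1) by simp
      then have 11: "hf (- e * B) B z \<le> f z" unfolding hf_def using B(2) by simp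
      have "hf (- e * B) B 2 = B * (2 powr (- \<beta>) - e * 2 powr \<alpha>)" unfolding hf_def by (simp add: algebra_simps)
      then have 12: "hf (- e * B) B 2 \<le> f 2" using e1 pos[of 2] by simp
      obtain \<tau> where "stopping_time Ft \<tau>" "hf (- e * B) B 1 \<le> (LINT \<omega>|P. discounted \<delta> f (X 1) \<tau> \<omega>)"
        using exit_compare[OF z 1 _ f(2) fi 11 12] by auto
      then have "(1 - e) * B \<le> f 1" using fl[of \<tau>] by (simp add: hf_def algebra_simps)
      then have "B \<le> ?C" using e by (simp add: pos_le_divide_eq mult.commute)
      then have "f z \<le> ?C * z powr (- \<beta>)" unfolding B(2)[symmetric] by (intro mult_right_mono) auto
      also have "\<dots> \<le> ?C * H z" using C by (intro mult_left_mono) (auto simp: H_def)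
      finally show ?thesis .
    next
      case 2
      have "f 1 * (1 - e) \<le> f 1 * 1" using e pos[of 1] by (intro mult_left_mono) auto
      then have "f 1 \<le> ?C * 1" using e by (simp add: pos_le_divide_eq)
      also have "\<dots> \<le> ?C * H z" using C H_ge(1)[OF z] by (intro mult_left_mono) auto
      finally show ?thesis using 2 by simp
    next
      case 3
      define A where "A = f z / z powr \<alpha>"
      have A: "0 \<le> A" "A * z powr \<alpha> = f z" using pos[OF z] z by (auto simp: A_def)
      have "0 \<le> e * A * z powr (- \<beta>)" using e A(1) by simp
      then have 11: "hf A (- e * A) z \<le> f z" unfolding hf_def using A(2) by simp
      have "hf A (- e * A) (1/2) = A * ((1/2) powr \<alpha> - e * (1/2) powr (- \<beta>))" unfolding hf_def by (simp add: algebra_simps)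
      then have 12: "hf A (- e * A) (1/2) \<le> f (1/2)" using e1 pos[of "1/2"] by simp
      obtain \<tau> where "stopping_time Ft \<tau>" "hf A (- e * A) 1 \<le> (LINT \<omega>|P. discounted \<delta> f (X 1) \<tau> \<omega>)"
        using exit_compare[OF _ _ 3 f(2) fi 12 11] by auto
      then have "(1 - e) * A \<le> f 1" using fl[of \<tau>] by (simp add: hf_def algebra_simps)
      then have "A \<le> ?C" using e by (simp add: pos_le_divide_eq mult.commute)
      then have "f z \<le> ?C * z powr \<alpha>" unfolding A(2)[symmetric] by (intro mult_right_mono) auto
      also have "\<dots> \<le> ?C * H z" using C by (intro mult_left_mono) (auto simp: H_def)
      finally show ?thesis .
    qed
    then show ?thesis using pos[OF z] by simp
  qed
  then show ?thesis using f(2) unfolding admissible_def by blast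
qed

text \<open>A solution \<open>f\<close> is a value function for its own gain: superharmonicity makes
  it an upper bound for all stopping values, and its form on \<open>[a, b]\<close> provides a
  stopping time that attains it. Two value functions of this kind differ by an error that the
  comparison of gains shrinks by \<open>1 - p\<close> each time.\<close>

theorem free_boundary_solution_unique:
  assumes sol: "free_boundary_solution M Ft \<delta> p F m (\<sigma>\<^sup>2) Z f a b"
  shows "\<forall>z>0. f z = u z" "{z. 0 < z \<and> G z < u z} = {a<..<b}" "a < b"
proof -
  have a: "0 < a" and lt: "a < b" and C1: "f C1_differentiable_on {0<..}" and C2: "C2_on_interval f a b"
    and sh: "superharmonic M Ft \<delta> Z f" and ge: "\<And>z. 0 < z \<Longrightarrow> max 1 (Pi_op M \<delta> p F Z f z) \<le> f z"
    and iff: "\<And>z. 0 < z \<Longrightarrow> max 1 (Pi_op M \<delta> p F Z f z) < f z \<longleftrightarrow> z \<in> {a<..<b}"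
    and gen: "\<And>z. z \<in> {a<..<b} \<Longrightarrow> generator m (\<sigma>\<^sup>2) f z - \<delta> * f z = 0"
    using sol unfolding free_boundary_solution_def by blast+
  have b: "0 < b" using a lt by simp
  have cont: "continuous_on {0<..} f"
  proof -
    obtain f' where "\<And>x. 0 < x \<Longrightarrow> (f has_vector_derivative f' x) (at x)"
      using C1 unfolding C1_differentiable_on_def by auto
    then show ?thesis by (intro continuous_at_imp_continuous_on ballI) (auto dest: has_vector_derivative_continuous)
  qed
  note fm = continuous_measurable[OF cont]
  have sup: "super f" using sh superharmonic_iff[OF fm] by simp
  have pos: "1 \<le> f z" if "0 < z" for z using ge[OF that] by simp
  have adm: "admissible f" by (rule super_growth[OF sup fm pos])
  have gain: "max 1 (Pi_op M \<delta> p F Z f z) = gain f z" if "0 < z" for z using Pi_op_eq[OF adm that] by (simp add: gain_def)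
  have ge': "gain f z \<le> f z" and iff': "gain f z < f z \<longleftrightarrow> z \<in> {a<..<b}" if "0 < z" for z
    using ge[OF that] iff[OF that] gain[OF that] by auto
  obtain f1 f2 where d1: "\<And>x. x \<in> {a..b} \<Longrightarrow> (f has_real_derivative f1 x) (at x within {a..b})"
    and d2: "\<And>x. x \<in> {a..b} \<Longrightarrow> (f1 has_real_derivative f2 x) (at x within {a..b})"
    using C2 unfolding C2_on_interval_def by blast
  have i1: "(f has_real_derivative f1 x) (at x)" and i2: "(f1 has_real_derivative f2 x) (at x)" if "x \<in> {a<..<b}" for x
    using d1[of x] d2[of x] that at_within_Icc_at[of a x b] by auto
  have df: "deriv f x = f1 x" if "x \<in> {a<..<b}" for x using i1[OF that] by (rule DERIV_imp_deriv)
  have ddf: "deriv (deriv f) x = f2 x" if x: "x \<in> {a<..<b}" for x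
    by (intro DERIV_imp_deriv has_field_derivative_transform_within_open[OF i2[OF x] open_greaterThanLessThan x]) (simp add: df)
  have "\<exists>A B. \<forall>x\<in>{a<..<b}. f x = A * x powr \<alpha> + B * x powr (- \<beta>)"
  proof (rule euler_ode_solution[OF a lt _ \<alpha> \<beta> i1 i2])
    show "1/2 * \<sigma>\<^sup>2 * x\<^sup>2 * f2 x + m * x * f1 x - \<delta> * f x = 0" if "x \<in> {a<..<b}" for x
      using gen[OF that] df[OF that] ddf[OF that] by (simp add: generator_def)
  qed (use \<sigma> in auto)
  then obtain A B where AB: "\<And>x. x \<in> {a<..<b} \<Longrightarrow> f x = hf A B x" unfolding hf_def by blast
  have closed: "f x = hf A B x" if x: "x \<in> {a..b}" for x
  proof -
    have "continuous_on (closure {a<..<b}) (\<lambda>x. f x - hf A B x)"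
      unfolding closure_greaterThanLessThan[OF lt] hf_def using a
      by (intro continuous_intros continuous_on_subset[OF cont]) auto
    then have "f x - hf A B x = 0"
      by (rule continuous_constant_on_closure) (use AB x lt in auto)
    then show ?thesis by simp
  qed
  \<comment> \<open>Inside \<open>(a, b)\<close> the exit time is used, where \<open>f\<close>
    solves the Euler equation and meets its gain at both ends; elsewhere immediate stopping is
    enough.\<close>
  have attain: "\<exists>\<tau>. stopping_time Ft \<tau> \<and> f z \<le> (LINT \<omega>|P. discounted \<delta> (gain f) (X z) \<tau> \<omega>)" if z: "0 < z" for z
  proof (cases "z \<in> {a<..<b}")
    case True
    have "f a = gain f a" "f b = gain f b" using ge'[OF a] iff'[OF a] ge'[OF b] iff'[OF b] by auto
    then have "hf A B a \<le> gain f a" "hf A B b \<le> gain f b" using closed[of a] closed[of b] lt by auto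
    from exit_compare[OF a _ _ gain_measurable[OF adm] discounted_admissible[OF admissible_gain[OF adm] z] this] True AB[OF True]
    show ?thesis by auto
  next
    case False
    then have "f z = gain f z" using ge'[OF z] iff'[OF z] by auto
    then show ?thesis using integral_discounted_zero[OF gain_measurable[OF adm] z] stopping_time_const[of Ft 0] by (intro exI[of _ "\<lambda>_. 0"]) simp
  qed
  have upper: "(LINT \<omega>|P. discounted \<delta> (gain f) (X z) \<tau> \<omega>) \<le> f z" if z: "0 < z" and \<tau>: "stopping_time Ft \<tau>" for z \<tau>
  proof -
    have "(LINT \<omega>|P. discounted \<delta> (gain f) (X z) \<tau> \<omega>) \<le> (LINT \<omega>|P. discounted \<delta> f (X z) \<tau> \<omega>)"
      by (intro integral_mono discounted_admissible[OF _ z \<tau>] admissible_gain adm discounted_mono[OF z] ge')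
    also have "\<dots> \<le> f z" using sup z \<tau> unfolding super_def by blast
    finally show ?thesis .
  qed
  obtain Cf where Cf: "\<And>z. 0 < z \<Longrightarrow> \<bar>f z\<bar> \<le> Cf * H z" using adm unfolding admissible_def by blast
  obtain Cu where Cu: "\<And>z. 0 < z \<Longrightarrow> \<bar>u z\<bar> \<le> Cu * H z" using u_admissible unfolding admissible_def by blast
  define C where "C = Cf + Cu"
  have C: "0 \<le> C"
  proof -
    have "0 \<le> Cf * H 1 + Cu * H 1" using Cf[of 1] Cu[of 1] by linarith
    then show ?thesis using H_pos[of 1] by (simp add: C_def distrib_right[symmetric] zero_le_mult_iff)
  qed
  \<comment> \<open>For \<open>f\<close> below \<open>u\<close>, the stopping time that attains
    \<open>f\<close> is tried in the problem of \<open>u\<close>; for \<open>u\<close> below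
    \<open>f\<close>, any stopping time for \<open>u\<close> is tried in the problem of
    \<open>f\<close>, where its value is at most \<open>f\<close>.\<close>
  have *: "\<forall>z>0. f z \<le> u z + (1 - p) ^ n * C * H z \<and> u z \<le> f z + (1 - p) ^ n * C * H z" for n
  proof (induction n)
    case 0
    show ?case
    proof (intro allI impI)
      fix z :: real assume z: "0 < z"
      have "\<bar>f z - u z\<bar> \<le> C * H z" using Cf[OF z] Cu[OF z] by (simp add: C_def distrib_right)
      then show "f z \<le> u z + (1 - p) ^ 0 * C * H z \<and> u z \<le> f z + (1 - p) ^ 0 * C * H z" by (simp add: abs_le_iff)
    qed
  next
    case (Suc n)
    have c: "0 \<le> (1 - p) ^ n * C" using C p by simp
    show ?case
    proof (intro allI impI conjI)
      fix z :: real assume z: "0 < z"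
      obtain \<tau> where \<tau>: "stopping_time Ft \<tau>" "f z \<le> (LINT \<omega>|P. discounted \<delta> (gain f) (X z) \<tau> \<omega>)" using attain[OF z] by blast
      have "f z \<le> val z \<tau> + (1 - p) * ((1 - p) ^ n * C) * H z"
        unfolding val_def by (rule order_trans[OF \<tau>(2) gain_compare[OF adm u_admissible c _ z \<tau>(1)]]) (use Suc.IH in blast)
      then show "f z \<le> u z + (1 - p) ^ Suc n * C * H z" using val_le_u[OF z \<tau>(1)] by (simp add: mult.assoc)
      show "u z \<le> f z + (1 - p) ^ Suc n * C * H z"
      proof (rule u_le[OF z])
        fix \<tau> assume \<tau>: "stopping_time Ft \<tau>"
        have "val z \<tau> \<le> (LINT \<omega>|P. discounted \<delta> (gain f) (X z) \<tau> \<omega>) + (1 - p) * ((1 - p) ^ n * C) * H z"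
          unfolding val_def by (rule gain_compare[OF u_admissible adm c _ z \<tau>]) (use Suc.IH in blast)
        then show "val z \<tau> \<le> f z + (1 - p) ^ Suc n * C * H z" using upper[OF z \<tau>] by (simp add: mult.assoc)
      qed
    qed
  qed
  have eq: "f z = u z" if z: "0 < z" for z
  proof -
    have lim: "(\<lambda>n. y + (1 - p) ^ n * C * H z) \<longlonglongrightarrow> y + 0 * C * H z" for y
      using p by (intro tendsto_intros LIMSEQ_realpow_zero) auto
    have "f z \<le> u z + 0 * C * H z" using * z by (intro LIMSEQ_le_const[OF lim]) auto
    moreover have "u z \<le> f z + 0 * C * H z" using * z by (intro LIMSEQ_le_const[OF lim]) auto
    ultimately show ?thesis by simp
  qed
  then show "\<forall>z>0. f z = u z" by blast
  have "gain f z = G z" if z: "0 < z" for z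
  proof -
    have "Pi_fun f z = Pi_fun u z" unfolding Pi_fun_def Ex_def using z by (simp add: eq)
    then show ?thesis by (simp add: gain_def)
  qed
  then show "{z. 0 < z \<and> G z < u z} = {a<..<b}" using iff' eq a by auto
  show "a < b" by (rule lt)
qed

end

theorem proposition4p13:
  fixes M :: "'a measure"
    and B1 B2 :: "real \<Rightarrow> 'a \<Rightarrow> real"
    and Z :: "real \<Rightarrow> real \<Rightarrow> 'a \<Rightarrow> real"
    and \<mu>1 \<mu>2 \<sigma>1 \<sigma>2 \<nu> p r \<beta>1 \<beta>2 :: real
    and F u :: "real \<Rightarrow> real"
    and \<F> :: "ennreal \<Rightarrow> 'a measure"
    and a_star b_star :: real
  assumes "prob_space M"
    and "brownian_motion M B1" and "brownian_motion M B2"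
    and "independent_processes M B1 B2"
    and \<F>: "\<F> = completed_filtration M B1 B2"
    and "0 < \<sigma>1" and "0 < \<sigma>2" and "-1 \<le> \<nu>" and "\<nu> \<le> 1"
    and "0 < p" and "p < 1" and "0 < r"
    and "\<mu>1 + \<sigma>1\<^sup>2 / 2 < r" and "\<mu>2 + \<sigma>2\<^sup>2 / 2 < r"
    and "nonneg_cdf F"
    and \<beta>1: "\<beta>1 = \<sigma>2 * \<nu> - \<sigma>1"
    and \<beta>2: "\<beta>2 = \<sigma>2 * sqrt (1 - \<nu>\<^sup>2)"
    and "0 < \<beta>1\<^sup>2 + \<beta>2\<^sup>2"
    and Z: "\<And>z. 0 < z \<Longrightarrow>
       solves_sde (completion M) \<F>
         (\<lambda>t \<omega>. (\<beta>1 * B1 t \<omega> + \<beta>2 * B2 t \<omega>) / sqrt (\<beta>1\<^sup>2 + \<beta>2\<^sup>2))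
         (\<lambda>x. (\<mu>2 - \<mu>1) * x) (\<lambda>x. sqrt (\<beta>1\<^sup>2 + \<beta>2\<^sup>2) * x) z (Z z)"
    and u: "value_fixed_point M \<F> (r - \<mu>1) p F Z u"
    and "F 0 < 1"
    and ab_star: "{z. 0 < z \<and> max 1 (Pi_op M (r - \<mu>1) p F Z u z) < u z} = {a_star<..<b_star}"
    and "0 < a_star"
    and "a_star < Inf {z. 0 < z \<and> 1 < Pi_op M (r - \<mu>1) p F Z u z}"
    and "Inf {z. 0 < z \<and> 1 < Pi_op M (r - \<mu>1) p F Z u z} < b_star"
  shows "free_boundary_solution M \<F> (r - \<mu>1) p F (\<mu>2 - \<mu>1) (\<beta>1\<^sup>2 + \<beta>2\<^sup>2) Z u a_star b_star \<and>
    (\<forall>u_hat a_hat b_hat.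
       free_boundary_solution M \<F> (r - \<mu>1) p F (\<mu>2 - \<mu>1) (\<beta>1\<^sup>2 + \<beta>2\<^sup>2) Z u_hat a_hat b_hat \<longrightarrow>
       (\<forall>z>0. u_hat z = u z) \<and> a_hat = a_star \<and> b_hat = b_star)"
proof -
  let ?v = "\<beta>1\<^sup>2 + \<beta>2\<^sup>2"
  let ?W = "\<lambda>t \<omega>. (\<beta>1 * B1 t \<omega> + \<beta>2 * B2 t \<omega>) / sqrt ?v"
  let ?m = "\<mu>2 - \<mu>1" and ?d = "r - \<mu>1"
  have vol: "0 < sqrt ?v" "(sqrt ?v)\<^sup>2 = ?v" using \<open>0 < ?v\<close> by auto
  have "0 \<le> \<sigma>1\<^sup>2 / 2" "0 \<le> \<sigma>2\<^sup>2 / 2" by auto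
  then have d: "0 < ?d" "?m < ?d"
    using \<open>\<mu>1 + \<sigma>1\<^sup>2 / 2 < r\<close> \<open>\<mu>2 + \<sigma>2\<^sup>2 / 2 < r\<close> by linarith+
  obtain \<alpha> \<beta> where roots: "1 < \<alpha>" "\<alpha> * (?m - (sqrt ?v)\<^sup>2 / 2) + \<alpha>\<^sup>2 * (sqrt ?v)\<^sup>2 / 2 = ?d"
    "0 < \<beta>" "- \<beta> * (?m - (sqrt ?v)\<^sup>2 / 2) + \<beta>\<^sup>2 * (sqrt ?v)\<^sup>2 / 2 = ?d"
    using ex_characteristic_roots[OF vol(1) d] by blast
  obtain D where D: "real_distribution D" "AE t in D. 0 \<le> t" "F = cdf D"
    using \<open>nonneg_cdf F\<close> unfolding nonneg_cdf_def by blast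
  have "wiener (completion M) \<F> ?W"
    unfolding \<F> using assms(1-4) \<open>0 < ?v\<close> by (rule wiener_of_brownian_motions)
  then have "gbm_stopping (completion M) \<F> ?W ?m (sqrt ?v) ?d \<alpha> \<beta>"
    by (intro gbm_stopping.intro gbm_stopping_axioms.intro vol d roots)
  then have "gbm_problem (completion M) \<F> ?W ?m (sqrt ?v) ?d \<alpha> \<beta> D p"
    by (intro gbm_problem.intro gbm_problem_axioms.intro D \<open>0 < p\<close> \<open>p < 1\<close>)
  then have "stopping_problem (completion M) \<F> ?W ?m (sqrt ?v) ?d \<alpha> \<beta> D p M Z F"
    by (intro stopping_problem.intro stopping_problem_axioms.intro refl D Z)
  then interpret value_problem "completion M" \<F> ?W ?m "sqrt ?v" ?d \<alpha> \<beta> D p M Z F u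
    by (intro value_problem.intro value_problem_axioms.intro u)
  have eq: "Pi_op M ?d p F Z u z = Pi_fun u z" if "0 < z" for z by (rule Pi_op_eq[OF u_admissible that])
  have sets: "{z. 0 < z \<and> 1 < Pi_op M ?d p F Z u z} = {z. 0 < z \<and> 1 < Pi_fun u z}"
    "{z. 0 < z \<and> max 1 (Pi_op M ?d p F Z u z) < u z} = {z. 0 < z \<and> gain u z < u z}"
    using eq by (auto simp: gain_def)
  note ab = ab_star[unfolded sets]
  have sol: "free_boundary_solution M \<F> ?d p F ?m ?v Z u a_star b_star"
    using free_boundary_solution_u[OF ab \<open>0 < a_star\<close>] assms(24,25) unfolding sets vol(2) by blast
  have "(\<forall>z>0. f z = u z) \<and> a = a_star \<and> b = b_star"
    if f: "free_boundary_solution M \<F> ?d p F ?m ?v Z f a b" for f a b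
  proof -
    have "free_boundary_solution M \<F> ?d p F ?m ((sqrt ?v)\<^sup>2) Z f a b" using f unfolding vol(2) .
    note uniq = free_boundary_solution_unique[OF this]
    have "{a<..<b} = {a_star<..<b_star}" using uniq(2) ab by simp
    moreover have "a_star < b_star" using sol by (simp add: free_boundary_solution_def)
    ultimately have "a = a_star" "b = b_star"
      using uniq(3) cInf_greaterThanLessThan[of a b] cSup_greaterThanLessThan[of a b] by auto
    then show ?thesis using uniq(1) by blast
  qed
  with sol show ?thesis by blast
qed

end
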